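(* Let $X$ be a connected, oriented, non-compact $C^\infty$ Riemannian manifold, $\mathcal D=C_0^\infty(X)$ (real-valued), $\mathcal D'$ its dual, and $\mathcal C_\sigma(\mathcal D')$ the cylinder $\sigma$-algebra on $\mathcal D'$. Let $\rho$ be a measure on $(\Gamma_{X,0},\mathcal B(\Gamma_{X,0}))$ such that: (1) $\rho(\Gamma_X^{(0)})=1$; (2) for every compact $\Lambda\subset X$ there is a constant $C_\Lambda>0$ such that $\rho(\Gamma_\Lambda^{(n)})\le C_\Lambda^n$ for all $n\in\mathbb N$; (3) $\int_{\Gamma_{X,0}}(G\star\overline G)(\eta)\,\rho(d\eta)\ge 0$ for every $G\in\mathcal F_{\rm fin}(\mathcal D)$; (4) every compact $\Lambda\subset X$ can be covered by finitely many open sets $\Lambda_1,\dots,\Lambda_k$ ($k\in\mathbb N$) which have compact closures and satisfy, for some $\varepsilon=\varepsilon(\Lambda)>0$, $$\rho(\Gamma_{\Lambda_i}^{(n)})\le(2+\varepsilon)^{-n}\quad\text{for all }i=1,\dots,k\text{ and }n\in\mathbb N.$$ Let $\mu$ be the probability measure on $(\mathcal D',\mathcal C_\sigma(\mathcal D'))$ associated with $\rho$, namely the spectral measure for which the map $$\widehat{\mathcal F}_{\rm fin}(\mathcal D)\ni\widehat G\mapsto(K\widehat G)(\omega)=\sum_{n=0}^\infty\langle G^{(n)},{:}\omega^{\otimes n}{:}\rangle$$ ($G$ any representative of $\widehat G$) is well defined and extends by continuity to a unitary isomorphism $K:\mathcal H_\rho\to L^2(\mathcal D',\mathcal C_\sigma(\mathcal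 D'),d\mu)$ with $KA_\varphi^\sim K^{-1}=\langle\varphi,\cdot\rangle\,\cdot$ (multiplication operator) for all $\varphi\in\mathcal D$. Then the configuration space $\Gamma_X$, regarded as a subset of $\mathcal D'$, is of full $\mu$-measure, i.e. $\mu(\Gamma_X)=1$.
   Context: **Function spaces.** $\mathcal D=C_0^\infty(X)$ carries its usual nuclear topology; $\mathcal D_{\mathbb C}$ is its complexification. $\mathcal F_0(\mathcal D)=\mathbb C$ and, for $n\ge1$, $\mathcal F_n(\mathcal D)=\mathcal D_{\mathbb C}^{\widehat\otimes n}$ ($\widehat\otimes$ = symmetric tensor product), i.e. the space of complex-valued symmetric $C^\infty$ functions on $X^n$ with compact support. $\mathcal F_{\rm fin}(\mathcal D)=\bigoplus_{n\ge0}\mathcal F_n(\mathcal D)$ is the topological direct sum: elements are finite sequences $G=(G^{(0)},\dots,G^{(n)},0,0,\dots)$, and convergence means uniform finiteness and coordinate-wise convergence. $G^{(n)}\in\mathcal F_n(\mathcal D)$ is identified with the sequence having $G^{(n)}$ at place $n$ and $0$ elsewhere; in particular $\varphi\in\mathcal D$ is an element of $\mathcal F_{\rm fin}(\mathcal D)$. Pairings $\langle\cdot,\cdot\rangle$ between (tensor powers of) $\mathcal D$ and $\mathcal D'$ are extended complex-bilinearly. **Finite configurations.** $\ddot\Gamma_{X,0}=\bigsqcup_{n\ge0}\ddot\Gamma_X^{(n)}$, where $\ddot\Gamma_X^{(0)}=\{\varnothing\}$ and $\ddot\Gamma_X^{(n)}=X^n/S_n$ with the quotient topology (disjoint-union topology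 on $\ddot\Gamma_{X,0}$); elements are written $[x_1,\dots,x_n]$. Each $G\in\mathcal F_{\rm fin}(\mathcal D)$ is a function on $\ddot\Gamma_{X,0}$ via $G(\varnothing)=G^{(0)}$, $G([x_1,\dots,x_n])=G^{(n)}(x_1,\dots,x_n)$. $\Gamma_{X,0}\subset\ddot\Gamma_{X,0}$ (relative topology) consists of $\varnothing$ and all $[x_1,\dots,x_n]$ with pairwise distinct $x_i$, identified with finite subsets of $X$; $\Gamma_X^{(n)}$ is the set of $n$-point elements of $\Gamma_{X,0}$, and for $\Lambda\subset X$, $\Gamma_\Lambda^{(n)}$ is the set of $n$-point subsets of $\Lambda$. **Convolution.** For $G_1,G_2\in\mathcal F_{\rm fin}(\mathcal D)$, $$(G_1\star G_2)(\eta)=\sum_{(\xi_1,\xi_2,\xi_3)\in\mathcal P_3(\eta)}G_1(\xi_1\cup\xi_2)\,G_2(\xi_2\cup\xi_3),$$ where for $\eta=[x_1,\dots,x_n]$ the sum is over all ordered triples of pairwise disjoint, possibly empty, subsets of $\{1,\dots,n\}$ with union $\{1,\dots,n\}$, and an index set $\xi$ is identified with the class $[x_i]_{i\in\xi}$ (and $\varnothing$ with $\varnothing$). One has $G_1\star G_2\in\mathcal F_{\rm fin}(\mathcal D)$. **Hilbert space and operators.** $a_\rho(G_1,G_2)=\int_{\Gamma_{X,0}}(G_1\star G_2)(\eta)\,\rho(d\eta)$. $\widehat{\mathcal F}_{\rm fin}(\mathcal D)=\mathcal F_{\rm fin}(\mathcal D)/\{G':a_\rho(G',\overline{G'})=0\}$,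 with classes denoted $\widehat G$; $\mathcal H_\rho$ is the complex Hilbert space obtained by completing $\widehat{\mathcal F}_{\rm fin}(\mathcal D)$ in the scalar product $(\widehat G_1,\widehat G_2)_{\mathcal H_\rho}=a_\rho(G_1,\overline{G_2})$. For $\varphi\in\mathcal D$, $A_\varphi$ is the (well-defined) operator in $\mathcal H_\rho$ with domain $\widehat{\mathcal F}_{\rm fin}(\mathcal D)$ given by $A_\varphi\widehat G=\widehat{\varphi\star G}$; under (1)–(3) it is essentially selfadjoint, and $A_\varphi^\sim$ denotes its closure. Under (1)–(3) a probability measure $\mu$ with the properties described in the claim exists. **Wick powers.** For $\omega\in\mathcal D'$, ${:}\omega^{\otimes n}{:}\in\mathcal D'^{\widehat\otimes n}$ is defined by ${:}\omega^{\otimes 0}{:}=1$, ${:}\omega^{\otimes1}{:}=\omega$, and, for all $\varphi\in\mathcal D$, $$\langle\varphi^{\otimes(n+1)},{:}\omega^{\otimes(n+1)}{:}\rangle=\tfrac1{n+1}\big[\langle\varphi^{\otimes(n+1)},{:}\omega^{\otimes n}{:}\,\widehat\otimes\,\omega\rangle-n\langle(\varphi^2)\widehat\otimes\varphi^{\otimes(n-1)},{:}\omega^{\otimes n}{:}\rangle\big].$$ **Configuration space.** $\Gamma_X=\{\gamma\subset X: |\gamma\cap\Lambda|<\infty\text{ for each compact }\Lambda\subset X\}$. Each $\gamma\in\Gamma_X$ is identified with the Radon measure $\sum_{x\in\gamma}\delta_x$ (zero measure if $\gamma=\varnothing$), hence with an element of $\mathcal D'$; $\Gamma_X$ is a measurable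 subset of $\mathcal D'$. *)

theory Defs
  imports "HOL-Analysis.Analysis" "HOL-Probability.Probability_Measure" "HOL-Combinatorics.Permutations"
begin

section \<open>Smooth functions\<close>

text \<open>
  Points of \<open>\<real>\<^sup>d\<close> have type \<^typ>\<open>real^'n\<close>; points of \<open>(\<real>\<^sup>d)\<^sup>n\<close>, with \<open>n\<close> varying,
  are extensional functions on \<open>{..<n}\<close>. To treat both at once, a coordinate direction is
  given by a map \<open>move d t\<close>, translating a point by \<open>t\<close> along the direction \<open>d\<close>. A function is
  \<open>C\<^sup>\<infinity>\<close> on an open set if all its iterated partial derivatives exist and are continuous there.
\<close>

definition pderiv_along ::
  "('d \<Rightarrow> real \<Rightarrow> 'p \<Rightarrow> 'p) \<Rightarrow> 'd \<Rightarrow> ('p \<Rightarrow> 'v::real_normed_vector) \<Rightarrow> 'p \<Rightarrow> 'v" where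
  "pderiv_along move d f y = vector_derivative (\<lambda>t. f (move d t y)) (at 0)"

definition iter_pderiv ::
  "('d \<Rightarrow> real \<Rightarrow> 'p \<Rightarrow> 'p) \<Rightarrow> 'd list \<Rightarrow> ('p \<Rightarrow> 'v::real_normed_vector) \<Rightarrow> 'p \<Rightarrow> 'v" where
  "iter_pderiv move ds f = foldr (pderiv_along move) ds f"

definition smooth_along ::
  "'p topology \<Rightarrow> ('d \<Rightarrow> real \<Rightarrow> 'p \<Rightarrow> 'p) \<Rightarrow> 'd set \<Rightarrow> ('p \<Rightarrow> 'v::real_normed_vector) \<Rightarrow> bool" where
  "smooth_along T move Ds f \<longleftrightarrow> (\<forall>ds\<in>lists Ds.
     continuous_map T euclidean (iter_pderiv move ds f) \<and>
     (\<forall>d\<in>Ds. \<forall>y\<in>topspace T. (\<lambda>t. iter_pderiv move ds f (move d t y)) differentiable (at 0)))"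

definition shift_vec :: "'n \<Rightarrow> real \<Rightarrow> real^'n \<Rightarrow> real^'n" where
  "shift_vec j t y = y + t *\<^sub>R axis j 1"

definition shift_tuple :: "nat \<times> 'n \<Rightarrow> real \<Rightarrow> (nat \<Rightarrow> real^'n) \<Rightarrow> nat \<Rightarrow> real^'n" where
  "shift_tuple d t y = y(fst d := shift_vec (snd d) t (y (fst d)))"

definition smooth_on_open :: "(real^'n) set \<Rightarrow> (real^'n \<Rightarrow> 'v::real_normed_vector) \<Rightarrow> bool" where
  "smooth_on_open U f \<longleftrightarrow> smooth_along (top_of_set U) shift_vec UNIV f"

section \<open>Manifolds\<close>

text \<open>The manifold is the whole type \<open>'a\<close>; a chart is a pair of a domain and a coordinate map.\<close>

type_synonym ('a, 'n) chart = "'a set \<times> ('a \<Rightarrow> real^'n)"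

definition chart_image :: "('a, 'n) chart \<Rightarrow> (real^'n) set" where
  "chart_image c = snd c ` fst c"

definition chart_inv :: "('a, 'n) chart \<Rightarrow> real^'n \<Rightarrow> 'a" where
  "chart_inv c = inv_into (fst c) (snd c)"

definition transition :: "('a, 'n) chart \<Rightarrow> ('a, 'n) chart \<Rightarrow> real^'n \<Rightarrow> real^'n" where
  "transition c d = snd d \<circ> chart_inv c"

definition transition_dom :: "('a, 'n) chart \<Rightarrow> ('a, 'n) chart \<Rightarrow> (real^'n) set" where
  "transition_dom c d = snd c ` (fst c \<inter> fst d)"

definition jacobian :: "(real^'n \<Rightarrow> real^'n) \<Rightarrow> real^'n \<Rightarrow> real^'n^'n" where
  "jacobian f y = matrix (frechet_derivative f (at y))"

definition smooth_atlas :: "('a::topological_space, 'n::finite) chart set \<Rightarrow> bool" where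
  "smooth_atlas A \<longleftrightarrow>
     (\<forall>c\<in>A. open (fst c) \<and> open (chart_image c) \<and>
        homeomorphism (fst c) (chart_image c) (snd c) (chart_inv c)) \<and>
     (\<Union>c\<in>A. fst c) = UNIV \<and>
     (\<forall>c\<in>A. \<forall>d\<in>A. smooth_on_open (transition_dom c d) (transition c d))"

definition oriented_atlas :: "('a::topological_space, 'n::finite) chart set \<Rightarrow> bool" where
  "oriented_atlas A \<longleftrightarrow> smooth_atlas A \<and>
     (\<forall>c\<in>A. \<forall>d\<in>A. \<forall>y\<in>transition_dom c d. det (jacobian (transition c d) y) > 0)"

text \<open>A Riemannian metric is given by its coefficient matrices in the charts of the atlas.\<close>

definition riemannian_metric ::
  "('a::topological_space, 'n::finite) chart set \<Rightarrow> (('a, 'n) chart \<Rightarrow> real^'n \<Rightarrow> real^'n^'n) \<Rightarrow> bool" where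
  "riemannian_metric A g \<longleftrightarrow>
     (\<forall>c\<in>A. smooth_on_open (chart_image c) (g c) \<and>
        (\<forall>y\<in>chart_image c. transpose (g c y) = g c y \<and> (\<forall>v. v \<noteq> 0 \<longrightarrow> v \<bullet> (g c y *v v) > 0))) \<and>
     (\<forall>c\<in>A. \<forall>d\<in>A. \<forall>y\<in>transition_dom c d.
        g c y = transpose (jacobian (transition c d) y) ** g d (transition c d y)
                  ** jacobian (transition c d) y)"

section \<open>Test functions on the powers of the manifold\<close>

text \<open>Points of \<open>X\<^sup>n\<close> are extensional functions on \<open>{..<n}\<close>; \<open>X\<^sup>0\<close> has exactly one point.\<close>

definition Xpow :: "nat \<Rightarrow> (nat \<Rightarrow> 'a::topological_space) topology" where
  "Xpow n = product_topology (\<lambda>_. euclidean) {..<n}"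

definition box_top ::
  "nat \<Rightarrow> (nat \<Rightarrow> ('a, 'n::finite) chart) \<Rightarrow> (nat \<Rightarrow> real^'n) topology" where
  "box_top n c = product_topology (\<lambda>i. top_of_set (chart_image (c i))) {..<n}"

definition in_charts ::
  "nat \<Rightarrow> (nat \<Rightarrow> ('a, 'n) chart) \<Rightarrow> ((nat \<Rightarrow> 'a) \<Rightarrow> 'v) \<Rightarrow> (nat \<Rightarrow> real^'n) \<Rightarrow> 'v" where
  "in_charts n c f y = f (\<lambda>i\<in>{..<n}. chart_inv (c i) (y i))"

definition smooth_pow ::
  "('a::topological_space, 'n::finite) chart set \<Rightarrow> nat \<Rightarrow> ((nat \<Rightarrow> 'a) \<Rightarrow> 'v::real_normed_vector) \<Rightarrow> bool" where
  "smooth_pow A n f \<longleftrightarrow> (\<forall>c\<in>{..<n} \<rightarrow>\<^sub>E A.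
     smooth_along (box_top n c) shift_tuple ({..<n} \<times> UNIV) (in_charts n c f))"

text \<open>
  Symmetric smooth functions on \<open>X\<^sup>n\<close> with compact support, extended by 0 to the rest of the
  type: \<open>\<D>\<^sup>\<otimes>\<^sup>n\<close> (symmetric tensor power) for \<open>'v = real\<close>, \<open>\<F>\<^sub>n(\<D>)\<close> for \<open>'v = complex\<close>.
\<close>

definition test_fun ::
  "('a::topological_space, 'n::finite) chart set \<Rightarrow> nat \<Rightarrow> ((nat \<Rightarrow> 'a) \<Rightarrow> 'v::real_normed_vector) set" where
  "test_fun A n = {f.
     (\<forall>x. x \<notin> topspace (Xpow n) \<longrightarrow> f x = 0) \<and>
     (\<forall>x\<in>topspace (Xpow n). \<forall>\<pi>. \<pi> permutes {..<n} \<longrightarrow> f (x \<circ> \<pi>) = f x) \<and>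
     smooth_pow A n f \<and>
     compactin (Xpow n) (Xpow n closure_of {x \<in> topspace (Xpow n). f x \<noteq> 0})}"

text \<open>
  The usual (strict inductive limit) topology: it is generated by all seminorms that, on the
  functions supported in a given compact set, are dominated by finitely many of the seminorms
  \<open>sup\<^sub>L |\<partial>\<^sup>\<alpha> f|\<close> taken in charts over compact sets \<open>L\<close>.
\<close>

definition chart_seminorm ::
  "nat \<Rightarrow> (nat \<Rightarrow> ('a, 'n::finite) chart) \<times> (nat \<times> 'n) list \<times> (nat \<Rightarrow> real^'n) set
     \<Rightarrow> ((nat \<Rightarrow> 'a) \<Rightarrow> real) \<Rightarrow> real" where
  "chart_seminorm n = (\<lambda>(c, ds, L) f.
     Sup (insert 0 ((\<lambda>y. \<bar>iter_pderiv shift_tuple ds (in_charts n c f) y\<bar>) ` L)))"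

definition chart_indices ::
  "('a::topological_space, 'n::finite) chart set \<Rightarrow> nat
     \<Rightarrow> ((nat \<Rightarrow> ('a, 'n) chart) \<times> (nat \<times> 'n) list \<times> (nat \<Rightarrow> real^'n) set) set" where
  "chart_indices A n = {(c, ds, L). c \<in> {..<n} \<rightarrow>\<^sub>E A \<and> ds \<in> lists ({..<n} \<times> UNIV) \<and>
     compactin (box_top n c) L}"

definition seminorm_on :: "('p \<Rightarrow> real) set \<Rightarrow> (('p \<Rightarrow> real) \<Rightarrow> real) \<Rightarrow> bool" where
  "seminorm_on V q \<longleftrightarrow> (\<forall>f\<in>V. q f \<ge> 0) \<and>
     (\<forall>f\<in>V. \<forall>g\<in>V. q (\<lambda>x. f x + g x) \<le> q f + q g) \<and>
     (\<forall>f\<in>V. \<forall>r. q (\<lambda>x. r * f x) = \<bar>r\<bar> * q f)"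

definition test_seminorm ::
  "('a::topological_space, 'n::finite) chart set \<Rightarrow> nat \<Rightarrow> (((nat \<Rightarrow> 'a) \<Rightarrow> real) \<Rightarrow> real) \<Rightarrow> bool" where
  "test_seminorm A n q \<longleftrightarrow> seminorm_on (test_fun A n) q \<and>
     (\<forall>S. compactin (Xpow n) S \<longrightarrow> (\<exists>F C. finite F \<and> F \<subseteq> chart_indices A n \<and>
        (\<forall>f\<in>test_fun A n. (\<forall>x. x \<notin> S \<longrightarrow> f x = 0) \<longrightarrow>
           q f \<le> C * (\<Sum>k\<in>F. chart_seminorm n k f))))"

definition test_topology ::
  "('a::topological_space, 'n::finite) chart set \<Rightarrow> nat \<Rightarrow> ((nat \<Rightarrow> 'a) \<Rightarrow> real) topology" where
  "test_topology A n = topology_generated_by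
     {{g \<in> test_fun A n. q (\<lambda>x. g x - f x) < r} | q f r.
        test_seminorm A n q \<and> f \<in> test_fun A n \<and> r > 0}"

definition tensor_pow :: "nat \<Rightarrow> ('a::topological_space \<Rightarrow> real) \<Rightarrow> (nat \<Rightarrow> 'a) \<Rightarrow> real" where
  "tensor_pow n \<phi> x = (if x \<in> topspace (Xpow n) then \<Prod>i<n. \<phi> (x i) else 0)"

text \<open>The symmetric tensor product \<open>\<phi>\<^sub>0 \<otimes> \<dots> \<otimes> \<phi>\<^sub>n\<^sub>-\<^sub>1\<close>.\<close>

definition sym_tensor :: "nat \<Rightarrow> (nat \<Rightarrow> 'a::topological_space \<Rightarrow> real) \<Rightarrow> (nat \<Rightarrow> 'a) \<Rightarrow> real" where
  "sym_tensor n \<phi> x = (if x \<in> topspace (Xpow n)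
     then (\<Sum>\<pi> | \<pi> permutes {..<n}. \<Prod>i<n. \<phi> (\<pi> i) (x i)) / fact n else 0)"

text \<open>
  \<open>\<D> = C\<^sub>0\<^sup>\<infinity>(X)\<close> and its topology are transported along the identification \<open>X\<^sup>1 = X\<close>,
  under which \<open>\<phi>\<close> corresponds to \<open>tensor_pow 1 \<phi>\<close>.
\<close>

definition DD :: "('a::topological_space, 'n::finite) chart set \<Rightarrow> ('a \<Rightarrow> real) set" where
  "DD A = {\<phi>. tensor_pow 1 \<phi> \<in> test_fun A 1}"

definition DD_topology :: "('a::topological_space, 'n::finite) chart set \<Rightarrow> ('a \<Rightarrow> real) topology" where
  "DD_topology A = pullback_topology (DD A) (tensor_pow 1) (test_topology A 1)"

definition dual_space :: "('p \<Rightarrow> real) topology \<Rightarrow> (('p \<Rightarrow> real) \<Rightarrow> real) set" where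
  "dual_space T = {\<omega> \<in> extensional (topspace T).
     (\<forall>f\<in>topspace T. \<forall>g\<in>topspace T. \<omega> (\<lambda>x. f x + g x) = \<omega> f + \<omega> g) \<and>
     (\<forall>f\<in>topspace T. \<forall>r. \<omega> (\<lambda>x. r * f x) = r * \<omega> f) \<and>
     continuous_map T euclidean \<omega>}"

definition DD_dual :: "('a::topological_space, 'n::finite) chart set \<Rightarrow> (('a \<Rightarrow> real) \<Rightarrow> real) set" where
  "DD_dual A = dual_space (DD_topology A)"

definition cylinder_sigma ::
  "('a::topological_space, 'n::finite) chart set \<Rightarrow> (('a \<Rightarrow> real) \<Rightarrow> real) measure" where
  "cylinder_sigma A = sigma (DD_dual A)
     {{\<omega> \<in> DD_dual A. \<omega> \<phi> \<in> B} | \<phi> B. \<phi> \<in> DD A \<and> B \<in> sets borel}"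

section \<open>Wick powers\<close>

text \<open>
  By definition of the symmetric tensor product of functionals,
  \<open>\<langle>\<phi>\<^sup>\<otimes>\<^sup>(\<^sup>n\<^sup>+\<^sup>1\<^sup>), W\<^sub>n \<otimes> \<omega>\<rangle> = \<langle>\<phi>\<^sup>\<otimes>\<^sup>n, W\<^sub>n\<rangle> \<langle>\<phi>, \<omega>\<rangle>\<close>. The values on the \<open>\<phi>\<^sup>\<otimes>\<^sup>n\<close> determine \<open>W\<^sub>n\<close>, by
  polarization and density.
\<close>

definition is_wick_powers ::
  "('a::topological_space, 'n::finite) chart set \<Rightarrow> (('a \<Rightarrow> real) \<Rightarrow> real)
     \<Rightarrow> (nat \<Rightarrow> ((nat \<Rightarrow> 'a) \<Rightarrow> real) \<Rightarrow> real) \<Rightarrow> bool" where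
  "is_wick_powers A \<omega> W \<longleftrightarrow>
     (\<forall>n. W n \<in> dual_space (test_topology A n)) \<and>
     (\<forall>\<phi>\<in>DD A. W 0 (tensor_pow 0 \<phi>) = 1) \<and>
     (\<forall>\<phi>\<in>DD A. W 1 (tensor_pow 1 \<phi>) = \<omega> \<phi>) \<and>
     (\<forall>n. \<forall>\<phi>\<in>DD A. W (Suc n) (tensor_pow (Suc n) \<phi>) =
        (W n (tensor_pow n \<phi>) * \<omega> \<phi>
         - real n * W n (sym_tensor n (\<lambda>i. if i = 0 then (\<lambda>x. (\<phi> x)\<^sup>2) else \<phi>))) / real (Suc n))"

definition wick ::
  "('a::topological_space, 'n::finite) chart set \<Rightarrow> (('a \<Rightarrow> real) \<Rightarrow> real)
     \<Rightarrow> nat \<Rightarrow> ((nat \<Rightarrow> 'a) \<Rightarrow> real) \<Rightarrow> real" where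
  "wick A \<omega> = (SOME W. is_wick_powers A \<omega> W)"

definition cpairing :: "(('p \<Rightarrow> real) \<Rightarrow> real) \<Rightarrow> ('p \<Rightarrow> complex) \<Rightarrow> complex" where
  "cpairing W f = Complex (W (\<lambda>x. Re (f x))) (W (\<lambda>x. Im (f x)))"

section \<open>Finite configurations\<close>

text \<open>
  The class \<open>[x\<^sub>1, \<dots>, x\<^sub>n] \<in> X\<^sup>n/S\<^sub>n\<close> is the multiset of the \<open>x\<^sub>i\<close>; \<open>cfg x I\<close> is \<open>[x\<^sub>i]\<^sub>i\<^sub>\<in>\<^sub>I\<close>.
\<close>

definition cfg :: "(nat \<Rightarrow> 'a) \<Rightarrow> nat set \<Rightarrow> 'a multiset" where
  "cfg x I = image_mset x (mset_set I)"

definition ddconf_topology :: "'a::topological_space multiset topology" where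
  "ddconf_topology = topology (\<lambda>U. \<forall>n. openin (Xpow n) {x \<in> topspace (Xpow n). cfg x {..<n} \<in> U})"

lemma openin_ddconf_topology:
  fixes U :: "'a::topological_space multiset set"
  shows "openin ddconf_topology U \<longleftrightarrow> (\<forall>n. openin (Xpow n) {x \<in> topspace (Xpow n). cfg x {..<n} \<in> U})"
proof -
  let ?S = "\<lambda>n (U :: 'a multiset set). {x \<in> topspace (Xpow n). cfg x {..<n} \<in> U}"
  have "istopology (\<lambda>U. \<forall>n. openin (Xpow n) (?S n U))"
    unfolding istopology_def
  proof (intro conjI allI impI)
    fix U V :: "'a multiset set" and n
    assume "\<forall>n. openin (Xpow n) (?S n U)" "\<forall>n. openin (Xpow n) (?S n V)"
    then have "openin (Xpow n) (?S n U \<inter> ?S n V)" by (intro openin_Int) blast+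
    moreover have "?S n (U \<inter> V) = ?S n U \<inter> ?S n V" by auto
    ultimately show "openin (Xpow n) (?S n (U \<inter> V))" by simp
  next
    fix \<U> :: "'a multiset set set" and n
    assume "\<forall>U\<in>\<U>. \<forall>n. openin (Xpow n) (?S n U)"
    then have "openin (Xpow n) (\<Union>U\<in>\<U>. ?S n U)" by (intro openin_Union) blast
    moreover have "?S n (\<Union>\<U>) = (\<Union>U\<in>\<U>. ?S n U)" by auto
    ultimately show "openin (Xpow n) (?S n (\<Union>\<U>))" by simp
  qed
  then show ?thesis unfolding ddconf_topology_def by (simp only: topology_inverse')
qed

definition conf0 :: "'a multiset set" where
  "conf0 = {\<eta>. \<forall>x. count \<eta> x \<le> 1}"

definition conf_n :: "'a set \<Rightarrow> nat \<Rightarrow> 'a multiset set" where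
  "conf_n \<Lambda> n = {\<eta> \<in> conf0. size \<eta> = n \<and> set_mset \<eta> \<subseteq> \<Lambda>}"

definition conf0_borel :: "'a::topological_space multiset measure" where
  "conf0_borel = sigma conf0 {U. openin (subtopology ddconf_topology conf0) U}"

section \<open>The convolution\<close>

text \<open>Elements of \<open>\<F>\<^sub>f\<^sub>i\<^sub>n(\<D>)\<close> are represented as functions on the multiple configurations.\<close>

definition component ::
  "nat \<Rightarrow> ('a::topological_space multiset \<Rightarrow> complex) \<Rightarrow> (nat \<Rightarrow> 'a) \<Rightarrow> complex" where
  "component n G x = (if x \<in> topspace (Xpow n) then G (cfg x {..<n}) else 0)"

definition Ffin ::
  "('a::topological_space, 'n::finite) chart set \<Rightarrow> ('a multiset \<Rightarrow> complex) set" where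
  "Ffin A = {G. (\<forall>n. component n G \<in> test_fun A n) \<and> (\<exists>N. \<forall>\<eta>. size \<eta> > N \<longrightarrow> G \<eta> = 0)}"

definition one_particle :: "('a \<Rightarrow> real) \<Rightarrow> 'a multiset \<Rightarrow> complex" where
  "one_particle \<phi> \<eta> = (if size \<eta> = 1 then complex_of_real (\<phi> (the_elem (set_mset \<eta>))) else 0)"

definition partitions3 :: "nat \<Rightarrow> (nat set \<times> nat set \<times> nat set) set" where
  "partitions3 n = {(I, J, L). I \<union> J \<union> L = {..<n} \<and> I \<inter> J = {} \<and> I \<inter> L = {} \<and> J \<inter> L = {}}"

definition star_tuple ::
  "('a multiset \<Rightarrow> complex) \<Rightarrow> ('a multiset \<Rightarrow> complex) \<Rightarrow> nat \<Rightarrow> (nat \<Rightarrow> 'a) \<Rightarrow> complex" where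
  "star_tuple G1 G2 n x =
     (\<Sum>(I, J, L)\<in>partitions3 n. G1 (cfg x (I \<union> J)) * G2 (cfg x (J \<union> L)))"

definition star ::
  "('a multiset \<Rightarrow> complex) \<Rightarrow> ('a multiset \<Rightarrow> complex) \<Rightarrow> 'a multiset \<Rightarrow> complex" where
  "star G1 G2 \<eta> = star_tuple G1 G2 (size \<eta>) (SOME x. cfg x {..<size \<eta>} = \<eta>)"

text \<open>The choice of the enumeration is immaterial.\<close>

lemma star_tuple_permute:
  assumes "\<pi> permutes {..<n}"
  shows "star_tuple G1 G2 n (x \<circ> \<pi>) = star_tuple G1 G2 n x"
proof -
  have inj: "inj \<pi>" using assms by (rule permutes_inj)
  have cfg: "cfg (x \<circ> \<pi>) I = cfg x (\<pi> ` I)" for I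
    unfolding cfg_def
    by (simp add: image_mset_mset_set[OF inj_on_subset[OF inj], symmetric]
        multiset.map_comp comp_def)
  let ?h = "\<lambda>(I, J, L). (\<pi> ` I, \<pi> ` J, \<pi> ` L)"
  let ?k = "\<lambda>(I, J, L). (inv \<pi> ` I, inv \<pi> ` J, inv \<pi> ` L)"
  have *: "(\<rho> ` I, \<rho> ` J, \<rho> ` L) \<in> partitions3 n"
    if "\<rho> permutes {..<n}" "(I, J, L) \<in> partitions3 n" for \<rho> I J L
  proof -
    have i: "inj \<rho>" using that(1) by (rule permutes_inj)
    have "\<rho> ` I \<union> \<rho> ` J \<union> \<rho> ` L = \<rho> ` (I \<union> J \<union> L)" by auto
    also have "\<dots> = {..<n}"
      using that permutes_image[OF that(1)] by (simp add: partitions3_def)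
    finally show ?thesis
      using that(2) by (auto simp: partitions3_def image_Int[OF i, symmetric])
  qed
  show ?thesis
    unfolding star_tuple_def
  proof (rule sum.reindex_bij_witness[where i = ?k and j = ?h], goal_cases)
    case (1 a) then show ?case
      by (cases a) (simp add: image_image permutes_inverses(2)[OF assms])
  next
    case (2 a) then show ?case using *[OF assms] by (cases a) simp
  next
    case (3 a) then show ?case
      by (cases a) (simp add: image_image permutes_inverses(1)[OF assms])
  next
    case (4 a) then show ?case using *[OF permutes_inv[OF assms]] by (cases a) simp
  next
    case (5 a) then show ?case by (cases a) (simp add: cfg image_Un)
  qed
qed

lemma star_cfg: "star G1 G2 (cfg x {..<n}) = star_tuple G1 G2 n x"
proof -
  have size: "size (cfg x {..<n}) = n" by (simp add: cfg_def)
  define y where "y = (SOME y. cfg y {..<n} = cfg x {..<n})"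
  have "cfg y {..<n} = cfg x {..<n}" unfolding y_def by (rule someI[where x = x]) (rule refl)
  then have "image_mset y (mset_set {..<n}) = image_mset x (mset_set {..<n})"
    by (simp only: cfg_def)
  then obtain \<pi> where \<pi>: "\<pi> permutes {..<n}" "\<forall>i\<in>{..<n}. y i = x (\<pi> i)"
    by (rule image_mset_eq_implies_permutes[OF finite_lessThan])
  have eq: "cfg y I = cfg (x \<circ> \<pi>) I" if "I \<subseteq> {..<n}" for I
  proof -
    have "finite I" using that by (rule finite_subset) simp
    then show ?thesis unfolding cfg_def comp_def
      using that \<pi>(2) by (intro image_mset_cong) (simp add: subset_iff)
  qed
  have "star_tuple G1 G2 n y = star_tuple G1 G2 n (x \<circ> \<pi>)"
    unfolding star_tuple_def
  proof (intro sum.cong refl)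
    fix p assume "p \<in> partitions3 n"
    moreover obtain I J L where p: "p = (I, J, L)" by (cases p)
    ultimately have "I \<union> J \<union> L = {..<n}" by (simp add: partitions3_def)
    then have sub: "I \<union> J \<subseteq> {..<n}" "J \<union> L \<subseteq> {..<n}" by blast+
    show "(case p of (I, J, L) \<Rightarrow> G1 (cfg y (I \<union> J)) * G2 (cfg y (J \<union> L))) =
      (case p of (I, J, L) \<Rightarrow> G1 (cfg (x \<circ> \<pi>) (I \<union> J)) * G2 (cfg (x \<circ> \<pi>) (J \<union> L)))"
      by (simp add: p eq[OF sub(1)] eq[OF sub(2)])
  qed
  also have "\<dots> = star_tuple G1 G2 n x" by (rule star_tuple_permute[OF \<pi>(1)])
  finally show ?thesis by (simp only: star_def size y_def)
qed

definition a_form ::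
  "'a multiset measure \<Rightarrow> ('a multiset \<Rightarrow> complex) \<Rightarrow> ('a multiset \<Rightarrow> complex) \<Rightarrow> complex" where
  "a_form \<rho> G1 G2 = (LINT \<eta>|\<rho>. star G1 G2 \<eta>)"

definition conj_fun :: "('p \<Rightarrow> complex) \<Rightarrow> 'p \<Rightarrow> complex" where
  "conj_fun G \<eta> = cnj (G \<eta>)"

section \<open>Complex Hilbert spaces with explicit carriers\<close>

text \<open>Complex vector spaces with a positive semidefinite Hermitian form, linear on the left.\<close>

record 'v sip =
  carr :: "'v set"
  vadd :: "'v \<Rightarrow> 'v \<Rightarrow> 'v"
  vscale :: "complex \<Rightarrow> 'v \<Rightarrow> 'v"
  inn :: "'v \<Rightarrow> 'v \<Rightarrow> complex"

definition vdiff :: "'v sip \<Rightarrow> 'v \<Rightarrow> 'v \<Rightarrow> 'v" where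
  "vdiff V x y = vadd V x (vscale V (- 1) y)"

definition sdist :: "'v sip \<Rightarrow> 'v \<Rightarrow> 'v \<Rightarrow> real" where
  "sdist V x y = sqrt (Re (inn V (vdiff V x y) (vdiff V x y)))"

definition null_rel :: "'v sip \<Rightarrow> ('v \<times> 'v) set" where
  "null_rel V = {(x, y). x \<in> carr V \<and> y \<in> carr V \<and> inn V (vdiff V x y) (vdiff V x y) = 0}"

definition vclass :: "'v sip \<Rightarrow> 'v \<Rightarrow> 'v set" where
  "vclass V x = null_rel V `` {x}"

definition rep :: "'v set \<Rightarrow> 'v" where
  "rep P = (SOME x. x \<in> P)"

definition quotient_space :: "'v sip \<Rightarrow> 'v set sip" where
  "quotient_space V = \<lparr>
     carr = carr V // null_rel V,
     vadd = (\<lambda>P Q. vclass V (vadd V (rep P) (rep Q))),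
     vscale = (\<lambda>z P. vclass V (vscale V z (rep P))),
     inn = (\<lambda>P Q. inn V (rep P) (rep Q))\<rparr>"

definition cauchy_seqs :: "'v sip \<Rightarrow> (nat \<Rightarrow> 'v) sip" where
  "cauchy_seqs V = \<lparr>
     carr = {s. (\<forall>n. s n \<in> carr V) \<and>
                (\<forall>e>0. \<exists>N. \<forall>m\<ge>N. \<forall>n\<ge>N. sdist V (s m) (s n) < e)},
     vadd = (\<lambda>s t n. vadd V (s n) (t n)),
     vscale = (\<lambda>z s n. vscale V z (s n)),
     inn = (\<lambda>s t. lim (\<lambda>n. inn V (s n) (t n)))\<rparr>"

definition completion :: "'v sip \<Rightarrow> (nat \<Rightarrow> 'v) set sip" where
  "completion V = quotient_space (cauchy_seqs V)"

definition embed :: "'v sip \<Rightarrow> 'v \<Rightarrow> (nat \<Rightarrow> 'v) set" where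
  "embed V x = vclass (cauchy_seqs V) (\<lambda>_. x)"

definition unitary_iso :: "'v sip \<Rightarrow> 'w sip \<Rightarrow> ('v \<Rightarrow> 'w) \<Rightarrow> bool" where
  "unitary_iso V W K \<longleftrightarrow> bij_betw K (carr V) (carr W) \<and>
     (\<forall>x\<in>carr V. \<forall>y\<in>carr V. K (vadd V x y) = vadd W (K x) (K y)) \<and>
     (\<forall>z. \<forall>x\<in>carr V. K (vscale V z x) = vscale W z (K x)) \<and>
     (\<forall>x\<in>carr V. \<forall>y\<in>carr V. inn W (K x) (K y) = inn V x y)"

text \<open>Unbounded operators are represented by their graphs.\<close>

definition op_closure :: "'v sip \<Rightarrow> ('v \<times> 'v) set \<Rightarrow> ('v \<times> 'v) set" where
  "op_closure V T = {(x, y). x \<in> carr V \<and> y \<in> carr V \<and>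
     (\<exists>s. (\<forall>n. s n \<in> T) \<and>
        (\<lambda>n. sdist V (fst (s n)) x) \<longlonglongrightarrow> 0 \<and> (\<lambda>n. sdist V (snd (s n)) y) \<longlonglongrightarrow> 0)}"

definition L2_pre :: "'w measure \<Rightarrow> ('w \<Rightarrow> complex) sip" where
  "L2_pre \<mu> = \<lparr>
     carr = {f \<in> borel_measurable \<mu>. integrable \<mu> (\<lambda>w. (cmod (f w))\<^sup>2)},
     vadd = (\<lambda>f g w. f w + g w),
     vscale = (\<lambda>z f w. z * f w),
     inn = (\<lambda>f g. LINT w|\<mu>. f w * cnj (g w))\<rparr>"

definition L2 :: "'w measure \<Rightarrow> ('w \<Rightarrow> complex) set sip" where
  "L2 \<mu> = quotient_space (L2_pre \<mu>)"

definition mult_op :: "'w measure \<Rightarrow> ('w \<Rightarrow> real) \<Rightarrow> (('w \<Rightarrow> complex) set \<times> ('w \<Rightarrow> complex) set) set" where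
  "mult_op \<mu> h = {(vclass (L2_pre \<mu>) f, vclass (L2_pre \<mu>) (\<lambda>w. complex_of_real (h w) * f w)) | f.
     f \<in> carr (L2_pre \<mu>) \<and> (\<lambda>w. complex_of_real (h w) * f w) \<in> carr (L2_pre \<mu>)}"

section \<open>The Hilbert space of a correlation measure and the associated measure\<close>

definition Ffin_pre ::
  "('a::topological_space, 'n::finite) chart set \<Rightarrow> 'a multiset measure
     \<Rightarrow> ('a multiset \<Rightarrow> complex) sip" where
  "Ffin_pre A \<rho> = \<lparr>
     carr = Ffin A,
     vadd = (\<lambda>G1 G2 \<eta>. G1 \<eta> + G2 \<eta>),
     vscale = (\<lambda>z G \<eta>. z * G \<eta>),
     inn = (\<lambda>G1 G2. a_form \<rho> G1 (conj_fun G2))\<rparr>"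

definition H_space ::
  "('a::topological_space, 'n::finite) chart set \<Rightarrow> 'a multiset measure
     \<Rightarrow> (nat \<Rightarrow> ('a multiset \<Rightarrow> complex) set) set sip" where
  "H_space A \<rho> = completion (quotient_space (Ffin_pre A \<rho>))"

text \<open>The class of \<open>G\<close>, as an element of the completion.\<close>

definition hat ::
  "('a::topological_space, 'n::finite) chart set \<Rightarrow> 'a multiset measure
     \<Rightarrow> ('a multiset \<Rightarrow> complex) \<Rightarrow> (nat \<Rightarrow> ('a multiset \<Rightarrow> complex) set) set" where
  "hat A \<rho> G = embed (quotient_space (Ffin_pre A \<rho>)) (vclass (Ffin_pre A \<rho>) G)"

definition A_op ::
  "('a::topological_space, 'n::finite) chart set \<Rightarrow> 'a multiset measure \<Rightarrow> ('a \<Rightarrow> real)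
     \<Rightarrow> ((nat \<Rightarrow> ('a multiset \<Rightarrow> complex) set) set \<times>
         (nat \<Rightarrow> ('a multiset \<Rightarrow> complex) set) set) set" where
  "A_op A \<rho> \<phi> = {(hat A \<rho> G, hat A \<rho> (star (one_particle \<phi>) G)) | G. G \<in> Ffin A}"

definition K_fun ::
  "('a::topological_space, 'n::finite) chart set \<Rightarrow> ('a multiset \<Rightarrow> complex)
     \<Rightarrow> (('a \<Rightarrow> real) \<Rightarrow> real) \<Rightarrow> complex" where
  "K_fun A G \<omega> = (\<Sum>n. cpairing (wick A \<omega> n) (component n G))"

text \<open>
  The last clause states the operator identity \<open>K A\<^sub>\<phi>\<^sup>~ K\<^sup>-\<^sup>1 = \<langle>\<phi>, \<cdot>\<rangle>\<cdot>\<close> for the graphs, domains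
  included; the multiplication operator has its maximal domain.
\<close>

definition associated_measure ::
  "('a::topological_space, 'n::finite) chart set \<Rightarrow> 'a multiset measure
     \<Rightarrow> (('a \<Rightarrow> real) \<Rightarrow> real) measure \<Rightarrow> bool" where
  "associated_measure A \<rho> \<mu> \<longleftrightarrow> prob_space \<mu> \<and> sets \<mu> = sets (cylinder_sigma A) \<and>
     (\<exists>K. unitary_iso (H_space A \<rho>) (L2 \<mu>) K \<and>
        (\<forall>G\<in>Ffin A. K_fun A G \<in> carr (L2_pre \<mu>) \<and>
           K (hat A \<rho> G) = vclass (L2_pre \<mu>) (K_fun A G)) \<and>
        (\<forall>\<phi>\<in>DD A. (\<lambda>(x, y). (K x, K y)) ` op_closure (H_space A \<rho>) (A_op A \<rho> \<phi>)
           = mult_op \<mu> (\<lambda>\<omega>. \<omega> \<phi>)))"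

section \<open>The configuration space\<close>

definition conf_space :: "'a::topological_space set set" where
  "conf_space = {\<gamma>. \<forall>\<Lambda>. compact \<Lambda> \<longrightarrow> finite (\<gamma> \<inter> \<Lambda>)}"

text \<open>The functional \<open>\<phi> \<mapsto> \<langle>\<phi>, \<Sum>\<^sub>x\<^sub>\<in>\<^sub>\<gamma> \<delta>\<^sub>x\<rangle>\<close>; only finitely many \<open>x \<in> \<gamma>\<close> lie in the support of \<open>\<phi>\<close>.\<close>

definition conf_functional ::
  "('a::topological_space, 'n::finite) chart set \<Rightarrow> 'a set \<Rightarrow> ('a \<Rightarrow> real) \<Rightarrow> real" where
  "conf_functional A \<gamma> = (\<lambda>\<phi>\<in>DD A. \<Sum>x | x \<in> \<gamma> \<and> \<phi> x \<noteq> 0. \<phi> x)"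

end

theory Submission
  imports Defs "HOL-Probability.Probability" "HOL-Combinatorics.Multiset_Permutations"
begin

text \<open>
  For \<open>\<phi> \<in> \<D>\<close> the moments of \<open>\<langle>\<phi>, \<cdot>\<rangle>\<close> under \<open>\<mu>\<close> are the integrals of the \<open>\<star>\<close>-powers of \<open>\<phi>\<close> against \<open>\<rho>\<close>, and on
  a finite set \<open>\<eta>\<close> the \<open>k\<close>-th such power is \<open>\<Sum> (-1)\<^sup>|\<^sup>\<eta>\<^sup>-\<^sup>\<xi>\<^sup>| \<langle>\<phi>, \<xi>\<rangle>\<^sup>k\<close>, summed over \<open>\<xi> \<subseteq> \<eta>\<close>. Hence, for test functions
  supported in a set \<open>\<Lambda>\<close>, \<open>\<mu>\<close> has the moments of a signed measure living on the finite subsets of \<open>\<Lambda>\<close>. If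
  \<open>\<rho>(\<Gamma>\<^sub>\<Lambda>\<^sup>(\<^sup>n\<^sup>)) \<le> (2 + \<epsilon>)\<^sup>-\<^sup>n\<close>, the total variation \<open>2\<^sup>|\<^sup>\<eta>\<^sup>|\<close> leaves an exponential moment finite, so both sides have analytic
  Fourier transforms with equal derivatives at 0 and therefore agree: \<open>\<mu>\<close>-almost every \<open>\<omega>\<close> coincides on
  \<open>\<Lambda>\<close> with a finite sum of point masses. A countable cover by such \<open>\<Lambda>\<close> and a partition of unity glue the
  local configurations to an element of \<open>\<Gamma>\<^sub>X\<close>.

  The vacuum vector is mapped by \<open>K\<close> to the constant 1, but this would require the existence of the Wick
  powers. The argument is therefore carried out for \<open>|h\<^sub>0|\<^sup>2 \<mu>\<close>, \<open>h\<^sub>0\<close> being the image of the vacuum. Multiplication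
  by the \<open>\<langle>\<phi>, \<cdot>\<rangle>\<close> and density of the tensor products show that all of \<open>L\<^sup>2(\<mu>)\<close> vanishes where \<open>h\<^sub>0\<close> does.
\<close>

section \<open>Smoothness along coordinate directions\<close>

text \<open>The alternating sum is a Moebius transform over the subsets of \<eta>, so the comparison
  measure is signed and uniqueness theorems for positive moment problems do not apply to it.
  Equality of the Fourier transforms is therefore extended by hand, from trigonometric polynomials
  to indicators of Borel sets, always for averages of the form \<open>D F\<close>; only at the end
  does positivity of the measure on the other side turn a vanishing average into a null set. The
  constant 2 counts the choices per point: each of the \<open>2 ^ n\<close> subsets of an
  \<open>n\<close>-point set carries mass one, and any \<epsilon> > 0 leaves a geometric margin.
  Locality comes from cancellation: if a point of \<eta> lies where the test function vanishes, the
  terms with and without it cancel. Measurability shapes the rest. A distribution is tested on a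
  sequence that is sequentially dense among the test functions on a coordinate ball, and the
  sequences of pairings with finite sets of distinct points form a sigma-compact, hence Borel, set.
  Disjoint compact boxes enforce distinctness there, which rules out multiple points.\<close>

definition flow :: "'p topology \<Rightarrow> ('d \<Rightarrow> real \<Rightarrow> 'p \<Rightarrow> 'p) \<Rightarrow> 'd set \<Rightarrow> bool" where
  "flow T move Ds \<longleftrightarrow> (\<forall>d\<in>Ds. \<forall>y\<in>topspace T.
     move d 0 y = y \<and> (\<forall>\<^sub>F t in nhds 0. move d t y \<in> topspace T))"

text \<open>Unlike \<open>pderiv_along\<close>, whose value is arbitrary when the limit does not
  exist, this relation asserts existence.\<close>

definition has_partial ::
  "('d \<Rightarrow> real \<Rightarrow> 'p \<Rightarrow> 'p) \<Rightarrow> 'd \<Rightarrow> ('p \<Rightarrow> 'v::real_normed_vector) \<Rightarrow> 'p \<Rightarrow> 'v \<Rightarrow> bool" where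
  "has_partial move d f y D \<longleftrightarrow> ((\<lambda>t. f (move d t y)) has_vector_derivative D) (at 0)"

lemma has_partial_imp_pderiv: "has_partial move d f y D \<Longrightarrow> pderiv_along move d f y = D"
  unfolding has_partial_def pderiv_along_def by (rule vector_derivative_at)

lemma flow_eventually_eq:
  assumes "flow T move Ds" "d \<in> Ds" "y \<in> topspace T" "\<And>z. z \<in> topspace T \<Longrightarrow> f z = g z"
  shows "\<forall>\<^sub>F t in nhds 0. f (move d t y) = g (move d t y)"
proof -
  have "\<forall>\<^sub>F t in nhds 0. move d t y \<in> topspace T"
    using assms(1,2,3) unfolding flow_def by blast
  then show ?thesis by eventually_elim (rule assms(4))
qed

text \<open>A derivative at 0 sees only small \<open>t\<close>, and \<open>flow\<close> keeps the
  translates \<open>move d t y\<close> in the domain for such \<open>t\<close>. Functions that agree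
  on \<open>topspace T\<close> alone thus have the same partial derivatives there.\<close>

lemma has_partial_cong:
  assumes "flow T move Ds" "d \<in> Ds" "y \<in> topspace T" "\<And>z. z \<in> topspace T \<Longrightarrow> f z = g z"
  shows "has_partial move d f y D \<longleftrightarrow> has_partial move d g y D"
proof -
  have ev: "\<forall>\<^sub>F t in nhds 0. f (move d t y) = g (move d t y)"
    by (rule flow_eventually_eq[OF assms(1-3)]) (rule assms(4))
  show ?thesis
    unfolding has_partial_def
    by (intro has_vector_derivative_cong_ev refl)
      (use ev eventually_nhds_x_imp_x[OF ev] in \<open>auto elim: eventually_mono\<close>)
qed

lemma pderiv_along_cong:
  assumes "flow T move Ds" "d \<in> Ds" "y \<in> topspace T" "\<And>z. z \<in> topspace T \<Longrightarrow> f z = g z"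
  shows "pderiv_along move d f y = pderiv_along move d g y"
proof -
  have "has_partial move d f y D \<longleftrightarrow> has_partial move d g y D" for D
    by (rule has_partial_cong[OF assms(1-3)]) (rule assms(4))
  then show ?thesis
    unfolding has_partial_def pderiv_along_def vector_derivative_def by simp
qed

lemma iter_pderiv_Nil [simp]: "iter_pderiv move [] f = f"
  and iter_pderiv_Cons [simp]: "iter_pderiv move (d # ds) f = pderiv_along move d (iter_pderiv move ds f)"
  by (simp_all add: iter_pderiv_def)

lemma iter_pderiv_append:
  "iter_pderiv move (ds @ es) f = iter_pderiv move ds (iter_pderiv move es f)"
  by (simp add: iter_pderiv_def)

lemma iter_pderiv_cong:
  assumes "flow T move Ds" "ds \<in> lists Ds" "y \<in> topspace T" "\<And>z. z \<in> topspace T \<Longrightarrow> f z = g z"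
  shows "iter_pderiv move ds f y = iter_pderiv move ds g y"
  using assms(2,3)
proof (induction ds arbitrary: y)
  case Nil
  then show ?case using assms(4) by simp
next
  case (Cons d ds)
  then show ?case by (auto intro!: pderiv_along_cong[OF assms(1)])
qed

text \<open>Smoothness is the greatest class of continuous functions stable under partial
  differentiation, so it is enough to exhibit one stable class \<open>P\<close> containing
  \<open>f\<close>. Most closure properties below choose such a \<open>P\<close> and differentiate
  once, without handling higher derivatives.\<close>

lemma smooth_along_coinduct:
  assumes "flow T move Ds" "P f"
    and step: "\<And>f. P f \<Longrightarrow> continuous_map T euclidean f \<and>
      (\<forall>d\<in>Ds. \<exists>g. P g \<and> (\<forall>y\<in>topspace T. has_partial move d f y (g y)))"
  shows "smooth_along T move Ds f"
proof -
  have *: "\<exists>g. P g \<and> (\<forall>y\<in>topspace T. iter_pderiv move ds f y = g y)" if "ds \<in> lists Ds" for ds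
    using that
  proof (induction ds)
    case Nil
    then show ?case using assms(2) by auto
  next
    case (Cons d ds)
    then obtain g where g: "P g" "\<forall>y\<in>topspace T. iter_pderiv move ds f y = g y" by auto
    obtain h where h: "P h" "\<forall>y\<in>topspace T. has_partial move d g y (h y)"
      using step[OF g(1)] Cons by auto
    have "iter_pderiv move (d # ds) f y = h y" if "y \<in> topspace T" for y
      using pderiv_along_cong[OF assms(1) _ that, of d "iter_pderiv move ds f" g] Cons.hyps g(2) h(2) that
      by (simp add: has_partial_imp_pderiv)
    then show ?case using h(1) by blast
  qed
  show ?thesis
    unfolding smooth_along_def
  proof (intro ballI conjI)
    fix ds assume ds: "ds \<in> lists Ds"
    from *[OF ds] obtain g where g: "P g" "\<forall>y\<in>topspace T. iter_pderiv move ds f y = g y" by auto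
    show "continuous_map T euclidean (iter_pderiv move ds f)"
      using step[OF g(1)] g(2) continuous_map_eq[of T euclidean g] by metis
    fix d y assume dy: "d \<in> Ds" "y \<in> topspace T"
    then obtain D where "has_partial move d g y D" using step[OF g(1)] by blast
    then have "has_partial move d (iter_pderiv move ds f) y D"
      using has_partial_cong[OF assms(1) dy, of "iter_pderiv move ds f" g] g(2) by blast
    then show "(\<lambda>t. iter_pderiv move ds f (move d t y)) differentiable at 0"
      unfolding has_partial_def by (rule differentiableI_vector)
  qed
qed

lemma smooth_along_continuous: "smooth_along T move Ds f \<Longrightarrow> continuous_map T euclidean f"
  unfolding smooth_along_def using lists.Nil by (metis iter_pderiv_Nil)

lemma smooth_along_iter:
  assumes "smooth_along T move Ds f" "ds \<in> lists Ds"
  shows "smooth_along T move Ds (iter_pderiv move ds f)"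
  using assms unfolding smooth_along_def iter_pderiv_append[symmetric] by (metis append_in_lists_conv)

lemma smooth_along_pderiv:
  assumes "smooth_along T move Ds f" "d \<in> Ds"
  shows "smooth_along T move Ds (pderiv_along move d f)"
  using smooth_along_iter[OF assms(1), of "[d]"] assms(2) by simp

lemma smooth_along_has_partial:
  assumes "smooth_along T move Ds f" "d \<in> Ds" "y \<in> topspace T"
  shows "has_partial move d f y (pderiv_along move d f y)"
proof -
  have "\<forall>d\<in>Ds. \<forall>y\<in>topspace T. (\<lambda>t. iter_pderiv move [] f (move d t y)) differentiable (at 0)"
    using assms(1) unfolding smooth_along_def by blast
  with assms(2,3) show ?thesis
    unfolding has_partial_def pderiv_along_def by (simp add: vector_derivative_works)
qed

lemma smooth_along_cong:
  assumes "flow T move Ds" "\<And>z. z \<in> topspace T \<Longrightarrow> f z = g z" "smooth_along T move Ds f"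
  shows "smooth_along T move Ds g"
proof (rule smooth_along_coinduct[OF assms(1), where P = "\<lambda>g. \<exists>f. smooth_along T move Ds f \<and> (\<forall>z\<in>topspace T. f z = g z)"])
  show "\<exists>f. smooth_along T move Ds f \<and> (\<forall>z\<in>topspace T. f z = g z)" using assms by blast
  fix g assume "\<exists>f. smooth_along T move Ds f \<and> (\<forall>z\<in>topspace T. f z = g z)"
  then obtain f where f: "smooth_along T move Ds f" "\<forall>z\<in>topspace T. f z = g z" by blast
  have "continuous_map T euclidean g"
    using smooth_along_continuous[OF f(1)] f(2) continuous_map_eq by metis
  moreover have "\<exists>h. (\<exists>f. smooth_along T move Ds f \<and> (\<forall>z\<in>topspace T. f z = h z)) \<and>
      (\<forall>y\<in>topspace T. has_partial move d g y (h y))" if "d \<in> Ds" for d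
    using smooth_along_pderiv[OF f(1) that] smooth_along_has_partial[OF f(1) that]
      has_partial_cong[OF assms(1) that, of _ f g] f(2)
    by (intro exI[of _ "pderiv_along move d f"] conjI) auto
  ultimately show "continuous_map T euclidean g \<and> (\<forall>d\<in>Ds. \<exists>h. (\<exists>f. smooth_along T move Ds f \<and>
      (\<forall>z\<in>topspace T. f z = h z)) \<and> (\<forall>y\<in>topspace T. has_partial move d g y (h y)))" by auto
qed

section \<open>Sums, products and compositions of smooth functions\<close>

inductive_set alg_hull :: "('p \<Rightarrow> 'v::real_normed_algebra) set \<Rightarrow> ('p \<Rightarrow> 'v) set" for B where
  base: "b \<in> B \<Longrightarrow> b \<in> alg_hull B"
| add: "f \<in> alg_hull B \<Longrightarrow> g \<in> alg_hull B \<Longrightarrow> (\<lambda>y. f y + g y) \<in> alg_hull B"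
| mult: "f \<in> alg_hull B \<Longrightarrow> g \<in> alg_hull B \<Longrightarrow> (\<lambda>y. f y * g y) \<in> alg_hull B"

text \<open>The sum and product rules keep the derivative of a polynomial expression in
  \<open>B\<close> inside the hull, so first derivatives have to be examined on the generators
  only.\<close>

lemma smooth_along_alg_hull:
  assumes fl: "flow T move Ds"
    and cont: "\<And>b. b \<in> B \<Longrightarrow> continuous_map T euclidean b"
    and part: "\<And>b d. b \<in> B \<Longrightarrow> d \<in> Ds \<Longrightarrow>
      \<exists>g\<in>alg_hull B. \<forall>y\<in>topspace T. has_partial move d b y (g y)"
    and f: "f \<in> alg_hull B"
  shows "smooth_along T move Ds f"
proof (rule smooth_along_coinduct[OF fl, where P = "\<lambda>f. f \<in> alg_hull B"])
  show "f \<in> alg_hull B" by fact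
  fix f assume "f \<in> alg_hull B"
  then show "continuous_map T euclidean f \<and>
      (\<forall>d\<in>Ds. \<exists>g. g \<in> alg_hull B \<and> (\<forall>y\<in>topspace T. has_partial move d f y (g y)))"
  proof induction
    case (base b)
    then show ?case using cont part by blast
  next
    case (add f g)
    have "\<exists>h. h \<in> alg_hull B \<and> (\<forall>y\<in>topspace T. has_partial move d (\<lambda>y. f y + g y) y (h y))"
      if d: "d \<in> Ds" for d
    proof -
      obtain f' g' where "f' \<in> alg_hull B" "\<forall>y\<in>topspace T. has_partial move d f y (f' y)"
        "g' \<in> alg_hull B" "\<forall>y\<in>topspace T. has_partial move d g y (g' y)"
        using add.IH d by blast
      then show ?thesis unfolding has_partial_def
        by (intro exI[of _ "\<lambda>y. f' y + g' y"]) (auto intro: alg_hull.add has_vector_derivative_add)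
    qed
    note p = this
    have c: "continuous_map T euclidean (\<lambda>y. f y + g y)"
      using add.IH by (intro continuous_map_add) blast+
    show ?case by (intro conjI ballI c p)
  next
    case (mult f g)
    have "\<exists>h. h \<in> alg_hull B \<and> (\<forall>y\<in>topspace T. has_partial move d (\<lambda>y. f y * g y) y (h y))"
      if d: "d \<in> Ds" for d
    proof -
      obtain f' g' where fg: "f' \<in> alg_hull B" "\<forall>y\<in>topspace T. has_partial move d f y (f' y)"
        "g' \<in> alg_hull B" "\<forall>y\<in>topspace T. has_partial move d g y (g' y)"
        using mult.IH d by blast
      have "(\<lambda>y. f y * g' y + f' y * g y) \<in> alg_hull B"
        using mult.hyps fg by (intro alg_hull.add alg_hull.mult)
      moreover have "has_partial move d (\<lambda>y. f y * g y) y (f y * g' y + f' y * g y)"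
        if y: "y \<in> topspace T" for y
      proof -
        have "move d 0 y = y" using fl d y unfolding flow_def by blast
        then show ?thesis
          using has_vector_derivative_mult[of "\<lambda>t. f (move d t y)" "f' y" 0 UNIV "\<lambda>t. g (move d t y)" "g' y"] fg y
          unfolding has_partial_def by simp
      qed
      ultimately show ?thesis by blast
    qed
    note p = this
    have c: "continuous_map T euclidean (\<lambda>y. f y * g y)"
      using mult.IH unfolding continuous_map_atin limitin_canonical_iff by (auto intro: tendsto_mult)
    show ?case by (intro conjI ballI c p)
  qed
qed

lemma
  fixes f g :: "'p \<Rightarrow> 'v::real_normed_algebra"
  assumes fl: "flow T move Ds" and f: "smooth_along T move Ds f" and g: "smooth_along T move Ds g"
  shows smooth_along_add: "smooth_along T move Ds (\<lambda>y. f y + g y)"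
    and smooth_along_mult: "smooth_along T move Ds (\<lambda>y. f y * g y)"
proof -
  have "smooth_along T move Ds h" if "h \<in> alg_hull (Collect (smooth_along T move Ds))"
    for h :: "'p \<Rightarrow> 'v"
    by (rule smooth_along_alg_hull[OF fl _ _ that])
      (auto intro: smooth_along_continuous smooth_along_pderiv smooth_along_has_partial alg_hull.base)
  then show "smooth_along T move Ds (\<lambda>y. f y + g y)" "smooth_along T move Ds (\<lambda>y. f y * g y)"
    using f g by (auto intro: alg_hull.intros)
qed

lemma smooth_along_const:
  assumes "flow T move Ds"
  shows "smooth_along T move Ds (\<lambda>_. c)"
  by (rule smooth_along_coinduct[OF assms, where P = "\<lambda>f. \<exists>c. f = (\<lambda>_. c)"])
    (auto simp: has_partial_def intro!: exI[of _ "\<lambda>_. 0"])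

lemma smooth_along_sum:
  fixes f :: "'i \<Rightarrow> 'p \<Rightarrow> 'v::real_normed_algebra"
  assumes "flow T move Ds" "\<And>i. i \<in> I \<Longrightarrow> smooth_along T move Ds (f i)"
  shows "smooth_along T move Ds (\<lambda>y. \<Sum>i\<in>I. f i y)"
  using assms(2)
  by (induction I rule: infinite_finite_induct)
    (auto simp: smooth_along_const[OF assms(1)] intro!: smooth_along_add[OF assms(1)])

lemma smooth_along_linear:
  assumes fl: "flow T move Ds" and L: "bounded_linear L" and f: "smooth_along T move Ds f"
  shows "smooth_along T move Ds (\<lambda>y. L (f y))"
proof (rule smooth_along_coinduct[OF fl, where P = "\<lambda>g. \<exists>f. smooth_along T move Ds f \<and> g = (\<lambda>y. L (f y))"])
  show "\<exists>f'. smooth_along T move Ds f' \<and> (\<lambda>y. L (f y)) = (\<lambda>y. L (f' y))" using f by blast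
  fix g assume "\<exists>f. smooth_along T move Ds f \<and> g = (\<lambda>y. L (f y))"
  then obtain f where f: "smooth_along T move Ds f" "g = (\<lambda>y. L (f y))" by blast
  have "continuous_map T euclidean (\<lambda>y. L (f y))"
    using smooth_along_continuous[OF f(1)] bounded_linear.tendsto[OF L]
    unfolding continuous_map_atin limitin_canonical_iff by blast
  moreover have "has_partial move d (\<lambda>y. L (f y)) y (L (pderiv_along move d f y))"
    if "d \<in> Ds" "y \<in> topspace T" for d y
    using smooth_along_has_partial[OF f(1) that] bounded_linear.has_vector_derivative[OF L]
    unfolding has_partial_def by blast
  ultimately show "continuous_map T euclidean g \<and> (\<forall>d\<in>Ds. \<exists>h. (\<exists>f. smooth_along T move Ds f \<and>
      h = (\<lambda>y. L (f y))) \<and> (\<forall>y\<in>topspace T. has_partial move d g y (h y)))"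
    unfolding f(2) using smooth_along_pderiv[OF f(1)]
    by (intro conjI ballI exI[of _ "\<lambda>y. L (pderiv_along move _ f y)"]) auto
qed

text \<open>\<open>h k\<close> plays the role of the \<open>k\<close>-th derivative of
  \<open>h 0\<close>. The hull of all smooth functions and all \<open>h k \<circ> g\<close> is
  stable, because the partial derivative of \<open>h k \<circ> g\<close> is that of \<open>g\<close>
  times \<open>h (Suc k) \<circ> g\<close>.\<close>

lemma smooth_along_compose_real:
  fixes h :: "nat \<Rightarrow> real \<Rightarrow> real" and g :: "'p \<Rightarrow> real"
  assumes fl: "flow T move Ds" and g: "smooth_along T move Ds g"
    and W: "\<And>y. y \<in> topspace T \<Longrightarrow> g y \<in> W"
    and h: "\<And>k t. t \<in> W \<Longrightarrow> (h k has_real_derivative h (Suc k) t) (at t)"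
  shows "smooth_along T move Ds (\<lambda>y. h 0 (g y))"
proof (rule smooth_along_alg_hull[OF fl, where B = "Collect (smooth_along T move Ds) \<union> range (\<lambda>k y. h k (g y))"])
  let ?B = "Collect (smooth_along T move Ds) \<union> range (\<lambda>k y. h k (g y))"
  show "(\<lambda>y. h 0 (g y)) \<in> alg_hull ?B" by (rule alg_hull.base) blast
  fix b assume "b \<in> ?B"
  then consider "smooth_along T move Ds b" | k where "b = (\<lambda>y. h k (g y))" by blast
  note cas = this
  show "continuous_map T euclidean b"
  proof (cases rule: cas)
    case 1
    then show ?thesis by (rule smooth_along_continuous)
  next
    case (2 k)
    have "isCont (h k) t" if "t \<in> W" for t
      by (rule DERIV_isCont[OF h[OF that]])
    then show ?thesis unfolding 2
      using smooth_along_continuous[OF g] W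
      unfolding continuous_map_atin limitin_canonical_iff
      by (auto intro!: isCont_tendsto_compose[where g = "h k"])
  qed
  fix d assume d: "d \<in> Ds"
  show "\<exists>q\<in>alg_hull ?B. \<forall>y\<in>topspace T. has_partial move d b y (q y)"
  proof (cases rule: cas)
    case 1
    then show ?thesis
      by (intro bexI[of _ "pderiv_along move d b"])
       (auto intro: alg_hull.base smooth_along_pderiv[OF _ d] smooth_along_has_partial[OF _ d])
  next
    case (2 k)
    show ?thesis
    proof (intro bexI ballI)
      show "(\<lambda>y. pderiv_along move d g y * h (Suc k) (g y)) \<in> alg_hull ?B"
        by (intro alg_hull.mult alg_hull.base) (auto intro: smooth_along_pderiv[OF g d])
      fix y assume y: "y \<in> topspace T"
      have "move d 0 y = y" using fl d y unfolding flow_def by blast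
      then have "(h k has_real_derivative h (Suc k) (g y)) (at (g (move d 0 y)))"
        using h[OF W[OF y]] by simp
      moreover have "((\<lambda>t. g (move d t y)) has_vector_derivative pderiv_along move d g y) (at 0)"
        using smooth_along_has_partial[OF g d y] unfolding has_partial_def .
      ultimately show "has_partial move d b y (pderiv_along move d g y * h (Suc k) (g y))"
        unfolding 2 has_partial_def has_real_derivative_iff_has_vector_derivative[symmetric]
        using DERIV_chain2 by (metis mult.commute)
    qed
  qed
qed

lemma flow_shift_vec: "open U \<Longrightarrow> flow (top_of_set U) shift_vec UNIV"
proof -
  assume U: "open U"
  have "\<forall>\<^sub>F t in nhds 0. shift_vec d t y \<in> U" if "y \<in> U" for d y
  proof -
    have "((\<lambda>t. shift_vec d t y) \<longlongrightarrow> shift_vec d 0 y) (nhds 0)"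
      unfolding shift_vec_def by (intro tendsto_intros filterlim_ident)
    then show ?thesis using topological_tendstoD[OF _ U] that by (auto simp: shift_vec_def)
  qed
  then show ?thesis by (auto simp: flow_def shift_vec_def)
qed

text \<open>Coordinates are moved one at a time, by induction over the set \<open>S\<close> of
  coordinates already moved, and each step is a one-dimensional mean value estimate. Smoothness is
  defined through partial derivatives only; this is the passage to a total derivative on which the
  chain rule rests.\<close>

lemma continuous_partials_imp_has_derivative:
  fixes f :: "real^'n \<Rightarrow> 'v::real_normed_vector"
  assumes U: "open U" "y \<in> U"
    and part: "\<And>k z. z \<in> U \<Longrightarrow> has_partial shift_vec k f z (D k z)"
    and cont: "\<And>k. continuous_on U (D k)"
  shows "(f has_derivative (\<lambda>h. \<Sum>k\<in>UNIV. h $ k *\<^sub>R D k y)) (at y)"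
proof -
  define tr :: "'n set \<Rightarrow> real^'n \<Rightarrow> real^'n" where "tr S h = (\<Sum>k\<in>S. h $ k *\<^sub>R axis k 1)" for S h
  have tr_nth: "tr S h $ j = (if j \<in> S then h $ j else 0)" for S h j
    unfolding tr_def by (simp add: axis_def if_distrib sum.delta cong: if_cong)
  have norm_tr: "norm (tr S h + s *\<^sub>R axis k 1) \<le> 2 * norm h" if "\<bar>s\<bar> \<le> \<bar>h $ k\<bar>" "k \<notin> S" for S h s k
  proof -
    have "norm (tr S h + s *\<^sub>R axis k 1) \<le> norm h"
      using that by (intro norm_le_componentwise_cart) (auto simp: tr_nth axis_def)
    then show ?thesis using norm_ge_zero[of h] by linarith
  qed
  have main: "\<forall>e>0. \<exists>d>0. \<forall>h. norm h < d \<longrightarrow>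
      norm (f (y + tr S h) - f y - (\<Sum>k\<in>S. h $ k *\<^sub>R D k y)) \<le> e * norm h" for S
  proof (induction S rule: infinite_finite_induct)
    case (infinite S)
    then show ?case by simp
  next
    case empty
    then show ?case by (auto simp: tr_def intro!: exI[of _ 1])
  next
    case (insert k S)
    show ?case
    proof (intro allI impI)
      fix e :: real assume e: "e > 0"
      obtain d1 where d1: "d1 > 0" "\<And>h. norm h < d1 \<Longrightarrow>
          norm (f (y + tr S h) - f y - (\<Sum>k\<in>S. h $ k *\<^sub>R D k y)) \<le> e / 2 * norm h"
        using insert.IH e half_gt_zero by blast
      obtain d2 where d2: "d2 > 0" "ball y d2 \<subseteq> U" using U open_contains_ball by blast
      have "isCont (D k) y" using cont[of k] U continuous_on_eq_continuous_at by blast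
      then obtain d3 where d3: "d3 > 0" "\<And>z. dist z y < d3 \<Longrightarrow> dist (D k z) (D k y) < e / 2"
        using e unfolding continuous_at_eps_delta by (meson half_gt_zero)
      \<comment> \<open>\<open>norm_tr\<close> places all intermediate points within
        \<open>2 * norm h\<close> of \<open>y\<close>, which is why \<open>d2\<close> and
        \<open>d3\<close> are halved.\<close>
      define d where "d = min d1 (min d2 d3 / 2)"
      have "norm (f (y + tr (insert k S) h) - f y - (\<Sum>k\<in>insert k S. h $ k *\<^sub>R D k y)) \<le> e * norm h"
        if h: "norm h < d" for h
      proof -
        define z where "z = y + tr S h"
        \<comment> \<open>Subtracting the linear term makes the derivative of \<open>g\<close> a
          difference of two values of \<open>D k\<close>, small by continuity.\<close>
        define g where "g s = f (z + s *\<^sub>R axis k 1) - s *\<^sub>R D k y" for s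
        have near: "dist (z + s *\<^sub>R axis k 1) y < min d2 d3" if "\<bar>s\<bar> \<le> \<bar>h $ k\<bar>" for s
        proof -
          have "dist (z + s *\<^sub>R axis k 1) y = norm (tr S h + s *\<^sub>R axis k 1)"
            by (simp add: z_def dist_norm algebra_simps)
          also have "\<dots> \<le> 2 * norm h" by (rule norm_tr[OF that insert.hyps(2)])
          also have "\<dots> < min d2 d3" using h unfolding d_def by linarith
          finally show ?thesis .
        qed
        have inU: "z + s *\<^sub>R axis k 1 \<in> U" if "\<bar>s\<bar> \<le> \<bar>h $ k\<bar>" for s
          using near[OF that] d2(2) by (auto simp: dist_commute subset_iff)
        have deriv: "(g has_vector_derivative (D k (z + s *\<^sub>R axis k 1) - D k y)) (at s)"
          if "\<bar>s\<bar> \<le> \<bar>h $ k\<bar>" for s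
        proof -
          have "((\<lambda>t. f (shift_vec k t (z + s *\<^sub>R axis k 1))) has_vector_derivative D k (z + s *\<^sub>R axis k 1)) (at 0)"
            using part[OF inU[OF that]] unfolding has_partial_def .
          then have "((\<lambda>t. f (z + (s + t) *\<^sub>R axis k 1)) has_vector_derivative D k (z + s *\<^sub>R axis k 1)) (at 0)"
            by (simp add: shift_vec_def scaleR_add_left add.assoc)
          then have *: "((\<lambda>t. f (z + t *\<^sub>R axis k 1)) has_vector_derivative D k (z + s *\<^sub>R axis k 1)) (at s)"
            using has_derivative_at_within has_vector_derivative_def
            by (simp add: has_vector_derivative_def has_derivative_at algebra_simps)
          show ?thesis unfolding g_def
            by (rule derivative_eq_intros * | simp)+
        qed
        have "norm (g (h $ k) - g 0) \<le> e / 2 * norm (h $ k - 0)"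
        proof (rule differentiable_bound[of "{- \<bar>h $ k\<bar>..\<bar>h $ k\<bar>}"])
          fix s assume "s \<in> {- \<bar>h $ k\<bar>..\<bar>h $ k\<bar>}"
          then have s: "\<bar>s\<bar> \<le> \<bar>h $ k\<bar>" by auto
          show "(g has_derivative (\<lambda>x. x *\<^sub>R (D k (z + s *\<^sub>R axis k 1) - D k y))) (at s within {- \<bar>h $ k\<bar>..\<bar>h $ k\<bar>})"
            using deriv[OF s] unfolding has_vector_derivative_def by (rule has_derivative_at_withinI)
          have "norm (D k (z + s *\<^sub>R axis k 1) - D k y) \<le> e / 2"
            using d3(2)[of "z + s *\<^sub>R axis k 1"] near[OF s] by (simp add: dist_norm)
          then show "onorm (\<lambda>x. x *\<^sub>R (D k (z + s *\<^sub>R axis k 1) - D k y)) \<le> e / 2"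
            by (simp add: onorm_scaleR_left bounded_linear_ident onorm_id)
        qed auto
        also have "\<dots> \<le> e / 2 * norm h"
          using e component_le_norm_cart[of h k] by (simp add: mult_left_mono)
        finally have 1: "norm (g (h $ k) - g 0) \<le> e / 2 * norm h" .
        have 2: "norm (f z - f y - (\<Sum>k\<in>S. h $ k *\<^sub>R D k y)) \<le> e / 2 * norm h"
          unfolding z_def using h by (intro d1(2)) (simp add: d_def)
        have "y + tr (insert k S) h = z + h $ k *\<^sub>R axis k 1"
          using insert.hyps by (simp add: tr_def z_def algebra_simps)
        then have "f (y + tr (insert k S) h) - f y - (\<Sum>k\<in>insert k S. h $ k *\<^sub>R D k y) =
            (g (h $ k) - g 0) + (f z - f y - (\<Sum>k\<in>S. h $ k *\<^sub>R D k y))"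
          using insert.hyps by (simp add: g_def algebra_simps)
        then have eq: "norm (f (y + tr (insert k S) h) - f y - (\<Sum>k\<in>insert k S. h $ k *\<^sub>R D k y)) =
            norm ((g (h $ k) - g 0) + (f z - f y - (\<Sum>k\<in>S. h $ k *\<^sub>R D k y)))"
          by (rule arg_cong)
        show ?thesis unfolding eq using norm_triangle_mono[OF 1 2] by linarith
      qed
      moreover have "d > 0" using d1 d2 d3 by (simp add: d_def)
      ultimately show "\<exists>d>0. \<forall>h. norm h < d \<longrightarrow>
        norm (f (y + tr (insert k S) h) - f y - (\<Sum>k\<in>insert k S. h $ k *\<^sub>R D k y)) \<le> e * norm h" by blast
    qed
  qed
  have tr_UNIV: "tr UNIV h = h" for h by (simp add: vec_eq_iff tr_nth)
  have bl: "bounded_linear (\<lambda>h. \<Sum>k\<in>UNIV. h $ k *\<^sub>R D k y)"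
    by (intro bounded_linear_sum bounded_linear_compose[OF bounded_linear_scaleR_left] bounded_linear_vec_nth)
  show ?thesis
    unfolding has_derivative_at_alt
  proof (intro conjI bl allI impI)
    fix e :: real assume "e > 0"
    then obtain d where d: "d > 0" "\<And>h. norm h < d \<Longrightarrow>
        norm (f (y + h) - f y - (\<Sum>k\<in>UNIV. h $ k *\<^sub>R D k y)) \<le> e * norm h"
      using main[of UNIV] unfolding tr_UNIV by blast
    show "\<exists>d>0. \<forall>y'. norm (y' - y) < d \<longrightarrow>
        norm (f y' - f y - (\<Sum>k\<in>UNIV. (y' - y) $ k *\<^sub>R D k y)) \<le> e * norm (y' - y)"
      using d(1) d(2)[of "_ - y"] by (intro exI[of _ d]) auto
  qed
qed

section \<open>The chain rule for iterated partial derivatives\<close>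

lemma has_partial_compose:
  fixes f :: "real^'m \<Rightarrow> real" and \<tau> :: "real^'n \<Rightarrow> real^'m"
  assumes V: "open V" and f: "smooth_on_open V f" and \<tau>: "\<tau> y \<in> V" "has_partial shift_vec k \<tau> y D"
  shows "has_partial shift_vec k (f \<circ> \<tau>) y (\<Sum>j\<in>UNIV. D $ j * pderiv_along shift_vec j f (\<tau> y))"
proof -
  note f' = f[unfolded smooth_on_open_def]
  have "shift_vec k 0 y = y" by (simp add: shift_vec_def)
  then have "(f has_derivative (\<lambda>h. \<Sum>j\<in>UNIV. h $ j *\<^sub>R pderiv_along shift_vec j f (\<tau> y))) (at (\<tau> (shift_vec k 0 y)))"
    unfolding \<open>shift_vec k 0 y = y\<close>
  proof (intro continuous_partials_imp_has_derivative[OF V \<tau>(1)])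
    show "has_partial shift_vec j f z (pderiv_along shift_vec j f z)" if "z \<in> V" for j z
      using smooth_along_has_partial[OF f'] that by simp
    show "continuous_on V (pderiv_along shift_vec j f)" for j
      using smooth_along_continuous[OF smooth_along_pderiv[OF f'], of j] by simp
  qed
  note 1 = this
  have 2: "((\<lambda>t. \<tau> (shift_vec k t y)) has_derivative (\<lambda>t. t *\<^sub>R D)) (at 0)"
    using \<tau>(2) unfolding has_partial_def has_vector_derivative_def .
  have "((\<lambda>t. f (\<tau> (shift_vec k t y))) has_derivative
      (\<lambda>t. \<Sum>j\<in>UNIV. (t *\<^sub>R D) $ j *\<^sub>R pderiv_along shift_vec j f (\<tau> y))) (at 0)"
    by (rule has_derivative_compose[OF 2 1])
  then show ?thesis
    unfolding has_partial_def has_vector_derivative_def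
    by (simp add: sum_distrib_left mult.assoc)
qed

text \<open>The formula of Faa di Bruno with its coefficients left unspecified: they are collected
  as functions \<open>p\<close>, each attached to the multi-index \<open>es\<close> of a derivative
  of \<open>f\<close>.\<close>

definition chain_sum :: "((real^'n \<Rightarrow> real) \<times> 'm list) list \<Rightarrow> (real^'m \<Rightarrow> real) \<Rightarrow> (real^'n \<Rightarrow> real^'m)
    \<Rightarrow> real^'n \<Rightarrow> real" where
  "chain_sum F f \<tau> y = (\<Sum>(p, es)\<leftarrow>F. p y * iter_pderiv shift_vec es f (\<tau> y))"

lemma smooth_on_open_component:
  fixes \<tau> :: "real^'n \<Rightarrow> real^'m"
  assumes "open U" "smooth_on_open U \<tau>"
  shows "smooth_on_open U (\<lambda>y. \<tau> y $ j)"
  using smooth_along_linear[OF flow_shift_vec[OF assms(1)] bounded_linear_vec_nth] assms(2)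
  unfolding smooth_on_open_def by blast

text \<open>The product rule turns a pair \<open>(p, es)\<close> into one with \<open>p\<close>
  differentiated, and the chain rule adds, for each target coordinate \<open>j\<close>, the pair of
  \<open>j # es\<close> with \<open>p\<close> times the derivative of the \<open>j\<close>-th
  component of \<tau>. None of this involves \<open>f\<close>, so a single list serves all
  \<open>f\<close>.\<close>

lemma chain_sum_partial:
  fixes \<tau> :: "real^'n \<Rightarrow> real^'m"
  assumes U: "open U" and V: "open V" and \<tau>: "smooth_on_open U \<tau>" "\<tau> ` U \<subseteq> V"
    and F: "\<And>p es. (p, es) \<in> set F \<Longrightarrow> smooth_on_open U p"
  shows "\<exists>F'. (\<forall>(p, es)\<in>set F'. smooth_on_open U p) \<and> (\<forall>f. smooth_on_open V f \<longrightarrow>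
    (\<forall>y\<in>U. has_partial shift_vec k (chain_sum F f \<tau>) y (chain_sum F' f \<tau> y)))"
  using F
proof (induction F)
  case Nil
  then show ?case by (intro exI[of _ "[]"]) (auto simp: chain_sum_def has_partial_def)
next
  case (Cons q F)
  obtain p es where q: "q = (p, es)" by (cases q)
  note fl = flow_shift_vec[OF U]
  have p: "smooth_on_open U p" using Cons.prems[of p es] q by simp
  have "\<And>p es. (p, es) \<in> set F \<Longrightarrow> smooth_on_open U p"
    using Cons.prems by (meson list.set_intros(2))
  then obtain F' where F': "\<forall>(p, es)\<in>set F'. smooth_on_open U p"
    "\<And>f y. smooth_on_open V f \<Longrightarrow> y \<in> U \<Longrightarrow> has_partial shift_vec k (chain_sum F f \<tau>) y (chain_sum F' f \<tau> y)"
    using Cons.IH by blast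
  obtain js :: "'m list" where js: "set js = UNIV" "distinct js"
    using finite_distinct_list[OF finite] by blast
  define F1 where "F1 = (pderiv_along shift_vec k p, es) #
    map (\<lambda>j. (\<lambda>y. p y * (pderiv_along shift_vec k \<tau> y $ j), j # es)) js"
  have "\<forall>(p, es)\<in>set (F1 @ F'). smooth_on_open U p"
  proof -
    have "smooth_on_open U (\<lambda>y. p y * (pderiv_along shift_vec k \<tau> y $ j))" for j
      using p \<tau>(1) smooth_on_open_component[OF U, of "pderiv_along shift_vec k \<tau>" j]
      unfolding smooth_on_open_def
      by (intro smooth_along_mult[OF fl]) (auto intro: smooth_along_pderiv)
    moreover have "smooth_on_open U (pderiv_along shift_vec k p)"
      using p unfolding smooth_on_open_def by (auto intro: smooth_along_pderiv)
    ultimately show ?thesis using F'(1) by (auto simp: F1_def)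
  qed
  moreover have "has_partial shift_vec k (chain_sum (q # F) f \<tau>) y (chain_sum (F1 @ F') f \<tau> y)"
    if f: "smooth_on_open V f" and y: "y \<in> U" for f y
  proof -
    let ?g = "iter_pderiv shift_vec es f"
    have g: "smooth_on_open V ?g"
      using f unfolding smooth_on_open_def by (auto intro: smooth_along_iter)
    have "has_partial shift_vec k \<tau> y (pderiv_along shift_vec k \<tau> y)"
      using \<tau>(1) y unfolding smooth_on_open_def by (auto intro: smooth_along_has_partial)
    then have 1: "has_partial shift_vec k (?g \<circ> \<tau>) y
        (\<Sum>j\<in>UNIV. pderiv_along shift_vec k \<tau> y $ j * pderiv_along shift_vec j ?g (\<tau> y))"
      using has_partial_compose[OF V g] \<tau>(2) y by blast
    have 2: "has_partial shift_vec k p y (pderiv_along shift_vec k p y)"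
      using p y unfolding smooth_on_open_def by (auto intro: smooth_along_has_partial)
    have "shift_vec k 0 y = y" by (simp add: shift_vec_def)
    then have "has_partial shift_vec k (chain_sum (q # F) f \<tau>) y
      (p y * (\<Sum>j\<in>UNIV. pderiv_along shift_vec k \<tau> y $ j * pderiv_along shift_vec j ?g (\<tau> y))
       + pderiv_along shift_vec k p y * ?g (\<tau> y) + chain_sum F' f \<tau> y)"
      using has_vector_derivative_add[OF has_vector_derivative_mult[OF 2[unfolded has_partial_def] 1[unfolded has_partial_def]]
         F'(2)[OF f y, unfolded has_partial_def]]
      unfolding has_partial_def chain_sum_def q by simp
    moreover have "(\<Sum>j\<leftarrow>js. h j) = (\<Sum>j\<in>UNIV. h j)" for h :: "'m \<Rightarrow> real"
      using js by (metis sum_list_distinct_conv_sum_set)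
    ultimately show ?thesis
      by (simp add: chain_sum_def F1_def o_def sum_distrib_left mult.assoc add_ac)
  qed
  ultimately show ?case by blast
qed

text \<open>The list is chosen before \<open>f\<close>. Bounding its coefficients on a compact set
  later converts uniform convergence of derivatives in one chart into uniform convergence in
  another.\<close>

lemma iter_pderiv_compose:
  fixes \<tau> :: "real^'n \<Rightarrow> real^'m"
  assumes U: "open U" and V: "open V" and \<tau>: "smooth_on_open U \<tau>" "\<tau> ` U \<subseteq> V"
  shows "\<exists>F. (\<forall>(p, es)\<in>set F. smooth_on_open U p) \<and> (\<forall>f. smooth_on_open V f \<longrightarrow>
    (\<forall>y\<in>U. iter_pderiv shift_vec ds (f \<circ> \<tau>) y = chain_sum F f \<tau> y))"
proof (induction ds)
  case Nil
  then show ?case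
    using smooth_along_const[OF flow_shift_vec[OF U], of "1::real"]
    by (intro exI[of _ "[(\<lambda>_. 1, [])]"]) (auto simp: chain_sum_def smooth_on_open_def)
next
  case (Cons k ds)
  then obtain F where F: "\<forall>(p, es)\<in>set F. smooth_on_open U p"
    "\<And>f y. smooth_on_open V f \<Longrightarrow> y \<in> U \<Longrightarrow> iter_pderiv shift_vec ds (f \<circ> \<tau>) y = chain_sum F f \<tau> y" by blast
  then obtain F' where F': "\<forall>(p, es)\<in>set F'. smooth_on_open U p" "\<And>f y. smooth_on_open V f \<Longrightarrow> y \<in> U \<Longrightarrow>
      has_partial shift_vec k (chain_sum F f \<tau>) y (chain_sum F' f \<tau> y)"
    using chain_sum_partial[OF U V \<tau>, of F k] by blast
  have "iter_pderiv shift_vec (k # ds) (f \<circ> \<tau>) y = chain_sum F' f \<tau> y"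
    if "smooth_on_open V f" "y \<in> U" for f y
    using pderiv_along_cong[OF flow_shift_vec[OF U], of k y "iter_pderiv shift_vec ds (f \<circ> \<tau>)" "chain_sum F f \<tau>"]
      F(2)[OF that(1)] has_partial_imp_pderiv[OF F'(2)[OF that]] that(2) by simp
  with F'(1) show ?case by blast
qed

lemma smooth_on_open_compose:
  fixes \<tau> :: "real^'n \<Rightarrow> real^'m" and f :: "real^'m \<Rightarrow> real"
  assumes U: "open U" and V: "open V" and \<tau>: "smooth_on_open U \<tau>" "\<tau> ` U \<subseteq> V" and f: "smooth_on_open V f"
  shows "smooth_on_open U (f \<circ> \<tau>)"
proof -
  note fl = flow_shift_vec[OF U]
  have cs: "continuous_map (top_of_set U) euclidean (chain_sum F f \<tau>)"
    if "\<forall>(p, es)\<in>set F. smooth_on_open U p" for F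
    using that
  proof (induction F)
    case Nil
    then show ?case by (simp add: chain_sum_def)
  next
    case (Cons q F)
    obtain p es where q: "q = (p, es)" by (cases q)
    have "continuous_on V (iter_pderiv shift_vec es f)"
      using smooth_along_continuous[OF smooth_along_iter[OF f[unfolded smooth_on_open_def]]] by simp
    moreover have "continuous_on U \<tau>"
      using smooth_along_continuous[OF \<tau>(1)[unfolded smooth_on_open_def]] by simp
    ultimately have "continuous_on U (\<lambda>y. iter_pderiv shift_vec es f (\<tau> y))"
      using \<tau>(2) by (rule continuous_on_compose2)
    moreover have "continuous_on U p"
      using Cons.prems smooth_along_continuous[of "top_of_set U" shift_vec UNIV p]
      by (auto simp: q smooth_on_open_def)
    ultimately show ?case
      using Cons by (auto simp: chain_sum_def q intro!: continuous_on_add continuous_on_mult)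
  qed
  show ?thesis unfolding smooth_on_open_def
  proof (rule smooth_along_coinduct[OF fl, where P = "\<lambda>h. \<exists>F. (\<forall>(p, es)\<in>set F. smooth_on_open U p) \<and> h = chain_sum F f \<tau>"])
    show "\<exists>F. (\<forall>(p, es)\<in>set F. smooth_on_open U p) \<and> f \<circ> \<tau> = chain_sum F f \<tau>"
      using smooth_along_const[OF fl, of "1::real"]
      by (intro exI[of _ "[(\<lambda>_. 1, [])]"]) (auto simp: chain_sum_def smooth_on_open_def)
    fix h assume "\<exists>F. (\<forall>(p, es)\<in>set F. smooth_on_open U p) \<and> h = chain_sum F f \<tau>"
    then obtain F where F: "\<forall>(p, es)\<in>set F. smooth_on_open U p" "h = chain_sum F f \<tau>" by blast
    have "\<exists>g. (\<exists>F. (\<forall>(p, es)\<in>set F. smooth_on_open U p) \<and> g = chain_sum F f \<tau>) \<and>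
        (\<forall>y\<in>topspace (top_of_set U). has_partial shift_vec d h y (g y))" for d
      using chain_sum_partial[OF U V \<tau>, of F d] F f by fastforce
    then show "continuous_map (top_of_set U) euclidean h \<and> (\<forall>d\<in>UNIV. \<exists>g. (\<exists>F.
        (\<forall>(p, es)\<in>set F. smooth_on_open U p) \<and> g = chain_sum F f \<tau>) \<and>
        (\<forall>y\<in>topspace (top_of_set U). has_partial shift_vec d h y (g y)))"
      using cs[OF F(1)] F(2) by simp
  qed
qed

section \<open>Bump functions\<close>

text \<open>With \<open>u = 1 / t\<close>, the derivative of \<open>p u * exp (- u)\<close> with
  respect to \<open>t\<close> is \<open>u ^ 2 * (p u - p' u) * exp (- u)\<close>; this is the
  recursion for the polynomial factors in the derivatives of \<open>exp (- 1 / t)\<close>.\<close>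

primrec bump_poly :: "nat \<Rightarrow> real poly" where
  "bump_poly 0 = 1"
| "bump_poly (Suc k) = monom 1 2 * (bump_poly k - pderiv (bump_poly k))"

definition bump_deriv :: "nat \<Rightarrow> real \<Rightarrow> real" where
  "bump_deriv k t = (if t > 0 then poly (bump_poly k) (1 / t) * exp (- (1 / t)) else 0)"

lemma poly_times_exp_tendsto_0: "((\<lambda>s. poly p s * exp (- s)) \<longlongrightarrow> 0) (at_top :: real filter)"
proof -
  have "((\<lambda>s. \<Sum>i\<le>degree p. coeff p i * (s ^ i / exp s)) \<longlongrightarrow> (\<Sum>i\<le>degree p. coeff p i * 0)) (at_top :: real filter)"
    by (intro tendsto_intros tendsto_power_div_exp_0)
  then show ?thesis
    by (simp add: poly_altdef exp_minus sum_distrib_right sum_divide_distrib field_simps)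
qed

lemma bump_deriv_deriv: "(bump_deriv k has_real_derivative bump_deriv (Suc k) t) (at t)"
proof -
  consider "t > 0" | "t < 0" | "t = 0" by linarith
  then show ?thesis
  proof cases
    case 1
    have ev: "\<forall>\<^sub>F s in nhds t. s > 0" using 1 by (rule order_tendstoD[OF filterlim_ident])
    have "((\<lambda>t. poly (bump_poly k) (1 / t) * exp (- (1 / t))) has_real_derivative bump_deriv (Suc k) t) (at t)"
      using 1 by (auto intro!: derivative_eq_intros DERIV_chain2[OF poly_DERIV]
          simp: bump_deriv_def poly_monom field_simps power2_eq_square)
    then show ?thesis
      by (rule DERIV_cong_ev[THEN iffD2, rotated 3])
        (use ev in \<open>auto simp: bump_deriv_def elim: eventually_mono\<close>)
  next
    case 2
    have ev: "\<forall>\<^sub>F s in nhds t. s < 0" using 2 by (rule order_tendstoD[OF filterlim_ident])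
    have "((\<lambda>t. 0) has_real_derivative bump_deriv (Suc k) t) (at t)"
      using 2 by (simp add: bump_deriv_def)
    then show ?thesis
      by (rule DERIV_cong_ev[THEN iffD2, rotated 3])
        (use ev in \<open>auto simp: bump_deriv_def elim: eventually_mono\<close>)
  next
    case 3
    \<comment> \<open>The difference quotient of \<open>bump_deriv k\<close> at 0 in the variable
      \<open>s = 1 / t\<close>; the extra factor \<open>s\<close> is the denominator
      \<open>t\<close>.\<close>
    have "((\<lambda>s. poly (monom 1 1 * bump_poly k) (inverse s) * exp (- inverse s)) \<longlongrightarrow> 0) (at_right (0::real))"
      by (rule filterlim_compose[OF poly_times_exp_tendsto_0 filterlim_inverse_at_top_right])
    then have "((\<lambda>s. bump_deriv k s / s) \<longlongrightarrow> 0) (at_right 0)"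
      by (rule Lim_transform_eventually)
        (auto simp: eventually_at_right_field bump_deriv_def poly_monom field_simps intro!: exI[of _ 1])
    moreover have "((\<lambda>s. bump_deriv k s / s) \<longlongrightarrow> 0) (at_left 0)"
      by (rule tendsto_eventually) (auto simp: eventually_at_left_field bump_deriv_def intro!: exI[of _ "-1"])
    ultimately have "((\<lambda>s. bump_deriv k s / s) \<longlongrightarrow> 0) (at 0)" by (rule filterlim_split_at[rotated])
    then show ?thesis using 3 by (simp add: has_field_derivative_iff bump_deriv_def)
  qed
qed

text \<open>The squared distance is spelled out as a sum of products, so that smoothness follows
  from the algebraic closure properties.\<close>

definition ball_bump :: "real^'n \<Rightarrow> real \<Rightarrow> real^'n \<Rightarrow> real" where
  "ball_bump a r y = bump_deriv 0 (r\<^sup>2 - (\<Sum>k\<in>UNIV. (y $ k - a $ k) * (y $ k - a $ k)))"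

lemma ball_bump_nonneg: "ball_bump a r y \<ge> 0"
  by (simp add: ball_bump_def bump_deriv_def)

lemma ball_bump_pos_iff:
  assumes "r > 0"
  shows "ball_bump a r y > 0 \<longleftrightarrow> y \<in> ball a r"
proof -
  have "(\<Sum>k\<in>UNIV. (y $ k - a $ k) * (y $ k - a $ k)) = (dist a y)\<^sup>2"
    by (simp add: dist_norm norm_vec_def L2_set_def sum_nonneg power2_eq_square[symmetric] power2_commute)
  moreover have "(dist a y)\<^sup>2 < r\<^sup>2 \<longleftrightarrow> dist a y < r" using assms by (auto intro: power_strict_mono power2_less_imp_less)
  ultimately show ?thesis by (simp add: ball_bump_def bump_deriv_def)
qed

lemma smooth_coordinate: "smooth_on_open UNIV (\<lambda>y::real^'n. y $ k)"
proof -
  have fl: "flow (top_of_set UNIV) (shift_vec :: 'n \<Rightarrow> _) UNIV" by (rule flow_shift_vec) simp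
  have c: "smooth_along (top_of_set UNIV) shift_vec UNIV (\<lambda>_::real^'n. c)" for c :: real
    by (rule smooth_along_const[OF fl])
  have "has_partial shift_vec j (\<lambda>y::real^'n. y $ k) y (if j = k then 1 else 0)" for j y
    unfolding has_partial_def shift_vec_def
    by (auto simp: axis_def has_real_derivative_iff_has_vector_derivative[symmetric] intro!: derivative_eq_intros)
  note p = this
  show ?thesis unfolding smooth_on_open_def
  proof (rule smooth_along_coinduct[OF fl, where P = "\<lambda>f. f = (\<lambda>y. y $ k) \<or> (\<exists>c. f = (\<lambda>_. c))"])
    fix f :: "real^'n \<Rightarrow> real" assume "f = (\<lambda>y. y $ k) \<or> (\<exists>c. f = (\<lambda>_. c))"
    then show "continuous_map (top_of_set UNIV) euclidean f \<and> (\<forall>d\<in>UNIV. \<exists>g.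
      (g = (\<lambda>y. y $ k) \<or> (\<exists>c. g = (\<lambda>_. c))) \<and> (\<forall>y\<in>topspace (top_of_set UNIV). has_partial shift_vec d f y (g y)))"
    proof (elim disjE exE)
      assume "f = (\<lambda>y. y $ k)"
      then show ?thesis using p
        by (auto intro!: continuous_intros exI[of _ "\<lambda>_. if _ = k then 1 else 0"])
    next
      fix c assume "f = (\<lambda>_. c)"
      then show ?thesis by (auto simp: has_partial_def intro!: exI[of _ "\<lambda>_. 0"])
    qed
  qed simp
qed

lemma smooth_ball_bump:
  fixes a :: "real^'n"
  shows "smooth_on_open UNIV (ball_bump a r)"
proof -
  have fl: "flow (top_of_set UNIV) (shift_vec :: 'n \<Rightarrow> _) UNIV" by (rule flow_shift_vec) simp
  have "smooth_along (top_of_set UNIV) shift_vec UNIV (\<lambda>y::real^'n. y $ k - a $ k)" for k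
    using smooth_along_add[OF fl smooth_coordinate[unfolded smooth_on_open_def] smooth_along_const[OF fl, of "- (a $ k)"]] by simp
  then have "smooth_along (top_of_set UNIV) shift_vec UNIV
      (\<lambda>y::real^'n. r\<^sup>2 + (-1) * (\<Sum>k\<in>UNIV. (y $ k - a $ k) * (y $ k - a $ k)))"
    by (intro smooth_along_add smooth_along_mult smooth_along_sum smooth_along_const fl)
  then have "smooth_along (top_of_set UNIV) shift_vec UNIV
      (\<lambda>y::real^'n. bump_deriv 0 (r\<^sup>2 + (-1) * (\<Sum>k\<in>UNIV. (y $ k - a $ k) * (y $ k - a $ k))))"
    by (rule smooth_along_compose_real[OF fl, where W = UNIV]) (auto intro: bump_deriv_deriv)
  then show ?thesis unfolding smooth_on_open_def ball_bump_def[abs_def] by simp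
qed

section \<open>Functions on tuples\<close>

lemma flow_box_top:
  fixes c :: "nat \<Rightarrow> ('a, 'n::finite) chart"
  assumes "\<And>i. i < n \<Longrightarrow> open (chart_image (c i))"
  shows "flow (box_top n c) shift_tuple ({..<n} \<times> UNIV)"
  unfolding flow_def
proof (intro ballI conjI)
  fix d y assume d: "d \<in> {..<n} \<times> (UNIV :: 'n set)" and y: "y \<in> topspace (box_top n c)"
  show "shift_tuple d 0 y = y" by (simp add: shift_tuple_def shift_vec_def)
  obtain i k where ik: "d = (i, k)" "i < n" using d by auto
  have "\<forall>\<^sub>F t in nhds 0. shift_vec k t (y i) \<in> chart_image (c i)"
    using flow_shift_vec[OF assms[OF ik(2)]] y ik by (auto simp: flow_def box_top_def)
  then show "\<forall>\<^sub>F t in nhds 0. shift_tuple d t y \<in> topspace (box_top n c)"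
    by eventually_elim (use y ik in \<open>auto simp: shift_tuple_def box_top_def PiE_iff extensional_def\<close>)
qed

lemma has_partial_tuple_same:
  "has_partial shift_vec k f (y i) D \<Longrightarrow> has_partial shift_tuple (i, k) (\<lambda>y. f (y i)) y D"
  by (simp add: has_partial_def shift_tuple_def)

lemma has_partial_tuple_other:
  "i \<noteq> j \<Longrightarrow> has_partial shift_tuple (j, k) (\<lambda>y. f (y i)) y 0"
  by (simp add: has_partial_def shift_tuple_def)

lemma continuous_map_box_top_nth:
  assumes "i < n" "continuous_on (chart_image (c i)) f"
  shows "continuous_map (box_top n c) euclidean (\<lambda>y. f (y i))"
proof -
  have "continuous_map (box_top n c) (top_of_set (chart_image (c i))) (\<lambda>y. y i)"
    unfolding box_top_def using assms(1) by (intro continuous_map_product_projection) auto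
  from continuous_map_compose[OF this, of euclidean f] assms(2) show ?thesis by (simp add: o_def)
qed

lemma smooth_along_tuple_nth:
  fixes f :: "real^'n \<Rightarrow> 'v::real_normed_vector"
  assumes fl: "flow (box_top n c) shift_tuple ({..<n} \<times> UNIV)" and i: "i < n"
    and f: "smooth_on_open (chart_image (c i)) f"
  shows "smooth_along (box_top n c) shift_tuple ({..<n} \<times> UNIV) (\<lambda>y. f (y i))"
proof (rule smooth_along_coinduct[OF fl,
      where P = "\<lambda>g. g = (\<lambda>_. 0) \<or> (\<exists>f. smooth_on_open (chart_image (c i)) f \<and> g = (\<lambda>y. f (y i)))"])
  show "(\<lambda>y. f (y i)) = (\<lambda>_. 0) \<or> (\<exists>f'. smooth_on_open (chart_image (c i)) f' \<and> (\<lambda>y. f (y i)) = (\<lambda>y. f' (y i)))"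
    using f by blast
  fix g :: "_ \<Rightarrow> 'v" assume "g = (\<lambda>_. 0) \<or> (\<exists>f. smooth_on_open (chart_image (c i)) f \<and> g = (\<lambda>y. f (y i)))"
  then consider "g = (\<lambda>_. 0)" | f where "smooth_on_open (chart_image (c i)) f" "g = (\<lambda>y. f (y i))" by blast
  then show "continuous_map (box_top n c) euclidean g \<and> (\<forall>d\<in>{..<n} \<times> UNIV. \<exists>h. (h = (\<lambda>_. 0) \<or>
     (\<exists>f. smooth_on_open (chart_image (c i)) f \<and> h = (\<lambda>y. f (y i)))) \<and>
     (\<forall>y\<in>topspace (box_top n c). has_partial shift_tuple d g y (h y)))"
  proof cases
    case 1
    then show ?thesis by (auto simp: has_partial_def intro!: exI[of _ "\<lambda>_. 0"])
  next
    case (2 f)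
    note f = 2(1)[unfolded smooth_on_open_def]
    have "\<exists>h. (h = (\<lambda>_. 0) \<or> (\<exists>f. smooth_on_open (chart_image (c i)) f \<and> h = (\<lambda>y. f (y i)))) \<and>
        (\<forall>y\<in>topspace (box_top n c). has_partial shift_tuple (j, k) g y (h y))" for j k
    proof (cases "j = i")
      case True
      have "smooth_on_open (chart_image (c i)) (pderiv_along shift_vec k f)"
        unfolding smooth_on_open_def by (rule smooth_along_pderiv[OF f]) simp
      moreover have "has_partial shift_tuple (j, k) g y (pderiv_along shift_vec k f (y i))"
        if "y \<in> topspace (box_top n c)" for y
        unfolding 2(2) True using that i
        by (intro has_partial_tuple_same smooth_along_has_partial[OF f]) (auto simp: box_top_def)
      ultimately show ?thesis by blast
    next
      case False
      then show ?thesis unfolding 2(2)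
        by (intro exI[of _ "\<lambda>_. 0"]) (simp add: has_partial_tuple_other)
    qed
    moreover have "continuous_map (box_top n c) euclidean g"
      unfolding 2(2) using smooth_along_continuous[OF f] by (intro continuous_map_box_top_nth i) simp
    ultimately show ?thesis by auto
  qed
qed

text \<open>Identifies derivatives in one slot of \<open>X^n\<close> with derivatives on
  \<open>X\<close>; for \<open>n = 1\<close> it translates the seminorms on
  \<open>test_fun A 1\<close> into chart derivatives of a function on \<open>X\<close>.\<close>

lemma iter_pderiv_tuple_nth:
  assumes fl: "flow (box_top n c) shift_tuple ({..<n} \<times> UNIV)" and i: "i < n"
    and f: "smooth_on_open (chart_image (c i)) f"
    and ds: "ds \<in> lists ({i} \<times> UNIV)" and y: "y \<in> topspace (box_top n c)"
  shows "iter_pderiv shift_tuple ds (\<lambda>y. f (y i)) y = iter_pderiv shift_vec (map snd ds) f (y i)"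
  using ds y
proof (induction ds arbitrary: y)
  case (Cons d ds)
  obtain k where k: "d = (i, k)" using Cons.hyps by auto
  have "smooth_along (top_of_set (chart_image (c i))) shift_vec UNIV (iter_pderiv shift_vec (map snd ds) f)"
    using f unfolding smooth_on_open_def by (rule smooth_along_iter) auto
  then have "has_partial shift_tuple (i, k) (\<lambda>y. iter_pderiv shift_vec (map snd ds) f (y i)) y
     (pderiv_along shift_vec k (iter_pderiv shift_vec (map snd ds) f) (y i))"
    by (rule has_partial_tuple_same[OF smooth_along_has_partial])
      (use Cons.prems i in \<open>auto simp: box_top_def\<close>)
  moreover have "pderiv_along shift_tuple (i, k) (iter_pderiv shift_tuple ds (\<lambda>y. f (y i))) y =
      pderiv_along shift_tuple (i, k) (\<lambda>y. iter_pderiv shift_vec (map snd ds) f (y i)) y"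
    by (rule pderiv_along_cong[OF fl]) (use i Cons.prems Cons.IH in auto)
  ultimately show ?case
    by (simp add: k has_partial_imp_pderiv)
qed simp

section \<open>Smooth functions on the manifold\<close>

text \<open>The open part \<open>O'\<close> matters for quotients and for functions given in a
  single chart, which are smooth only there before they are extended by zero.\<close>

definition msmooth :: "('a::topological_space, 'n::finite) chart set \<Rightarrow> 'a set \<Rightarrow> ('a \<Rightarrow> 'v::real_normed_vector) \<Rightarrow> bool" where
  "msmooth A O' f \<longleftrightarrow> (\<forall>c\<in>A. smooth_on_open (snd c ` (fst c \<inter> O')) (\<lambda>y. f (chart_inv c y)))"

lemma topspace_Xpow [simp]: "topspace (Xpow n) = PiE {..<n} (\<lambda>_. UNIV)"
  by (simp add: Xpow_def)

lemma topspace_box_top [simp]: "topspace (box_top n c) = PiE {..<n} (\<lambda>i. chart_image (c i))"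
  by (simp add: box_top_def)

lemma smooth_on_open_Un:
  assumes "open U" "open V" "smooth_on_open U f" "smooth_on_open V f"
  shows "smooth_on_open (U \<union> V) f"
  using assms unfolding smooth_on_open_def smooth_along_def
  by (auto intro!: continuous_on_open_Un)

lemma smooth_on_open_subset:
  assumes "smooth_on_open U f" "V \<subseteq> U"
  shows "smooth_on_open V f"
  using assms unfolding smooth_on_open_def smooth_along_def
  by (auto intro: continuous_on_subset)

lemma smooth_on_open_cong:
  assumes "open U" "\<And>y. y \<in> U \<Longrightarrow> f y = g y" "smooth_on_open U f"
  shows "smooth_on_open U g"
  using smooth_along_cong[OF flow_shift_vec[OF assms(1)], of f g] assms(2,3) unfolding smooth_on_open_def by simp

lemma smooth_pow_cong:
  fixes A :: "('a::topological_space, 'n::finite) chart set"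
  assumes "\<And>x. x \<in> PiE {..<n} (\<lambda>_. UNIV) \<Longrightarrow> f x = g x"
  shows "smooth_pow A n f \<longleftrightarrow> smooth_pow A n g"
proof -
  have "in_charts n c f = in_charts n c g" for c :: "nat \<Rightarrow> ('a, 'n) chart"
    unfolding in_charts_def using assms by auto
  then show ?thesis unfolding smooth_pow_def by simp
qed

locale smooth_manifold =
  fixes A :: "('a::{t2_space, second_countable_topology}, 'n::finite) chart set"
  assumes atlas: "smooth_atlas A"
begin

lemma open_chart_dom: "c \<in> A \<Longrightarrow> open (fst c)"
  and open_chart_image: "c \<in> A \<Longrightarrow> open (chart_image c)"
  and chart_homeomorphism: "c \<in> A \<Longrightarrow> homeomorphism (fst c) (chart_image c) (snd c) (chart_inv c)"
  and smooth_transition: "c \<in> A \<Longrightarrow> d \<in> A \<Longrightarrow> smooth_on_open (transition_dom c d) (transition c d)"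
  using atlas unfolding smooth_atlas_def by blast+

lemma chart_cover: "\<exists>c\<in>A. x \<in> fst c"
  using atlas unfolding smooth_atlas_def by blast

lemma chart_inv_simps:
  assumes "c \<in> A"
  shows "y \<in> chart_image c \<Longrightarrow> chart_inv c y \<in> fst c"
    and "y \<in> chart_image c \<Longrightarrow> snd c (chart_inv c y) = y"
    and "x \<in> fst c \<Longrightarrow> snd c x \<in> chart_image c"
    and "x \<in> fst c \<Longrightarrow> chart_inv c (snd c x) = x"
  using chart_homeomorphism[OF assms] unfolding homeomorphism_def by auto

lemma chart_image_Int: 
  assumes "c \<in> A"
  shows "snd c ` (fst c \<inter> O') = {y \<in> chart_image c. chart_inv c y \<in> O'}"
  using chart_inv_simps[OF assms] by (auto simp: image_iff) (metis IntI)

lemma open_chart_image_Int: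
  assumes "c \<in> A" "open O'"
  shows "open (snd c ` (fst c \<inter> O'))"
proof -
  have "continuous_on (chart_image c) (chart_inv c)"
    using chart_homeomorphism[OF assms(1)] by (simp add: homeomorphism_def)
  from continuous_open_preimage[OF this open_chart_image[OF assms(1)] assms(2)]
  show ?thesis unfolding chart_image_Int[OF assms(1)] by (simp add: vimage_def Int_def conj_commute)
qed

lemma flow_chart: "c \<in> A \<Longrightarrow> open O' \<Longrightarrow> flow (top_of_set (snd c ` (fst c \<inter> O'))) shift_vec UNIV"
  by (intro flow_shift_vec open_chart_image_Int)

lemma msmooth_Un:
  assumes "open U" "open V" "msmooth A U f" "msmooth A V f"
  shows "msmooth A (U \<union> V) f"
  unfolding msmooth_def
proof
  fix c assume c: "c \<in> A"
  have "snd c ` (fst c \<inter> (U \<union> V)) = snd c ` (fst c \<inter> U) \<union> snd c ` (fst c \<inter> V)" by blast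
  moreover have "smooth_on_open (snd c ` (fst c \<inter> U) \<union> snd c ` (fst c \<inter> V)) (\<lambda>y. f (chart_inv c y))"
    using assms c by (intro smooth_on_open_Un open_chart_image_Int) (auto simp: msmooth_def)
  ultimately show "smooth_on_open (snd c ` (fst c \<inter> (U \<union> V))) (\<lambda>y. f (chart_inv c y))" by simp
qed

lemma msmooth_subset: "msmooth A U f \<Longrightarrow> V \<subseteq> U \<Longrightarrow> msmooth A V f"
  unfolding msmooth_def by (meson smooth_on_open_subset image_mono Int_mono order_refl)

lemma msmooth_cong:
  assumes "open U" "\<And>x. x \<in> U \<Longrightarrow> f x = g x" "msmooth A U f"
  shows "msmooth A U g"
  unfolding msmooth_def
proof
  fix c assume c: "c \<in> A"
  show "smooth_on_open (snd c ` (fst c \<inter> U)) (\<lambda>y. g (chart_inv c y))"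
    by (rule smooth_on_open_cong[OF open_chart_image_Int[OF c assms(1)], of "\<lambda>y. f (chart_inv c y)"])
      (use assms c in \<open>auto simp: msmooth_def chart_image_Int[OF c]\<close>)
qed

lemma msmooth_const: "open U \<Longrightarrow> msmooth A U (\<lambda>_. k)"
  unfolding msmooth_def smooth_on_open_def by (auto intro!: smooth_along_const flow_chart)

lemma
  fixes f g :: "'a \<Rightarrow> 'v::real_normed_algebra"
  assumes "open U" "msmooth A U f" "msmooth A U g"
  shows msmooth_add: "msmooth A U (\<lambda>x. f x + g x)" and msmooth_mult: "msmooth A U (\<lambda>x. f x * g x)"
  using assms unfolding msmooth_def smooth_on_open_def
  by (auto intro!: smooth_along_add smooth_along_mult flow_chart)

lemma msmooth_inverse:
  fixes f :: "'a \<Rightarrow> real"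
  assumes "open U" "msmooth A U f" "\<And>x. x \<in> U \<Longrightarrow> f x > 0"
  shows "msmooth A U (\<lambda>x. inverse (f x))"
  unfolding msmooth_def smooth_on_open_def
proof
  fix c assume c: "c \<in> A"
  \<comment> \<open>The \<open>k\<close>-th derivative of \<open>1 / t\<close>.\<close>
  define h :: "nat \<Rightarrow> real \<Rightarrow> real" where "h k t = (-1) ^ k * fact k * inverse t ^ (k + 1)" for k t
  have h: "(h k has_real_derivative h (Suc k) t) (at t)" if "t \<in> {0<..}" for k t
  proof -
    have "((\<lambda>t. (-1) ^ k * fact k * inverse t ^ (k + 1)) has_real_derivative
       (-1) ^ k * fact k * (real (k + 1) * (- (inverse t ^ Suc (Suc 0)) * inverse t ^ (k + 1 - Suc 0)))) (at t)"
      using that by (intro DERIV_cmult DERIV_power DERIV_inverse) auto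
    then show ?thesis unfolding h_def
      by (rule DERIV_cong) (simp add: algebra_simps)
  qed
  have "smooth_along (top_of_set (snd c ` (fst c \<inter> U))) shift_vec UNIV (\<lambda>y. h 0 (f (chart_inv c y)))"
    by (rule smooth_along_compose_real[OF flow_chart[OF c assms(1)], where W = "{0<..}"])
      (use assms(2,3) c h in \<open>auto simp: msmooth_def smooth_on_open_def chart_image_Int\<close>)
  then show "smooth_along (top_of_set (snd c ` (fst c \<inter> U))) shift_vec UNIV (\<lambda>y. inverse (f (chart_inv c y)))"
    by (simp add: h_def)
qed

text \<open>Read in another chart \<open>d\<close>, the function is \<open>f\<close> composed with
  the transition map from \<open>d\<close> to \<open>c\<close>.\<close>

lemma msmooth_compose_chart:
  assumes c: "c \<in> A" and V: "open V" and f: "smooth_on_open V (f :: real^'n \<Rightarrow> real)"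
    and U: "open U" "U \<subseteq> fst c" "snd c ` U \<subseteq> V"
  shows "msmooth A U (\<lambda>x. f (snd c x))"
  unfolding msmooth_def
proof
  fix d assume d: "d \<in> A"
  let ?U = "snd d ` (fst d \<inter> U)"
  have "smooth_on_open ?U (f \<circ> transition d c)"
  proof (rule smooth_on_open_compose[OF open_chart_image_Int[OF d U(1)] V _ _ f])
    show "smooth_on_open ?U (transition d c)"
      by (rule smooth_on_open_subset[OF smooth_transition[OF d c]]) (use U in \<open>auto simp: transition_dom_def\<close>)
    show "transition d c ` ?U \<subseteq> V"
      using U chart_inv_simps[OF d] by (auto simp: transition_def)
  qed
  then show "smooth_on_open ?U (\<lambda>y. f (snd c (chart_inv d y)))"
    by (simp add: transition_def o_def)
qed

lemma msmooth_continuous: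
  assumes "msmooth A UNIV f"
  shows "continuous_on UNIV f"
proof -
  have "continuous_on (\<Union>c\<in>A. fst c) f"
  proof (rule continuous_on_open_UN)
  fix c assume c: "c \<in> A"
  have "continuous_on (chart_image c) (\<lambda>y. f (chart_inv c y))"
    using assms c smooth_along_continuous unfolding msmooth_def smooth_on_open_def chart_image_def by fastforce
  then have "continuous_on (fst c) (\<lambda>x. f (chart_inv c (snd c x)))"
    by (rule continuous_on_compose2) (use chart_homeomorphism[OF c] in \<open>auto simp: homeomorphism_def\<close>)
  then show "continuous_on (fst c) f"
    by (rule continuous_on_eq) (simp add: chart_inv_simps[OF c])
  qed (rule open_chart_dom)
  moreover have "(\<Union>c\<in>A. fst c) = UNIV" using chart_cover by blast
  ultimately show ?thesis by simp
qed

section \<open>Smooth functions and test functions on the powers of the manifold\<close>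

lemma flow_box: "c \<in> {..<n} \<rightarrow>\<^sub>E A \<Longrightarrow> flow (box_top n c) shift_tuple ({..<n} \<times> UNIV)"
  by (rule flow_box_top) (auto intro: open_chart_image)

lemma
  fixes f g :: "(nat \<Rightarrow> 'a) \<Rightarrow> 'v::real_normed_algebra"
  assumes "smooth_pow A n f" "smooth_pow A n g"
  shows smooth_pow_add: "smooth_pow A n (\<lambda>x. f x + g x)"
    and smooth_pow_mult: "smooth_pow A n (\<lambda>x. f x * g x)"
  using assms unfolding smooth_pow_def in_charts_def
  by (auto intro!: smooth_along_add smooth_along_mult flow_box)

lemma smooth_pow_const: "smooth_pow A n (\<lambda>x. k)"
  unfolding smooth_pow_def in_charts_def by (auto intro!: smooth_along_const flow_box)

lemma smooth_pow_sum:
  fixes f :: "'i \<Rightarrow> (nat \<Rightarrow> 'a) \<Rightarrow> 'v::real_normed_algebra"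
  assumes "\<And>i. i \<in> I \<Longrightarrow> smooth_pow A n (f i)"
  shows "smooth_pow A n (\<lambda>x. \<Sum>i\<in>I. f i x)"
  using assms by (induction I rule: infinite_finite_induct) (auto intro: smooth_pow_const smooth_pow_add)

lemma smooth_pow_linear:
  assumes "bounded_linear L" "smooth_pow A n f"
  shows "smooth_pow A n (\<lambda>x. L (f x))"
  unfolding smooth_pow_def
proof
  fix c :: "nat \<Rightarrow> ('a, 'n) chart" assume c: "c \<in> {..<n} \<rightarrow>\<^sub>E A"
  have "smooth_along (box_top n c) shift_tuple ({..<n} \<times> UNIV) (\<lambda>y. L (in_charts n c f y))"
    using assms(2) c by (intro smooth_along_linear[OF flow_box[OF c] assms(1)]) (simp add: smooth_pow_def)
  then show "smooth_along (box_top n c) shift_tuple ({..<n} \<times> UNIV) (in_charts n c (\<lambda>x. L (f x)))"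
    by (simp add: in_charts_def[abs_def])
qed

lemma smooth_pow_nth:
  assumes "msmooth A UNIV f" "i < n"
  shows "smooth_pow A n (\<lambda>x. f (x i))"
  unfolding smooth_pow_def
proof
  fix c assume c: "c \<in> {..<n} \<rightarrow>\<^sub>E A"
  have "smooth_along (box_top n c) shift_tuple ({..<n} \<times> UNIV) (\<lambda>y. f (chart_inv (c i) (y i)))"
    by (rule smooth_along_tuple_nth[OF flow_box[OF c] assms(2)])
      (use assms c in \<open>auto simp: msmooth_def chart_image_def\<close>)
  then show "smooth_along (box_top n c) shift_tuple ({..<n} \<times> UNIV) (in_charts n c (\<lambda>x. f (x i)))"
    using assms(2) by (simp add: in_charts_def[abs_def])
qed

lemma Hausdorff_Xpow: "Hausdorff_space (Xpow n :: (nat \<Rightarrow> 'a) topology)"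
proof -
  have "Hausdorff_space (euclidean :: 'a topology)" by (simp add: Hausdorff_space_def disjnt_def) (metis hausdorff)
  then show ?thesis unfolding Xpow_def by (simp add: Hausdorff_space_product_topology)
qed

lemma compactin_Xpow: "compact K \<Longrightarrow> compactin (Xpow n) (PiE {..<n} (\<lambda>_. K))"
  unfolding Xpow_def by (simp add: compactin_PiE)

text \<open>The box over \<open>K\<close> is compact, hence closed in the Hausdorff space
  \<open>X^n\<close>, so it contains the closure of the support as well.\<close>

lemma test_funI:
  assumes "smooth_pow A n f" "\<And>x. x \<notin> PiE {..<n} (\<lambda>_. UNIV) \<Longrightarrow> f x = 0"
    and "\<And>x \<pi>. x \<in> PiE {..<n} (\<lambda>_. UNIV) \<Longrightarrow> \<pi> permutes {..<n} \<Longrightarrow> f (x \<circ> \<pi>) = f x"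
    and "compact K" "\<And>x. x \<in> PiE {..<n} (\<lambda>_. UNIV) \<Longrightarrow> f x \<noteq> 0 \<Longrightarrow> x \<in> PiE {..<n} (\<lambda>_. K)"
  shows "f \<in> test_fun A n"
proof -
  have K: "compactin (Xpow n) (PiE {..<n} (\<lambda>_. K))" by (rule compactin_Xpow[OF assms(4)])
  have "Xpow n closure_of {x \<in> topspace (Xpow n). f x \<noteq> 0} \<subseteq> PiE {..<n} (\<lambda>_. K)"
    by (rule closure_of_minimal)
      (use assms(5) compactin_imp_closedin[OF Hausdorff_Xpow K] in auto)
  then have "compactin (Xpow n) (Xpow n closure_of {x \<in> topspace (Xpow n). f x \<noteq> 0})"
    by (rule closed_compactin[OF K]) (rule closedin_closure_of)
  then show ?thesis using assms(1-3) unfolding test_fun_def by simp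
qed

lemma test_fun_support:
  assumes "f \<in> test_fun A n"
  obtains K where "compact K" "\<And>x. f x \<noteq> 0 \<Longrightarrow> x \<in> PiE {..<n} (\<lambda>_. K)"
proof
  let ?S = "Xpow n closure_of {x \<in> topspace (Xpow n). f x \<noteq> 0}"
  have S: "compactin (Xpow n) ?S" using assms by (simp add: test_fun_def)
  show "compact (\<Union>i<n. (\<lambda>x. x i) ` ?S)"
  proof (rule compact_UN)
    fix i assume "i \<in> {..<n}"
    then have "continuous_map (Xpow n) euclidean (\<lambda>x. x i)"
      unfolding Xpow_def by (rule continuous_map_product_projection)
    from image_compactin[OF S this] show "compact ((\<lambda>x. x i) ` ?S)" by simp
  qed simp
  fix x assume "f x \<noteq> 0"
  moreover from this have "x \<in> topspace (Xpow n)" using assms unfolding test_fun_def by blast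
  ultimately have "x \<in> ?S" using closure_of_subset[of "{x \<in> topspace (Xpow n). f x \<noteq> 0}" "Xpow n"] by auto
  with \<open>x \<in> topspace (Xpow n)\<close> show "x \<in> PiE {..<n} (\<lambda>_. \<Union>i<n. (\<lambda>x. x i) ` ?S)"
    by (auto simp: PiE_iff)
qed

section \<open>Test functions on the manifold itself\<close>

lemma tensor_pow_1: "x \<in> PiE {..<1} (\<lambda>_. UNIV) \<Longrightarrow> tensor_pow 1 \<phi> x = \<phi> (x 0)"
  by (simp add: tensor_pow_def)

text \<open>Removes the tuples of length one from the definition of \<open>DD\<close>. In the
  forward direction, smoothness on \<open>X^1\<close> is pulled back along \<open>em\<close>, which
  carries a shift of a point into a shift of slot 0.\<close>

lemma DD_iff:
  "\<phi> \<in> DD A \<longleftrightarrow> msmooth A UNIV \<phi> \<and> (\<exists>K. compact K \<and> (\<forall>x. \<phi> x \<noteq> 0 \<longrightarrow> x \<in> K))"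
proof safe
  assume \<phi>: "\<phi> \<in> DD A"
  then have t: "tensor_pow 1 \<phi> \<in> test_fun A 1" by (simp add: DD_def)
  show "msmooth A UNIV \<phi>"
    unfolding msmooth_def Int_UNIV_right chart_image_def[symmetric]
  proof
    fix c assume c: "c \<in> A"
    define c' where "c' = (\<lambda>i\<in>{..<1::nat}. c)"
    have c': "c' \<in> {..<1} \<rightarrow>\<^sub>E A" using c by (simp add: c'_def)
    have "smooth_pow A 1 (\<lambda>x. \<phi> (x 0))"
      using t smooth_pow_cong[of 1 "tensor_pow 1 \<phi>" "\<lambda>x. \<phi> (x 0)"] tensor_pow_1 by (auto simp: test_fun_def)
    then have sm: "smooth_along (box_top 1 c') shift_tuple ({..<1} \<times> UNIV) (\<lambda>y. \<phi> (chart_inv c (y 0)))"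
    proof -
      have "in_charts 1 c' (\<lambda>x. \<phi> (x 0)) = (\<lambda>y. \<phi> (chart_inv c (y 0)))"
        by (auto simp: in_charts_def c'_def)
      with \<open>smooth_pow A 1 (\<lambda>x. \<phi> (x 0))\<close> c' show ?thesis unfolding smooth_pow_def by metis
    qed
    note fl = flow_shift_vec[OF open_chart_image[OF c]]
    define em where "em z = (\<lambda>i\<in>{..<1::nat}. z)" for z :: "real^'n"
    have em: "em z \<in> topspace (box_top 1 c')" if "z \<in> chart_image c" for z
      using that by (auto simp: em_def c'_def)
    have em_cont: "continuous_map (top_of_set (chart_image c)) (box_top 1 c') em"
      unfolding box_top_def em_def c'_def by (auto simp: continuous_map_componentwise)
    have em_shift: "em (shift_vec k t z) = shift_tuple (0, k) t (em z)" for k t z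
      by (auto simp: em_def shift_tuple_def)
    show "smooth_on_open (chart_image c) (\<lambda>y. \<phi> (chart_inv c y))"
      unfolding smooth_on_open_def
    proof (rule smooth_along_coinduct[OF fl, where P = "\<lambda>g. \<exists>F. smooth_along (box_top 1 c') shift_tuple ({..<1} \<times> UNIV) F
        \<and> g = (\<lambda>z. F (em z))"])
      show "\<exists>F. smooth_along (box_top 1 c') shift_tuple ({..<1} \<times> UNIV) F \<and>
          (\<lambda>y. \<phi> (chart_inv c y)) = (\<lambda>z. F (em z))"
        using sm by (intro exI conjI) (auto simp: em_def)
      fix g :: "real^'n \<Rightarrow> real"
      assume "\<exists>F. smooth_along (box_top 1 c') shift_tuple ({..<1} \<times> UNIV) F \<and> g = (\<lambda>z. F (em z))"
      then obtain F where F: "smooth_along (box_top 1 c') shift_tuple ({..<1} \<times> UNIV) F" "g = (\<lambda>z. F (em z))" by blast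
      have "continuous_map (top_of_set (chart_image c)) euclidean g"
        using continuous_map_compose[OF em_cont smooth_along_continuous[OF F(1)]] by (simp add: F(2) o_def)
      moreover have "has_partial shift_vec k g z (pderiv_along shift_tuple (0, k) F (em z))"
        if "z \<in> chart_image c" for k z
        using smooth_along_has_partial[OF F(1), of "(0, k)" "em z"] em[OF that]
        by (simp add: has_partial_def F(2) em_shift)
      moreover have "smooth_along (box_top 1 c') shift_tuple ({..<1} \<times> UNIV) (pderiv_along shift_tuple (0, k) F)" for k
        by (rule smooth_along_pderiv[OF F(1)]) simp
      ultimately show "continuous_map (top_of_set (chart_image c)) euclidean g \<and> (\<forall>k\<in>UNIV. \<exists>h.
         (\<exists>F. smooth_along (box_top 1 c') shift_tuple ({..<1} \<times> UNIV) F \<and> h = (\<lambda>z. F (em z))) \<and>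
         (\<forall>y\<in>topspace (top_of_set (chart_image c)). has_partial shift_vec k g y (h y)))"
        by (intro conjI ballI exI[of _ "\<lambda>z. pderiv_along shift_tuple (0, _) F (em z)"]
            exI[of _ "pderiv_along shift_tuple (0, _) F"]) auto
    qed
  qed
  obtain K where K: "compact K" "\<And>x. tensor_pow 1 \<phi> x \<noteq> 0 \<Longrightarrow> x \<in> PiE {..<1} (\<lambda>_. K)"
    using test_fun_support[OF t] by blast
  have "x \<in> K" if "\<phi> x \<noteq> 0" for x
    using K(2)[of "\<lambda>i\<in>{..<1}. x"] that tensor_pow_1[of "\<lambda>i\<in>{..<1}. x" \<phi>] by (auto simp: PiE_iff)
  with K(1) show "\<exists>K. compact K \<and> (\<forall>x. \<phi> x \<noteq> 0 \<longrightarrow> x \<in> K)" by blast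
next
  fix K assume K: "msmooth A UNIV \<phi>" "compact K" "\<forall>x. \<phi> x \<noteq> 0 \<longrightarrow> x \<in> K"
  have "tensor_pow 1 \<phi> \<in> test_fun A 1"
  proof (rule test_funI[OF _ _ _ K(2)])
    show "smooth_pow A 1 (tensor_pow 1 \<phi>)"
      using smooth_pow_nth[OF K(1), of 0 1] smooth_pow_cong[of 1 "tensor_pow 1 \<phi>" "\<lambda>x. \<phi> (x 0)"] tensor_pow_1 by auto
  next
    fix x :: "nat \<Rightarrow> 'a" and \<pi> :: "nat \<Rightarrow> nat" assume "\<pi> permutes {..<1}"
    then have "\<pi> = id" by (simp add: lessThan_Suc)
    then show "tensor_pow 1 \<phi> (x \<circ> \<pi>) = tensor_pow 1 \<phi> x" by simp
  next
    fix x :: "nat \<Rightarrow> 'a" assume "x \<in> PiE {..<1} (\<lambda>_. UNIV)" "tensor_pow 1 \<phi> x \<noteq> 0"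
    then show "x \<in> PiE {..<1} (\<lambda>_. K)" using K(3) by (auto simp: tensor_pow_def PiE_iff)
  qed (simp add: tensor_pow_def)
  then show "\<phi> \<in> DD A" by (simp add: DD_def)
qed

lemma DD_msmooth: "\<phi> \<in> DD A \<Longrightarrow> msmooth A UNIV \<phi>"
  and DD_support: "\<phi> \<in> DD A \<Longrightarrow> \<exists>K. compact K \<and> (\<forall>x. \<phi> x \<noteq> 0 \<longrightarrow> x \<in> K)"
  by (simp_all add: DD_iff)

lemma DD_continuous: "\<phi> \<in> DD A \<Longrightarrow> continuous_on UNIV \<phi>"
  by (simp add: DD_msmooth msmooth_continuous)

lemma DD_mult_left:
  assumes "\<phi> \<in> DD A" "msmooth A UNIV \<psi>"
  shows "(\<lambda>x. \<phi> x * \<psi> x) \<in> DD A"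
  using DD_support[OF assms(1)] msmooth_mult[OF open_UNIV DD_msmooth[OF assms(1)] assms(2)]
  by (auto simp: DD_iff)

lemma DD_mult: "\<phi> \<in> DD A \<Longrightarrow> \<psi> \<in> DD A \<Longrightarrow> (\<lambda>x. \<phi> x * \<psi> x) \<in> DD A"
  by (simp add: DD_mult_left DD_msmooth)

lemma DD_scale: "\<phi> \<in> DD A \<Longrightarrow> (\<lambda>x. r * \<phi> x) \<in> DD A"
  using DD_mult_left[OF _ msmooth_const[OF open_UNIV, of r]] by (simp add: mult.commute)

lemma DD_add:
  assumes "\<phi> \<in> DD A" "\<psi> \<in> DD A"
  shows "(\<lambda>x. \<phi> x + \<psi> x) \<in> DD A"
proof -
  obtain K L where "compact K" "compact L" "\<forall>x. \<phi> x \<noteq> 0 \<longrightarrow> x \<in> K" "\<forall>x. \<psi> x \<noteq> 0 \<longrightarrow> x \<in> L"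
    using DD_support assms by metis
  then have "compact (K \<union> L)" "\<forall>x. \<phi> x + \<psi> x \<noteq> 0 \<longrightarrow> x \<in> K \<union> L" by (auto simp: compact_Un) (metis add_0)
  then show ?thesis
    unfolding DD_iff using msmooth_add[OF open_UNIV DD_msmooth DD_msmooth] assms by blast
qed

lemma DD_zero: "(\<lambda>_. 0) \<in> DD A"
  by (simp add: DD_iff msmooth_const) (rule exI[of _ "{}"], simp)

lemma DD_sum: "(\<And>i. i \<in> I \<Longrightarrow> \<phi> i \<in> DD A) \<Longrightarrow> (\<lambda>x. \<Sum>i\<in>I. \<phi> i x) \<in> DD A"
  by (induction I rule: infinite_finite_induct) (auto intro: DD_zero DD_add)

text \<open>The function is smooth on \<open>U\<close> by assumption and on the complement of
  \<open>K\<close> because it vanishes there; these two open sets cover the manifold.\<close>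

lemma DD_if:
  assumes "open U" "msmooth A U f" "compact K" "K \<subseteq> U" "\<And>x. x \<in> U \<Longrightarrow> f x \<noteq> 0 \<Longrightarrow> x \<in> K"
  shows "(\<lambda>x. if x \<in> U then f x else 0) \<in> DD A"
proof -
  have K: "open (- K)" using assms(3) by (simp add: compact_imp_closed open_Compl)
  have "msmooth A (U \<union> - K) (\<lambda>x. if x \<in> U then f x else 0)"
  proof (rule msmooth_Un[OF assms(1) K])
    show "msmooth A U (\<lambda>x. if x \<in> U then f x else 0)"
      by (rule msmooth_cong[OF assms(1) _ assms(2)]) simp
    show "msmooth A (- K) (\<lambda>x. if x \<in> U then f x else 0)"
      by (rule msmooth_cong[OF K _ msmooth_const[OF K, of 0]]) (use assms(5) in auto)
  qed
  moreover have "U \<union> - K = UNIV" using assms(4) by blast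
  ultimately show ?thesis unfolding DD_iff using assms(3,5) by auto
qed

text \<open>The closed ball, not just the open one, must lie in the chart image: its preimage is
  then compact and can carry a bump function.\<close>

definition coord_ball :: "('a, 'n) chart \<Rightarrow> real^'n \<Rightarrow> real \<Rightarrow> bool" where
  "coord_ball c a r \<longleftrightarrow> c \<in> A \<and> r > 0 \<and> cball a r \<subseteq> chart_image c"

lemma chart_inv_image:
  assumes "c \<in> A" "S \<subseteq> chart_image c"
  shows "chart_inv c ` S = {x \<in> fst c. snd c x \<in> S}"
  using assms chart_inv_simps[OF assms(1)] by (force simp: image_iff)

lemma coord_ball_open: "coord_ball c a r \<Longrightarrow> open (chart_inv c ` ball a r)"
  and coord_ball_compact: "coord_ball c a r \<Longrightarrow> compact (chart_inv c ` cball a r)"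
proof -
  assume c: "coord_ball c a r"
  then have c': "c \<in> A" "ball a r \<subseteq> chart_image c" "cball a r \<subseteq> chart_image c"
    using ball_subset_cball by (auto simp: coord_ball_def)
  have cont: "continuous_on (fst c) (snd c)" "continuous_on (chart_image c) (chart_inv c)"
    using chart_homeomorphism[OF c'(1)] by (auto simp: homeomorphism_def)
  show "open (chart_inv c ` ball a r)"
    using continuous_open_preimage[OF cont(1) open_chart_dom[OF c'(1)] open_ball[of a r]]
    by (simp add: chart_inv_image[OF c'(1,2)] vimage_def Int_def)
  show "compact (chart_inv c ` cball a r)"
    using cont(2) c'(3) by (intro compact_continuous_image) (auto intro: continuous_on_subset)
qed

lemma coord_ball_exists:
  assumes "open W" "p \<in> W"
  obtains c a r where "coord_ball c a r" "p \<in> chart_inv c ` ball a r" "chart_inv c ` cball a r \<subseteq> W"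
proof -
  obtain c where c: "c \<in> A" "p \<in> fst c" using chart_cover by blast
  have "open (snd c ` (fst c \<inter> W))" "snd c p \<in> snd c ` (fst c \<inter> W)"
    using open_chart_image_Int[OF c(1) assms(1)] c assms(2) by auto
  then obtain r where r: "r > 0" "cball (snd c p) r \<subseteq> snd c ` (fst c \<inter> W)"
    using open_contains_cball by blast
  then have sub: "cball (snd c p) r \<subseteq> chart_image c" by (auto simp: chart_image_def)
  have "p = chart_inv c (snd c p)" by (simp add: chart_inv_simps(4)[OF c])
  then have "p \<in> chart_inv c ` ball (snd c p) r" using r(1) by (intro image_eqI[of _ _ "snd c p"]) auto
  moreover have "chart_inv c ` cball (snd c p) r \<subseteq> W"
    using r(2) unfolding chart_image_Int[OF c(1)] by blast
  ultimately show thesis using that[of c "snd c p" r] r(1) sub c(1) by (simp add: coord_ball_def)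
qed

lemma coord_ball_bump:
  assumes "coord_ball c a r"
  obtains \<beta> where "\<beta> \<in> DD A" "\<And>x. \<beta> x \<ge> 0" "\<And>x. \<beta> x > 0 \<longleftrightarrow> x \<in> chart_inv c ` ball a r"
proof
  have c: "c \<in> A" "r > 0" "ball a r \<subseteq> chart_image c" "cball a r \<subseteq> chart_image c"
    using assms ball_subset_cball by (auto simp: coord_ball_def)
  let ?b = "\<lambda>x. if x \<in> fst c then ball_bump a r (snd c x) else 0"
  have pos: "ball_bump a r y \<noteq> 0 \<longleftrightarrow> y \<in> ball a r" for y
    using ball_bump_pos_iff[OF c(2), of a y] ball_bump_nonneg[of a r y] by linarith
  show "?b \<in> DD A"
  proof (rule DD_if[OF open_chart_dom[OF c(1)] _ coord_ball_compact[OF assms]])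
    show "msmooth A (fst c) (\<lambda>x. ball_bump a r (snd c x))"
      by (rule msmooth_compose_chart[OF c(1) open_UNIV smooth_ball_bump open_chart_dom[OF c(1)]]) auto
    show "chart_inv c ` cball a r \<subseteq> fst c" using chart_inv_image[OF c(1,4)] by blast
    show "x \<in> chart_inv c ` cball a r" if "x \<in> fst c" "ball_bump a r (snd c x) \<noteq> 0" for x
      using that pos chart_inv_image[OF c(1,4)] by auto
  qed
  show "?b x \<ge> 0" for x by (simp add: ball_bump_nonneg)
  show "?b x > 0 \<longleftrightarrow> x \<in> chart_inv c ` ball a r" for x
    using ball_bump_pos_iff[OF c(2)] chart_inv_image[OF c(1,3)] by auto
qed

end

section \<open>Pre-Hilbert spaces\<close>

text \<open>Only closure and the form are axiomatised; identities between vectors are replaced by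
  equality of inner products with all vectors. In this shape the axioms pass to quotients and to
  spaces of Cauchy sequences, where operations go through representatives.\<close>

locale psd_space =
  fixes V :: "'v sip"
  assumes add_closed: "x \<in> carr V \<Longrightarrow> y \<in> carr V \<Longrightarrow> vadd V x y \<in> carr V"
    and scale_closed: "x \<in> carr V \<Longrightarrow> vscale V z x \<in> carr V"
    and inn_add: "x \<in> carr V \<Longrightarrow> y \<in> carr V \<Longrightarrow> w \<in> carr V \<Longrightarrow> inn V (vadd V x y) w = inn V x w + inn V y w"
    and inn_scale: "x \<in> carr V \<Longrightarrow> w \<in> carr V \<Longrightarrow> inn V (vscale V z x) w = z * inn V x w"
    and inn_cnj: "x \<in> carr V \<Longrightarrow> y \<in> carr V \<Longrightarrow> inn V y x = cnj (inn V x y)"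
    and inn_self: "x \<in> carr V \<Longrightarrow> inn V x x \<in> \<real>\<^sub>\<ge>\<^sub>0"
begin

definition nrm :: "'v \<Rightarrow> real" where "nrm x = sqrt (Re (inn V x x))"

lemma diff_closed: "x \<in> carr V \<Longrightarrow> y \<in> carr V \<Longrightarrow> vdiff V x y \<in> carr V"
  by (simp add: vdiff_def add_closed scale_closed)

lemma inn_diff: "x \<in> carr V \<Longrightarrow> y \<in> carr V \<Longrightarrow> w \<in> carr V \<Longrightarrow> inn V (vdiff V x y) w = inn V x w - inn V y w"
  by (simp add: vdiff_def inn_add inn_scale scale_closed)

lemma inn_add_right: "x \<in> carr V \<Longrightarrow> y \<in> carr V \<Longrightarrow> w \<in> carr V \<Longrightarrow> inn V w (vadd V x y) = inn V w x + inn V w y"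
  by (metis inn_cnj inn_add add_closed complex_cnj_add)

lemma inn_scale_right: "x \<in> carr V \<Longrightarrow> w \<in> carr V \<Longrightarrow> inn V w (vscale V z x) = cnj z * inn V w x"
  by (metis inn_cnj inn_scale scale_closed complex_cnj_mult)

lemma inn_diff_right: "x \<in> carr V \<Longrightarrow> y \<in> carr V \<Longrightarrow> w \<in> carr V \<Longrightarrow> inn V w (vdiff V x y) = inn V w x - inn V w y"
  by (simp add: vdiff_def inn_add_right inn_scale_right scale_closed)

lemma inn_self_eq: "x \<in> carr V \<Longrightarrow> inn V x x = of_real ((nrm x)\<^sup>2)"
  using inn_self[of x] by (auto simp: nrm_def complex_nonneg_Reals_iff complex_eq_iff)

lemma nrm_nonneg: "nrm x \<ge> 0 \<or> x \<notin> carr V"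
  using inn_self[of x] by (auto simp: nrm_def complex_nonneg_Reals_iff)

lemma sdist_nonneg: "x \<in> carr V \<Longrightarrow> y \<in> carr V \<Longrightarrow> sdist V x y \<ge> 0"
  using nrm_nonneg[of "vdiff V x y"] by (simp add: sdist_def nrm_def diff_closed)

lemma Cauchy_Schwarz:
  assumes x: "x \<in> carr V" and y: "y \<in> carr V"
  shows "cmod (inn V x y) \<le> nrm x * nrm y"
proof -
  define a b c where "a = (nrm x)\<^sup>2" and "b = (nrm y)\<^sup>2" and "c = inn V x y"
  have q: "0 \<le> a - 2 * t * (cmod c)\<^sup>2 + t\<^sup>2 * (cmod c)\<^sup>2 * b" for t :: real
  proof -
    \<comment> \<open>With this multiple of \<open>y\<close> the cross terms become real, and
      positivity of \<open>inn V w w\<close> is a quadratic inequality in the real number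
      \<open>t\<close>.\<close>
    define s where "s = - of_real t * c"
    define w where "w = vadd V x (vscale V s y)"
    have w: "w \<in> carr V" by (simp add: w_def x y add_closed scale_closed)
    have "inn V w w = of_real a + cnj s * c + s * cnj c + s * cnj s * of_real b"
      using x y by (simp add: w_def inn_add inn_add_right inn_scale inn_scale_right scale_closed add_closed
          inn_self_eq[OF x] inn_self_eq[OF y] a_def b_def c_def inn_cnj[of x y] algebra_simps)
    also have "\<dots> = of_real a - 2 * of_real t * (c * cnj c) + (of_real t)\<^sup>2 * (c * cnj c) * of_real b"
      unfolding s_def by (simp add: algebra_simps power2_eq_square)
    also have "\<dots> = of_real (a - 2 * t * (cmod c)\<^sup>2 + t\<^sup>2 * (cmod c)\<^sup>2 * b)"
      unfolding complex_norm_square[symmetric] by simp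
    finally have "inn V w w = of_real (a - 2 * t * (cmod c)\<^sup>2 + t\<^sup>2 * (cmod c)\<^sup>2 * b)" .
    with inn_self[OF w] show ?thesis by (simp only: nonneg_Reals_of_real_iff)
  qed
  have "(cmod c)\<^sup>2 \<le> a * b"
  proof (cases "b = 0")
    case True
    have "a \<ge> 0" by (simp add: a_def)
    have "\<not> (cmod c)\<^sup>2 > 0"
    proof
      assume p: "(cmod c)\<^sup>2 > 0"
      \<comment> \<open>At this \<open>t\<close> the quadratic takes the value
        \<open>a - (a + 1) = - 1\<close>.\<close>
      show False using q[of "(a + 1) / (2 * (cmod c)\<^sup>2)"] p True by (simp add: field_simps)
    qed
    then show ?thesis using True by simp
  next
    case False
    then have b: "b > 0" by (simp add: b_def)
    show ?thesis using q[of "1 / b"] b by (simp add: field_simps power2_eq_square)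
  qed
  also have "a * b = (nrm x * nrm y)\<^sup>2" by (simp add: a_def b_def power_mult_distrib)
  finally show ?thesis
    unfolding c_def by (rule power2_le_imp_le) (use nrm_nonneg x y in \<open>auto intro: mult_nonneg_nonneg\<close>)
qed

lemma nrm_sq: "x \<in> carr V \<Longrightarrow> (nrm x)\<^sup>2 = Re (inn V x x)"
  by (simp add: inn_self_eq)

text \<open>Stands in for identities between vectors, for instance between a difference of sums and
  a sum of differences, which need not hold literally in the carrier.\<close>

lemma nrm_cong:
  assumes "x \<in> carr V" "y \<in> carr V" "\<And>w. w \<in> carr V \<Longrightarrow> inn V x w = inn V y w"
  shows "nrm x = nrm y"
proof -
  have "inn V x x = inn V y x" using assms by blast
  also have "\<dots> = cnj (inn V x y)" by (rule inn_cnj) (use assms in auto)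
  also have "inn V x y = inn V y y" using assms by blast
  also have "cnj \<dots> = inn V y y" using assms(2) by (simp add: inn_self_eq)
  finally show ?thesis by (simp add: nrm_def)
qed

lemma nrm_triangle:
  assumes "x \<in> carr V" "y \<in> carr V"
  shows "nrm (vadd V x y) \<le> nrm x + nrm y"
proof (rule power2_le_imp_le)
  have "(nrm (vadd V x y))\<^sup>2 = Re (inn V x x) + 2 * Re (inn V x y) + Re (inn V y y)"
    using assms by (simp add: nrm_sq add_closed inn_add inn_add_right inn_cnj[of x y])
  also have "Re (inn V x y) \<le> nrm x * nrm y"
    using Cauchy_Schwarz[OF assms] complex_Re_le_cmod order_trans by blast
  finally show "(nrm (vadd V x y))\<^sup>2 \<le> (nrm x + nrm y)\<^sup>2"
    using assms by (simp add: nrm_sq[symmetric] power2_sum)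
qed (use nrm_nonneg[of x] nrm_nonneg[of y] assms in auto)

lemma nrm_scale: "x \<in> carr V \<Longrightarrow> nrm (vscale V z x) = cmod z * nrm x"
proof -
  assume x: "x \<in> carr V"
  have "inn V (vscale V z x) (vscale V z x) = of_real ((cmod z * nrm x)\<^sup>2)"
    using x complex_norm_square[of z]
    by (simp add: inn_scale inn_scale_right scale_closed inn_self_eq[OF x] power_mult_distrib ac_simps)
  then show ?thesis using nrm_nonneg[of x] x by (simp add: nrm_def[of "vscale V z x"])
qed

lemma sdist_nrm: "sdist V x y = nrm (vdiff V x y)"
  by (simp add: sdist_def nrm_def)

text \<open>By Cauchy--Schwarz, distance zero means equal inner products with every vector; symmetry
  and transitivity of the relation are then immediate.\<close>

lemma null_rel_iff:
  "(x, y) \<in> null_rel V \<longleftrightarrow> x \<in> carr V \<and> y \<in> carr V \<and> (\<forall>w\<in>carr V. inn V x w = inn V y w)"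
proof (cases "x \<in> carr V \<and> y \<in> carr V")
  case True
  then have d: "vdiff V x y \<in> carr V" by (simp add: diff_closed)
  show ?thesis
  proof
    assume "(x, y) \<in> null_rel V"
    then have "nrm (vdiff V x y) = 0" by (simp add: null_rel_def nrm_def)
    then have "inn V (vdiff V x y) w = 0" if "w \<in> carr V" for w
      using Cauchy_Schwarz[OF d that] by simp
    then show "x \<in> carr V \<and> y \<in> carr V \<and> (\<forall>w\<in>carr V. inn V x w = inn V y w)"
      using True by (auto simp: inn_diff)
  next
    assume "x \<in> carr V \<and> y \<in> carr V \<and> (\<forall>w\<in>carr V. inn V x w = inn V y w)"
    then show "(x, y) \<in> null_rel V" using d by (simp add: null_rel_def inn_diff)
  qed
qed (auto simp: null_rel_def)

section \<open>The quotient by null vectors\<close>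

lemma equiv_null_rel: "equiv (carr V) (null_rel V)"
  by (rule equivI) (auto simp: refl_on_def sym_def trans_def null_rel_iff)

lemma vclass_in: "x \<in> carr V \<Longrightarrow> vclass V x \<in> carr (quotient_space V)"
  by (simp add: quotient_space_def vclass_def quotientI)

lemma rep_in: "P \<in> carr (quotient_space V) \<Longrightarrow> rep P \<in> carr V \<and> vclass V (rep P) = P"
proof -
  assume "P \<in> carr (quotient_space V)"
  then have P: "P \<in> carr V // null_rel V" by (simp add: quotient_space_def)
  have "rep P \<in> P"
    unfolding rep_def some_in_eq by (rule in_quotient_imp_non_empty[OF equiv_null_rel P])
  obtain x where x: "P = null_rel V `` {x}" using P by (rule quotientE)
  have xr: "(x, rep P) \<in> null_rel V"
    by (rule subst[OF x, of "\<lambda>S. rep P \<in> S", THEN Image_singleton_iff[THEN iffD1], OF \<open>rep P \<in> P\<close>])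
  have "vclass V (rep P) = null_rel V `` {x}"
    unfolding vclass_def by (rule equiv_class_eq[OF equiv_null_rel xr, symmetric])
  also have "\<dots> = P" by (rule x[symmetric])
  finally show ?thesis using xr[unfolded null_rel_iff] by simp
qed

lemma vclass_eq_iff: "x \<in> carr V \<Longrightarrow> y \<in> carr V \<Longrightarrow> vclass V x = vclass V y \<longleftrightarrow> (x, y) \<in> null_rel V"
  unfolding vclass_def by (rule eq_equiv_class_iff[OF equiv_null_rel])

lemma inn_rep:
  assumes "x \<in> carr V" "w \<in> carr V"
  shows "inn V (rep (vclass V x)) w = inn V x w"
proof -
  note r = rep_in[OF vclass_in[OF assms(1)]]
  have "(rep (vclass V x), x) \<in> null_rel V"
    by (rule vclass_eq_iff[OF conjunct1[OF r] assms(1), THEN iffD1, OF conjunct2[OF r]])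
  then show ?thesis using assms(2) by (simp add: null_rel_iff)
qed

lemma inn_vclass:
  assumes "x \<in> carr V" "y \<in> carr V"
  shows "inn (quotient_space V) (vclass V x) (vclass V y) = inn V x y"
proof -
  have r: "rep (vclass V y) \<in> carr V" using rep_in[OF vclass_in[OF assms(2)]] by blast
  have "inn (quotient_space V) (vclass V x) (vclass V y) = inn V x (rep (vclass V y))"
    using inn_rep[OF assms(1) r] by (simp add: quotient_space_def)
  also have "\<dots> = cnj (inn V (rep (vclass V y)) x)" by (rule inn_cnj[OF r assms(1)])
  also have "\<dots> = inn V x y" by (simp only: inn_rep[OF assms(2,1)] inn_cnj[OF assms(2,1), symmetric])
  finally show ?thesis .
qed

lemma psd_quotient: "psd_space (quotient_space V)"
proof
  let ?Q = "quotient_space V"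
  note r = rep_in[THEN conjunct1]
  have add: "vadd ?Q P R = vclass V (vadd V (rep P) (rep R))"
    and sc: "vscale ?Q z P = vclass V (vscale V z (rep P))"
    and inn: "inn ?Q P R = inn V (rep P) (rep R)" for P R z by (simp_all add: quotient_space_def)
  show "vscale ?Q z P \<in> carr ?Q" if "P \<in> carr ?Q" for P z
    unfolding sc by (intro vclass_in scale_closed r that)
  show "inn ?Q P P \<in> \<real>\<^sub>\<ge>\<^sub>0" if "P \<in> carr ?Q" for P
    unfolding inn by (intro inn_self r that)
  show "vadd ?Q P R \<in> carr ?Q" if "P \<in> carr ?Q" "R \<in> carr ?Q" for P R
    unfolding add by (intro vclass_in add_closed r that)
  show "inn ?Q R P = cnj (inn ?Q P R)" if "P \<in> carr ?Q" "R \<in> carr ?Q" for P R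
    unfolding inn by (intro inn_cnj r that)
  show "inn ?Q (vadd ?Q P R) W = inn ?Q P W + inn ?Q R W"
    if "P \<in> carr ?Q" "R \<in> carr ?Q" "W \<in> carr ?Q" for P R W
    unfolding inn add
    by (simp only: inn_rep[OF add_closed[OF r r] r] inn_add[OF r r r] that)
  show "inn ?Q (vscale ?Q z P) W = z * inn ?Q P W" if "P \<in> carr ?Q" "W \<in> carr ?Q" for P W z
    unfolding inn sc by (simp only: inn_rep[OF scale_closed[OF r] r] inn_scale[OF r r] that)
qed

section \<open>The completion by Cauchy sequences\<close>

lemma sdist_self: "x \<in> carr V \<Longrightarrow> sdist V x x = 0"
  by (simp add: sdist_def inn_diff diff_closed)

lemma cauchy_seqsD:
  "s \<in> carr (cauchy_seqs V) \<Longrightarrow> e > 0 \<Longrightarrow> \<exists>N. \<forall>m\<ge>N. \<forall>n\<ge>N. sdist V (s m) (s n) < e"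
  by (simp add: cauchy_seqs_def)

lemma cauchy_seqsI:
  assumes "\<And>n. s n \<in> carr V" "\<And>e. e > 0 \<Longrightarrow> \<exists>N. \<forall>m\<ge>N. \<forall>n\<ge>N. sdist V (s m) (s n) < e"
  shows "s \<in> carr (cauchy_seqs V)"
  using assms by (simp add: cauchy_seqs_def)

lemma cauchy_bounded:
  assumes s: "s \<in> carr (cauchy_seqs V)"
  obtains B where "B > 0" "\<And>n. nrm (s n) \<le> B"
proof -
  have c: "s n \<in> carr V" for n using s by (simp add: cauchy_seqs_def)
  obtain N where N: "\<forall>m\<ge>N. \<forall>n\<ge>N. sdist V (s m) (s n) < 1"
    using cauchy_seqsD[OF s zero_less_one] by (elim exE)
  have "nrm (s n) \<le> 1 + nrm (s N)" if "n \<ge> N" for n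
  proof -
    have "nrm (s n) = nrm (vadd V (vdiff V (s n) (s N)) (s N))"
      by (rule nrm_cong) (auto simp: c add_closed diff_closed inn_add inn_diff)
    also have "\<dots> \<le> nrm (vdiff V (s n) (s N)) + nrm (s N)" by (intro nrm_triangle diff_closed c)
    also have "\<dots> \<le> 1 + nrm (s N)" using N that by (simp add: sdist_nrm less_imp_le)
    finally show ?thesis .
  qed
  then have "nrm (s n) \<le> Max (insert (1 + nrm (s N)) ((\<lambda>n. nrm (s n)) ` {..<N}))" for n
    by (cases "n \<ge> N") (auto simp: Max_ge_iff not_le)
  moreover have "0 < Max (insert (1 + nrm (s N)) ((\<lambda>n. nrm (s n)) ` {..<N}))"
    using nrm_nonneg[of "s N"] c by (simp add: Max_gr_iff add_pos_nonneg)
  ultimately show thesis using that by blast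
qed

lemma cauchy_inn:
  assumes s: "s \<in> carr (cauchy_seqs V)" and t: "t \<in> carr (cauchy_seqs V)"
  shows "(\<lambda>n. inn V (s n) (t n)) \<longlonglongrightarrow> inn (cauchy_seqs V) s t"
proof -
  have c: "s n \<in> carr V" "t n \<in> carr V" for n using s t by (simp_all add: cauchy_seqs_def)
  obtain B where B: "B > 0" "\<And>n. nrm (s n) \<le> B" using cauchy_bounded[OF s] by blast
  obtain C where C: "C > 0" "\<And>n. nrm (t n) \<le> C" using cauchy_bounded[OF t] by blast
  have "Cauchy (\<lambda>n. inn V (s n) (t n))"
  proof (rule metric_CauchyI)
    fix e :: real assume e: "e > 0"
    have pos: "e / (2 * C) > 0" "e / (2 * B) > 0" using e B C by auto
    obtain N where N: "\<forall>m\<ge>N. \<forall>n\<ge>N. sdist V (s m) (s n) < e / (2 * C)"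
      using cauchy_seqsD[OF s pos(1)] by (elim exE)
    obtain M where M: "\<forall>m\<ge>M. \<forall>n\<ge>M. sdist V (t m) (t n) < e / (2 * B)"
      using cauchy_seqsD[OF t pos(2)] by (elim exE)
    have "dist (inn V (s m) (t m)) (inn V (s n) (t n)) < e" if "m \<ge> max N M" "n \<ge> max N M" for m n
    proof -
      have "dist (inn V (s m) (t m)) (inn V (s n) (t n)) =
          cmod (inn V (vdiff V (s m) (s n)) (t m) + inn V (s n) (vdiff V (t m) (t n)))"
        by (simp add: dist_norm inn_diff inn_diff_right c)
      also have "\<dots> \<le> cmod (inn V (vdiff V (s m) (s n)) (t m)) + cmod (inn V (s n) (vdiff V (t m) (t n)))"
        by (rule norm_triangle_ineq)
      also have "\<dots> \<le> sdist V (s m) (s n) * nrm (t m) + nrm (s n) * sdist V (t m) (t n)"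
        unfolding sdist_nrm by (intro add_mono Cauchy_Schwarz diff_closed c)
      also have "\<dots> \<le> sdist V (s m) (s n) * C + B * sdist V (t m) (t n)"
        using B C by (intro add_mono mult_left_mono mult_right_mono sdist_nonneg c) auto
      also have "\<dots> < e / (2 * C) * C + B * (e / (2 * B))"
        using N M that B C by (intro add_strict_mono mult_strict_right_mono mult_strict_left_mono) auto
      also have "\<dots> = e" using B C by simp
      finally show ?thesis .
    qed
    then show "\<exists>M. \<forall>m\<ge>M. \<forall>n\<ge>M. dist (inn V (s m) (t m)) (inn V (s n) (t n)) < e" by blast
  qed
  then show ?thesis
    by (simp add: cauchy_seqs_def Cauchy_convergent_iff convergent_LIMSEQ_iff)
qed

lemma cauchy_seqs_const: "x \<in> carr V \<Longrightarrow> (\<lambda>_. x) \<in> carr (cauchy_seqs V)"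
  by (simp add: cauchy_seqs_def sdist_self)

lemma psd_cauchy_seqs: "psd_space (cauchy_seqs V)"
proof
  let ?C = "cauchy_seqs V"
  have c: "s n \<in> carr V" if "s \<in> carr ?C" for s n using that by (simp add: cauchy_seqs_def)
  have op: "vadd ?C s t = (\<lambda>n. vadd V (s n) (t n))" "vscale ?C z s = (\<lambda>n. vscale V z (s n))" for s t z
    by (simp_all add: cauchy_seqs_def)
  have cau: "\<exists>N. \<forall>m\<ge>N. \<forall>n\<ge>N. sdist V (s m) (s n) < e" if "s \<in> carr ?C" "e > 0" for s e
    using that by (simp add: cauchy_seqs_def)
  have sc: "vscale ?C z s \<in> carr ?C" if s: "s \<in> carr ?C" for s z
  proof -
    have d: "sdist V (vscale V z (s m)) (vscale V z (s n)) = cmod z * sdist V (s m) (s n)" for m n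
    proof -
      have "nrm (vdiff V (vscale V z (s m)) (vscale V z (s n))) = nrm (vscale V z (vdiff V (s m) (s n)))"
        by (rule nrm_cong) (auto simp: c[OF s] diff_closed scale_closed inn_diff inn_scale algebra_simps)
      then show ?thesis by (simp add: sdist_nrm nrm_scale diff_closed c[OF s])
    qed
    have "\<exists>N. \<forall>m\<ge>N. \<forall>n\<ge>N. cmod z * sdist V (s m) (s n) < e" if e: "e > 0" for e
    proof (cases "z = 0")
      case False
      then have "e / cmod z > 0" using e by simp
      from cau[OF s this] show ?thesis using False by (simp add: field_simps)
    qed (use e in auto)
    then show ?thesis
      unfolding op by (intro cauchy_seqsI scale_closed c[OF s]) (simp only: d)
  qed
  show "vscale ?C z s \<in> carr ?C" if "s \<in> carr ?C" for s z by (rule sc[OF that])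
  show "inn ?C s s \<in> \<real>\<^sub>\<ge>\<^sub>0" if s: "s \<in> carr ?C" for s
    by (rule closed_sequentially[OF closed_nonneg_Reals_complex _ cauchy_inn[OF s s]]) (simp add: inn_self c[OF s])
  have ad: "vadd ?C s t \<in> carr ?C" if s: "s \<in> carr ?C" and t: "t \<in> carr ?C" for s t
    proof -
      have d: "sdist V (vadd V (s m) (t m)) (vadd V (s n) (t n)) \<le> sdist V (s m) (s n) + sdist V (t m) (t n)" for m n
      proof -
        have "nrm (vdiff V (vadd V (s m) (t m)) (vadd V (s n) (t n))) =
            nrm (vadd V (vdiff V (s m) (s n)) (vdiff V (t m) (t n)))"
          by (rule nrm_cong) (auto simp: c[OF s] c[OF t] diff_closed add_closed inn_diff inn_add algebra_simps)
        also have "\<dots> \<le> nrm (vdiff V (s m) (s n)) + nrm (vdiff V (t m) (t n))"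
          by (intro nrm_triangle diff_closed c s t)
        finally show ?thesis by (simp add: sdist_nrm)
      qed
      have "\<exists>N. \<forall>m\<ge>N. \<forall>n\<ge>N. sdist V (vadd V (s m) (t m)) (vadd V (s n) (t n)) < e" if e: "e > 0" for e
      proof -
        obtain N where N: "\<forall>m\<ge>N. \<forall>n\<ge>N. sdist V (s m) (s n) < e / 2"
          using cau[OF s half_gt_zero[OF e]] by (elim exE)
        obtain M where M: "\<forall>m\<ge>M. \<forall>n\<ge>M. sdist V (t m) (t n) < e / 2"
          using cau[OF t half_gt_zero[OF e]] by (elim exE)
        show ?thesis
        proof (intro exI[of _ "max N M"] allI impI)
          fix m n assume mn: "max N M \<le> m" "max N M \<le> n"
          have "sdist V (s m) (s n) < e / 2" "sdist V (t m) (t n) < e / 2" using N M mn by auto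
          then show "sdist V (vadd V (s m) (t m)) (vadd V (s n) (t n)) < e"
            using d[of m n] by linarith
        qed
      qed
      then show ?thesis unfolding op by (intro cauchy_seqsI add_closed c[OF s] c[OF t])
    qed
  show "vadd ?C s t \<in> carr ?C" if "s \<in> carr ?C" "t \<in> carr ?C" for s t by (rule ad[OF that])
  show "inn ?C t s = cnj (inn ?C s t)" if s: "s \<in> carr ?C" and t: "t \<in> carr ?C" for s t
    proof (rule LIMSEQ_unique[OF cauchy_inn[OF t s]])
      have "(\<lambda>n. cnj (inn V (s n) (t n))) \<longlonglongrightarrow> cnj (inn ?C s t)"
        by (intro tendsto_cnj cauchy_inn s t)
      then show "(\<lambda>n. inn V (t n) (s n)) \<longlonglongrightarrow> cnj (inn ?C s t)"
        by (simp add: inn_cnj[OF c[OF s] c[OF t]])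
    qed
  show "inn ?C (vadd ?C s t) w = inn ?C s w + inn ?C t w"
    if s: "s \<in> carr ?C" and t: "t \<in> carr ?C" and w: "w \<in> carr ?C" for s t w
    proof (rule LIMSEQ_unique[OF cauchy_inn[OF ad[OF s t] w]])
      show "(\<lambda>n. inn V (vadd ?C s t n) (w n)) \<longlonglongrightarrow> inn ?C s w + inn ?C t w"
        using tendsto_add[OF cauchy_inn[OF s w] cauchy_inn[OF t w]] by (simp add: op inn_add c s t w)
    qed
  show "inn ?C (vscale ?C z s) w = z * inn ?C s w" if s: "s \<in> carr ?C" and w: "w \<in> carr ?C" for s w z
  proof (rule LIMSEQ_unique[OF cauchy_inn[OF sc[OF s] w]])
    show "(\<lambda>n. inn V (vscale ?C z s n) (w n)) \<longlonglongrightarrow> z * inn ?C s w"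
      using tendsto_mult_left[OF cauchy_inn[OF s w], of z] by (simp add: op inn_scale c s w)
  qed
qed

lemma psd_completion: "psd_space (completion V)"
  unfolding completion_def by (rule psd_space.psd_quotient[OF psd_cauchy_seqs])

lemma embed_in: "x \<in> carr V \<Longrightarrow> embed V x \<in> carr (completion V)"
  unfolding embed_def completion_def by (intro psd_space.vclass_in psd_cauchy_seqs cauchy_seqs_const)

lemma inn_class_embed:
  assumes "s \<in> carr (cauchy_seqs V)" "x \<in> carr V"
  shows "(\<lambda>n. inn V (s n) x) \<longlonglongrightarrow> inn (completion V) (vclass (cauchy_seqs V) s) (embed V x)"
  using cauchy_inn[OF assms(1) cauchy_seqs_const[OF assms(2)]]
  by (simp add: embed_def completion_def psd_space.inn_vclass[OF psd_cauchy_seqs] assms cauchy_seqs_const)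

lemma inn_embed:
  assumes "x \<in> carr V" "y \<in> carr V"
  shows "inn (completion V) (embed V x) (embed V y) = inn V x y"
  using LIMSEQ_unique[OF inn_class_embed[OF cauchy_seqs_const[OF assms(1)] assms(2)] tendsto_const]
  by (simp add: embed_def)

text \<open>For a Cauchy sequence \<open>s\<close> representing \<open>h\<close>, the number
  \<open>inn V (s n) (s n)\<close> is split at a fixed \<open>s N\<close>: the part with
  \<open>s n - s N\<close> is small for all large \<open>n\<close>, and
  \<open>inn V (s n) (s N)\<close> tends to 0 because \<open>h\<close> is orthogonal to
  \<open>s N\<close>.\<close>

lemma embed_total:
  assumes h: "h \<in> carr (completion V)" and orth: "\<And>x. x \<in> carr V \<Longrightarrow> inn (completion V) h (embed V x) = 0"
  shows "inn (completion V) h h = 0"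
proof -
  interpret C: psd_space "cauchy_seqs V" by (rule psd_cauchy_seqs)
  define s where "s = rep h"
  have s: "s \<in> carr (cauchy_seqs V)" "h = vclass (cauchy_seqs V) s"
    using C.rep_in[of h] h by (auto simp: s_def completion_def)
  have c: "s n \<in> carr V" for n using s(1) by (simp add: cauchy_seqs_def)
  have z: "(\<lambda>n. inn V (s n) (s m)) \<longlonglongrightarrow> 0" for m
    using inn_class_embed[OF s(1) c, of m] orth[OF c, of m] s(2) by simp
  have "inn (completion V) h h = inn (cauchy_seqs V) s s"
    by (simp add: s(2) completion_def C.inn_vclass s(1))
  moreover have "(\<lambda>n. inn V (s n) (s n)) \<longlonglongrightarrow> 0"
  proof (rule metric_LIMSEQ_I)
    fix e :: real assume e: "e > 0"
    obtain B where B: "B > 0" "\<And>n. nrm (s n) \<le> B" using cauchy_bounded[OF s(1)] by blast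
    have pos: "e / (2 * B) > 0" using e B by simp
    obtain N where N: "\<forall>m\<ge>N. \<forall>n\<ge>N. sdist V (s m) (s n) < e / (2 * B)"
      using cauchy_seqsD[OF s(1) pos] by (elim exE)
    obtain M where M: "\<forall>n\<ge>M. dist (inn V (s n) (s N)) 0 < e / 2"
      using metric_LIMSEQ_D[OF z half_gt_zero[OF e], of N] by (elim exE)
    have "dist (inn V (s n) (s n)) 0 < e" if n: "n \<ge> max N M" for n
    proof -
      have "dist (inn V (s n) (s n)) 0 = cmod (inn V (s n) (vdiff V (s n) (s N)) + inn V (s n) (s N))"
        by (simp add: inn_diff_right c)
      also have "\<dots> \<le> cmod (inn V (s n) (vdiff V (s n) (s N))) + cmod (inn V (s n) (s N))"
        by (rule norm_triangle_ineq)
      also have "cmod (inn V (s n) (vdiff V (s n) (s N))) \<le> nrm (s n) * sdist V (s n) (s N)"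
        unfolding sdist_nrm by (intro Cauchy_Schwarz diff_closed c)
      also have "\<dots> \<le> B * sdist V (s n) (s N)"
        using B by (intro mult_right_mono sdist_nonneg c) auto
      also have "\<dots> < B * (e / (2 * B))" using N n B by (intro mult_strict_left_mono) auto
      also have "cmod (inn V (s n) (s N)) < e / 2" using M n by simp
      finally show ?thesis using B by simp
    qed
    then show "\<exists>no. \<forall>n\<ge>no. dist (inn V (s n) (s n)) 0 < e" by blast
  qed
  ultimately show ?thesis using LIMSEQ_unique[OF cauchy_inn[OF s(1) s(1)]] by simp
qed

end

section \<open>Square-integrable functions\<close>

lemma borel_measurable_cnj: "f \<in> borel_measurable M \<Longrightarrow> (\<lambda>w. cnj (f w)) \<in> borel_measurable M"
  by (rule measurable_compose[where N = borel]) (auto intro!: borel_measurable_continuous_onI continuous_intros)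

lemma integral_mult_cnj_self: "(LINT w|\<mu>. f w * cnj (f w)) = complex_of_real (LINT w|\<mu>. (cmod (f w))\<^sup>2)"
  by (simp only: complex_norm_square[symmetric] integral_complex_of_real)

lemma L2_pre_integrable:
  assumes "f \<in> carr (L2_pre \<mu>)" "g \<in> carr (L2_pre \<mu>)"
  shows "integrable \<mu> (\<lambda>w. f w * cnj (g w))"
proof (rule Bochner_Integration.integrable_bound)
  show "integrable \<mu> (\<lambda>w. (cmod (f w))\<^sup>2 + (cmod (g w))\<^sup>2)" using assms by (simp add: L2_pre_def)
  show "(\<lambda>w. f w * cnj (g w)) \<in> borel_measurable \<mu>"
    using assms by (auto simp: L2_pre_def intro!: borel_measurable_times borel_measurable_cnj)
  show "AE w in \<mu>. norm (f w * cnj (g w)) \<le> norm ((cmod (f w))\<^sup>2 + (cmod (g w))\<^sup>2)"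
  proof (rule AE_I2)
    fix w
    have "0 \<le> (cmod (f w) - cmod (g w))\<^sup>2" by simp
    moreover have "0 \<le> cmod (f w) * cmod (g w)" by simp
    ultimately show "norm (f w * cnj (g w)) \<le> norm ((cmod (f w))\<^sup>2 + (cmod (g w))\<^sup>2)"
      unfolding norm_mult complex_mod_cnj power2_diff real_norm_def by linarith
  qed
qed

lemma psd_L2_pre: "psd_space (L2_pre \<mu>)"
proof
  let ?L = "L2_pre \<mu>"
  have iff: "f \<in> carr ?L \<longleftrightarrow> f \<in> borel_measurable \<mu> \<and> integrable \<mu> (\<lambda>w. (cmod (f w))\<^sup>2)" for f
    by (simp add: L2_pre_def)
  have inn: "inn ?L f g = (LINT w|\<mu>. f w * cnj (g w))" for f g by (simp add: L2_pre_def)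
  have op: "vadd ?L f g = (\<lambda>w. f w + g w)" "vscale ?L z f = (\<lambda>w. z * f w)" for f g z by (simp_all add: L2_pre_def)
  show "vscale ?L z f \<in> carr ?L" if f: "f \<in> carr ?L" for f z using f by (auto simp: op iff norm_mult power_mult_distrib)
  show "inn ?L f f \<in> \<real>\<^sub>\<ge>\<^sub>0" for f
  proof -
    have "inn ?L f f = of_real (LINT w|\<mu>. (cmod (f w))\<^sup>2)"
      unfolding inn by (rule integral_mult_cnj_self)
    then show ?thesis by simp
  qed
  show "vadd ?L f g \<in> carr ?L" if f: "f \<in> carr ?L" and g: "g \<in> carr ?L" for f g
    proof -
      have "integrable \<mu> (\<lambda>w. 2 * (cmod (f w))\<^sup>2 + 2 * (cmod (g w))\<^sup>2)" using f g by (simp add: iff)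
      then have "integrable \<mu> (\<lambda>w. (cmod (f w + g w))\<^sup>2)"
      proof (rule Bochner_Integration.integrable_bound)
        show "(\<lambda>w. (cmod (f w + g w))\<^sup>2) \<in> borel_measurable \<mu>" using f g by (auto simp: iff)
        show "AE w in \<mu>. norm ((cmod (f w + g w))\<^sup>2) \<le> norm (2 * (cmod (f w))\<^sup>2 + 2 * (cmod (g w))\<^sup>2)"
        proof (rule AE_I2)
          fix w
          have "(cmod (f w + g w))\<^sup>2 \<le> (cmod (f w) + cmod (g w))\<^sup>2"
            by (intro power_mono norm_triangle_ineq) simp
          also have "\<dots> \<le> 2 * (cmod (f w))\<^sup>2 + 2 * (cmod (g w))\<^sup>2"
            using zero_le_power2[of "cmod (f w) - cmod (g w)"] by (simp add: power2_sum power2_diff)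
          finally show "norm ((cmod (f w + g w))\<^sup>2) \<le> norm (2 * (cmod (f w))\<^sup>2 + 2 * (cmod (g w))\<^sup>2)" by simp
        qed
      qed
      then show ?thesis using f g by (auto simp: op iff)
    qed
  show "inn ?L g f = cnj (inn ?L f g)" for f g
  proof -
    have "(\<lambda>w. g w * cnj (f w)) = (\<lambda>w. cnj (f w * cnj (g w)))" by (simp add: mult.commute)
    then show ?thesis unfolding inn by (simp only: Bochner_Integration.integral_cnj)
  qed
  show "inn ?L (vadd ?L f g) h = inn ?L f h + inn ?L g h"
    if f: "f \<in> carr ?L" and g: "g \<in> carr ?L" and h: "h \<in> carr ?L" for f g h
      unfolding inn op distrib_right
      by (rule Bochner_Integration.integral_add) (intro L2_pre_integrable f g h)+
  show "inn ?L (vscale ?L z f) h = z * inn ?L f h" for f h z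
    unfolding inn op by (simp only: mult.assoc integral_mult_right_zero)
qed

lemma L2_pre_null:
  assumes "f \<in> carr (L2_pre \<mu>)" "inn (L2_pre \<mu>) f f = 0"
  shows "AE w in \<mu>. f w = 0"
proof -
  have "inn (L2_pre \<mu>) f f = of_real (LINT w|\<mu>. (cmod (f w))\<^sup>2)"
    by (simp add: L2_pre_def integral_mult_cnj_self)
  then have "(LINT w|\<mu>. (cmod (f w))\<^sup>2) = 0" using assms(2) by simp
  moreover have "integrable \<mu> (\<lambda>w. (cmod (f w))\<^sup>2)" using assms(1) by (simp add: L2_pre_def)
  ultimately have "AE w in \<mu>. (cmod (f w))\<^sup>2 = 0"
    by (subst (asm) integral_nonneg_eq_0_iff_AE) auto
  then show ?thesis by simp
qed

lemma L2_vclass_eq: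
  assumes "f \<in> carr (L2_pre \<mu>)" "g \<in> carr (L2_pre \<mu>)" "vclass (L2_pre \<mu>) f = vclass (L2_pre \<mu>) g"
  shows "AE w in \<mu>. f w = g w"
proof -
  interpret psd_space "L2_pre \<mu>" by (rule psd_L2_pre)
  have "(f, g) \<in> null_rel (L2_pre \<mu>)" using vclass_eq_iff[OF assms(1,2)] assms(3) by (rule iffD1)
  then have "inn (L2_pre \<mu>) (vdiff (L2_pre \<mu>) f g) (vdiff (L2_pre \<mu>) f g) = 0"
    by (simp only: null_rel_def mem_Collect_eq prod.case)
  then have "AE w in \<mu>. vdiff (L2_pre \<mu>) f g w = 0"
    by (rule L2_pre_null[OF diff_closed[OF assms(1,2)]])
  then show ?thesis by eventually_elim (simp add: vdiff_def L2_pre_def)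
qed

text \<open>\<open>F x\<close> is a function in the class that \<open>K\<close> assigns to
  \<open>x\<close>. The abstract unitary map is thereby replaced by statements about functions that
  hold almost everywhere.\<close>

locale L2_realization = P: psd_space P for P :: "'p sip" +
  fixes \<mu> :: "'w measure" and K and F :: "'p \<Rightarrow> 'w \<Rightarrow> complex"
  assumes K: "unitary_iso (completion (quotient_space P)) (L2 \<mu>) K"
    and F: "x \<in> carr P \<Longrightarrow> F x \<in> carr (L2_pre \<mu>)"
    and K_F: "x \<in> carr P \<Longrightarrow> K (embed (quotient_space P) (vclass P x)) = vclass (L2_pre \<mu>) (F x)"
begin

sublocale Q: psd_space "quotient_space P" by (rule P.psd_quotient)
sublocale H: psd_space "completion (quotient_space P)" by (rule Q.psd_completion)
sublocale L: psd_space "L2_pre \<mu>" by (rule psd_L2_pre)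

abbreviation emb where "emb x \<equiv> embed (quotient_space P) (vclass P x)"

lemma K_surj: "K ` carr (completion (quotient_space P)) = carr (L2 \<mu>)"
  using K unfolding unitary_iso_def by (intro bij_betw_imp_surj_on) (rule conjunct1)

lemma K_inn:
  "x \<in> carr (completion (quotient_space P)) \<Longrightarrow> y \<in> carr (completion (quotient_space P)) \<Longrightarrow>
    inn (L2 \<mu>) (K x) (K y) = inn (completion (quotient_space P)) x y"
  by (rule K[unfolded unitary_iso_def, THEN conjunct2, THEN conjunct2, THEN conjunct2, rule_format])

lemma emb_in: "x \<in> carr P \<Longrightarrow> emb x \<in> carr (completion (quotient_space P))"
  by (intro Q.embed_in P.vclass_in)

lemma inn_F:
  assumes "x \<in> carr P" "y \<in> carr P"
  shows "(LINT w|\<mu>. F x w * cnj (F y w)) = inn P x y"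
proof -
  have "inn P x y = inn (completion (quotient_space P)) (emb x) (emb y)"
    using assms by (simp add: Q.inn_embed P.vclass_in P.inn_vclass)
  also have "\<dots> = inn (L2 \<mu>) (K (emb x)) (K (emb y))"
    by (intro K_inn[symmetric] emb_in assms)
  also have "\<dots> = inn (L2_pre \<mu>) (F x) (F y)"
    using assms by (simp add: K_F L2_def L.inn_vclass F)
  finally show ?thesis by (simp add: L2_pre_def)
qed

text \<open>The class of \<open>f\<close> has a preimage since \<open>K\<close> is onto, and
  orthogonality to all \<open>F x\<close> makes this preimage orthogonal to the embedded pre-Hilbert
  space, which is dense.\<close>

lemma F_total:
  assumes f: "f \<in> carr (L2_pre \<mu>)" and orth: "\<And>x. x \<in> carr P \<Longrightarrow> (LINT w|\<mu>. f w * cnj (F x w)) = 0"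
  shows "AE w in \<mu>. f w = 0"
proof -
  have "vclass (L2_pre \<mu>) f \<in> carr (L2 \<mu>)" unfolding L2_def by (rule L.vclass_in[OF f])
  then have "vclass (L2_pre \<mu>) f \<in> K ` carr (completion (quotient_space P))"
    by (simp only: K_surj)
  then obtain h where h: "vclass (L2_pre \<mu>) f = K h" "h \<in> carr (completion (quotient_space P))"
    by (rule imageE) (rule that)
  have iso: "inn (completion (quotient_space P)) x y = inn (L2 \<mu>) (K x) (K y)"
    if "x \<in> carr (completion (quotient_space P))" "y \<in> carr (completion (quotient_space P))" for x y
    by (rule K_inn[OF that, symmetric])
  have "inn (completion (quotient_space P)) h (embed (quotient_space P) y) = 0"
    if y: "y \<in> carr (quotient_space P)" for y
  proof -
    note x = conjunct1[OF P.rep_in[OF y]] conjunct2[OF P.rep_in[OF y]]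
    have "inn (completion (quotient_space P)) h (emb (rep y)) = inn (L2_pre \<mu>) f (F (rep y))"
      using x(1) h(2) by (simp only: iso h(1)[symmetric] emb_in K_F L2_def L.inn_vclass f F)
    then show ?thesis using orth[OF x(1)] x(2) by (simp add: L2_pre_def)
  qed
  then have "inn (completion (quotient_space P)) h h = 0" by (rule Q.embed_total[OF h(2)])
  then have "inn (L2_pre \<mu>) f f = 0" using h(2) by (simp only: iso h(1)[symmetric] L2_def L.inn_vclass[OF f f])
  then show ?thesis by (rule L2_pre_null[OF f])
qed

text \<open>A constant sequence puts the pair itself into the closure. Membership in the graph of
  the multiplication operator provides some representative \<open>f\<close>, which agrees with
  \<open>F x\<close> only up to a null set.\<close>

lemma F_mult:
  assumes graph: "(\<lambda>(x, y). (K x, K y)) ` op_closure (completion (quotient_space P)) T = mult_op \<mu> u"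
    and T: "(emb x, emb y) \<in> T" and x: "x \<in> carr P" and y: "y \<in> carr P"
  shows "AE w in \<mu>. F y w = complex_of_real (u w) * F x w"
proof -
  let ?s = "\<lambda>_::nat. (emb x, emb y)"
  have "\<forall>n. ?s n \<in> T" by (intro allI T)
  moreover have "(\<lambda>n. sdist (completion (quotient_space P)) (fst (?s n)) (emb x)) \<longlonglongrightarrow> 0"
    unfolding fst_conv H.sdist_self[OF emb_in[OF x]] by (rule tendsto_const)
  moreover have "(\<lambda>n. sdist (completion (quotient_space P)) (snd (?s n)) (emb y)) \<longlonglongrightarrow> 0"
    unfolding snd_conv H.sdist_self[OF emb_in[OF y]] by (rule tendsto_const)
  ultimately have "(emb x, emb y) \<in> op_closure (completion (quotient_space P)) T"
    unfolding op_closure_def mem_Collect_eq prod.case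
    by (intro conjI emb_in x y exI[of _ ?s])
  then have "(\<lambda>(x, y). (K x, K y)) (emb x, emb y) \<in> mult_op \<mu> u"
    unfolding graph[symmetric] by (rule imageI)
  then have "(vclass (L2_pre \<mu>) (F x), vclass (L2_pre \<mu>) (F y)) \<in> mult_op \<mu> u"
    by (simp only: prod.case K_F[OF x] K_F[OF y])
  then have "\<exists>f. (vclass (L2_pre \<mu>) (F x), vclass (L2_pre \<mu>) (F y)) =
      (vclass (L2_pre \<mu>) f, vclass (L2_pre \<mu>) (\<lambda>w. complex_of_real (u w) * f w)) \<and>
      f \<in> carr (L2_pre \<mu>) \<and> (\<lambda>w. complex_of_real (u w) * f w) \<in> carr (L2_pre \<mu>)"
    unfolding mult_op_def by (rule CollectD)
  then obtain f where "(vclass (L2_pre \<mu>) (F x), vclass (L2_pre \<mu>) (F y)) =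
      (vclass (L2_pre \<mu>) f, vclass (L2_pre \<mu>) (\<lambda>w. complex_of_real (u w) * f w))"
    and f: "f \<in> carr (L2_pre \<mu>)" "(\<lambda>w. complex_of_real (u w) * f w) \<in> carr (L2_pre \<mu>)"
    by (elim exE conjE) (rule that)
  then have eq: "vclass (L2_pre \<mu>) (F x) = vclass (L2_pre \<mu>) f"
    "vclass (L2_pre \<mu>) (F y) = vclass (L2_pre \<mu>) (\<lambda>w. complex_of_real (u w) * f w)"
    by (simp_all only: prod.inject)
  have "AE w in \<mu>. F x w = f w" by (rule L2_vclass_eq[OF F[OF x] f(1) eq(1)])
  moreover have "AE w in \<mu>. F y w = complex_of_real (u w) * f w" by (rule L2_vclass_eq[OF F[OF y] f(2) eq(2)])
  ultimately show ?thesis by eventually_elim simp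
qed

end

section \<open>Determinacy of signed averages by their moments\<close>

text \<open>\<open>g k\<close> is the integrand of the \<open>k\<close>-th derivative of a Fourier transform, without the factor \<open>\<i>\<^sup>k\<close>.\<close>

lemma fourier_taylor:
  fixes g :: "nat \<Rightarrow> real \<Rightarrow> 'e \<Rightarrow> complex" and e :: "nat \<Rightarrow> 'e \<Rightarrow> real"
  assumes meas: "\<And>k. g k t \<in> borel_measurable M"
    and bound: "\<And>k x. x \<in> space M \<Longrightarrow> norm (g k t x) \<le> e k x"
    and e: "\<And>k. integrable M (e k)" "\<And>k. (LINT x|M. e k x) \<le> d k"
    and sums: "\<And>x. x \<in> space M \<Longrightarrow> (\<lambda>n. (\<i> * of_real h) ^ n / fact n * g (n + k) t x) sums g k (t + h) x"
    and pt: "\<And>x. x \<in> space M \<Longrightarrow> summable (\<lambda>n. norm ((\<i> * of_real h) ^ n / fact n * g (n + k) t x))"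
    and d: "summable (\<lambda>n. \<bar>h\<bar> ^ n / fact n * d (n + k))"
  shows "(\<lambda>n. (\<i> * of_real h) ^ n / fact n * (LINT x|M. g (n + k) t x)) sums (LINT x|M. g k (t + h) x)"
proof -
  let ?f = "\<lambda>n x. (\<i> * of_real h) ^ n / fact n * g (n + k) t x"
  have int_g: "integrable M (g k t)" for k
    by (rule Bochner_Integration.integrable_bound[OF e(1)[of k] meas])
      (use bound in \<open>auto intro!: AE_I2 order_trans[OF _ abs_ge_self]\<close>)
  have int: "integrable M (?f n)" for n by (intro integrable_mult_right int_g)
  have "summable (\<lambda>n. LINT x|M. norm (?f n x))"
  proof (rule summable_comparison_test'[OF d])
    fix n
    have "(LINT x|M. norm (?f n x)) \<le> (LINT x|M. \<bar>h\<bar> ^ n / fact n * e (n + k) x)"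
    proof (rule integral_mono)
      show "norm (?f n x) \<le> \<bar>h\<bar> ^ n / fact n * e (n + k) x" if "x \<in> space M" for x
        using bound[OF that, of "n + k"] by (auto simp: norm_mult norm_divide norm_power intro!: divide_right_mono mult_left_mono)
    qed (intro integrable_norm int integrable_mult_right e)+
    also have "\<dots> = \<bar>h\<bar> ^ n / fact n * (LINT x|M. e (n + k) x)" by simp
    also have "\<dots> \<le> \<bar>h\<bar> ^ n / fact n * d (n + k)" by (intro mult_left_mono e) simp
    finally show "norm (LINT x|M. norm (?f n x)) \<le> \<bar>h\<bar> ^ n / fact n * d (n + k)"
      by (simp add: integral_nonneg)
  qed
  then have "(\<lambda>n. LINT x|M. ?f n x) sums (LINT x|M. (\<Sum>n. ?f n x))"
    using pt by (intro sums_integral int AE_I2) auto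
  moreover have "(LINT x|M. (\<Sum>n. ?f n x)) = (LINT x|M. g k (t + h) x)"
    by (intro Bochner_Integration.integral_cong refl) (simp add: sums_unique[OF sums])
  ultimately show ?thesis by simp
qed

lemma exp_power_sums:
  fixes x t h :: real
  shows "(\<lambda>n. (\<i> * of_real h) ^ n / fact n * (of_real x ^ (n + k) * exp (\<i> * of_real (t * x))))
      sums (of_real x ^ k * exp (\<i> * of_real ((t + h) * x)))"
    and "summable (\<lambda>n. norm ((\<i> * of_real h) ^ n / fact n * (of_real x ^ (n + k) * exp (\<i> * of_real (t * x)))))"
proof -
  have *: "(\<i> * of_real h) ^ n / fact n * (of_real x ^ (n + k) * exp (\<i> * of_real (t * x))) =
     (of_real x ^ k * exp (\<i> * of_real (t * x))) * ((\<i> * of_real (h * x)) ^ n /\<^sub>R fact n)" for n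
    by (simp add: power_mult_distrib power_add scaleR_conv_of_real field_simps)
  have "exp (\<i> * of_real (t * x)) * exp (\<i> * of_real (h * x)) = exp (\<i> * of_real ((t + h) * x))"
    by (simp add: exp_add[symmetric] algebra_simps)
  then show "(\<lambda>n. (\<i> * of_real h) ^ n / fact n * (of_real x ^ (n + k) * exp (\<i> * of_real (t * x))))
      sums (of_real x ^ k * exp (\<i> * of_real ((t + h) * x)))"
    unfolding * using sums_mult[OF exp_converges[of "\<i> * of_real (h * x)"], of "of_real x ^ k * exp (\<i> * of_real (t * x))"]
    by (simp add: mult.assoc)
  have "summable (\<lambda>n. norm (of_real x ^ k * exp (\<i> * of_real (t * x))) * norm ((\<i> * of_real (h * x)) ^ n /\<^sub>R fact n))"
    by (intro summable_mult summable_norm_exp)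
  then show "summable (\<lambda>n. norm ((\<i> * of_real h) ^ n / fact n * (of_real x ^ (n + k) * exp (\<i> * of_real (t * x)))))"
    unfolding * norm_mult .
qed

text \<open>The binomial bound gives
  \<open>(n + k + 1)! / n! \<le> (k + 1)! * 2 ^ (n + k + 1)\<close>; against the factor
  \<open>(1 / 4) ^ n\<close> granted by \<open>h\<close> this leaves the ratio 1/2. The shift by one
  in the factorial makes room for odd absolute moments.\<close>

lemma summable_factorial_moments:
  fixes a h :: real
  assumes "a > 0" "\<bar>h\<bar> \<le> a / 4"
  shows "summable (\<lambda>n. \<bar>h\<bar> ^ n / fact n * (W * fact (n + k + 1) / a ^ (n + k)))"
proof -
  have "summable (\<lambda>n. (\<bar>W\<bar> * fact (k + 1) * 2 ^ (k + 1) / a ^ k) * (1 / 2) ^ n)"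
    by (intro summable_mult summable_geometric) simp
  then show ?thesis
  proof (rule summable_comparison_test')
    fix n
    have "(n + k + 1) choose n \<le> 2 ^ (n + k + 1)" by (rule binomial_le_pow2)
    moreover have "(fact (n + k + 1) :: real) = fact n * fact (k + 1) * real ((n + k + 1) choose n)"
      using binomial_fact_lemma[of n "n + k + 1"] by (metis (no_types) add.assoc add_diff_cancel_left' le_add1 of_nat_fact of_nat_mult)
    ultimately have "fact (n + k + 1) / fact n \<le> fact (k + 1) * (2::real) ^ (n + k + 1)"
      using of_nat_mono[of "(n + k + 1) choose n" "2 ^ (n + k + 1)", where 'a = real] by (simp add: mult_left_mono)
    then have 1: "\<bar>W\<bar> * (fact (n + k + 1) / fact n) \<le> \<bar>W\<bar> * (fact (k + 1) * 2 ^ (n + k + 1))"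
      by (intro mult_left_mono) auto
    have "\<bar>h\<bar> ^ n \<le> (a / 4) ^ n" using assms by (intro power_mono) auto
    then have 2: "\<bar>h\<bar> ^ n / a ^ (n + k) \<le> (a / 4) ^ n / a ^ (n + k)" using assms by (intro divide_right_mono) auto
    have "norm (\<bar>h\<bar> ^ n / fact n * (W * fact (n + k + 1) / a ^ (n + k))) =
        (\<bar>W\<bar> * (fact (n + k + 1) / fact n)) * (\<bar>h\<bar> ^ n / a ^ (n + k))"
      using assms(1) by (simp add: abs_mult)
    also have "\<dots> \<le> (\<bar>W\<bar> * (fact (k + 1) * 2 ^ (n + k + 1))) * ((a / 4) ^ n / a ^ (n + k))"
      by (rule mult_mono[OF 1 2]) (use assms in auto)
    also have "\<dots> = (\<bar>W\<bar> * fact (k + 1) * 2 ^ (k + 1) / a ^ k) * (1 / 2) ^ n"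
    proof -
      have "(2::real) ^ (n + k + 1) * ((a / 4) ^ n / a ^ (n + k)) = 2 ^ (k + 1) / a ^ k * (2 ^ n * (1 / 4) ^ n)"
        using assms(1) by (simp add: power_add power_divide field_simps)
      also have "(2 ^ n * (1 / 4) ^ n :: real) = (1 / 2) ^ n"
        by (simp add: power_mult_distrib[symmetric])
      finally have eq: "(2::real) ^ (n + k + 1) * ((a / 4) ^ n / a ^ (n + k)) = 2 ^ (k + 1) / a ^ k * (1 / 2) ^ n" .
      have "(\<bar>W\<bar> * (fact (k + 1) * 2 ^ (n + k + 1))) * ((a / 4) ^ n / a ^ (n + k)) =
          \<bar>W\<bar> * fact (k + 1) * (2 ^ (n + k + 1) * ((a / 4) ^ n / a ^ (n + k)))" by (simp only: mult.assoc)
      also have "\<dots> = \<bar>W\<bar> * fact (k + 1) * (2 ^ (k + 1) / a ^ k * (1 / 2) ^ n)" by (simp only: eq)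
      finally show ?thesis by (simp only: mult.assoc times_divide_eq_right times_divide_eq_left)
    qed
    finally show "norm (\<bar>h\<bar> ^ n / fact n * (W * fact (n + k + 1) / a ^ (n + k))) \<le>
      (\<bar>W\<bar> * fact (k + 1) * 2 ^ (k + 1) / a ^ k) * (1 / 2) ^ n" .
  qed
qed

lemma half_le: "0 \<le> u \<Longrightarrow> u / 2 \<le> (u::real)"
  by simp

lemma power_divide_fact_le_exp:
  fixes x :: real
  assumes "x \<ge> 0"
  shows "x ^ k / fact k \<le> exp x"
proof -
  have "(\<Sum>n\<in>{k}. x ^ n /\<^sub>R fact n) \<le> (\<Sum>n. x ^ n /\<^sub>R fact n)"
    by (rule sum_le_suminf[OF summable_exp_generic]) (use assms in auto)
  then show ?thesis by (simp add: exp_def divide_inverse mult.commute)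
qed

definition lin_form :: "nat \<Rightarrow> (nat \<Rightarrow> real) \<Rightarrow> (nat \<Rightarrow> real) \<Rightarrow> real" where
  "lin_form m t y = (\<Sum>j<m. t j * y j)"

lemma continuous_lin_form: "continuous_on UNIV (lin_form m t)"
  unfolding lin_form_def by (intro continuous_intros continuous_on_product_coordinates)

text \<open>The signed measure is an average over \<eta> of finite sums of point masses at
  \<open>Y z\<close> with weights \<open>s \<eta> z\<close>. The number \<open>N \<eta>\<close>
  controls the number of atoms, by \<open>2 ^ N \<eta>\<close>, and linearly the size of their
  coordinates; \<theta> measures the exponential moment left after the factor
  \<open>2 ^ N \<eta>\<close>. In the application the \<open>z\<close> are the subsets of \<eta> and
  \<open>N\<close> is its size.\<close>

locale signed_moments =
  fixes \<nu> :: "'w measure" and X :: "nat \<Rightarrow> 'w \<Rightarrow> real"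
    and M :: "'e measure" and N :: "'e \<Rightarrow> nat" and I :: "'e \<Rightarrow> 'z set"
    and s :: "'e \<Rightarrow> 'z \<Rightarrow> real" and Y :: "'z \<Rightarrow> nat \<Rightarrow> real" and B :: "nat \<Rightarrow> real" and \<theta> :: real
  assumes fin: "finite_measure \<nu>" and X: "X j \<in> borel_measurable \<nu>"
    and I: "\<eta> \<in> space M \<Longrightarrow> finite (I \<eta>)" "\<eta> \<in> space M \<Longrightarrow> card (I \<eta>) \<le> 2 ^ N \<eta>"
    and s: "\<eta> \<in> space M \<Longrightarrow> z \<in> I \<eta> \<Longrightarrow> \<bar>s \<eta> z\<bar> \<le> 1"
    and Y: "\<eta> \<in> space M \<Longrightarrow> z \<in> I \<eta> \<Longrightarrow> \<bar>Y z j\<bar> \<le> B j * real (N \<eta>)"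
    and meas: "continuous_on UNIV F \<Longrightarrow> (\<lambda>\<eta>. \<Sum>z\<in>I \<eta>. s \<eta> z * F (Y z)) \<in> borel_measurable M"
    and N: "N \<in> measurable M (count_space UNIV)"
    and \<theta>: "\<theta> > 0" "integrable M (\<lambda>\<eta>. 2 ^ N \<eta> * exp (\<theta> * real (N \<eta>)))"
    and moments: "integrable \<nu> (\<lambda>w. lin_form m t (\<lambda>j. X j w) ^ k)"
      "(LINT w|\<nu>. lin_form m t (\<lambda>j. X j w) ^ k) = (LINT \<eta>|M. (\<Sum>z\<in>I \<eta>. s \<eta> z * lin_form m t (Y z) ^ k))"
begin

definition D :: "((nat \<Rightarrow> real) \<Rightarrow> real) \<Rightarrow> 'e \<Rightarrow> real" where
  "D F \<eta> = (\<Sum>z\<in>I \<eta>. s \<eta> z * F (Y z))"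

lemma weighted_sum_bound:
  fixes F :: "'z \<Rightarrow> complex"
  assumes \<eta>: "\<eta> \<in> space M" and C: "C \<ge> 0" and F: "\<And>z. z \<in> I \<eta> \<Longrightarrow> norm (F z) \<le> C"
  shows "norm (\<Sum>z\<in>I \<eta>. of_real (s \<eta> z) * F z) \<le> 2 ^ N \<eta> * C"
proof -
  have "norm (\<Sum>z\<in>I \<eta>. of_real (s \<eta> z) * F z) \<le> (\<Sum>z\<in>I \<eta>. 1 * C)"
  proof (rule sum_norm_le)
    show "norm (of_real (s \<eta> z) * F z) \<le> 1 * C" if "z \<in> I \<eta>" for z
      unfolding norm_mult norm_of_real by (rule mult_mono[OF s[OF \<eta> that] F[OF that]]) auto
  qed
  also have "\<dots> = real (card (I \<eta>)) * C" by simp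
  also have "real (card (I \<eta>)) \<le> 2 ^ N \<eta>"
    using of_nat_mono[OF I(2)[OF \<eta>], where 'a = real] by simp
  finally show ?thesis using C by (simp add: mult_right_mono)
qed

lemma D_bound:
  assumes "\<eta> \<in> space M" "\<And>y. \<bar>F y\<bar> \<le> C"
  shows "\<bar>D F \<eta>\<bar> \<le> 2 ^ N \<eta> * C"
proof -
  have "C \<ge> 0" using assms(2)[of undefined] by linarith
  moreover have "\<bar>D F \<eta>\<bar> = norm (\<Sum>z\<in>I \<eta>. complex_of_real (s \<eta> z) * of_real (F (Y z)))"
    unfolding D_def of_real_mult[symmetric] of_real_sum[symmetric] norm_of_real ..
  ultimately show ?thesis using weighted_sum_bound[OF assms(1), of C "\<lambda>z. of_real (F (Y z))"] assms(2) by simp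
qed

lemma N_measurable: "(\<lambda>\<eta>. f (N \<eta>) :: real) \<in> borel_measurable M"
  by (rule measurable_compose[OF N]) simp

definition W :: real where "W = (LINT \<eta>|M. 2 ^ N \<eta> * exp (\<theta> * real (N \<eta>)))"

text \<open>The inequality \<open>(\<theta> * N) ^ k / k! \<le> exp (\<theta> * N)\<close> trades
  powers for the exponential moment, so the moments grow at most like \<open>k!\<close> with rate
  \<open>\<theta> / b\<close>.\<close>

lemma N_moment:
  assumes "b > 0"
  shows "integrable M (\<lambda>\<eta>. 2 ^ N \<eta> * (b * real (N \<eta>)) ^ k)"
    and "(LINT \<eta>|M. 2 ^ N \<eta> * (b * real (N \<eta>)) ^ k) \<le> W * fact k / (\<theta> / b) ^ k"
proof -
  have le: "2 ^ N \<eta> * (b * real (N \<eta>)) ^ k \<le> fact k / (\<theta> / b) ^ k * (2 ^ N \<eta> * exp (\<theta> * real (N \<eta>)))" for \<eta>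
  proof -
    have "(\<theta> * real (N \<eta>)) ^ k / fact k \<le> exp (\<theta> * real (N \<eta>))"
      using \<theta>(1) by (intro power_divide_fact_le_exp) simp
    then have "fact k / (\<theta> / b) ^ k * ((\<theta> * real (N \<eta>)) ^ k / fact k) \<le> fact k / (\<theta> / b) ^ k * exp (\<theta> * real (N \<eta>))"
      using \<theta>(1) assms by (intro mult_left_mono) auto
    moreover have "fact k / (\<theta> / b) ^ k * ((\<theta> * real (N \<eta>)) ^ k / fact k) = (b * real (N \<eta>)) ^ k"
      using \<theta>(1) assms by (simp add: power_mult_distrib power_divide field_simps)
    ultimately have "(b * real (N \<eta>)) ^ k \<le> fact k / (\<theta> / b) ^ k * exp (\<theta> * real (N \<eta>))" by simp
    then have "2 ^ N \<eta> * (b * real (N \<eta>)) ^ k \<le> 2 ^ N \<eta> * (fact k / (\<theta> / b) ^ k * exp (\<theta> * real (N \<eta>)))"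
      by (rule mult_left_mono) simp
    then show ?thesis by (simp only: mult.left_commute)
  qed
  have int: "integrable M (\<lambda>\<eta>. fact k / (\<theta> / b) ^ k * (2 ^ N \<eta> * exp (\<theta> * real (N \<eta>))))"
    by (intro integrable_mult_right \<theta>(2))
  show i: "integrable M (\<lambda>\<eta>. 2 ^ N \<eta> * (b * real (N \<eta>)) ^ k)"
    by (rule Bochner_Integration.integrable_bound[OF int N_measurable])
      (rule AE_I2, use le assms \<theta>(1) in \<open>simp add: abs_mult\<close>)
  have "(LINT \<eta>|M. 2 ^ N \<eta> * (b * real (N \<eta>)) ^ k) \<le> (LINT \<eta>|M. fact k / (\<theta> / b) ^ k * (2 ^ N \<eta> * exp (\<theta> * real (N \<eta>))))"
    by (rule integral_mono[OF i int le])
  then show "(LINT \<eta>|M. 2 ^ N \<eta> * (b * real (N \<eta>)) ^ k) \<le> W * fact k / (\<theta> / b) ^ k"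
    by (simp add: W_def mult.commute)
qed

lemma W_nonneg: "W \<ge> 0"
  unfolding W_def by (intro Bochner_Integration.integral_nonneg) simp

text \<open>The summand 1 keeps the slope positive, so that \<open>rate\<close> is meaningful also
  for the zero form.\<close>

definition slope :: "nat \<Rightarrow> (nat \<Rightarrow> real) \<Rightarrow> real" where
  "slope m t = 1 + (\<Sum>j<m. \<bar>t j\<bar> * \<bar>B j\<bar>)"

lemma slope_pos: "slope m t > 0"
  unfolding slope_def by (intro add_pos_nonneg sum_nonneg) auto

lemma lin_form_Y:
  assumes "\<eta> \<in> space M" "z \<in> I \<eta>"
  shows "\<bar>lin_form m t (Y z)\<bar> \<le> slope m t * real (N \<eta>)"
proof -
  have "\<bar>lin_form m t (Y z)\<bar> \<le> (\<Sum>j<m. \<bar>t j\<bar> * \<bar>B j\<bar> * real (N \<eta>))"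
    unfolding lin_form_def
  proof (rule order_trans[OF sum_abs], rule sum_mono)
    fix j
    have "\<bar>Y z j\<bar> \<le> B j * real (N \<eta>)" by (rule Y[OF assms])
    also have "\<dots> \<le> \<bar>B j\<bar> * real (N \<eta>)" by (intro mult_right_mono) auto
    finally show "\<bar>t j * Y z j\<bar> \<le> \<bar>t j\<bar> * \<bar>B j\<bar> * real (N \<eta>)"
      by (simp add: abs_mult mult.assoc mult_left_mono)
  qed
  also have "\<dots> \<le> slope m t * real (N \<eta>)"
    unfolding slope_def sum_distrib_right[symmetric] by (simp add: distrib_right)
  finally show ?thesis .
qed

section \<open>Fourier transforms along a fixed linear form\<close>

context
  fixes m :: nat and t :: "nat \<Rightarrow> real"
begin

definition lX where "lX w = lin_form m t (\<lambda>j. X j w)"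
definition lY where "lY z = lin_form m t (Y z)"
definition FX where "FX k \<tau> = (LINT w|\<nu>. of_real (lX w) ^ k * exp (\<i> * of_real (\<tau> * lX w)))"
definition FY where "FY k \<tau> \<eta> = (\<Sum>z\<in>I \<eta>. of_real (s \<eta> z) * (of_real (lY z) ^ k * exp (\<i> * of_real (\<tau> * lY z))))"
definition rate where "rate = \<theta> / slope m t"
text \<open>The factor in parentheses and the shifted factorial leave room for odd absolute moments,
  which are estimated by the two neighbouring even ones at the cost of one power of
  \<open>rate\<close> in either direction.\<close>

definition dbound where "dbound k = (W * (1 + rate + 1 / rate)) * fact (k + 1) / rate ^ k"

lemma rate_pos: "rate > 0"
  unfolding rate_def using \<theta>(1) slope_pos by simp

lemma lX_measurable: "lX \<in> borel_measurable \<nu>"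
  unfolding lX_def[abs_def] lin_form_def by (intro borel_measurable_sum borel_measurable_times borel_measurable_const X)

lemma dbound_ge: "W * fact k / rate ^ k \<le> dbound k"
proof -
  have "W * fact k \<le> W * (1 + rate + 1 / rate) * fact (k + 1)"
  proof (rule mult_mono)
    show "W \<le> W * (1 + rate + 1 / rate)"
      using W_nonneg rate_pos mult_left_mono[of 1 "1 + rate + 1 / rate" W] by simp
    show "(fact k :: real) \<le> fact (k + 1)" by (rule fact_mono) simp
  qed (use W_nonneg rate_pos in auto)
  then show ?thesis unfolding dbound_def using rate_pos by (intro divide_right_mono) auto
qed

lemma FY_bound: "\<eta> \<in> space M \<Longrightarrow> norm (FY k \<tau> \<eta>) \<le> 2 ^ N \<eta> * (slope m t * real (N \<eta>)) ^ k"
  unfolding FY_def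
proof (rule weighted_sum_bound)
  fix z assume "\<eta> \<in> space M" "z \<in> I \<eta>"
  then have "\<bar>lY z\<bar> ^ k \<le> (slope m t * real (N \<eta>)) ^ k"
    unfolding lY_def by (intro power_mono lin_form_Y) auto
  then show "norm (of_real (lY z) ^ k * exp (\<i> * of_real (\<tau> * lY z))) \<le> (slope m t * real (N \<eta>)) ^ k"
    using norm_exp_i_times[of "\<tau> * lY z"] by (simp add: norm_mult norm_power)
qed (use slope_pos[of m t] in auto)

lemma FY_Re_Im:
  "Re (FY k \<tau> \<eta>) = D (\<lambda>v. lin_form m t v ^ k * cos (\<tau> * lin_form m t v)) \<eta>"
  "Im (FY k \<tau> \<eta>) = D (\<lambda>v. lin_form m t v ^ k * sin (\<tau> * lin_form m t v)) \<eta>"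
proof -
  have "of_real (s \<eta> z) * (of_real (lY z) ^ k * exp (\<i> * of_real (\<tau> * lY z))) =
    Complex (s \<eta> z * (lY z ^ k * cos (\<tau> * lY z))) (s \<eta> z * (lY z ^ k * sin (\<tau> * lY z)))" for z
    unfolding cis_conv_exp[symmetric] of_real_power[symmetric] by (simp add: complex_eq_iff)
  then show "Re (FY k \<tau> \<eta>) = D (\<lambda>v. lin_form m t v ^ k * cos (\<tau> * lin_form m t v)) \<eta>"
    "Im (FY k \<tau> \<eta>) = D (\<lambda>v. lin_form m t v ^ k * sin (\<tau> * lin_form m t v)) \<eta>"
    by (simp_all add: FY_def D_def lY_def)
qed

lemma FY_measurable: "FY k \<tau> \<in> borel_measurable M"
proof -
  have "(\<lambda>\<eta>. Re (FY k \<tau> \<eta>)) \<in> borel_measurable M" "(\<lambda>\<eta>. Im (FY k \<tau> \<eta>)) \<in> borel_measurable M"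
    unfolding FY_Re_Im D_def by (intro meas continuous_intros continuous_lin_form)+
  then show ?thesis by (simp add: borel_measurable_complex_iff)
qed

lemma FY_integrable: "integrable M (FY k \<tau>)"
  by (rule Bochner_Integration.integrable_bound[OF N_moment(1)[OF slope_pos[of m t], of k] FY_measurable])
    (use FY_bound slope_pos[of m t] in \<open>auto simp: abs_mult\<close>)

text \<open>The moment identity controls only powers of \<open>lX\<close>, not of its modulus; for
  even exponents the two coincide, so the bound on the signed side carries over.\<close>

lemma even_moment: "(LINT w|\<nu>. lX w ^ (2 * l)) \<le> W * fact (2 * l) / rate ^ (2 * l)"
proof -
  have "(LINT w|\<nu>. lX w ^ (2 * l)) = (LINT \<eta>|M. Re (FY (2 * l) 0 \<eta>))"
    unfolding lX_def moments(2) FY_Re_Im D_def by simp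
  also have "\<dots> \<le> (LINT \<eta>|M. 2 ^ N \<eta> * (slope m t * real (N \<eta>)) ^ (2 * l))"
    by (intro integral_mono integrable_Re FY_integrable N_moment slope_pos
        order_trans[OF complex_Re_le_cmod FY_bound])
  also have "\<dots> \<le> W * fact (2 * l) / rate ^ (2 * l)"
    unfolding rate_def by (rule N_moment(2)[OF slope_pos])
  finally show ?thesis .
qed

lemma abs_moment: "integrable \<nu> (\<lambda>w. \<bar>lX w\<bar> ^ k)" "(LINT w|\<nu>. \<bar>lX w\<bar> ^ k) \<le> dbound k"
proof -
  have int: "integrable \<nu> (\<lambda>w. lX w ^ k)" for k unfolding lX_def by (rule moments(1))
  show abs: "integrable \<nu> (\<lambda>w. \<bar>lX w\<bar> ^ k)"
    using integrable_abs[OF int[of k]] by (simp add: power_abs)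
  show "(LINT w|\<nu>. \<bar>lX w\<bar> ^ k) \<le> dbound k"
  proof (cases "even k")
    case True
    then obtain l where l: "k = 2 * l" by blast
    show ?thesis using even_moment[of l] dbound_ge[of k] by (simp add: l power_mult)
  next
    case False
    then obtain l where l: "k = 2 * l + 1" by (rule oddE)
    \<comment> \<open>The inequality \<open>2 * u \<le> 1 + u ^ 2\<close> for
      \<open>u = \<bar>lX w\<bar>\<close>, multiplied by the next lower even power.\<close>
    have le: "\<bar>lX w\<bar> ^ k \<le> (lX w ^ (2 * l) + lX w ^ (2 * (l + 1))) / 2" for w
    proof -
      have "2 * \<bar>lX w\<bar> \<le> 1 + (lX w)\<^sup>2"
        using zero_le_power2[of "\<bar>lX w\<bar> - 1"] by (simp add: power2_diff)
      then have "lX w ^ (2 * l) * (2 * \<bar>lX w\<bar>) \<le> lX w ^ (2 * l) * (1 + (lX w)\<^sup>2)" by (rule mult_left_mono) simp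
      moreover have "\<bar>lX w\<bar> ^ k = lX w ^ (2 * l) * \<bar>lX w\<bar>" by (simp add: l power_mult)
      ultimately show ?thesis by (simp add: power_add power2_eq_square algebra_simps)
    qed
    have "(LINT w|\<nu>. \<bar>lX w\<bar> ^ k) \<le> (LINT w|\<nu>. (lX w ^ (2 * l) + lX w ^ (2 * (l + 1))) / 2)"
      by (intro integral_mono abs le integrable_divide Bochner_Integration.integrable_add int)
    also have "\<dots> = ((LINT w|\<nu>. lX w ^ (2 * l)) + (LINT w|\<nu>. lX w ^ (2 * (l + 1)))) / 2"
      by (subst integral_divide_zero, subst Bochner_Integration.integral_add) (rule int refl)+
    also have "\<dots> \<le> (W * fact (2 * l) / rate ^ (2 * l) + W * fact (2 * (l + 1)) / rate ^ (2 * (l + 1))) / 2"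
      by (intro divide_right_mono add_mono even_moment) simp
    also have "\<dots> \<le> W * fact (2 * l) / rate ^ (2 * l) + W * fact (2 * (l + 1)) / rate ^ (2 * (l + 1))"
    proof -
      have "0 \<le> W * fact (2 * l) / rate ^ (2 * l)" "0 \<le> W * fact (2 * (l + 1)) / rate ^ (2 * (l + 1))"
        using W_nonneg rate_pos by (intro divide_nonneg_nonneg mult_nonneg_nonneg; simp)+
      then show ?thesis by (metis add_nonneg_nonneg half_le)
    qed
    also have "\<dots> = (W * rate * fact (2 * l) + W * (1 / rate) * fact (k + 1)) / rate ^ k"
      using rate_pos by (simp add: l field_simps)
    also have "\<dots> \<le> (W * rate * fact (k + 1) + W * (1 / rate) * fact (k + 1)) / rate ^ k"
      using W_nonneg rate_pos by (intro divide_right_mono add_right_mono mult_left_mono fact_mono) (auto simp: l)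
    also have "\<dots> \<le> dbound k"
      unfolding dbound_def using W_nonneg rate_pos by (intro divide_right_mono) (auto simp: algebra_simps)
    finally show ?thesis .
  qed
qed

text \<open>Both transforms have Taylor expansions at \<tau> valid for
  \<open>\<bar>h\<bar> \<le> rate / 4\<close>, and by assumption their coefficients agree. The
  conclusion again concerns every order \<open>k\<close>, so the step can be iterated.\<close>

lemma fourier_step:
  assumes h: "\<bar>h\<bar> \<le> rate / 4" and eq: "\<And>k. FX k \<tau> = (LINT \<eta>|M. FY k \<tau> \<eta>)"
  shows "FX k (\<tau> + h) = (LINT \<eta>|M. FY k (\<tau> + h) \<eta>)"
proof -
  have d: "summable (\<lambda>n. \<bar>h\<bar> ^ n / fact n * dbound (n + k))"
    unfolding dbound_def using summable_factorial_moments[OF rate_pos h] by simp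
  have "(\<lambda>n. (\<i> * of_real h) ^ n / fact n * FX (n + k) \<tau>) sums FX k (\<tau> + h)"
    unfolding FX_def
  proof (rule fourier_taylor[where e = "\<lambda>k w. \<bar>lX w\<bar> ^ k" and d = dbound])
    show "(\<lambda>w. of_real (lX w) ^ k * exp (\<i> * of_real (\<tau> * lX w))) \<in> borel_measurable \<nu>" for k
      by (rule measurable_compose[OF lX_measurable]) (intro borel_measurable_continuous_onI continuous_intros)
    show "norm (of_real (lX w) ^ k * exp (\<i> * of_real (\<tau> * lX w))) \<le> \<bar>lX w\<bar> ^ k" for k w
      using norm_exp_i_times[of "\<tau> * lX w"] by (simp add: norm_mult norm_power)
  qed (rule abs_moment exp_power_sums d)+
  moreover have "(\<lambda>n. (\<i> * of_real h) ^ n / fact n * (LINT \<eta>|M. FY (n + k) \<tau> \<eta>)) sums (LINT \<eta>|M. FY k (\<tau> + h) \<eta>)"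
  proof (rule fourier_taylor[where e = "\<lambda>k \<eta>. 2 ^ N \<eta> * (slope m t * real (N \<eta>)) ^ k" and d = dbound])
    show "(LINT \<eta>|M. 2 ^ N \<eta> * (slope m t * real (N \<eta>)) ^ k) \<le> dbound k" for k
      by (rule order_trans[OF N_moment(2)[OF slope_pos, of m t k] dbound_ge[of k, unfolded rate_def]])
    fix \<eta> assume \<eta>: "\<eta> \<in> space M"
    have *: "(\<i> * of_real h) ^ n / fact n * FY (n + k) \<tau> \<eta> = (\<Sum>z\<in>I \<eta>. of_real (s \<eta> z) *
        ((\<i> * of_real h) ^ n / fact n * (of_real (lY z) ^ (n + k) * exp (\<i> * of_real (\<tau> * lY z)))))" for n
      unfolding FY_def sum_distrib_left by (intro sum.cong refl) (simp only: mult.left_commute)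
    show "(\<lambda>n. (\<i> * of_real h) ^ n / fact n * FY (n + k) \<tau> \<eta>) sums FY k (\<tau> + h) \<eta>"
      unfolding * unfolding FY_def by (intro sums_sum sums_mult exp_power_sums)
    have "summable (\<lambda>n. \<Sum>z\<in>I \<eta>. \<bar>s \<eta> z\<bar> *
        norm ((\<i> * of_real h) ^ n / fact n * (of_real (lY z) ^ (n + k) * exp (\<i> * of_real (\<tau> * lY z)))))"
      by (intro summable_sum summable_mult exp_power_sums)
    then show "summable (\<lambda>n. norm ((\<i> * of_real h) ^ n / fact n * FY (n + k) \<tau> \<eta>))"
    proof (rule summable_comparison_test')
      show "norm (norm ((\<i> * of_real h) ^ n / fact n * FY (n + k) \<tau> \<eta>)) \<le> (\<Sum>z\<in>I \<eta>. \<bar>s \<eta> z\<bar> *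
        norm ((\<i> * of_real h) ^ n / fact n * (of_real (lY z) ^ (n + k) * exp (\<i> * of_real (\<tau> * lY z)))))" for n
        unfolding * real_norm_def abs_norm_cancel by (rule sum_norm_le) (simp only: norm_mult norm_of_real order_refl)
    qed
  qed (rule FY_measurable N_moment slope_pos d FY_bound | assumption)+
  ultimately show ?thesis unfolding eq by (rule sums_unique2)
qed

text \<open>The Taylor radius does not depend on the point, so equality propagates from \<open>i h\<close> to \<open>(i + 1) h\<close> for all derivatives at once.\<close>

lemma fourier_eq: "FX k \<tau> = (LINT \<eta>|M. FY k \<tau> \<eta>)"
proof -
  obtain n :: nat where n: "\<bar>\<tau>\<bar> / (rate / 4) \<le> real n" using real_arch_simple by blast
  define h where "h = \<tau> / real (Suc n)"
  have "\<bar>\<tau>\<bar> \<le> real n * (rate / 4)" using n rate_pos by (simp add: pos_divide_le_eq)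
  also have "\<dots> \<le> real (Suc n) * (rate / 4)" using rate_pos by (intro mult_right_mono) auto
  finally have h: "\<bar>h\<bar> \<le> rate / 4" unfolding h_def by (simp add: pos_divide_le_eq mult.commute del: of_nat_Suc)
  have "FX k (real i * h) = (LINT \<eta>|M. FY k (real i * h) \<eta>)" for i k
  proof (induction i arbitrary: k)
    case 0
    have "FX k 0 = of_real (LINT w|\<nu>. lX w ^ k)"
      unfolding FX_def by (simp flip: of_real_power)
    moreover
    have "FY k 0 \<eta> = of_real (D (\<lambda>v. lin_form m t v ^ k) \<eta>)" for \<eta>
      by (simp add: complex_eq_iff FY_Re_Im) (simp add: D_def)
    then have "(LINT \<eta>|M. FY k 0 \<eta>) = of_real (LINT \<eta>|M. D (\<lambda>v. lin_form m t v ^ k) \<eta>)"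
      by (simp only: integral_complex_of_real)
    ultimately show ?case by (simp add: lX_def moments(2) D_def)
  next
    case (Suc i)
    have "FX k (real i * h + h) = (LINT \<eta>|M. FY k (real i * h + h) \<eta>)" by (rule fourier_step[OF h Suc])
    moreover have "real (Suc i) * h = real i * h + h" by (simp add: distrib_right)
    ultimately show ?case by (simp only:)
  qed
  from this[of k "Suc n"] show ?thesis unfolding h_def by simp
qed

lemma cos_sin_eq:
  "(LINT w|\<nu>. cos (lin_form m t (\<lambda>j. X j w))) = (LINT \<eta>|M. D (\<lambda>v. cos (lin_form m t v)) \<eta>)"
  "(LINT w|\<nu>. sin (lin_form m t (\<lambda>j. X j w))) = (LINT \<eta>|M. D (\<lambda>v. sin (lin_form m t v)) \<eta>)"
proof -
  have int: "integrable \<nu> (\<lambda>w. exp (\<i> * of_real (lX w)))"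
  proof (rule Bochner_Integration.integrable_bound)
    show "integrable \<nu> (\<lambda>_. 1::real)" using fin by (simp add: finite_measure.integrable_const)
    show "(\<lambda>w. exp (\<i> * of_real (lX w))) \<in> borel_measurable \<nu>"
      by (rule measurable_compose[OF lX_measurable]) (intro borel_measurable_continuous_onI continuous_intros)
  qed simp
  have "Re (FX 0 1) = (LINT w|\<nu>. cos (lX w))" "Im (FX 0 1) = (LINT w|\<nu>. sin (lX w))"
    unfolding FX_def using integral_Re[OF int] integral_Im[OF int] by (simp_all add: Re_exp Im_exp)
  moreover have "Re (LINT \<eta>|M. FY 0 1 \<eta>) = (LINT \<eta>|M. D (\<lambda>v. cos (lin_form m t v)) \<eta>)"
    "Im (LINT \<eta>|M. FY 0 1 \<eta>) = (LINT \<eta>|M. D (\<lambda>v. sin (lin_form m t v)) \<eta>)"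
    using integral_Re[OF FY_integrable, of 0 1] integral_Im[OF FY_integrable, of 0 1] by (simp_all add: FY_Re_Im)
  ultimately show "(LINT w|\<nu>. cos (lin_form m t (\<lambda>j. X j w))) = (LINT \<eta>|M. D (\<lambda>v. cos (lin_form m t v)) \<eta>)"
    "(LINT w|\<nu>. sin (lin_form m t (\<lambda>j. X j w))) = (LINT \<eta>|M. D (\<lambda>v. sin (lin_form m t v)) \<eta>)"
    using fourier_eq[of 0 1] by (simp_all add: lX_def)
qed

end

section \<open>From trigonometric polynomials to Borel sets\<close>

inductive trig :: "((nat \<Rightarrow> real) \<Rightarrow> real) \<Rightarrow> bool" where
  cos: "trig (\<lambda>v. cos (lin_form m t v))"
| sin: "trig (\<lambda>v. sin (lin_form m t v))"
| add: "trig f \<Longrightarrow> trig g \<Longrightarrow> trig (\<lambda>v. f v + g v)"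
| scale: "trig f \<Longrightarrow> trig (\<lambda>v. c * f v)"

text \<open>The functions on which the law of \<open>X\<close> under \<nu> and the signed average
  agree. Boundedness and measurability are part of the notion in order to make it stable under
  bounded limits.\<close>

definition good :: "((nat \<Rightarrow> real) \<Rightarrow> real) \<Rightarrow> bool" where
  "good F \<longleftrightarrow> (\<exists>C. \<forall>v. \<bar>F v\<bar> \<le> C) \<and> (\<lambda>w. F (\<lambda>j. X j w)) \<in> borel_measurable \<nu> \<and> D F \<in> borel_measurable M \<and>
    (LINT w|\<nu>. F (\<lambda>j. X j w)) = (LINT \<eta>|M. D F \<eta>)"

lemma exp_integrable: "integrable M (\<lambda>\<eta>. 2 ^ N \<eta> * (C::real))"
  by (rule Bochner_Integration.integrable_bound[OF integrable_mult_right[OF \<theta>(2), of C] N_measurable])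
    (rule AE_I2, use \<theta>(1) in \<open>auto simp: abs_mult mult_le_cancel_left1\<close>)

lemma
  assumes "good F"
  shows good_integrable: "integrable \<nu> (\<lambda>w. F (\<lambda>j. X j w))" and good_D_integrable: "integrable M (D F)"
proof -
  obtain C where C: "\<And>v. \<bar>F v\<bar> \<le> C" using assms unfolding good_def by blast
  show "integrable \<nu> (\<lambda>w. F (\<lambda>j. X j w))"
    by (rule finite_measure.integrable_const_bound[OF fin, of _ C]) (use C assms in \<open>auto simp: good_def\<close>)
  show "integrable M (D F)"
    by (rule Bochner_Integration.integrable_bound[OF exp_integrable[of C]])
      (use D_bound[OF _ C] assms in \<open>auto simp: good_def intro!: AE_I2 order_trans[OF _ abs_ge_self]\<close>)
qed

lemma D_add: "D (\<lambda>v. F v + G v) \<eta> = D F \<eta> + D G \<eta>"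
  and D_scale: "D (\<lambda>v. c * F v) \<eta> = c * D F \<eta>"
  by (simp_all add: D_def sum.distrib sum_distrib_left algebra_simps)

lemma good_add:
  assumes "good F" "good G"
  shows "good (\<lambda>v. F v + G v)"
proof -
  obtain C where C: "\<And>v. \<bar>F v\<bar> \<le> C" using assms unfolding good_def by blast
  obtain C' where C': "\<And>v. \<bar>G v\<bar> \<le> C'" using assms unfolding good_def by blast
  have "\<bar>F v + G v\<bar> \<le> C + C'" for v using C[of v] C'[of v] by linarith
  then have 1: "\<exists>C. \<forall>v. \<bar>F v + G v\<bar> \<le> C" by blast
  have "(LINT w|\<nu>. F (\<lambda>j. X j w) + G (\<lambda>j. X j w)) = (LINT \<eta>|M. D F \<eta> + D G \<eta>)"
    using assms by (simp add: Bochner_Integration.integral_add good_integrable good_D_integrable) (simp add: good_def)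
  then show ?thesis
    using assms 1 unfolding good_def by (auto simp: D_add[abs_def])
qed

lemma good_scale:
  assumes "good F"
  shows "good (\<lambda>v. c * F v)"
proof -
  obtain C where C: "\<And>v. \<bar>F v\<bar> \<le> C" using assms unfolding good_def by blast
  have "\<bar>c * F v\<bar> \<le> \<bar>c\<bar> * C" for v using C[of v] by (simp add: abs_mult mult_left_mono)
  then have "\<exists>C. \<forall>v. \<bar>c * F v\<bar> \<le> C" by blast
  then show ?thesis
    using assms unfolding good_def by (auto simp: D_scale[abs_def])
qed

text \<open>Dominated convergence on both sides. On the signed side the majorant is
  \<open>2 ^ N \<eta> * C\<close>, integrable because the exponential factor in the assumption on
  \<theta> is at least 1.\<close>

lemma good_limit:
  assumes F: "\<And>n. good (F n)" and C: "\<And>n v. \<bar>F n v\<bar> \<le> C" and lim: "\<And>v. (\<lambda>n. F n v) \<longlonglongrightarrow> G v"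
  shows "good G"
proof -
  have G: "\<bar>G v\<bar> \<le> C" for v
    by (rule LIMSEQ_le_const2[OF tendsto_rabs[OF lim]]) (use C in auto)
  have Dlim: "(\<lambda>n. D (F n) \<eta>) \<longlonglongrightarrow> D G \<eta>" for \<eta>
    unfolding D_def by (intro tendsto_intros lim)
  have m: "(\<lambda>w. F n (\<lambda>j. X j w)) \<in> borel_measurable \<nu>" "D (F n) \<in> borel_measurable M" for n
    using F[of n] by (auto simp: good_def)
  have m1: "(\<lambda>w. G (\<lambda>j. X j w)) \<in> borel_measurable \<nu>"
    by (rule borel_measurable_LIMSEQ_real[OF _ m(1)]) (rule lim)
  have m2: "D G \<in> borel_measurable M" by (rule borel_measurable_LIMSEQ_real[OF _ m(2)]) (rule Dlim)
  have "(\<lambda>n. LINT w|\<nu>. F n (\<lambda>j. X j w)) \<longlonglongrightarrow> (LINT w|\<nu>. G (\<lambda>j. X j w))"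
    by (rule integral_dominated_convergence[where w = "\<lambda>_. C"])
      (use m m1 C lim fin in \<open>auto simp: finite_measure.integrable_const\<close>)
  moreover have "(\<lambda>n. LINT \<eta>|M. D (F n) \<eta>) \<longlonglongrightarrow> (LINT \<eta>|M. D G \<eta>)"
    by (rule integral_dominated_convergence[where w = "\<lambda>\<eta>. 2 ^ N \<eta> * C"])
      (use m(2) m2 Dlim exp_integrable[of C] D_bound[OF _ C] in \<open>simp_all add: AE_I2\<close>)
  moreover have "(LINT w|\<nu>. F n (\<lambda>j. X j w)) = (LINT \<eta>|M. D (F n) \<eta>)" for n using F[of n] by (simp add: good_def)
  ultimately have "(LINT w|\<nu>. G (\<lambda>j. X j w)) = (LINT \<eta>|M. D G \<eta>)" by (simp add: LIMSEQ_unique)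
  then show ?thesis using G m1 m2 unfolding good_def by blast
qed

lemma lin_form_combine:
  "lin_form m t v + c * lin_form m' t' v =
    lin_form (max m m') (\<lambda>j. (if j < m then t j else 0) + c * (if j < m' then t' j else 0)) v"
proof -
  have "lin_form m t v = (\<Sum>j<max m m'. (if j < m then t j else 0) * v j)" for m m' t
    unfolding lin_form_def by (rule sum.mono_neutral_cong_left) auto
  from this[of m t m'] this[of m' t' m] show ?thesis
    unfolding lin_form_def by (simp add: sum.distrib sum_distrib_left distrib_right max.commute mult.assoc)
qed

lemma trig_const: "trig (\<lambda>_. c)"
  using trig.scale[OF trig.cos[of 0 undefined], of c] by (simp add: lin_form_def)

lemma trig_diff: "trig f \<Longrightarrow> trig g \<Longrightarrow> trig (\<lambda>v. f v - g v)"
  using trig.add[OF _ trig.scale[of g "-1"], of f] by simp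

text \<open>The product-to-sum formulas, after two linear forms of different length have been
  brought to a common one by \<open>lin_form_combine\<close>. Being an algebra is what opens the way
  to polynomial approximation.\<close>

lemma trig_mult:
  assumes "trig f" "trig g"
  shows "trig (\<lambda>v. f v * g v)"
proof -
  have p: "lin_form m t v + lin_form m' t' v = lin_form (max m m') (\<lambda>j. (if j < m then t j else 0) + 1 * (if j < m' then t' j else 0)) v"
    and n: "lin_form m t v - lin_form m' t' v = lin_form (max m m') (\<lambda>j. (if j < m then t j else 0) + (-1) * (if j < m' then t' j else 0)) v"
    for m m' t t' v
    using lin_form_combine[of m t v 1 m' t'] lin_form_combine[of m t v "-1" m' t'] by simp_all
  have base: "trig (\<lambda>v. cos (lin_form m t v) * cos (lin_form m' t' v))" "trig (\<lambda>v. cos (lin_form m t v) * sin (lin_form m' t' v))"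
    "trig (\<lambda>v. sin (lin_form m t v) * cos (lin_form m' t' v))" "trig (\<lambda>v. sin (lin_form m t v) * sin (lin_form m' t' v))" for m t m' t'
    unfolding cos_times_cos cos_times_sin sin_times_cos sin_times_sin p n divide_real_def
    using trig.scale[of _ "inverse 2"] by (auto simp: mult.commute intro!: trig.intros trig_diff)
  have 1: "trig (\<lambda>v. f v * cos (lin_form m t v)) \<and> trig (\<lambda>v. f v * sin (lin_form m t v))" for m t
    using assms(1)
  proof induction
    case (add f g)
    then show ?case using trig.add by (simp add: distrib_right)
  next
    case (scale f c)
    then show ?case using trig.scale by (simp add: mult.assoc)
  qed (use base in auto)
  show ?thesis
    using assms(2)
  proof induction
    case (add g h)
    then show ?case using trig.add by (simp add: distrib_left)
  next
    case (scale g c)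
    then show ?case using trig.scale[of "\<lambda>v. f v * g v" c] by (simp add: mult.left_commute)
  qed (use 1 in auto)
qed

lemma trig_bounded: "trig f \<Longrightarrow> \<exists>C. \<forall>v. \<bar>f v\<bar> \<le> C"
proof (induction rule: trig.induct)
  case (add f g)
  then obtain C C' where C: "\<And>v. \<bar>f v\<bar> \<le> C" "\<And>v. \<bar>g v\<bar> \<le> C'" by blast
  have "\<bar>f v + g v\<bar> \<le> C + C'" for v using C(1)[of v] C(2)[of v] by linarith
  then show ?case by blast
next
  case (scale f c)
  then obtain C where C: "\<And>v. \<bar>f v\<bar> \<le> C" by blast
  have "\<bar>c * f v\<bar> \<le> \<bar>c\<bar> * C" for v using C[of v] by (simp add: abs_mult mult_left_mono)
  then show ?case by blast
qed (intro exI[of _ 1] allI, simp)+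

lemma trig_good: "trig f \<Longrightarrow> good f"
proof (induction rule: trig.induct)
  case (cos m t)
  have "(\<lambda>w. cos (lin_form m t (\<lambda>j. X j w))) \<in> borel_measurable \<nu>"
    by (rule measurable_compose[OF lX_measurable[unfolded lX_def[abs_def]]]) simp
  moreover have "D (\<lambda>v. cos (lin_form m t v)) \<in> borel_measurable M"
    unfolding D_def[abs_def] by (intro meas continuous_intros continuous_lin_form)
  moreover have "\<exists>C. \<forall>v. \<bar>cos (lin_form m t v)\<bar> \<le> C" by (intro exI[of _ 1] allI abs_cos_le_one)
  ultimately show ?case unfolding good_def using cos_sin_eq(1) by blast
next
  case (sin m t)
  have "(\<lambda>w. sin (lin_form m t (\<lambda>j. X j w))) \<in> borel_measurable \<nu>"
    by (rule measurable_compose[OF lX_measurable[unfolded lX_def[abs_def]]]) simp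
  moreover have "D (\<lambda>v. sin (lin_form m t v)) \<in> borel_measurable M"
    unfolding D_def[abs_def] by (intro meas continuous_intros continuous_lin_form)
  moreover have "\<exists>C. \<forall>v. \<bar>sin (lin_form m t v)\<bar> \<le> C" by (intro exI[of _ 1] allI abs_sin_le_one)
  ultimately show ?case unfolding good_def using cos_sin_eq(2) by blast
qed (rule good_add good_scale; assumption)+

lemma trig_polynomial:
  fixes p :: "real \<Rightarrow> real"
  assumes "real_polynomial_function p" "trig f"
  shows "trig (\<lambda>v. p (f v))"
  using assms(1)
proof induction
  case (linear p)
  then obtain c where "p = (\<lambda>u. u * c)" using real_bounded_linear by blast
  then show ?case using trig.scale[OF assms(2), of c] by (simp add: mult.commute)
qed (auto intro: trig_const trig.add trig_mult)

text \<open>Nothing makes \<open>good\<close> stable under products. Keeping a free trigonometric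
  multiplier in the definition is what allows a further factor to be added in the steps
  below.\<close>

definition good_factor :: "((nat \<Rightarrow> real) \<Rightarrow> real) \<Rightarrow> bool" where
  "good_factor F \<longleftrightarrow> (\<exists>C. \<forall>v. \<bar>F v\<bar> \<le> C) \<and> (\<forall>a. trig a \<longrightarrow> good (\<lambda>v. a v * F v))"

text \<open>On the bounded range of \<open>f\<close> the function \<open>h\<close> is a uniform
  limit of polynomials, and a polynomial in \<open>f\<close> times \<open>a\<close> is again a
  trigonometric multiplier. Boundedness of all factors supplies the majorant.\<close>

lemma good_factor_continuous:
  fixes h :: "real \<Rightarrow> real"
  assumes F: "good_factor F" and f: "trig f" and h: "continuous_on UNIV h" and a: "trig a"
  shows "good (\<lambda>v. a v * h (f v) * F v)"
proof -
  obtain C where C: "\<And>v. \<bar>f v\<bar> \<le> C" using trig_bounded[OF f] by blast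
  obtain A where A: "\<And>v. \<bar>a v\<bar> \<le> A" using trig_bounded[OF a] by blast
  obtain K where K: "\<And>v. \<bar>F v\<bar> \<le> K" using F unfolding good_factor_def by blast
  have h': "continuous_on {-C..C} h" by (rule continuous_on_subset[OF h]) simp
  have "compact (h ` {-C..C})" by (intro compact_continuous_image h') simp
  then have "bounded (h ` {-C..C})" by (rule compact_imp_bounded)
  then obtain H where "\<forall>u\<in>h ` {-C..C}. norm u \<le> H" unfolding bounded_iff by blast
  then have H: "\<bar>h u\<bar> \<le> H" if "u \<in> {-C..C}" for u using that by auto
  have "\<exists>p. real_polynomial_function p \<and> (\<forall>u\<in>{-C..C}. \<bar>h u - p u\<bar> < 1 / real (Suc n))" for n
    by (rule Stone_Weierstrass_real_polynomial_function[OF compact_Icc h', of "1 / real (Suc n)"]) auto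
  then obtain p where p: "\<And>n. real_polynomial_function (p n)"
    "\<And>n u. u \<in> {-C..C} \<Longrightarrow> \<bar>h u - p n u\<bar> < 1 / real (Suc n)" by metis
  have fC: "f v \<in> {-C..C}" for v using C[of v] by (simp add: abs_le_iff)
  show ?thesis
  proof (rule good_limit[where F = "\<lambda>n v. a v * p n (f v) * F v"])
    show "good (\<lambda>v. a v * p n (f v) * F v)" for n
      using F trig_mult[OF a trig_polynomial[OF p(1)[of n] f]] unfolding good_factor_def by blast
    show "\<bar>a v * p n (f v) * F v\<bar> \<le> A * (H + 1) * K" for n v
    proof -
      have "1 / real (Suc n) \<le> 1" by simp
      then have "\<bar>p n (f v)\<bar> \<le> H + 1" using p(2)[OF fC[of v], of n] H[OF fC[of v]] by linarith
      moreover have "A \<ge> 0" "H + 1 \<ge> 0" using A[of v] H[OF fC[of v]] by linarith+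
      ultimately show ?thesis unfolding abs_mult using A[of v] K[of v] by (intro mult_mono) auto
    qed
    fix v
    have "(\<lambda>n. h (f v) - p n (f v)) \<longlonglongrightarrow> 0"
      by (rule Lim_null_comparison[OF _ LIMSEQ_inverse_real_of_nat])
        (use p(2)[OF fC[of v]] in \<open>auto simp: inverse_eq_divide less_imp_le\<close>)
    then have "(\<lambda>n. p n (f v)) \<longlonglongrightarrow> h (f v)"
      using tendsto_diff[OF tendsto_const[of "h (f v)"]] by fastforce
    then show "(\<lambda>n. a v * p n (f v) * F v) \<longlonglongrightarrow> a v * h (f v) * F v" by (intro tendsto_intros)
  qed
qed

lemma good_factor_step:
  assumes F: "good_factor F" and f: "trig f"
  shows "good_factor (\<lambda>v. F v * indicator {v. f v > \<alpha>} v)"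
  unfolding good_factor_def
proof (intro conjI allI impI)
  obtain K where K: "\<And>v. \<bar>F v\<bar> \<le> K" using F unfolding good_factor_def by blast
  then show "\<exists>C. \<forall>v. \<bar>F v * indicator {v. f v > \<alpha>} v\<bar> \<le> C"
    by (intro exI[of _ K]) (auto simp: indicator_def intro: order_trans[OF abs_ge_zero])
  fix a assume a: "trig a"
  obtain A where A: "\<And>v. \<bar>a v\<bar> \<le> A" using trig_bounded[OF a] by blast
  \<comment> \<open>Ramps of slope \<open>n\<close> that vanish up to \<alpha> and increase to the
    indicator of the open half line beyond it.\<close>
  define h where "h n u = min 1 (max 0 (real n * (u - \<alpha>)))" for n u
  have "good (\<lambda>v. a v * (F v * indicator {v. f v > \<alpha>} v))"
  proof (rule good_limit[where F = "\<lambda>n v. a v * h n (f v) * F v"])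
    show "good (\<lambda>v. a v * h n (f v) * F v)" for n
      unfolding h_def by (intro good_factor_continuous F f a continuous_intros)
    show "\<bar>a v * h n (f v) * F v\<bar> \<le> A * 1 * K" for n v
      unfolding abs_mult using A[of v] K[of v] by (intro mult_mono) (auto simp: h_def)
    fix v
    have "(\<lambda>n. h n (f v)) \<longlonglongrightarrow> indicator {v. f v > \<alpha>} v"
    proof (cases "f v > \<alpha>")
      case True
      have "\<forall>\<^sub>F n in sequentially. real n \<ge> 1 / (f v - \<alpha>)"
        using filterlim_real_sequentially by (simp add: filterlim_at_top)
      then have "\<forall>\<^sub>F n in sequentially. h n (f v) = 1"
        by eventually_elim (use True in \<open>simp add: h_def field_simps\<close>)
      then show ?thesis using True by (simp add: tendsto_eventually)
    next
      case False
      then have "h n (f v) = 0" for n by (simp add: h_def mult_nonneg_nonpos)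
      then show ?thesis using False by simp
    qed
    then have "(\<lambda>n. a v * h n (f v) * F v) \<longlonglongrightarrow> a v * indicator {v. f v > \<alpha>} v * F v" by (intro tendsto_intros)
    then show "(\<lambda>n. a v * h n (f v) * F v) \<longlonglongrightarrow> a v * (F v * indicator {v. f v > \<alpha>} v)" by (simp add: ac_simps)
  qed
  then show "good (\<lambda>v. a v * (F v * indicator {v. f v > \<alpha>} v))" .
qed

text \<open>Finite intersections of strict superlevel sets, presented by lists so that intersection
  becomes concatenation and the empty list gives the whole space.\<close>

definition trig_sets :: "(nat \<Rightarrow> real) set set" where
  "trig_sets = {{v. \<forall>(f, \<alpha>)\<in>set fs. f v > \<alpha>} | fs. \<forall>(f, \<alpha>)\<in>set fs. trig f}"

lemma trig_sets_good: "S \<in> trig_sets \<Longrightarrow> good (indicator S)"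
proof -
  have *: "good_factor (indicator {v. \<forall>(f, \<alpha>)\<in>set fs. f v > \<alpha>})"
    if "\<forall>(f, \<alpha>)\<in>set fs. trig f" for fs :: "(((nat \<Rightarrow> real) \<Rightarrow> real) \<times> real) list"
    using that
  proof (induction fs)
    case Nil
    have "\<exists>C. \<forall>v. \<bar>indicator UNIV v :: real\<bar> \<le> C" by (intro exI[of _ 1]) auto
    then show ?case by (simp add: good_factor_def trig_good)
  next
    case (Cons q fs)
    obtain f \<alpha> where q: "q = (f, \<alpha>)" by (cases q)
    have "(indicator {v. \<forall>(f, \<alpha>)\<in>set (q # fs). f v > \<alpha>} :: _ \<Rightarrow> real) =
        (\<lambda>v. indicator {v. \<forall>(f, \<alpha>)\<in>set fs. f v > \<alpha>} v * indicator {v. f v > \<alpha>} v)"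
      by (auto simp: q indicator_def fun_eq_iff)
    then show ?case using good_factor_step[of _ f \<alpha>] Cons q by simp
  qed
  assume "S \<in> trig_sets"
  then obtain fs where "S = {v. \<forall>(f, \<alpha>)\<in>set fs. f v > \<alpha>}" "\<forall>(f, \<alpha>)\<in>set fs. trig f"
    unfolding trig_sets_def by blast
  then have "good_factor (indicator S)" using * by blast
  then have "good (\<lambda>v. 1 * indicator S v)" using trig_const[of 1] unfolding good_factor_def by blast
  then show ?thesis by simp
qed

lemma Int_stable_trig_sets: "Int_stable trig_sets"
proof (rule Int_stableI)
  fix S T assume "S \<in> trig_sets" "T \<in> trig_sets"
  then obtain fs gs where "S = {v. \<forall>(f, \<alpha>)\<in>set fs. f v > \<alpha>}" "\<forall>(f, \<alpha>)\<in>set fs. trig f"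
    "T = {v. \<forall>(f, \<alpha>)\<in>set gs. f v > \<alpha>}" "\<forall>(f, \<alpha>)\<in>set gs. trig f"
    unfolding trig_sets_def by blast
  then show "S \<inter> T \<in> trig_sets"
    unfolding trig_sets_def by (intro CollectI exI[of _ "fs @ gs"]) auto
qed

lemma sigma_trig_sets_good:
  assumes "S \<in> sigma_sets UNIV trig_sets"
  shows "good (indicator S)"
proof -
  have sub: "trig_sets \<subseteq> Pow UNIV" by simp
  from Int_stable_trig_sets sub assms show ?thesis
proof (induction rule: sigma_sets_induct_disjoint)
  case empty
  show ?case using trig_good[OF trig_const[of 0]] by (simp add: indicator_def[abs_def])
next
  case (compl S)
  have "(indicator (UNIV - S) :: _ \<Rightarrow> real) = (\<lambda>v. 1 + (-1) * indicator S v)"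
    by (auto simp: indicator_def fun_eq_iff)
  then show ?case using good_add[OF trig_good[OF trig_const[of 1]] good_scale[OF compl(2), of "-1"]] by simp
next
  case (union S)
  have fin_good: "good (\<lambda>v. \<Sum>i<n. indicator (S i) v)" for n
    by (induction n) (use trig_good[OF trig_const[of 0]] good_add union(3) in auto)
  have eq: "(\<Sum>i<n. indicator (S i) v) = (indicator (\<Union>i<n. S i) v :: real)" for n v
    by (rule indicator_UN_disjoint[symmetric]) (use union(1) in \<open>auto intro: disjoint_family_on_mono\<close>)
  show ?case
  proof (rule good_limit[OF fin_good])
    show "\<bar>\<Sum>i<n. indicator (S i) v\<bar> \<le> (1::real)" for n v unfolding eq by (simp add: indicator_def)
    show "(\<lambda>n. \<Sum>i<n. indicator (S i) v) \<longlonglongrightarrow> (indicator (\<Union>(range S)) v :: real)" for v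
      unfolding eq by (rule LIMSEQ_indicator_UN)
  qed
qed (simp_all add: trig_sets_good)
qed

text \<open>A coordinate is the pointwise limit of \<open>n * sin (v j / n)\<close>, hence
  measurable for the sigma-algebra of the trigonometric superlevel sets, which therefore contains
  all Borel sets of sequences.\<close>

lemma borel_good:
  assumes "S \<in> sets borel"
  shows "good (indicator S)"
proof -
  define T where "T = sigma UNIV trig_sets"
  have T: "sets T = sigma_sets UNIV trig_sets" "space T = UNIV" by (simp_all add: T_def)
  have tm: "f \<in> borel_measurable T" if "trig f" for f
    unfolding borel_measurable_iff_greater
  proof
    fix \<alpha>
    have "{v. f v > \<alpha>} \<in> trig_sets"
      unfolding trig_sets_def using that by (intro CollectI exI[of _ "[(f, \<alpha>)]"]) auto
    then show "{w \<in> space T. \<alpha> < f w} \<in> sets T" by (simp add: T sigma_sets.Basic)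
  qed
  have s: "(\<lambda>v. sin (lin_form m t v)) \<in> borel_measurable T" for m t by (rule tm[OF trig.sin])
  have "(\<lambda>v. v j) \<in> borel_measurable T" for j
  proof (rule borel_measurable_LIMSEQ_real)
    show "(\<lambda>v. real (Suc n) * sin (lin_form (Suc j) (\<lambda>i. if i = j then 1 / real (Suc n) else 0) v)) \<in> borel_measurable T" for n
      by (intro borel_measurable_times borel_measurable_const s)
    fix v :: "nat \<Rightarrow> real"
    have lf: "lin_form (Suc j) (\<lambda>i. if i = j then 1 / real (Suc n) else 0) v = v j / real (Suc n)" for n
      by (simp add: lin_form_def)
    have "((\<lambda>u. sin (u * v j) / u) \<longlongrightarrow> v j) (at 0)"
    proof -
      have "((\<lambda>u. sin (u * v j)) has_real_derivative v j) (at 0)" by (auto intro!: derivative_eq_intros)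
      from DERIV_D[OF this] show ?thesis by simp
    qed
    moreover have "filterlim (\<lambda>n. 1 / real (Suc n)) (at 0) sequentially"
      using LIMSEQ_inverse_real_of_nat unfolding filterlim_at by (simp add: inverse_eq_divide)
    ultimately have "(\<lambda>n. sin (1 / real (Suc n) * v j) / (1 / real (Suc n))) \<longlonglongrightarrow> v j"
      by (rule filterlim_compose)
    then show "(\<lambda>n. real (Suc n) * sin (lin_form (Suc j) (\<lambda>i. if i = j then 1 / real (Suc n) else 0) v)) \<longlonglongrightarrow> v j"
      unfolding lf by (simp add: mult.commute)
  qed
  then have "(\<lambda>v. v) \<in> measurable T (borel :: (nat \<Rightarrow> real) measure)"
    by (rule measurable_coordinatewise_then_product)
  then have "(\<lambda>v. v) -` S \<inter> space T \<in> sets T" using assms by (rule measurable_sets)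
  then show ?thesis using sigma_trig_sets_good T by simp
qed

text \<open>No atom lies in \<open>S\<close>, so the signed average of its indicator vanishes term
  by term. The corresponding integral over \<nu> is that of a nonnegative function, so the event is
  null.\<close>

theorem AE_not_in:
  assumes "S \<in> sets borel" "\<And>\<eta> z. \<eta> \<in> space M \<Longrightarrow> z \<in> I \<eta> \<Longrightarrow> Y z \<notin> S"
  shows "AE w in \<nu>. (\<lambda>j. X j w) \<notin> S"
proof -
  have g: "good (indicator S)" by (rule borel_good[OF assms(1)])
  have "(LINT \<eta>|M. D (indicator S) \<eta>) = (LINT \<eta>|M. 0)"
    by (rule Bochner_Integration.integral_cong) (use assms(2) in \<open>auto simp: D_def\<close>)
  then have "(LINT w|\<nu>. indicator S (\<lambda>j. X j w)) = (0::real)" using g by (simp add: good_def)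
  then have "AE w in \<nu>. indicator S (\<lambda>j. X j w) = (0::real)"
    by (subst (asm) integral_nonneg_eq_0_iff_AE) (use good_integrable[OF g] in auto)
  then show ?thesis by eventually_elim (simp add: indicator_def split: if_splits)
qed

end

section \<open>Sequential continuity of distributions\<close>

lemma iter_pderiv_zero: "iter_pderiv move ds (\<lambda>_. 0) = (\<lambda>_. 0)"
  by (induction ds) (auto simp: pderiv_along_def)

lemma iter_pderiv_lin:
  fixes f g :: "'p \<Rightarrow> real"
  assumes fl: "flow T move Ds" and f: "smooth_along T move Ds f" and g: "smooth_along T move Ds g"
    and ds: "ds \<in> lists Ds" and y: "y \<in> topspace T"
  shows "iter_pderiv move ds (\<lambda>y. f y - g y) y = iter_pderiv move ds f y - iter_pderiv move ds g y"
  using ds y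
proof (induction ds arbitrary: y)
  case (Cons d ds)
  have ds: "ds \<in> lists Ds" and d: "d \<in> Ds" using Cons.hyps by auto
  have "has_partial move d (iter_pderiv move ds f) y (pderiv_along move d (iter_pderiv move ds f) y)"
    "has_partial move d (iter_pderiv move ds g) y (pderiv_along move d (iter_pderiv move ds g) y)"
    using smooth_along_has_partial[OF smooth_along_iter[OF f ds] d Cons.prems]
      smooth_along_has_partial[OF smooth_along_iter[OF g ds] d Cons.prems] .
  then have "has_partial move d (\<lambda>y. iter_pderiv move ds f y - iter_pderiv move ds g y) y
      (pderiv_along move d (iter_pderiv move ds f) y - pderiv_along move d (iter_pderiv move ds g) y)"
    unfolding has_partial_def by (rule has_vector_derivative_diff)
  then have "pderiv_along move d (\<lambda>y. iter_pderiv move ds f y - iter_pderiv move ds g y) y =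
      pderiv_along move d (iter_pderiv move ds f) y - pderiv_along move d (iter_pderiv move ds g) y"
    by (rule has_partial_imp_pderiv)
  moreover have "pderiv_along move d (iter_pderiv move ds (\<lambda>y. f y - g y)) y =
      pderiv_along move d (\<lambda>y. iter_pderiv move ds f y - iter_pderiv move ds g y) y"
    by (rule pderiv_along_cong[OF fl d Cons.prems]) (rule Cons.IH)
  ultimately show ?case by simp
qed simp

context smooth_manifold
begin

lemma test_fun_lin:
  fixes f g :: "(nat \<Rightarrow> 'a) \<Rightarrow> 'v::real_normed_algebra"
  assumes f: "f \<in> test_fun A n" and g: "g \<in> test_fun A n"
  shows "(\<lambda>x. f x + k * g x) \<in> test_fun A n"
proof -
  obtain K where K: "compact K" "\<And>x. f x \<noteq> 0 \<Longrightarrow> x \<in> PiE {..<n} (\<lambda>_. K)" using test_fun_support[OF f] by blast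
  obtain L where L: "compact L" "\<And>x. g x \<noteq> 0 \<Longrightarrow> x \<in> PiE {..<n} (\<lambda>_. L)" using test_fun_support[OF g] by blast
  show ?thesis
  proof (rule test_funI[OF _ _ _ compact_Un[OF K(1) L(1)]])
    show "smooth_pow A n (\<lambda>x. f x + k * g x)"
      using f g by (intro smooth_pow_add smooth_pow_mult smooth_pow_const) (auto simp: test_fun_def)
    show "f x + k * g x = 0" if "x \<notin> PiE {..<n} (\<lambda>_. UNIV)" for x
      using that f g by (auto simp: test_fun_def)
    show "f (x \<circ> \<pi>) + k * g (x \<circ> \<pi>) = f x + k * g x" if "x \<in> PiE {..<n} (\<lambda>_. UNIV)" "\<pi> permutes {..<n}" for x \<pi>
      using that f g by (simp add: test_fun_def)
    fix x assume "f x + k * g x \<noteq> 0"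
    then have "f x \<noteq> 0 \<or> g x \<noteq> 0" by auto
    then show "x \<in> PiE {..<n} (\<lambda>_. K \<union> L)" using K(2)[of x] L(2)[of x] by (auto simp: PiE_iff)
  qed
qed

lemma topspace_test_topology: "topspace (test_topology A n) = test_fun A n"
proof
  show "topspace (test_topology A n) \<subseteq> test_fun A n"
    unfolding test_topology_def topology_generated_by_topspace by auto
  have q: "test_seminorm A n (\<lambda>_. 0)"
    unfolding test_seminorm_def seminorm_on_def by (auto intro!: exI[of _ "{}"])
  show "test_fun A n \<subseteq> topspace (test_topology A n)"
  proof
    fix f :: "(nat \<Rightarrow> 'a) \<Rightarrow> real" assume f: "f \<in> test_fun A n"
    have "f \<in> {g \<in> test_fun A n. (\<lambda>_. 0) (\<lambda>x. g x - f x) < (1::real)}" using f by simp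
    moreover have "{g \<in> test_fun A n. (\<lambda>_. 0) (\<lambda>x. g x - f x) < (1::real)} \<in>
        {{g \<in> test_fun A n. q (\<lambda>x. g x - f x) < r} | q f r. test_seminorm A n q \<and> f \<in> test_fun A n \<and> r > 0}"
      by (intro CollectI exI[of _ "\<lambda>_. 0"] exI[of _ f] exI[of _ 1]) (use q f in simp)
    ultimately show "f \<in> topspace (test_topology A n)"
      unfolding test_topology_def topology_generated_by_topspace by (rule UnionI[rotated])
  qed
qed

lemma topspace_DD_topology: "topspace (DD_topology A) = DD A"
  unfolding DD_topology_def topspace_pullback_topology topspace_test_topology by (auto simp: DD_def)

section \<open>Convergence of test functions\<close>

lemma DD_diff: "\<phi> \<in> DD A \<Longrightarrow> \<psi> \<in> DD A \<Longrightarrow> (\<lambda>x. \<phi> x - \<psi> x) \<in> DD A"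
  using DD_add[OF _ DD_scale[of \<psi> "-1"], of \<phi>] by simp

lemma tensor_pow_diff: "tensor_pow 1 (\<lambda>x. \<phi> x - \<psi> x) = (\<lambda>x. tensor_pow 1 \<phi> x - tensor_pow 1 \<psi> x)"
  by (rule ext) (simp add: tensor_pow_def)

text \<open>Convergence in the sense of Schwartz: one compact set carries all differences, and all
  derivatives converge uniformly on compact parts of every chart.\<close>

definition DD_conv :: "(nat \<Rightarrow> 'a \<Rightarrow> real) \<Rightarrow> ('a \<Rightarrow> real) \<Rightarrow> bool" where
  "DD_conv \<phi>s \<phi> \<longleftrightarrow> (\<exists>K. compact K \<and> (\<forall>n x. x \<notin> K \<longrightarrow> \<phi>s n x = \<phi> x)) \<and>
    (\<forall>c\<in>A. \<forall>ds L e. compact L \<and> L \<subseteq> chart_image c \<and> e > 0 \<longrightarrow>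
      (\<forall>\<^sub>F n in sequentially. \<forall>y\<in>L.
        \<bar>iter_pderiv shift_vec ds (\<lambda>y. \<phi>s n (chart_inv c y) - \<phi> (chart_inv c y)) y\<bar> \<le> e))"

lemma iter_pderiv_in_charts:
  assumes c: "c \<in> {..<1} \<rightarrow>\<^sub>E A" and \<phi>: "\<phi> \<in> DD A" and ds: "ds \<in> lists ({..<1} \<times> UNIV)"
    and y: "y \<in> topspace (box_top 1 c)"
  shows "iter_pderiv shift_tuple ds (in_charts 1 c (tensor_pow 1 \<phi>)) y =
    iter_pderiv shift_vec (map snd ds) (\<lambda>z. \<phi> (chart_inv (c 0) z)) (y 0)"
proof -
  have c0: "c 0 \<in> A" using c by auto
  have "in_charts 1 c (tensor_pow 1 \<phi>) z = \<phi> (chart_inv (c 0) (z 0))" for z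
    by (simp add: in_charts_def tensor_pow_def)
  then have "in_charts 1 c (tensor_pow 1 \<phi>) = (\<lambda>z. \<phi> (chart_inv (c 0) (z 0)))" by blast
  moreover have "smooth_on_open (chart_image (c 0)) (\<lambda>z. \<phi> (chart_inv (c 0) z))"
    using DD_msmooth[OF \<phi>] c0 by (auto simp: msmooth_def chart_image_def)
  moreover have "ds \<in> lists ({0} \<times> UNIV)" using ds by (auto simp: lessThan_Suc)
  ultimately show ?thesis
    using iter_pderiv_tuple_nth[OF flow_box[OF c], of 0 "\<lambda>z. \<phi> (chart_inv (c 0) z)" ds y] y by simp
qed

lemma chart_seminorm_tendsto:
  assumes k: "k \<in> chart_indices A 1" and \<phi>: "\<And>n. \<phi>s n \<in> DD A" "\<phi> \<in> DD A" "DD_conv \<phi>s \<phi>" and e: "e > 0"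
  shows "\<forall>\<^sub>F n in sequentially. chart_seminorm 1 k (tensor_pow 1 (\<lambda>x. \<phi>s n x - \<phi> x)) \<le> e"
proof -
  obtain c ds L where kk: "k = (c, ds, L)" by (cases k)
  then have c: "c \<in> {..<1} \<rightarrow>\<^sub>E A" and ds: "ds \<in> lists ({..<1} \<times> UNIV)" and L: "compactin (box_top 1 c) L"
    using k by (auto simp: chart_indices_def)
  have Lsub: "L \<subseteq> topspace (box_top 1 c)" by (rule compactin_subset_topspace[OF L])
  have "continuous_map (box_top 1 c) (top_of_set (chart_image (c 0))) (\<lambda>y. y 0)"
    unfolding box_top_def by (rule continuous_map_product_projection) simp
  from image_compactin[OF L this] have L0: "compact ((\<lambda>y. y 0) ` L)" "(\<lambda>y. y 0) ` L \<subseteq> chart_image (c 0)"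
    by (auto simp: compactin_subtopology)
  have c0: "c 0 \<in> A" using c by auto
  have "\<forall>\<^sub>F n in sequentially. \<forall>y\<in>(\<lambda>y. y 0) ` L. \<bar>iter_pderiv shift_vec (map snd ds)
        (\<lambda>y. \<phi>s n (chart_inv (c 0) y) - \<phi> (chart_inv (c 0) y)) y\<bar> \<le> e"
    using \<phi>(3) c0 L0 e unfolding DD_conv_def by blast
  then show ?thesis
  proof eventually_elim
    case (elim n)
    have "\<bar>iter_pderiv shift_tuple ds (in_charts 1 c (tensor_pow 1 (\<lambda>x. \<phi>s n x - \<phi> x))) y\<bar> \<le> e" if y: "y \<in> L" for y
      unfolding iter_pderiv_in_charts[OF c DD_diff[OF \<phi>(1) \<phi>(2)] ds subsetD[OF Lsub y]]
      using elim y by blast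
    then show ?case
      unfolding kk chart_seminorm_def prod.case using e by (intro cSup_least) auto
  qed
qed

text \<open>On differences carried by a fixed compact set, every seminorm of the topology is
  dominated by finitely many instances of \<open>chart_seminorm\<close>, which tend to 0. Open sets
  are handled by induction over the generated topology, the basic ones being balls around an
  arbitrary centre \<open>f\<close>.\<close>

lemma dual_tendsto:
  assumes \<omega>: "\<omega> \<in> DD_dual A" and \<phi>: "\<And>n. \<phi>s n \<in> DD A" "\<phi> \<in> DD A" "DD_conv \<phi>s \<phi>"
  shows "(\<lambda>n. \<omega> (\<phi>s n)) \<longlonglongrightarrow> \<omega> \<phi>"
proof (rule topological_tendstoI)
  fix O' :: "real set" assume O': "open O'" "\<omega> \<phi> \<in> O'"
  have "continuous_map (DD_topology A) euclidean \<omega>" using \<omega> by (simp add: DD_dual_def dual_space_def)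
  then have "openin (DD_topology A) {\<psi> \<in> topspace (DD_topology A). \<omega> \<psi> \<in> O'}"
    by (rule openin_continuous_map_preimage) (use O' in simp)
  then obtain V where V: "openin (test_topology A 1) V" "{\<psi> \<in> DD A. \<omega> \<psi> \<in> O'} = tensor_pow 1 -` V \<inter> DD A"
    unfolding topspace_DD_topology unfolding DD_topology_def openin_pullback_topology by blast
  have "generate_topology_on {{g \<in> test_fun A 1. q (\<lambda>x. g x - f x) < r} | q f r.
        test_seminorm A 1 q \<and> f \<in> test_fun A 1 \<and> r > 0} V"
    using V(1) unfolding test_topology_def openin_topology_generated_by_iff .
  then have "tensor_pow 1 \<phi> \<in> V \<longrightarrow> (\<forall>\<^sub>F n in sequentially. tensor_pow 1 (\<phi>s n) \<in> V)"
  proof induction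
    case (Int U V)
    then show ?case by (auto intro: eventually_conj)
  next
    case (UN K)
    show ?case
    proof
      assume "tensor_pow 1 \<phi> \<in> \<Union>K"
      then obtain k where k: "k \<in> K" "tensor_pow 1 \<phi> \<in> k" by blast
      then have "\<forall>\<^sub>F n in sequentially. tensor_pow 1 (\<phi>s n) \<in> k" using UN by blast
      then show "\<forall>\<^sub>F n in sequentially. tensor_pow 1 (\<phi>s n) \<in> \<Union>K"
        by eventually_elim (use k in blast)
    qed
  next
    case (Basis U)
    then obtain q f r where q: "U = {g \<in> test_fun A 1. q (\<lambda>x. g x - f x) < r}" "test_seminorm A 1 q" "f \<in> test_fun A 1"
      by blast
    show ?case
    proof
      assume in_U: "tensor_pow 1 \<phi> \<in> U"
      define s where "s = r - q (\<lambda>x. tensor_pow 1 \<phi> x - f x)"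
      have s: "s > 0" using in_U unfolding q(1) s_def by simp
      obtain K where K: "compact K" "\<forall>n x. x \<notin> K \<longrightarrow> \<phi>s n x = \<phi> x" using \<phi>(3) unfolding DD_conv_def by blast
      have "compactin (Xpow 1) (PiE {..<1} (\<lambda>_. K))" by (rule compactin_Xpow[OF K(1)])
      then obtain F C where F: "finite F" "F \<subseteq> chart_indices A 1"
        "\<And>f. f \<in> test_fun A 1 \<Longrightarrow> \<forall>x. x \<notin> PiE {..<1} (\<lambda>_. K) \<longrightarrow> f x = 0 \<Longrightarrow> q f \<le> C * (\<Sum>k\<in>F. chart_seminorm 1 k f)"
        using q(2) unfolding test_seminorm_def by metis
      \<comment> \<open>The added ones keep \<open>D\<close> positive even if \<open>C\<close> is 0
        or \<open>F\<close> is empty; the modulus is there because \<open>C\<close> may be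
        negative.\<close>
      define D where "D = (\<bar>C\<bar> + 1) * (real (card F) + 1)"
      have D: "D > 0" unfolding D_def by (intro mult_pos_pos add_nonneg_pos) auto
      define e where "e = s / (2 * D)"
      have e: "e > 0" using s D by (simp add: e_def)
      have "\<forall>\<^sub>F n in sequentially. \<forall>k\<in>F. chart_seminorm 1 k (tensor_pow 1 (\<lambda>x. \<phi>s n x - \<phi> x)) \<le> e"
        by (intro eventually_ball_finite F(1) ballI chart_seminorm_tendsto \<phi> e) (use F(2) in blast)
      then show "\<forall>\<^sub>F n in sequentially. tensor_pow 1 (\<phi>s n) \<in> U"
      proof eventually_elim
        case (elim n)
        let ?d = "tensor_pow 1 (\<lambda>x. \<phi>s n x - \<phi> x)"
        have d: "?d \<in> test_fun A 1" using DD_diff[OF \<phi>(1) \<phi>(2)] by (simp add: DD_def)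
        have "?d x = 0" if "x \<notin> PiE {..<1} (\<lambda>_. K)" for x
        proof (cases "x \<in> topspace (Xpow 1)")
          case True
          then have "x 0 \<notin> K" using that by (auto simp: PiE_iff)
          then show ?thesis using K(2) True by (simp add: tensor_pow_def)
        qed (simp add: tensor_pow_def)
        then have "q ?d \<le> C * (\<Sum>k\<in>F. chart_seminorm 1 k ?d)" by (intro F(3) d) blast
        also have "\<dots> \<le> \<bar>C\<bar> * (\<Sum>k\<in>F. chart_seminorm 1 k ?d)"
        proof (rule mult_right_mono)
          \<comment> \<open>A real \<open>Sup\<close> is controlled only on bounded sets;
            boundedness, from compactness of \<open>L\<close>, is what makes
            \<open>chart_seminorm\<close> nonnegative here.\<close>
          have bdd: "bdd_above (insert 0 ((\<lambda>y. \<bar>iter_pderiv shift_tuple ds (in_charts 1 c ?d) y\<bar>) ` L)) \<and>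
              0 \<le> chart_seminorm 1 (c, ds, L) ?d" if "(c, ds, L) \<in> F" for c ds L
          proof -
            have idx: "(c, ds, L) \<in> chart_indices A 1" using that F(2) by blast
            then have L: "compactin (box_top 1 c) L" by (simp add: chart_indices_def)
            have "smooth_along (box_top 1 c) shift_tuple ({..<1} \<times> UNIV) (in_charts 1 c ?d)"
              using d idx by (auto simp: test_fun_def smooth_pow_def chart_indices_def)
            then have "continuous_map (box_top 1 c) euclidean (iter_pderiv shift_tuple ds (in_charts 1 c ?d))"
              by (rule smooth_along_continuous[OF smooth_along_iter]) (use idx in \<open>auto simp: chart_indices_def\<close>)
            from image_compactin[OF L this] have "bounded (iter_pderiv shift_tuple ds (in_charts 1 c ?d) ` L)"
              by (simp add: compact_imp_bounded)
            then obtain B where "\<forall>u\<in>iter_pderiv shift_tuple ds (in_charts 1 c ?d) ` L. norm u \<le> B"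
              unfolding bounded_iff by blast
            then have "bdd_above ((\<lambda>y. \<bar>iter_pderiv shift_tuple ds (in_charts 1 c ?d) y\<bar>) ` L)"
              by (intro bdd_aboveI2[of _ _ B]) auto
            then have b: "bdd_above (insert 0 ((\<lambda>y. \<bar>iter_pderiv shift_tuple ds (in_charts 1 c ?d) y\<bar>) ` L))"
              unfolding bdd_above_insert .
            then have "0 \<le> chart_seminorm 1 (c, ds, L) ?d"
              unfolding chart_seminorm_def prod.case by (intro cSup_upper) auto
            with b show ?thesis by blast
          qed
          show "0 \<le> (\<Sum>k\<in>F. chart_seminorm 1 k ?d)"
          proof (rule sum_nonneg)
            fix k assume "k \<in> F"
            then show "0 \<le> chart_seminorm 1 k ?d" using bdd by (cases k) blast
          qed
        qed simp
        also have "\<dots> \<le> \<bar>C\<bar> * (\<Sum>k\<in>F. e)" by (intro mult_left_mono sum_mono) (use elim in auto)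
        also have "\<dots> = \<bar>C\<bar> * (real (card F) * e)" by simp
        also have "\<dots> \<le> (\<bar>C\<bar> + 1) * ((real (card F) + 1) * e)" using e by (intro mult_mono) auto
        also have "\<dots> = D * e" by (simp only: D_def mult.assoc)
        also have "\<dots> = s / 2" using D by (simp add: e_def)
        also have "\<dots> < s" using s by simp
        finally have 1: "q ?d < s" .
        have f2: "(\<lambda>x. tensor_pow 1 \<phi> x - f x) \<in> test_fun A 1"
          using test_fun_lin[of "tensor_pow 1 \<phi>" 1 f "-1"] \<phi>(2) q(3) by (simp add: DD_def)
        have "q (\<lambda>x. ?d x + (tensor_pow 1 \<phi> x - f x)) \<le> q ?d + q (\<lambda>x. tensor_pow 1 \<phi> x - f x)"
          by (rule q(2)[unfolded test_seminorm_def seminorm_on_def, THEN conjunct1, THEN conjunct2, THEN conjunct1, rule_format, OF d f2])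
        moreover have "(\<lambda>x. ?d x + (tensor_pow 1 \<phi> x - f x)) = (\<lambda>x. tensor_pow 1 (\<phi>s n) x - f x)"
          unfolding tensor_pow_diff by (rule ext) simp
        ultimately have "q (\<lambda>x. tensor_pow 1 (\<phi>s n) x - f x) < r" using 1 unfolding s_def by simp
        then show ?case unfolding q(1) using \<phi>(1)[of n] by (simp add: DD_def)
      qed
    qed
  qed simp
  moreover have "tensor_pow 1 \<phi> \<in> V" using V(2) \<phi>(2) O'(2) by blast
  ultimately have "\<forall>\<^sub>F n in sequentially. tensor_pow 1 (\<phi>s n) \<in> V" by blast
  then show "\<forall>\<^sub>F n in sequentially. \<omega> (\<phi>s n) \<in> O'"
    by eventually_elim (use V(2) \<phi>(1) in blast)
qed

end

section \<open>Separability of the local test function spaces\<close>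

text \<open>The approximants are step functions: a point is assigned the first nearby point of a
  finite net of mesh \<open>1 / (k + 1)\<close>, and with it a rational value. There are countably
  many of them; they need not be continuous.\<close>

lemma continuous_functions_separable:
  fixes K :: "'b::metric_space set"
  assumes K: "compact K"
  obtains Q :: "('b \<Rightarrow> real) set" where "countable Q"
    "\<And>f e. continuous_on K f \<Longrightarrow> e > 0 \<Longrightarrow> \<exists>q\<in>Q. \<forall>x\<in>K. \<bar>f x - q x\<bar> < e"
proof -
  have "\<exists>ps. set ps \<subseteq> K \<and> K \<subseteq> (\<Union>p\<in>set ps. ball p (1 / real (Suc k)))" for k
  proof -
    have sub: "K \<subseteq> (\<Union>p\<in>K. ball p (1 / real (Suc k)))" by force
    obtain P where "P \<subseteq> K" "finite P" "K \<subseteq> (\<Union>p\<in>P. ball p (1 / real (Suc k)))"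
      by (rule compactE_image[OF K _ sub]) (use that in auto)
    then show ?thesis using finite_list[of P] by metis
  qed
  then obtain ps where ps: "\<And>k. set (ps k) \<subseteq> K" "\<And>k. K \<subseteq> (\<Union>p\<in>set (ps k). ball p (1 / real (Suc k)))" by metis
  define ix where "ix k x = (LEAST i. i < length (ps k) \<and> dist (ps k ! i) x < 1 / real (Suc k))" for k x
  define st where "st = (\<lambda>(k, vs :: rat list) x. real_of_rat (vs ! ix k x))"
  show thesis
  proof
    show "countable (range st)" by simp
    fix f :: "'b \<Rightarrow> real" and e :: real assume f: "continuous_on K f" and e: "e > 0"
    have "uniformly_continuous_on K f" by (rule compact_uniformly_continuous[OF f K])
    then obtain d where d: "d > 0" "\<And>x y. x \<in> K \<Longrightarrow> y \<in> K \<Longrightarrow> dist y x < d \<Longrightarrow> dist (f y) (f x) < e / 2"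
      unfolding uniformly_continuous_on_def using half_gt_zero[OF e] by metis
    obtain k where k: "1 / real (Suc k) < d" using nat_approx_posE[OF d(1)] by (metis of_nat_Suc)
    have "\<exists>r. \<bar>f (ps k ! i) - real_of_rat r\<bar> < e / 2" for i
    proof -
      obtain q where q: "f (ps k ! i) - e / 2 < real_of_rat q" "real_of_rat q < f (ps k ! i)"
        using of_rat_dense[of "f (ps k ! i) - e / 2" "f (ps k ! i)"] e by auto
      then show ?thesis by (intro exI[of _ q]) linarith
    qed
    then obtain r where r: "\<And>i. \<bar>f (ps k ! i) - real_of_rat (r i)\<bar> < e / 2" by metis
    define vs where "vs = map r [0..<length (ps k)]"
    have "\<bar>f x - st (k, vs) x\<bar> < e" if x: "x \<in> K" for x
    proof -
      obtain p where "p \<in> set (ps k)" "dist p x < 1 / real (Suc k)" using ps(2)[of k] x by auto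
      then have "\<exists>i. i < length (ps k) \<and> dist (ps k ! i) x < 1 / real (Suc k)" by (auto simp: in_set_conv_nth)
      then have i: "ix k x < length (ps k)" "dist (ps k ! ix k x) x < 1 / real (Suc k)"
        unfolding ix_def using LeastI_ex[of "\<lambda>i. i < length (ps k) \<and> dist (ps k ! i) x < 1 / real (Suc k)"] by auto
      have "ps k ! ix k x \<in> K" using ps(1)[of k] i(1) by auto
      then have "dist (f (ps k ! ix k x)) (f x) < e / 2" using d(2)[OF x] i(2) k by simp
      moreover have "st (k, vs) x = real_of_rat (r (ix k x))" using i(1) by (simp add: st_def vs_def)
      ultimately show ?thesis using r[of "ix k x"] unfolding dist_real_def by linarith
    qed
    then show "\<exists>q\<in>range st. \<forall>x\<in>K. \<bar>f x - q x\<bar> < e" by (intro bexI[of _ "st (k, vs)"]) auto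
  qed
qed

text \<open>The argument that a subset of a separable metric space is separable: for every finite
  list of features, accuracy and choice of approximants from \<open>Q\<close>, one member of
  \<open>V\<close> realising these data is picked, if there is any. This keeps the dense family
  inside \<open>V\<close>.\<close>

lemma features_separable:
  fixes K :: "'b::metric_space set" and feat :: "'i::countable \<Rightarrow> 'f \<Rightarrow> 'b \<Rightarrow> real"
  assumes K: "compact K" and cont: "\<And>i \<phi>. \<phi> \<in> V \<Longrightarrow> continuous_on K (feat i \<phi>)"
  obtains C where "countable C" "C \<subseteq> V"
    "\<And>\<phi> js e. \<phi> \<in> V \<Longrightarrow> e > 0 \<Longrightarrow> \<exists>\<psi>\<in>C. \<forall>i\<in>set js. \<forall>x\<in>K. \<bar>feat i \<psi> x - feat i \<phi> x\<bar> < e"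
proof -
  obtain Q :: "('b \<Rightarrow> real) set" where Q: "countable Q"
    "\<And>f e. continuous_on K f \<Longrightarrow> e > 0 \<Longrightarrow> \<exists>q\<in>Q. \<forall>x\<in>K. \<bar>f x - q x\<bar> < e"
    using continuous_functions_separable[OF K] by blast
  define R where "R js m qs \<phi> \<longleftrightarrow> \<phi> \<in> V \<and> length qs = length js \<and>
    (\<forall>k<length js. \<forall>x\<in>K. \<bar>feat (js ! k) \<phi> x - (qs ! k) x\<bar> < 1 / real (Suc m))" for js m qs \<phi>
  define pick where "pick = (\<lambda>(js, m, qs). SOME \<phi>. R js m qs \<phi>)"
  define C where "C = pick ` {(js, m, qs). qs \<in> lists Q \<and> (\<exists>\<phi>. R js m qs \<phi>)}"
  show thesis
  proof
    have "countable ((UNIV :: 'i list set) \<times> ((UNIV :: nat set) \<times> lists Q))"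
      by (intro countable_SIGMA countable_lists Q(1)) simp_all
    then have "countable {(js :: 'i list, m :: nat, qs). qs \<in> lists Q \<and> (\<exists>\<phi>. R js m qs \<phi>)}"
      by (rule countable_subset[rotated]) blast
    then show "countable C" unfolding C_def by (rule countable_image)
    show "C \<subseteq> V"
    proof
      fix \<psi> assume "\<psi> \<in> C"
      then obtain js m qs where "\<psi> = (SOME \<phi>. R js m qs \<phi>)" "\<exists>\<phi>. R js m qs \<phi>" by (auto simp: C_def pick_def)
      then have "R js m qs \<psi>" using someI_ex[of "R js m qs"] by simp
      then show "\<psi> \<in> V" by (simp add: R_def)
    qed
    fix \<phi> and js :: "'i list" and e :: real assume \<phi>: "\<phi> \<in> V" and e: "e > 0"
    obtain m where m: "1 / real (Suc m) < e / 2" using nat_approx_posE[OF half_gt_zero[OF e]] by (metis of_nat_Suc)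
    have "\<forall>i. \<exists>q\<in>Q. \<forall>x\<in>K. \<bar>feat i \<phi> x - q x\<bar> < 1 / real (Suc m)" using Q(2)[OF cont[OF \<phi>]] by simp
    then obtain q where q: "\<And>i. q i \<in> Q" "\<And>i x. x \<in> K \<Longrightarrow> \<bar>feat i \<phi> x - q i x\<bar> < 1 / real (Suc m)" by metis
    define qs where "qs = map q js"
    have R: "R js m qs \<phi>" using \<phi> q(2) by (simp add: R_def qs_def)
    define \<psi> where "\<psi> = pick (js, m, qs)"
    have "R js m qs \<psi>" unfolding \<psi>_def pick_def prod.case using someI[of "R js m qs", OF R] .
    moreover have "\<psi> \<in> C" unfolding C_def \<psi>_def using R q(1) by (intro imageI) (auto simp: qs_def)
    moreover have "\<bar>feat i \<psi> x - feat i \<phi> x\<bar> < e" if r: "R js m qs \<psi>" and i: "i \<in> set js" and x: "x \<in> K" for i x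
    proof -
      obtain k where k: "k < length js" "js ! k = i" using i by (auto simp: in_set_conv_nth)
      have "\<bar>feat i \<psi> x - q i x\<bar> < 1 / real (Suc m)" using r x k by (auto simp: R_def qs_def)
      then show ?thesis using q(2)[OF x, of i] m by linarith
    qed
    ultimately show "\<exists>\<psi>\<in>C. \<forall>i\<in>set js. \<forall>x\<in>K. \<bar>feat i \<psi> x - feat i \<phi> x\<bar> < e" by blast
  qed
qed

context smooth_manifold
begin

text \<open>The support may reach the boundary of \<open>V\<close>, so the bump function of a
  coordinate ball belongs to the space attached to that ball.\<close>

definition DD_in :: "'a set \<Rightarrow> ('a \<Rightarrow> real) set" where
  "DD_in V = {\<phi> \<in> DD A. \<forall>x. x \<notin> V \<longrightarrow> \<phi> x = 0}"

lemma DD_smooth_chart: "\<phi> \<in> DD A \<Longrightarrow> c \<in> A \<Longrightarrow> smooth_on_open (chart_image c) (\<lambda>y. \<phi> (chart_inv c y))"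
  using DD_msmooth[of \<phi>] by (auto simp: msmooth_def chart_image_def)

text \<open>In a second chart the derivatives are a \<open>chain_sum\<close> of those in
  \<open>c\<close>, with coefficients bounded on the compact part of \<open>L\<close> lying over the
  closed ball; near the remaining points of \<open>L\<close> all functions vanish. Hence one chart
  decides convergence.\<close>

lemma DD_conv_in_chart:
  assumes cb: "coord_ball c a r" and \<phi>: "\<And>n. \<phi>s n \<in> DD_in (chart_inv c ` ball a r)" "\<phi> \<in> DD_in (chart_inv c ` ball a r)"
    and conv: "\<And>es e. e > 0 \<Longrightarrow> \<forall>\<^sub>F n in sequentially. \<forall>y\<in>cball a r.
      \<bar>iter_pderiv shift_vec es (\<lambda>y. \<phi>s n (chart_inv c y) - \<phi> (chart_inv c y)) y\<bar> \<le> e"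
  shows "DD_conv \<phi>s \<phi>"
  unfolding DD_conv_def
proof (intro conjI ballI allI impI)
  let ?K = "chart_inv c ` cball a r"
  have c: "c \<in> A" "cball a r \<subseteq> chart_image c" using cb by (auto simp: coord_ball_def)
  have K: "compact ?K" by (rule coord_ball_compact[OF cb])
  have off: "\<phi>s n x = 0" "\<phi> x = 0" if "x \<notin> ?K" for n x
  proof -
    have "x \<notin> chart_inv c ` ball a r" using that ball_subset_cball by blast
    then show "\<phi>s n x = 0" "\<phi> x = 0" using \<phi> by (auto simp: DD_in_def)
  qed
  then show "\<exists>K. compact K \<and> (\<forall>n x. x \<notin> K \<longrightarrow> \<phi>s n x = \<phi> x)" using K by (intro exI[of _ ?K]) simp
  fix d ds L and e :: real assume d: "d \<in> A" and "compact L \<and> L \<subseteq> chart_image d \<and> e > 0"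
  then have L: "compact L" "L \<subseteq> chart_image d" and e: "e > 0" by auto
  define f where "f n x = \<phi>s n x - \<phi> x" for n x
  have f: "f n \<in> DD A" for n unfolding f_def using \<phi> by (auto simp: DD_in_def intro: DD_diff)
  define U where "U = transition_dom d c"
  have U: "open U" unfolding U_def transition_dom_def by (rule open_chart_image_Int[OF d open_chart_dom[OF c(1)]])
  have U_eq: "U = {y \<in> chart_image d. chart_inv d y \<in> fst c}"
    unfolding U_def transition_dom_def by (rule chart_image_Int[OF d])
  have \<tau>: "smooth_on_open U (transition d c)" unfolding U_def by (rule smooth_transition[OF d c(1)])
  have \<tau>U: "transition d c ` U \<subseteq> chart_image c"
    using chart_inv_simps(3)[OF c(1)] by (auto simp: U_eq transition_def)
  obtain F where F: "\<forall>(p, es)\<in>set F. smooth_on_open U p"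
    "\<And>f y. smooth_on_open (chart_image c) f \<Longrightarrow> y \<in> U \<Longrightarrow>
      iter_pderiv shift_vec ds (f \<circ> transition d c) y = chain_sum F f (transition d c) y"
    using iter_pderiv_compose[OF U open_chart_image[OF c(1)] \<tau> \<tau>U, of ds] by blast
  define L' where "L' = L \<inter> chart_inv d -` ?K"
  have inv_cont: "continuous_on (chart_image d) (chart_inv d)"
    using chart_homeomorphism[OF d] by (simp add: homeomorphism_def)
  have "closed (L \<inter> chart_inv d -` ?K)"
    by (rule continuous_closed_preimage[OF continuous_on_subset[OF inv_cont L(2)]
        compact_imp_closed[OF L(1)] compact_imp_closed[OF K]])
  then have "compact (L \<inter> L')" unfolding L'_def by (rule compact_Int_closed[OF L(1)])
  then have L'c: "compact L'" by (simp add: L'_def)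
  have Ksub: "?K \<subseteq> fst c" using chart_inv_simps(1)[OF c(1)] c(2) by blast
  have L'U: "L' \<subseteq> U" unfolding L'_def U_eq using L(2) Ksub by blast
  have \<tau>ball: "transition d c y \<in> cball a r" if "y \<in> L'" for y
  proof -
    obtain z where z: "z \<in> cball a r" "chart_inv d y = chart_inv c z" using \<open>y \<in> L'\<close> by (auto simp: L'_def)
    then show ?thesis using chart_inv_simps(2)[OF c(1), of z] c(2) by (auto simp: transition_def)
  qed
  have chain: "\<forall>\<^sub>F n in sequentially. \<forall>y\<in>L'. \<bar>chain_sum F (\<lambda>z. f n (chart_inv c z)) (transition d c) y\<bar> \<le> e"
    using F(1) e
  proof (induction F arbitrary: e)
    case Nil
    then show ?case by (simp add: chain_sum_def)
  next
    case (Cons q F)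
    obtain p es where q: "q = (p, es)" by (cases q)
    have "continuous_on U p"
      using Cons.prems(1) smooth_along_continuous[of "top_of_set U" shift_vec UNIV p] by (auto simp: q smooth_on_open_def)
    then have "compact (p ` L')" by (intro compact_continuous_image L'c continuous_on_subset[OF _ L'U])
    then have "bounded (p ` L')" by (rule compact_imp_bounded)
    then obtain B where "\<forall>u\<in>p ` L'. norm u \<le> B" unfolding bounded_iff by blast
    then have B: "\<bar>p y\<bar> \<le> \<bar>B\<bar> + 1" if "y \<in> L'" for y using that by fastforce
    have "e / (2 * (\<bar>B\<bar> + 1)) > 0" "e / 2 > 0" using Cons.prems(2) by auto
    then have "\<forall>\<^sub>F n in sequentially. \<forall>y\<in>cball a r. \<bar>iter_pderiv shift_vec es (\<lambda>z. f n (chart_inv c z)) y\<bar> \<le> e / (2 * (\<bar>B\<bar> + 1))"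
      "\<forall>\<^sub>F n in sequentially. \<forall>y\<in>L'. \<bar>chain_sum F (\<lambda>z. f n (chart_inv c z)) (transition d c) y\<bar> \<le> e / 2"
      using conv[of "e / (2 * (\<bar>B\<bar> + 1))" es] Cons.IH[of "e / 2"] Cons.prems(1) by (auto simp: f_def)
    then show ?case
    proof eventually_elim
      case (elim n)
      show ?case
      proof
        fix y assume y: "y \<in> L'"
        have "\<bar>p y * iter_pderiv shift_vec es (\<lambda>z. f n (chart_inv c z)) (transition d c y)\<bar> \<le> (\<bar>B\<bar> + 1) * (e / (2 * (\<bar>B\<bar> + 1)))"
          unfolding abs_mult using elim(1) \<tau>ball[OF y] B[OF y] by (intro mult_mono) auto
        also have "(\<bar>B\<bar> + 1) * (e / (2 * (\<bar>B\<bar> + 1))) = e / 2" by (simp add: field_simps)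
        finally have 1: "\<bar>p y * iter_pderiv shift_vec es (\<lambda>z. f n (chart_inv c z)) (transition d c y)\<bar> \<le> e / 2" .
        have 2: "\<bar>chain_sum F (\<lambda>z. f n (chart_inv c z)) (transition d c) y\<bar> \<le> e / 2" using elim(2) y by blast
        have "chain_sum (q # F) (\<lambda>z. f n (chart_inv c z)) (transition d c) y =
            p y * iter_pderiv shift_vec es (\<lambda>z. f n (chart_inv c z)) (transition d c y) +
            chain_sum F (\<lambda>z. f n (chart_inv c z)) (transition d c) y" by (simp add: chain_sum_def q)
        then show "\<bar>chain_sum (q # F) (\<lambda>z. f n (chart_inv c z)) (transition d c) y\<bar> \<le> e" using 1 2 by linarith
      qed
    qed
  qed
  show "\<forall>\<^sub>F n in sequentially. \<forall>y\<in>L. \<bar>iter_pderiv shift_vec ds (\<lambda>y. \<phi>s n (chart_inv d y) - \<phi> (chart_inv d y)) y\<bar> \<le> e"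
    using chain
  proof eventually_elim
    case (elim n)
    show ?case
    proof
      fix y assume y: "y \<in> L"
      show "\<bar>iter_pderiv shift_vec ds (\<lambda>y. \<phi>s n (chart_inv d y) - \<phi> (chart_inv d y)) y\<bar> \<le> e"
      proof (cases "y \<in> L'")
        case True
        have "iter_pderiv shift_vec ds (\<lambda>y. f n (chart_inv d y)) y =
            iter_pderiv shift_vec ds ((\<lambda>z. f n (chart_inv c z)) \<circ> transition d c) y"
          by (rule iter_pderiv_cong[OF flow_shift_vec[OF U]])
            (use True L'U chart_inv_simps(4)[OF c(1)] in \<open>auto simp: transition_def U_eq\<close>)
        also have "\<dots> = chain_sum F (\<lambda>z. f n (chart_inv c z)) (transition d c) y"
          by (rule F(2)[OF DD_smooth_chart[OF f c(1)]]) (use True L'U in blast)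
        finally show ?thesis using elim True by (simp add: f_def)
      next
        case False
        have op: "open (snd d ` (fst d \<inter> - ?K))"
          by (rule open_chart_image_Int[OF d]) (use compact_imp_closed[OF K] in auto)
        have "y \<in> snd d ` (fst d \<inter> - ?K)"
          unfolding chart_image_Int[OF d] using False y L(2) by (auto simp: L'_def)
        then have "iter_pderiv shift_vec ds (\<lambda>y. \<phi>s n (chart_inv d y) - \<phi> (chart_inv d y)) y = iter_pderiv shift_vec ds (\<lambda>_. 0) y"
          by (intro iter_pderiv_cong[OF flow_shift_vec[OF op]]) (auto simp: chart_image_Int[OF d] off)
        then show ?thesis using e by (simp add: iter_pderiv_zero)
      qed
    qed
  qed
qed

text \<open>The features are all iterated partial derivatives in the chart of the ball. At stage
  \<open>n\<close> those of order at most \<open>n\<close> are approximated up to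
  \<open>1 / (n + 1)\<close>, so a single sequence converges in every order.\<close>

lemma DD_in_separable:
  assumes cb: "coord_ball c a r"
  obtains \<psi> :: "nat \<Rightarrow> 'a \<Rightarrow> real" where "\<And>j. \<psi> j \<in> DD_in (chart_inv c ` ball a r)"
    "\<And>\<phi>. \<phi> \<in> DD_in (chart_inv c ` ball a r) \<Longrightarrow> \<exists>k. DD_conv (\<lambda>n. \<psi> (k n)) \<phi>"
proof -
  let ?V = "DD_in (chart_inv c ` ball a r)"
  let ?feat = "\<lambda>es \<phi>. iter_pderiv shift_vec es (\<lambda>y. \<phi> (chart_inv c y))"
  have c: "c \<in> A" "cball a r \<subseteq> chart_image c" using cb by (auto simp: coord_ball_def)
  have sm: "smooth_along (top_of_set (chart_image c)) shift_vec UNIV (\<lambda>y. \<phi> (chart_inv c y))" if "\<phi> \<in> ?V" for \<phi>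
    using DD_smooth_chart[OF _ c(1)] that by (simp add: DD_in_def smooth_on_open_def)
  have cont: "continuous_on (cball a r) (?feat es \<phi>)" if "\<phi> \<in> ?V" for es \<phi>
  proof -
    have "continuous_on (chart_image c) (?feat es \<phi>)"
      using smooth_along_continuous[OF smooth_along_iter[OF sm[OF that]], of es] by simp
    then show ?thesis by (rule continuous_on_subset[OF _ c(2)])
  qed
  obtain C where C: "countable C" "C \<subseteq> ?V" and dense:
    "\<And>\<phi> js e. \<phi> \<in> ?V \<Longrightarrow> e > 0 \<Longrightarrow> \<exists>\<psi>\<in>C. \<forall>es\<in>set js. \<forall>x\<in>cball a r. \<bar>?feat es \<psi> x - ?feat es \<phi> x\<bar> < e"
    using features_separable[where feat = ?feat and V = ?V, OF compact_cball cont] by metis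
  have "(\<lambda>_. 0) \<in> ?V" by (simp add: DD_in_def DD_zero)
  then have "C \<noteq> {}" using dense[of "\<lambda>_. 0" 1 "[]"] by auto
  show thesis
  proof
    show in_V: "from_nat_into C j \<in> ?V" for j using from_nat_into[OF \<open>C \<noteq> {}\<close>] C(2) by blast
    fix \<phi> assume \<phi>: "\<phi> \<in> ?V"
    have "finite {es :: 'n list. set es \<subseteq> UNIV \<and> length es \<le> n}" for n by (rule finite_lists_length_le) simp
    then have "\<exists>js :: 'n list list. set js = {es. length es \<le> n}" for n
      using finite_list[of "{es :: 'n list. length es \<le> n}"] by simp
    then obtain js :: "nat \<Rightarrow> 'n list list" where js: "\<And>n. set (js n) = {es. length es \<le> n}" by metis
    have "\<exists>k. \<forall>es\<in>set (js n). \<forall>x\<in>cball a r. \<bar>?feat es (from_nat_into C k) x - ?feat es \<phi> x\<bar> < 1 / real (Suc n)" for n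
    proof -
      obtain \<psi> where "\<psi> \<in> C" "\<forall>es\<in>set (js n). \<forall>x\<in>cball a r. \<bar>?feat es \<psi> x - ?feat es \<phi> x\<bar> < 1 / real (Suc n)"
        using dense[OF \<phi>, of "1 / real (Suc n)" "js n"] by auto
      then show ?thesis using from_nat_into_to_nat_on[OF C(1)] by metis
    qed
    then obtain k where k: "\<And>n es x. length es \<le> n \<Longrightarrow> x \<in> cball a r \<Longrightarrow>
        \<bar>?feat es (from_nat_into C (k n)) x - ?feat es \<phi> x\<bar> < 1 / real (Suc n)"
      unfolding js by (metis mem_Collect_eq)
    have "DD_conv (\<lambda>n. from_nat_into C (k n)) \<phi>"
    proof (rule DD_conv_in_chart[OF cb in_V \<phi>])
      fix es :: "'n list" and e :: real assume e: "e > 0"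
      obtain N where N: "1 / real (Suc N) < e" using nat_approx_posE[OF e] by (metis of_nat_Suc)
      show "\<forall>\<^sub>F n in sequentially. \<forall>y\<in>cball a r.
        \<bar>iter_pderiv shift_vec es (\<lambda>y. from_nat_into C (k n) (chart_inv c y) - \<phi> (chart_inv c y)) y\<bar> \<le> e"
        using eventually_ge_at_top[of "max N (length es)"]
      proof eventually_elim
        case (elim n)
        show ?case
        proof
          fix y assume y: "y \<in> cball a r"
          have "iter_pderiv shift_vec es (\<lambda>y. from_nat_into C (k n) (chart_inv c y) - \<phi> (chart_inv c y)) y =
              ?feat es (from_nat_into C (k n)) y - ?feat es \<phi> y"
            by (rule iter_pderiv_lin[OF flow_shift_vec[OF open_chart_image[OF c(1)]] sm[OF in_V] sm[OF \<phi>]])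
              (use y c(2) in auto)
          moreover have "1 / real (Suc n) \<le> 1 / real (Suc N)" using elim by (simp add: frac_le)
          ultimately show "\<bar>iter_pderiv shift_vec es (\<lambda>y. from_nat_into C (k n) (chart_inv c y) - \<phi> (chart_inv c y)) y\<bar> \<le> e"
            using k[of es n y] elim y N by simp
        qed
      qed
    qed
    then show "\<exists>k. DD_conv (\<lambda>n. from_nat_into C (k n)) \<phi>" by blast
  qed
qed

end

section \<open>Configurations inside the space of distributions\<close>

definition pairings :: "(nat \<Rightarrow> 'a \<Rightarrow> real) \<Rightarrow> 'a set \<Rightarrow> nat \<Rightarrow> real" where
  "pairings \<psi> Z j = (\<Sum>x\<in>Z. \<psi> j x)"

text \<open>Pairwise disjoint subsets of \<open>V\<close>, as a list. One point taken from each
  gives a set of distinct points, so that sums over sets and sums over choices agree.\<close>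

primrec disjoint_boxes :: "'a set \<Rightarrow> 'a set list \<Rightarrow> bool" where
  "disjoint_boxes V [] \<longleftrightarrow> True"
| "disjoint_boxes V (K # Ks) \<longleftrightarrow> K \<subseteq> V \<and> disjoint_boxes (V - K) Ks"

primrec box_pairings :: "(nat \<Rightarrow> 'a \<Rightarrow> real) \<Rightarrow> 'a set list \<Rightarrow> (nat \<Rightarrow> real) set" where
  "box_pairings \<psi> [] = {\<lambda>_. 0}"
| "box_pairings \<psi> (K # Ks) = (\<lambda>(x, v) j. \<psi> j x + v j) ` (K \<times> box_pairings \<psi> Ks)"

lemma compact_box_pairings:
  fixes \<psi> :: "nat \<Rightarrow> 'a::topological_space \<Rightarrow> real"
  assumes "\<And>j. continuous_on UNIV (\<psi> j)" "\<forall>K\<in>set Ks. compact K"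
  shows "compact (box_pairings \<psi> Ks)"
  using assms(2)
proof (induction Ks)
  case (Cons K Ks)
  have "continuous_on (K \<times> box_pairings \<psi> Ks) (\<lambda>p j. \<psi> j (fst p) + snd p j)"
  proof (intro continuous_on_coordinatewise_then_product continuous_on_add)
    fix j
    show "continuous_on (K \<times> box_pairings \<psi> Ks) (\<lambda>p. \<psi> j (fst p))"
      by (rule continuous_on_compose2[OF assms(1)]) (intro continuous_on_fst continuous_on_id, simp)
    show "continuous_on (K \<times> box_pairings \<psi> Ks) (\<lambda>p. snd p j)"
      by (rule continuous_on_product_then_coordinatewise[OF continuous_on_snd[OF continuous_on_id]])
  qed
  then show ?case
    using Cons by (auto simp: case_prod_beta' intro!: compact_continuous_image compact_Times)
qed simp

lemma box_pairings_imp: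
  assumes "disjoint_boxes V Ks" "v \<in> box_pairings \<psi> Ks"
  shows "\<exists>Z. finite Z \<and> Z \<subseteq> V \<and> v = pairings \<psi> Z"
  using assms
proof (induction Ks arbitrary: V v)
  case Nil
  then have "v = (\<lambda>_. 0)" by simp
  then show ?case by (intro exI[of _ "{}"]) (simp add: pairings_def[abs_def])
next
  case (Cons K Ks)
  obtain p where p: "v = (\<lambda>(x, v) j. \<psi> j x + v j) p" "p \<in> K \<times> box_pairings \<psi> Ks"
    using Cons.prems(2) unfolding box_pairings.simps by (rule imageE) (rule that)
  obtain x w where "p = (x, w)" by (cases p)
  with p have x: "x \<in> K" "w \<in> box_pairings \<psi> Ks" "v = (\<lambda>j. \<psi> j x + w j)" by simp_all
  have K: "K \<subseteq> V" "disjoint_boxes (V - K) Ks" using Cons.prems(1) by simp_all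
  obtain Z where Z: "finite Z" "Z \<subseteq> V - K" "w = pairings \<psi> Z"
    using Cons.IH[OF K(2) x(2)] by (elim exE conjE) (rule that)
  have "x \<notin> Z" "insert x Z \<subseteq> V" using Z(2) x(1) K(1) by blast+
  moreover have "v = pairings \<psi> (insert x Z)"
    unfolding x(3) Z(3) using Z(1) \<open>x \<notin> Z\<close> by (simp add: pairings_def[abs_def])
  ultimately show ?case using Z(1) by (intro exI[of _ "insert x Z"]) simp
qed

context smooth_manifold
begin

text \<open>Local compactness enters through coordinate balls: a basis set inside one has compact
  closure. Only the basis sets with compact closure are kept.\<close>

lemma countable_compact_basis:
  obtains \<K> :: "'a set set" where "countable \<K>" "\<And>K. K \<in> \<K> \<Longrightarrow> compact K"
    "\<And>W x. open W \<Longrightarrow> x \<in> W \<Longrightarrow> \<exists>K\<in>\<K>. x \<in> K \<and> K \<subseteq> W"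
proof -
  obtain \<B> :: "'a set set" where \<B>: "countable \<B>" "topological_basis \<B>"
    using ex_countable_basis by blast
  show thesis
  proof
    show "countable {K \<in> closure ` \<B>. compact K}" using \<B>(1) by simp
    show "compact K" if "K \<in> {K \<in> closure ` \<B>. compact K}" for K using that by simp
    fix W and x :: 'a assume "open W" "x \<in> W"
    then obtain c a r where cb: "coord_ball c a r" "x \<in> chart_inv c ` ball a r" "chart_inv c ` cball a r \<subseteq> W"
      using coord_ball_exists by blast
    obtain B where B: "B \<in> \<B>" "x \<in> B" "B \<subseteq> chart_inv c ` ball a r"
      by (rule topological_basisE[OF \<B>(2) coord_ball_open[OF cb(1)] cb(2)])
    have K: "compact (chart_inv c ` cball a r)" by (rule coord_ball_compact[OF cb(1)])
    have "B \<subseteq> chart_inv c ` cball a r" using B(3) image_mono[OF ball_subset_cball[of a r], of "chart_inv c"] by blast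
    then have sub: "closure B \<subseteq> chart_inv c ` cball a r" by (rule closure_minimal[OF _ compact_imp_closed[OF K]])
    then have "compact (closure B)" using compact_Int_closed[OF K closed_closure[of B]] by (simp add: Int_absorb1)
    then show "\<exists>K\<in>{K \<in> closure ` \<B>. compact K}. x \<in> K \<and> K \<subseteq> W"
      using B(1,2) subset_trans[OF sub cb(3)] subsetD[OF closure_subset[of B]] by (intro bexI[of _ "closure B"]) simp_all
  qed
qed

text \<open>Distinct points can be enclosed in disjoint members of a countable family of compact
  sets. The image is therefore a countable union, over lists of disjoint boxes, of compact
  sets.\<close>

lemma pairings_borel:
  fixes V :: "'a set" and \<psi> :: "nat \<Rightarrow> 'a \<Rightarrow> real"
  assumes V: "open V" and \<psi>: "\<And>j. continuous_on UNIV (\<psi> j)"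
  shows "pairings \<psi> ` {Z. finite Z \<and> Z \<subseteq> V} \<in> sets borel"
proof -
  obtain \<K> :: "'a set set" where \<K>: "countable \<K>" "\<And>K. K \<in> \<K> \<Longrightarrow> compact K"
    "\<And>W x. open W \<Longrightarrow> x \<in> W \<Longrightarrow> \<exists>K\<in>\<K>. x \<in> K \<and> K \<subseteq> W"
    using countable_compact_basis by metis
  have conv: "\<exists>Ks\<in>lists \<K>. disjoint_boxes V Ks \<and> pairings \<psi> Z \<in> box_pairings \<psi> Ks"
    if "finite Z" "Z \<subseteq> V" "open V" for Z V
    using that
  proof (induction Z arbitrary: V)
    case empty
    show ?case by (intro bexI[of _ "[]"]) (auto simp: pairings_def)
  next
    case (insert x Z)
    have "open (V - Z)" using insert.prems(2) insert.hyps(1) by (intro open_Diff finite_imp_closed)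
    moreover have "x \<in> V - Z" using insert.prems insert.hyps by blast
    ultimately obtain K where K: "K \<in> \<K>" "x \<in> K" "K \<subseteq> V - Z" using \<K>(3) by blast
    have "open (V - K)" using insert.prems(2) \<K>(2)[OF K(1)] by (intro open_Diff compact_imp_closed)
    moreover have "Z \<subseteq> V - K" using insert.prems(1) K(3) by blast
    ultimately obtain Ks where Ks: "Ks \<in> lists \<K>" "disjoint_boxes (V - K) Ks" "pairings \<psi> Z \<in> box_pairings \<psi> Ks"
      using insert.IH by blast
    have "pairings \<psi> (insert x Z) = (\<lambda>j. \<psi> j x + pairings \<psi> Z j)" using insert.hyps by (auto simp: pairings_def)
    then have "pairings \<psi> (insert x Z) \<in> box_pairings \<psi> (K # Ks)"
      unfolding box_pairings.simps using K(2) Ks(3) by (intro image_eqI[of _ _ "(x, pairings \<psi> Z)"]) simp_all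
    then show ?case using K Ks by (intro bexI[of _ "K # Ks"]) auto
  qed
  define \<L> where "\<L> = {Ks \<in> lists \<K>. disjoint_boxes V Ks}"
  have "pairings \<psi> ` {Z. finite Z \<and> Z \<subseteq> V} = (\<Union>Ks\<in>\<L>. box_pairings \<psi> Ks)"
  proof (intro subset_antisym subsetI)
    fix v assume "v \<in> pairings \<psi> ` {Z. finite Z \<and> Z \<subseteq> V}"
    then obtain Z where Z: "finite Z" "Z \<subseteq> V" "v = pairings \<psi> Z" by auto
    obtain Ks where "Ks \<in> lists \<K>" "disjoint_boxes V Ks" "v \<in> box_pairings \<psi> Ks"
      using conv[OF Z(1,2) V] unfolding Z(3) by auto
    then show "v \<in> (\<Union>Ks\<in>\<L>. box_pairings \<psi> Ks)" unfolding \<L>_def by auto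
  next
    fix v assume "v \<in> (\<Union>Ks\<in>\<L>. box_pairings \<psi> Ks)"
    then obtain Ks where Ks: "disjoint_boxes V Ks" "v \<in> box_pairings \<psi> Ks" unfolding \<L>_def by auto
    show "v \<in> pairings \<psi> ` {Z. finite Z \<and> Z \<subseteq> V}" using box_pairings_imp[OF Ks] by auto
  qed
  also have "\<dots> \<in> sets borel"
  proof (rule sets.countable_UN'')
    show "countable \<L>"
      unfolding \<L>_def by (rule countable_subset[OF _ countable_lists[OF \<K>(1)]]) blast
    show "box_pairings \<psi> Ks \<in> sets borel" if "Ks \<in> \<L>" for Ks
      by (rule borel_closed[OF compact_imp_closed[OF compact_box_pairings[OF \<psi>]]]) (use that \<K>(2) in \<open>auto simp: \<L>_def\<close>)
  qed
  finally show ?thesis .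
qed

definition loc_conf :: "'a set \<Rightarrow> (('a \<Rightarrow> real) \<Rightarrow> real) \<Rightarrow> 'a set \<Rightarrow> bool" where
  "loc_conf V \<omega> Z \<longleftrightarrow> finite Z \<and> Z \<subseteq> V \<and> (\<forall>\<phi>\<in>DD_in V. \<omega> \<phi> = (\<Sum>x\<in>Z. \<phi> x))"

lemma DD_conv_pointwise:
  assumes "DD_conv \<phi>s \<phi>"
  shows "(\<lambda>n. \<phi>s n x) \<longlonglongrightarrow> \<phi> x"
proof (rule metric_LIMSEQ_I)
  fix e :: real assume e: "e > 0"
  obtain c where c: "c \<in> A" "x \<in> fst c" using chart_cover by blast
  have "compact {snd c x} \<and> {snd c x} \<subseteq> chart_image c \<and> e / 2 > 0" using chart_inv_simps(3)[OF c] e by simp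
  then have "\<forall>\<^sub>F n in sequentially. \<forall>y\<in>{snd c x}. \<bar>iter_pderiv shift_vec [] (\<lambda>y. \<phi>s n (chart_inv c y) - \<phi> (chart_inv c y)) y\<bar> \<le> e / 2"
    by (rule assms[unfolded DD_conv_def, THEN conjunct2, rule_format, OF c(1)])
  then have "\<forall>\<^sub>F n in sequentially. dist (\<phi>s n x) (\<phi> x) < e"
    by eventually_elim (use e in \<open>simp add: chart_inv_simps(4)[OF c] dist_real_def\<close>)
  then show "\<exists>N. \<forall>n\<ge>N. dist (\<phi>s n x) (\<phi> x) < e" by (simp add: eventually_sequentially)
qed

text \<open>Whether \<omega> is a finite sum of point masses on the ball is decided by its values on
  a sequence that is sequentially dense among the test functions of the ball. The condition becomes
  membership of a real sequence in a Borel set.\<close>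

lemma loc_conf_sequence:
  assumes cb: "coord_ball c a r"
  shows "\<exists>\<psi> :: nat \<Rightarrow> 'a \<Rightarrow> real. (\<forall>j. \<psi> j \<in> DD_in (chart_inv c ` ball a r)) \<and>
    pairings \<psi> ` {Z. finite Z \<and> Z \<subseteq> chart_inv c ` ball a r} \<in> sets borel \<and>
    (\<forall>\<omega>\<in>DD_dual A. (\<lambda>j. \<omega> (\<psi> j)) \<in> pairings \<psi> ` {Z. finite Z \<and> Z \<subseteq> chart_inv c ` ball a r} \<longleftrightarrow>
      (\<exists>Z. loc_conf (chart_inv c ` ball a r) \<omega> Z))"
proof -
  let ?V = "chart_inv c ` ball a r"
  obtain \<psi> :: "nat \<Rightarrow> 'a \<Rightarrow> real" where \<psi>: "\<And>j. \<psi> j \<in> DD_in ?V"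
    "\<And>\<phi>. \<phi> \<in> DD_in ?V \<Longrightarrow> \<exists>k. DD_conv (\<lambda>n. \<psi> (k n)) \<phi>"
    using DD_in_separable[OF cb] by metis
  show ?thesis
  proof (intro exI[of _ \<psi>] conjI allI ballI)
    show "\<psi> j \<in> DD_in ?V" for j by (rule \<psi>(1))
    show "pairings \<psi> ` {Z. finite Z \<and> Z \<subseteq> ?V} \<in> sets borel"
      by (rule pairings_borel[OF coord_ball_open[OF cb]]) (use \<psi>(1) DD_continuous in \<open>auto simp: DD_in_def\<close>)
    fix \<omega> assume \<omega>: "\<omega> \<in> DD_dual A"
    show "(\<lambda>j. \<omega> (\<psi> j)) \<in> pairings \<psi> ` {Z. finite Z \<and> Z \<subseteq> ?V} \<longleftrightarrow> (\<exists>Z. loc_conf ?V \<omega> Z)"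
    proof
      assume "(\<lambda>j. \<omega> (\<psi> j)) \<in> pairings \<psi> ` {Z. finite Z \<and> Z \<subseteq> ?V}"
      then obtain Z where Z: "finite Z" "Z \<subseteq> ?V" "(\<lambda>j. \<omega> (\<psi> j)) = pairings \<psi> Z" by blast
      have "\<omega> \<phi> = (\<Sum>x\<in>Z. \<phi> x)" if \<phi>: "\<phi> \<in> DD_in ?V" for \<phi>
      proof -
        obtain k where k: "DD_conv (\<lambda>n. \<psi> (k n)) \<phi>" using \<psi>(2)[OF \<phi>] by blast
        have "(\<lambda>n. \<omega> (\<psi> (k n))) \<longlonglongrightarrow> \<omega> \<phi>"
          by (rule dual_tendsto[OF \<omega> _ _ k]) (use \<psi>(1) \<phi> in \<open>auto simp: DD_in_def\<close>)
        moreover have "\<omega> (\<psi> (k n)) = (\<Sum>x\<in>Z. \<psi> (k n) x)" for n using fun_cong[OF Z(3), of "k n"] by (simp add: pairings_def)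
        moreover have "(\<lambda>n. \<Sum>x\<in>Z. \<psi> (k n) x) \<longlonglongrightarrow> (\<Sum>x\<in>Z. \<phi> x)"
          by (intro tendsto_sum DD_conv_pointwise k)
        ultimately show ?thesis by (simp add: LIMSEQ_unique)
      qed
      then show "\<exists>Z. loc_conf ?V \<omega> Z" using Z(1,2) unfolding loc_conf_def by blast
    next
      assume "\<exists>Z. loc_conf ?V \<omega> Z"
      then obtain Z where Z: "finite Z" "Z \<subseteq> ?V" "\<And>\<phi>. \<phi> \<in> DD_in ?V \<Longrightarrow> \<omega> \<phi> = (\<Sum>x\<in>Z. \<phi> x)"
        unfolding loc_conf_def by blast
      have "(\<lambda>j. \<omega> (\<psi> j)) = pairings \<psi> Z" using Z(3)[OF \<psi>(1)] by (simp add: pairings_def fun_eq_iff)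
      then show "(\<lambda>j. \<omega> (\<psi> j)) \<in> pairings \<psi> ` {Z. finite Z \<and> Z \<subseteq> ?V}" using Z(1,2) by blast
    qed
  qed
qed

lemma add_nonzeroD: "(a::real) + b \<noteq> 0 \<Longrightarrow> a \<noteq> 0 \<or> b \<noteq> 0"
  by auto

section \<open>Configurations as distributions\<close>

lemma conf_finite: "\<gamma> \<in> conf_space \<Longrightarrow> compact K \<Longrightarrow> finite (\<gamma> \<inter> K)"
  by (simp add: conf_space_def)

lemma conf_sum:
  assumes "\<gamma> \<in> conf_space" "compact K" "\<And>x. f x \<noteq> (0::real) \<Longrightarrow> x \<in> K"
  shows "(\<Sum>x | x \<in> \<gamma> \<and> f x \<noteq> 0. f x) = (\<Sum>x\<in>\<gamma> \<inter> K. f x)"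
  by (rule sum.mono_neutral_left[OF conf_finite[OF assms(1,2)]]) (use assms(3) in auto)

text \<open>Over a compact set only finitely many points of \<gamma> count, and the modulus of the
  value at such a point is a chart seminorm of order zero. This is the estimate behind the
  continuity of \<gamma> as a functional.\<close>

lemma conf_seminorm:
  assumes \<gamma>: "\<gamma> \<in> conf_space"
  shows "test_seminorm A 1 (\<lambda>f. \<bar>\<Sum>x | x \<in> \<gamma> \<and> f (\<lambda>i\<in>{..<1}. x) \<noteq> 0. f (\<lambda>i\<in>{..<1}. x)\<bar>)"
    (is "test_seminorm A 1 (\<lambda>f. \<bar>?s f\<bar>)")
  unfolding test_seminorm_def
proof (intro conjI allI impI)
  let ?e = "\<lambda>x::'a. \<lambda>i\<in>{..<1::nat}. x"
  have supp: "\<exists>K. compact K \<and> (\<forall>x. f (?e x) \<noteq> 0 \<longrightarrow> x \<in> K)" if f: "f \<in> test_fun A 1" for f :: "(nat \<Rightarrow> 'a) \<Rightarrow> real"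
  proof -
    obtain K where K: "compact K" "\<And>x. f x \<noteq> 0 \<Longrightarrow> x \<in> PiE {..<1} (\<lambda>_. K)" using test_fun_support[OF f] by blast
    have "x \<in> K" if fx: "f (?e x) \<noteq> 0" for x using K(2)[OF fx] by (auto simp: PiE_iff)
    with K(1) show ?thesis by blast
  qed
  show "seminorm_on (test_fun A 1) (\<lambda>f. \<bar>?s f\<bar>)"
    unfolding seminorm_on_def
  proof (intro conjI ballI allI)
    fix f g :: "(nat \<Rightarrow> 'a) \<Rightarrow> real" assume f: "f \<in> test_fun A 1" and g: "g \<in> test_fun A 1"
    obtain K L where K: "compact K" "\<forall>x. f (?e x) \<noteq> 0 \<longrightarrow> x \<in> K" and L: "compact L" "\<forall>x. g (?e x) \<noteq> 0 \<longrightarrow> x \<in> L"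
      using supp[OF f] supp[OF g] by blast
    have KL: "compact (K \<union> L)" using K(1) L(1) by (rule compact_Un)
    have "?s (\<lambda>x. f x + g x) = (\<Sum>x\<in>\<gamma> \<inter> (K \<union> L). f (?e x) + g (?e x))"
      by (rule conf_sum[OF \<gamma> KL], drule add_nonzeroD) (use K(2) L(2) in blast)
    also have "\<dots> = ?s f + ?s g"
      using conf_sum[OF \<gamma> KL, of "\<lambda>x. f (?e x)"] conf_sum[OF \<gamma> KL, of "\<lambda>x. g (?e x)"] K(2) L(2)
      by (simp add: sum.distrib)
    finally show "\<bar>?s (\<lambda>x. f x + g x)\<bar> \<le> \<bar>?s f\<bar> + \<bar>?s g\<bar>" by simp
  next
    fix f :: "(nat \<Rightarrow> 'a) \<Rightarrow> real" and k :: real assume f: "f \<in> test_fun A 1"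
    obtain K where K: "compact K" "\<forall>x. f (?e x) \<noteq> 0 \<longrightarrow> x \<in> K" using supp[OF f] by blast
    have "?s (\<lambda>x. k * f x) = (\<Sum>x\<in>\<gamma> \<inter> K. k * f (?e x))" by (rule conf_sum[OF \<gamma> K(1)]) (use K(2) in auto)
    also have "\<dots> = k * ?s f" using conf_sum[OF \<gamma> K(1), of "\<lambda>x. f (?e x)"] K(2) by (simp add: sum_distrib_left)
    finally show "\<bar>?s (\<lambda>x. k * f x)\<bar> = \<bar>k\<bar> * \<bar>?s f\<bar>" by (simp add: abs_mult)
  qed simp
  fix S :: "(nat \<Rightarrow> 'a) set" assume S: "compactin (Xpow 1) S"
  define P where "P = \<gamma> \<inter> (\<lambda>x. x 0) ` S"
  have "continuous_map (Xpow 1) euclidean (\<lambda>x. x 0 :: 'a)"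
    unfolding Xpow_def by (rule continuous_map_product_projection) simp
  from image_compactin[OF S this] have P: "finite P" unfolding P_def by (intro conf_finite \<gamma>) simp
  obtain ch where ch: "\<And>x. ch x \<in> A" "\<And>x. x \<in> fst (ch x)" using chart_cover by metis
  \<comment> \<open>The index whose seminorm is evaluation at \<open>x\<close>: no derivatives, and
    the coordinate vector of \<open>x\<close> as a one-point compact set.\<close>
  define k where "k x = (\<lambda>i\<in>{..<1::nat}. ch x, [] :: (nat \<times> 'n) list, {\<lambda>i\<in>{..<1::nat}. snd (ch x) x})" for x
  have "k x \<in> chart_indices A 1" for x
    using ch chart_inv_simps(3)[OF ch(1) ch(2)]
    by (auto simp: k_def chart_indices_def compactin_def box_top_def finite_imp_compactin)
  moreover have inj: "inj_on k P"
  proof (rule inj_onI)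
    fix x y assume "k x = k y"
    then have "(\<lambda>i\<in>{..<1::nat}. ch x) 0 = (\<lambda>i\<in>{..<1::nat}. ch y) 0"
      "(\<lambda>i\<in>{..<1::nat}. snd (ch x) x) 0 = (\<lambda>i\<in>{..<1::nat}. snd (ch y) y) 0"
      unfolding k_def by (auto dest: fun_cong)
    then have "ch x = ch y" "snd (ch x) x = snd (ch y) y" by simp_all
    then have "chart_inv (ch x) (snd (ch x) x) = chart_inv (ch y) (snd (ch y) y)" by (simp only:)
    then show "x = y" unfolding chart_inv_simps(4)[OF ch(1) ch(2)] .
  qed
  moreover have "\<bar>?s f\<bar> \<le> 1 * (\<Sum>j\<in>k ` P. chart_seminorm 1 j f)"
    if f: "f \<in> test_fun A 1" "\<forall>x. x \<notin> S \<longrightarrow> f x = 0" for f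
  proof -
    have "?s f = (\<Sum>x\<in>P. f (?e x))"
      unfolding P_def
    proof (rule sum.mono_neutral_left)
      show "{x \<in> \<gamma>. f (?e x) \<noteq> 0} \<subseteq> \<gamma> \<inter> (\<lambda>x. x 0) ` S"
      proof
        fix x assume x: "x \<in> {x \<in> \<gamma>. f (?e x) \<noteq> 0}"
        then have "?e x \<in> S" using f(2) by blast
        then have "(?e x) 0 \<in> (\<lambda>x. x 0) ` S" by (rule imageI)
        then show "x \<in> \<gamma> \<inter> (\<lambda>x. x 0) ` S" using x by simp
      qed
    qed (use P in \<open>auto simp: P_def\<close>)
    also have "\<bar>\<dots>\<bar> \<le> (\<Sum>x\<in>P. \<bar>f (?e x)\<bar>)" by (rule sum_abs)
    also have "\<dots> = (\<Sum>x\<in>P. chart_seminorm 1 (k x) f)"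
    proof (rule sum.cong[OF refl])
      fix x
      have "in_charts 1 (\<lambda>i\<in>{..<1}. ch x) f (\<lambda>i\<in>{..<1}. snd (ch x) x) = f (?e x)"
        unfolding in_charts_def by (rule arg_cong[of _ _ f]) (auto simp: chart_inv_simps(4)[OF ch(1) ch(2)])
      then show "\<bar>f (?e x)\<bar> = chart_seminorm 1 (k x) f"
        unfolding chart_seminorm_def k_def prod.case iter_pderiv_Nil by (simp add: cSup_eq_Max)
    qed
    also have "\<dots> = (\<Sum>j\<in>k ` P. chart_seminorm 1 j f)" by (simp add: sum.reindex[OF inj])
    finally show ?thesis by simp
  qed
  ultimately show "\<exists>F C. finite F \<and> F \<subseteq> chart_indices A 1 \<and> (\<forall>f\<in>test_fun A 1. (\<forall>x. x \<notin> S \<longrightarrow> f x = 0) \<longrightarrow>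
      \<bar>?s f\<bar> \<le> C * (\<Sum>j\<in>F. chart_seminorm 1 j f))"
    using P by (intro exI[of _ "k ` P"] exI[of _ 1]) blast
qed

lemma conf_functional_sum:
  assumes "\<gamma> \<in> conf_space" "\<phi> \<in> DD A" "compact K" "\<And>x. \<phi> x \<noteq> 0 \<Longrightarrow> x \<in> K"
  shows "conf_functional A \<gamma> \<phi> = (\<Sum>x\<in>\<gamma> \<inter> K. \<phi> x)"
  using conf_sum[OF assms(1,3,4)] assms(2) by (simp add: conf_functional_def)

lemma conf_functional_dual:
  assumes \<gamma>: "\<gamma> \<in> conf_space"
  shows "conf_functional A \<gamma> \<in> DD_dual A"
  unfolding DD_dual_def dual_space_def topspace_DD_topology
proof (intro CollectI conjI ballI allI)
  let ?c = "conf_functional A \<gamma>"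
  show "?c \<in> extensional (DD A)" by (simp add: conf_functional_def)
  show add: "?c (\<lambda>x. f x + g x) = ?c f + ?c g" if f: "f \<in> DD A" and g: "g \<in> DD A" for f g
  proof -
    obtain K L where K: "compact K" "\<forall>x. f x \<noteq> 0 \<longrightarrow> x \<in> K" and L: "compact L" "\<forall>x. g x \<noteq> 0 \<longrightarrow> x \<in> L"
      using DD_support[OF f] DD_support[OF g] by blast
    have KL: "compact (K \<union> L)" using K(1) L(1) by (rule compact_Un)
    have "?c (\<lambda>x. f x + g x) = (\<Sum>x\<in>\<gamma> \<inter> (K \<union> L). f x + g x)"
      by (rule conf_functional_sum[OF \<gamma> DD_add[OF f g] KL], drule add_nonzeroD) (use K(2) L(2) in blast)
    then show ?thesis
      using conf_functional_sum[OF \<gamma> f KL] conf_functional_sum[OF \<gamma> g KL] K(2) L(2) by (simp add: sum.distrib)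
  qed
  show scale: "?c (\<lambda>x. k * f x) = k * ?c f" if f: "f \<in> DD A" for f k
  proof -
    obtain K where K: "compact K" "\<forall>x. f x \<noteq> 0 \<longrightarrow> x \<in> K" using DD_support[OF f] by blast
    have "?c (\<lambda>x. k * f x) = (\<Sum>x\<in>\<gamma> \<inter> K. k * f x)"
      by (rule conf_functional_sum[OF \<gamma> DD_scale[OF f] K(1)]) (use K(2) in auto)
    then show ?thesis using conf_functional_sum[OF \<gamma> f K(1)] K(2) by (simp add: sum_distrib_left)
  qed
  define q where "q f = \<bar>\<Sum>x | x \<in> \<gamma> \<and> f (\<lambda>i\<in>{..<1::nat}. x) \<noteq> 0. f (\<lambda>i\<in>{..<1}. x)\<bar>" for f :: "(nat \<Rightarrow> 'a) \<Rightarrow> real"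
  have q: "test_seminorm A 1 q" unfolding q_def[abs_def] by (rule conf_seminorm[OF \<gamma>])
  have q_eq: "q (\<lambda>x. tensor_pow 1 \<psi> x - tensor_pow 1 \<phi> x) = \<bar>?c \<psi> - ?c \<phi>\<bar>" if \<phi>: "\<phi> \<in> DD A" and \<psi>: "\<psi> \<in> DD A" for \<phi> \<psi>
  proof -
    have "?c (\<lambda>x. \<psi> x + (-1) * \<phi> x) = ?c \<psi> - ?c \<phi>"
      using add[OF \<psi> DD_scale[OF \<phi>, of "-1"]] scale[OF \<phi>, of "-1"] by simp
    moreover have "(\<lambda>x. \<psi> x + (-1) * \<phi> x) \<in> DD A" by (intro DD_add DD_scale \<phi> \<psi>)
    ultimately show ?thesis by (simp add: q_def tensor_pow_def conf_functional_def)
  qed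
  show "continuous_map (DD_topology A) euclidean ?c"
    unfolding continuous_map_def topspace_DD_topology
  proof (intro conjI allI impI)
    fix U :: "real set" assume U: "openin euclidean U"
    show "openin (DD_topology A) {\<psi> \<in> DD A. ?c \<psi> \<in> U}"
    proof (subst openin_subopen, intro ballI)
      fix \<phi> assume "\<phi> \<in> {\<psi> \<in> DD A. ?c \<psi> \<in> U}"
      then have \<phi>: "\<phi> \<in> DD A" "?c \<phi> \<in> U" by auto
      then obtain r where r: "r > 0" "\<And>u. dist u (?c \<phi>) < r \<Longrightarrow> u \<in> U" using U open_dist[of U] by auto
      define W where "W = {g \<in> test_fun A 1. q (\<lambda>x. g x - tensor_pow 1 \<phi> x) < r}"
      have \<phi>t: "tensor_pow 1 \<phi> \<in> test_fun A 1" using \<phi>(1) by (simp add: DD_def)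
      have "W \<in> {{g \<in> test_fun A 1. q (\<lambda>x. g x - f x) < r} | q f r. test_seminorm A 1 q \<and> f \<in> test_fun A 1 \<and> r > 0}"
        unfolding W_def using q \<phi>t r(1) by (intro CollectI exI[of _ q] exI[of _ "tensor_pow 1 \<phi>"] exI[of _ r]) simp
      then have W: "openin (test_topology A 1) W"
        unfolding test_topology_def openin_topology_generated_by_iff by (rule generate_topology_on.Basis)
      show "\<exists>T. openin (DD_topology A) T \<and> \<phi> \<in> T \<and> T \<subseteq> {\<psi> \<in> DD A. ?c \<psi> \<in> U}"
      proof (intro exI[of _ "tensor_pow 1 -` W \<inter> DD A"] conjI)
        show "openin (DD_topology A) (tensor_pow 1 -` W \<inter> DD A)"
          unfolding DD_topology_def openin_pullback_topology using W by blast
        have "tensor_pow 1 \<phi> \<in> W" unfolding W_def using \<phi>t q_eq[OF \<phi>(1) \<phi>(1)] r(1) by simp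
        then show "\<phi> \<in> tensor_pow 1 -` W \<inter> DD A" using \<phi>(1) by simp
        show "tensor_pow 1 -` W \<inter> DD A \<subseteq> {\<psi> \<in> DD A. ?c \<psi> \<in> U}"
        proof
          fix \<psi> assume "\<psi> \<in> tensor_pow 1 -` W \<inter> DD A"
          then have \<psi>: "\<psi> \<in> DD A" "q (\<lambda>x. tensor_pow 1 \<psi> x - tensor_pow 1 \<phi> x) < r" by (auto simp: W_def)
          then have "?c \<psi> \<in> U" using q_eq[OF \<phi>(1) \<psi>(1)] by (intro r(2)) (simp add: dist_real_def)
          then show "\<psi> \<in> {\<psi> \<in> DD A. ?c \<psi> \<in> U}" using \<psi>(1) by simp
        qed
      qed
    qed
  qed simp
qed

lemma conf_functional_loc_conf:
  assumes \<gamma>: "\<gamma> \<in> conf_space" and cb: "coord_ball c a r"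
  shows "loc_conf (chart_inv c ` ball a r) (conf_functional A \<gamma>) (\<gamma> \<inter> chart_inv c ` ball a r)"
proof -
  let ?V = "chart_inv c ` ball a r" and ?K = "chart_inv c ` cball a r"
  have VK: "?V \<subseteq> ?K" by (rule image_mono[OF ball_subset_cball])
  have fin: "finite (\<gamma> \<inter> ?K)" by (rule conf_finite[OF \<gamma> coord_ball_compact[OF cb]])
  have "conf_functional A \<gamma> \<phi> = (\<Sum>x\<in>\<gamma> \<inter> ?V. \<phi> x)" if \<phi>: "\<phi> \<in> DD_in ?V" for \<phi>
  proof -
    have "conf_functional A \<gamma> \<phi> = (\<Sum>x\<in>\<gamma> \<inter> ?K. \<phi> x)"
      by (rule conf_functional_sum[OF \<gamma> _ coord_ball_compact[OF cb]]) (use \<phi> VK in \<open>unfold DD_in_def, blast+\<close>)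
    also have "\<dots> = (\<Sum>x\<in>\<gamma> \<inter> ?V. \<phi> x)"
      by (rule sum.mono_neutral_right[OF fin]) (use \<phi> VK in \<open>auto simp: DD_in_def\<close>)
    finally show ?thesis .
  qed
  moreover have "finite (\<gamma> \<inter> ?V)" by (rule finite_subset[OF _ fin]) (use VK in blast)
  ultimately show ?thesis unfolding loc_conf_def by blast
qed

section \<open>Gluing local configurations\<close>

lemma dual_sum:
  assumes \<omega>: "\<omega> \<in> DD_dual A" and \<phi>: "\<And>i. i \<in> I \<Longrightarrow> \<phi> i \<in> DD A"
  shows "\<omega> (\<lambda>x. \<Sum>i\<in>I. \<phi> i x) = (\<Sum>i\<in>I. \<omega> (\<phi> i))"
proof -
  have add: "\<omega> (\<lambda>x. f x + g x) = \<omega> f + \<omega> g" if "f \<in> DD A" "g \<in> DD A" for f g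
    using \<omega> that by (simp add: DD_dual_def dual_space_def topspace_DD_topology)
  have "\<omega> (\<lambda>x. 0 * 0) = 0 * \<omega> (\<lambda>_. 0)"
    using \<omega> DD_zero by (simp only: DD_dual_def dual_space_def topspace_DD_topology mem_Collect_eq)
  then have zero: "\<omega> (\<lambda>_. 0) = 0" by simp
  show ?thesis
    using \<phi>
  proof (induction I rule: infinite_finite_induct)
    case (insert i I)
    then show ?case using add[of "\<phi> i" "\<lambda>x. \<Sum>i\<in>I. \<phi> i x"] DD_sum[of I \<phi>] by simp
  qed (simp_all add: zero)
qed

text \<open>A bump at \<open>x\<close> inside both open sets that vanishes at every other point of
  \<open>Y\<close> and \<open>Z\<close>: its pairing with \<omega> is positive because of
  \<open>Y\<close>, and must come from a point of \<open>Z\<close>, which can only be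
  \<open>x\<close>.\<close>

lemma loc_conf_agree:
  assumes U: "open U" "loc_conf U \<omega> Y" and V: "open V" "loc_conf V \<omega> Z" and x: "x \<in> U" "x \<in> V" "x \<in> Y"
  shows "x \<in> Z"
proof -
  have fin: "finite Y" "finite Z" using U V by (auto simp: loc_conf_def)
  define W where "W = U \<inter> V - ((Y \<union> Z) - {x})"
  have "open W" unfolding W_def using U(1) V(1) fin by (intro open_Diff open_Int finite_imp_closed) auto
  moreover have "x \<in> W" using x by (simp add: W_def)
  ultimately obtain c a r where cb: "coord_ball c a r" "x \<in> chart_inv c ` ball a r" "chart_inv c ` cball a r \<subseteq> W"
    using coord_ball_exists by blast
  obtain \<beta> where \<beta>: "\<beta> \<in> DD A" "\<And>x. \<beta> x \<ge> 0" "\<And>x. \<beta> x > 0 \<longleftrightarrow> x \<in> chart_inv c ` ball a r"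
    using coord_ball_bump[OF cb(1)] by blast
  have "chart_inv c ` ball a r \<subseteq> W" using cb(3) image_mono[OF ball_subset_cball[of a r], of "chart_inv c"] by blast
  then have off: "\<beta> y = 0" if "y \<notin> W" for y using \<beta>(2)[of y] \<beta>(3)[of y] that by force
  have \<beta>in: "\<beta> \<in> DD_in U" "\<beta> \<in> DD_in V" using \<beta>(1) off by (auto simp: DD_in_def W_def)
  have "(\<Sum>y\<in>Y. \<beta> y) = (\<Sum>y\<in>Z. \<beta> y)" 
  proof -
    have "\<omega> \<beta> = (\<Sum>y\<in>Y. \<beta> y)" "\<omega> \<beta> = (\<Sum>y\<in>Z. \<beta> y)" using U(2) V(2) \<beta>in unfolding loc_conf_def by blast+
    then show ?thesis by simp
  qed
  moreover have "(\<Sum>y\<in>Y. \<beta> y) \<ge> \<beta> x" using fin(1) x(3) \<beta>(2) by (intro member_le_sum) auto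
  moreover have "\<beta> x > 0" using \<beta>(3) cb(2) by blast
  ultimately have "(\<Sum>y\<in>Z. \<beta> y) \<noteq> 0" by linarith
  then obtain y where y: "y \<in> Z" "\<beta> y \<noteq> 0" by (rule sum.not_neutral_contains_not_neutral)
  then have "y \<in> W" using off by blast
  then show ?thesis using y(1) by (auto simp: W_def)
qed

text \<open>By \<open>loc_conf_agree\<close> the local sets are the traces of one set \<gamma>,
  locally finite because compact sets have finite subcovers. The partition of unity is built
  separately for each test function, over a finite subcover of its support.\<close>

lemma dual_loc_conf_imp:
  assumes \<omega>: "\<omega> \<in> DD_dual A"
    and cov: "\<And>V. V \<in> \<V> \<Longrightarrow> \<exists>c a r. coord_ball c a r \<and> V = chart_inv c ` ball a r" "\<Union>\<V> = UNIV"
    and loc: "\<And>V. V \<in> \<V> \<Longrightarrow> \<exists>Z. loc_conf V \<omega> Z"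
  shows "\<omega> \<in> conf_functional A ` conf_space"
proof -
  have op: "open V" if "V \<in> \<V>" for V using cov(1)[OF that] coord_ball_open by blast
  obtain Z where Z: "\<And>V. V \<in> \<V> \<Longrightarrow> loc_conf V \<omega> (Z V)" using loc by metis
  define \<gamma> where "\<gamma> = (\<Union>V\<in>\<V>. Z V)"
  have \<gamma>V: "\<gamma> \<inter> V = Z V" if V: "V \<in> \<V>" for V
  proof
    show "Z V \<subseteq> \<gamma> \<inter> V" using Z[OF V] V unfolding \<gamma>_def loc_conf_def by blast
    show "\<gamma> \<inter> V \<subseteq> Z V"
    proof
      fix x assume "x \<in> \<gamma> \<inter> V"
      then obtain U where U: "U \<in> \<V>" "x \<in> Z U" "x \<in> V" unfolding \<gamma>_def by blast
      have "x \<in> U" using Z[OF U(1)] U(2) unfolding loc_conf_def by blast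
      then show "x \<in> Z V" using loc_conf_agree[OF op[OF U(1)] Z[OF U(1)] op[OF V] Z[OF V]] U by blast
    qed
  qed
  have \<gamma>: "\<gamma> \<in> conf_space"
    unfolding conf_space_def
  proof (intro CollectI allI impI)
    fix K :: "'a set" assume "compact K"
    then obtain F where F: "F \<subseteq> \<V>" "finite F" "K \<subseteq> \<Union>F"
      by (rule compactE[of K \<V>]) (use cov(2) op in auto)
    have "\<gamma> \<inter> K \<subseteq> (\<Union>V\<in>F. \<gamma> \<inter> V)" using F(3) by blast
    moreover have "finite (\<Union>V\<in>F. \<gamma> \<inter> V)"
    proof (rule finite_UN_I[OF F(2)])
      fix V assume "V \<in> F"
      then have "V \<in> \<V>" using F(1) by blast
      then show "finite (\<gamma> \<inter> V)" using Z \<gamma>V by (simp add: loc_conf_def)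
    qed
    ultimately show "finite (\<gamma> \<inter> K)" by (rule finite_subset)
  qed
  have "\<omega> \<phi> = conf_functional A \<gamma> \<phi>" if \<phi>: "\<phi> \<in> DD A" for \<phi>
  proof -
    obtain K where K: "compact K" "\<forall>x. \<phi> x \<noteq> 0 \<longrightarrow> x \<in> K" using DD_support[OF \<phi>] by blast
    obtain F where F: "F \<subseteq> \<V>" "finite F" "K \<subseteq> \<Union>F"
      by (rule compactE[OF K(1), of \<V>]) (use cov(2) op in auto)
    have "\<forall>V\<in>F. \<exists>\<beta>. \<beta> \<in> DD A \<and> (\<forall>x. \<beta> x \<ge> 0) \<and> (\<forall>x. \<beta> x > 0 \<longleftrightarrow> x \<in> V)"
    proof
      fix V assume "V \<in> F"
      then obtain c a r where cb: "coord_ball c a r" "V = chart_inv c ` ball a r" using F(1) cov(1) by blast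
      obtain \<beta> where "\<beta> \<in> DD A" "\<And>x. \<beta> x \<ge> 0" "\<And>x. \<beta> x > 0 \<longleftrightarrow> x \<in> chart_inv c ` ball a r"
        using coord_ball_bump[OF cb(1)] by blast
      then show "\<exists>\<beta>. \<beta> \<in> DD A \<and> (\<forall>x. \<beta> x \<ge> 0) \<and> (\<forall>x. \<beta> x > 0 \<longleftrightarrow> x \<in> V)"
        unfolding cb(2) by (intro exI[of _ \<beta>]) simp
    qed
    then obtain \<beta> where \<beta>: "\<And>V. V \<in> F \<Longrightarrow> \<beta> V \<in> DD A" "\<And>V x. V \<in> F \<Longrightarrow> \<beta> V x \<ge> 0" "\<And>V x. V \<in> F \<Longrightarrow> \<beta> V x > 0 \<longleftrightarrow> x \<in> V"
      by metis
    define s where "s x = (\<Sum>V\<in>F. \<beta> V x)" for x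
    have U: "open (\<Union>F)" using op F(1) by blast
    have s: "msmooth A (\<Union>F) s" unfolding s_def
      by (rule msmooth_subset[OF DD_msmooth[OF DD_sum[of F \<beta>]]]) (use \<beta>(1) in auto)
    have s_pos: "s x > 0" if x: "x \<in> \<Union>F" for x
    proof -
      obtain V where V: "V \<in> F" "x \<in> V" using x by blast
      have "0 < \<beta> V x" using \<beta>(3)[OF V(1)] V(2) by blast
      also have "\<beta> V x \<le> s x" unfolding s_def using F(2) V(1) \<beta>(2) by (intro member_le_sum) auto
      finally show ?thesis .
    qed
    \<comment> \<open>Division by \<open>s\<close> takes place on the union of \<open>F\<close>,
      where \<open>s\<close> is positive; since \<phi> vanishes off a compact subset of that union,
      extension by 0 stays smooth.\<close>
    define \<phi>V where "\<phi>V V x = (if x \<in> \<Union>F then \<phi> x * \<beta> V x * inverse (s x) else 0)" for V x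
    have \<phi>V: "\<phi>V V \<in> DD A" if "V \<in> F" for V
      unfolding \<phi>V_def
    proof (rule DD_if[OF U _ K(1) F(3)])
      show "msmooth A (\<Union>F) (\<lambda>x. \<phi> x * \<beta> V x * inverse (s x))"
        by (intro msmooth_mult U msmooth_inverse s s_pos)
          (use msmooth_subset[OF DD_msmooth[OF \<phi>]] msmooth_subset[OF DD_msmooth[OF \<beta>(1)[OF that]]] in auto)
    qed (use K(2) in auto)
    have \<phi>V_in: "\<phi>V V \<in> DD_in V" if "V \<in> F" for V
    proof -
      have "\<beta> V x = 0" if "x \<notin> V" for x using \<beta>(2)[OF \<open>V \<in> F\<close>, of x] \<beta>(3)[OF \<open>V \<in> F\<close>, of x] that by force
      then show ?thesis using \<phi>V[OF that] by (simp add: DD_in_def \<phi>V_def)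
    qed
    have sum: "(\<Sum>V\<in>F. \<phi>V V x) = \<phi> x" for x
    proof (cases "x \<in> \<Union>F")
      case True
      have "(\<Sum>V\<in>F. \<phi>V V x) = (\<Sum>V\<in>F. \<phi> x * \<beta> V x * inverse (s x))" using True by (simp add: \<phi>V_def)
      also have "\<dots> = \<phi> x * s x * inverse (s x)" by (simp add: s_def sum_distrib_left sum_distrib_right)
      also have "\<dots> = \<phi> x" using s_pos[OF True] by simp
      finally show ?thesis .
    next
      case False
      then have "\<phi> x = 0" using K(2) F(3) by blast
      then show ?thesis using False by (simp add: \<phi>V_def)
    qed
    have fin: "finite (\<gamma> \<inter> K)" by (rule conf_finite[OF \<gamma> K(1)])
    have "\<omega> \<phi> = \<omega> (\<lambda>x. \<Sum>V\<in>F. \<phi>V V x)" by (simp add: sum)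
    also have "\<dots> = (\<Sum>V\<in>F. \<omega> (\<phi>V V))" by (rule dual_sum[OF \<omega> \<phi>V])
    also have "\<dots> = (\<Sum>V\<in>F. \<Sum>x\<in>\<gamma> \<inter> K. \<phi>V V x)"
    proof (rule sum.cong[OF refl])
      fix V assume V: "V \<in> F"
      then have V': "V \<in> \<V>" using F(1) by blast
      have "\<omega> (\<phi>V V) = (\<Sum>x\<in>\<gamma> \<inter> V. \<phi>V V x)"
        using Z[OF V'] \<phi>V_in[OF V] unfolding loc_conf_def \<gamma>V[OF V'] by blast
      also have "\<dots> = (\<Sum>x\<in>\<gamma> \<inter> V \<inter> K. \<phi>V V x)"
      proof (rule sum.mono_neutral_right)
        show "finite (\<gamma> \<inter> V)" using Z[OF V'] unfolding loc_conf_def \<gamma>V[OF V'] by blast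
        show "\<forall>i\<in>\<gamma> \<inter> V - \<gamma> \<inter> V \<inter> K. \<phi>V V i = 0" using K(2) by (auto simp: \<phi>V_def)
      qed blast
      also have "\<dots> = (\<Sum>x\<in>\<gamma> \<inter> K. \<phi>V V x)"
        by (rule sum.mono_neutral_left[OF fin]) (use \<phi>V_in[OF V] in \<open>auto simp: DD_in_def\<close>)
      finally show "\<omega> (\<phi>V V) = (\<Sum>x\<in>\<gamma> \<inter> K. \<phi>V V x)" .
    qed
    also have "\<dots> = (\<Sum>x\<in>\<gamma> \<inter> K. \<Sum>V\<in>F. \<phi>V V x)" by (rule sum.swap)
    also have "\<dots> = (\<Sum>x\<in>\<gamma> \<inter> K. \<phi> x)" by (simp only: sum)
    also have "\<dots> = conf_functional A \<gamma> \<phi>" using conf_functional_sum[OF \<gamma> \<phi> K(1)] K(2) by simp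
    finally show ?thesis .
  qed
  moreover have "\<omega> \<in> extensional (DD A)" using \<omega> by (simp add: DD_dual_def dual_space_def topspace_DD_topology)
  moreover have "conf_functional A \<gamma> \<in> extensional (DD A)" by (simp add: conf_functional_def)
  ultimately have "\<omega> = conf_functional A \<gamma>" by (intro extensionalityI) auto
  then show ?thesis using \<gamma> by blast
qed

section \<open>Cylinder sets and countable covers\<close>

lemma cylinder_sigma_simps: "space (cylinder_sigma A) = DD_dual A"
  unfolding cylinder_sigma_def by (rule space_measure_of) blast

lemma evaluation_measurable:
  assumes "\<phi> \<in> DD A"
  shows "(\<lambda>\<omega>. \<omega> \<phi>) \<in> borel_measurable (cylinder_sigma A)"
proof (rule measurableI)
  fix B :: "real set" assume B: "B \<in> sets borel"
  have "sets (cylinder_sigma A) = sigma_sets (DD_dual A) {{\<omega> \<in> DD_dual A. \<omega> \<phi> \<in> B} | \<phi> B. \<phi> \<in> DD A \<and> B \<in> sets borel}"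
    unfolding cylinder_sigma_def by (rule sets_measure_of) blast
  moreover have "(\<lambda>\<omega>. \<omega> \<phi>) -` B \<inter> space (cylinder_sigma A) = {\<omega> \<in> DD_dual A. \<omega> \<phi> \<in> B}"
    unfolding cylinder_sigma_simps by blast
  ultimately show "(\<lambda>\<omega>. \<omega> \<phi>) -` B \<inter> space (cylinder_sigma A) \<in> sets (cylinder_sigma A)"
    using assms B by (auto intro!: sigma_sets.Basic)
qed simp

text \<open>Heredity of \<open>P\<close> allows each neighbourhood to be shrunk to a coordinate
  ball; second countability then leaves a countable subcover.\<close>

lemma countable_coord_cover:
  assumes cover: "\<And>p. \<exists>W. open W \<and> p \<in> W \<and> P W" and mono: "\<And>V W. P W \<Longrightarrow> V \<subseteq> W \<Longrightarrow> P V"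
  obtains \<V> where "countable \<V>" "\<Union>\<V> = UNIV"
    "\<And>V. V \<in> \<V> \<Longrightarrow> P V \<and> (\<exists>c a r. coord_ball c a r \<and> V = chart_inv c ` ball a r)"
proof -
  define F where "F = {V. P V \<and> (\<exists>c a r. coord_ball c a r \<and> V = chart_inv c ` ball a r)}"
  have op: "open V" if "V \<in> F" for V using that coord_ball_open by (auto simp: F_def)
  obtain \<V> where \<V>: "\<V> \<subseteq> F" "countable \<V>" "\<Union>\<V> = \<Union>F" using Lindelof[of F] op by metis
  have "p \<in> \<Union>F" for p
  proof -
    obtain W where W: "open W" "p \<in> W" "P W" using cover by blast
    obtain c a r where cb: "coord_ball c a r" "p \<in> chart_inv c ` ball a r" "chart_inv c ` cball a r \<subseteq> W"
      using coord_ball_exists[OF W(1,2)] by blast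
    have "chart_inv c ` ball a r \<subseteq> W" using cb(3) image_mono[OF ball_subset_cball[of a r], of "chart_inv c"] by blast
    then have "chart_inv c ` ball a r \<in> F" unfolding F_def using mono[OF W(3)] cb(1) by blast
    then show ?thesis using cb(2) by blast
  qed
  then have "\<Union>\<V> = UNIV" using \<V>(3) by blast
  then show thesis using that[OF \<V>(2)] \<V>(1) unfolding F_def by blast
qed

end

section \<open>Functions on finite configurations\<close>

lemma cfg_size [simp]: "finite I \<Longrightarrow> size (cfg x I) = card I"
  by (simp add: cfg_def)

lemma set_mset_cfg [simp]: "finite I \<Longrightarrow> set_mset (cfg x I) = x ` I"
  by (simp add: cfg_def)

lemma sum_mset_cfg: "finite I \<Longrightarrow> (\<Sum>y\<in>#cfg x I. f y) = (\<Sum>i\<in>I. f (x i))"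
  by (simp add: cfg_def image_mset.compositionality comp_def sum_unfold_sum_mset)

lemma cfg_remove:
  assumes "finite I" "i \<in> I"
  shows "cfg x I - {#x i#} = cfg x (I - {i})"
proof -
  have "mset_set I = add_mset i (mset_set (I - {i}))" using mset_set.remove[OF assms] .
  then show ?thesis by (simp add: cfg_def)
qed

lemma cfg_exists: "\<exists>x. cfg x {..<size \<eta>} = \<eta>"
proof -
  obtain xs where xs: "mset xs = \<eta>" using ex_mset by blast
  have "image_mset (\<lambda>i. xs ! i) (mset_set {..<length xs}) = mset (map (\<lambda>i. xs ! i) [0..<length xs])"
    by (simp add: lessThan_atLeast0 mset_map)
  also have "map (\<lambda>i. xs ! i) [0..<length xs] = xs" by (rule map_nth)
  finally show ?thesis using xs by (intro exI[of _ "\<lambda>i. xs ! i"]) (auto simp: cfg_def)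
qed

lemma cfg_conf0: "cfg x {..<n} \<in> conf0 \<longleftrightarrow> inj_on x {..<n}"
proof
  assume inj: "inj_on x {..<n}"
  then have "cfg x {..<n} = mset_set (x ` {..<n})" by (simp add: cfg_def image_mset_mset_set)
  then show "cfg x {..<n} \<in> conf0" by (simp add: conf0_def count_mset_set')
next
  assume c: "cfg x {..<n} \<in> conf0"
  show "inj_on x {..<n}"
  proof (rule inj_onI, rule ccontr)
    fix i j assume ij: "i \<in> {..<n}" "j \<in> {..<n}" "x i = x j" "i \<noteq> j"
    have "mset_set {..<n} = add_mset i (add_mset j (mset_set ({..<n} - {i} - {j})))"
      using mset_set.remove[of "{..<n}" i] mset_set.remove[of "{..<n} - {i}" j] ij by simp
    then have "count (cfg x {..<n}) (x i) \<ge> 2" using ij(3) by (simp add: cfg_def)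
    then show False using c by (auto simp: conf0_def dest!: spec[of _ "x i"])
  qed
qed

lemma conf0_eq_mset_set: "\<eta> \<in> conf0 \<Longrightarrow> \<eta> = mset_set (set_mset \<eta>)"
proof (rule multiset_eqI)
  fix x assume "\<eta> \<in> conf0"
  then have "count \<eta> x \<le> 1" by (simp add: conf0_def)
  moreover have "count \<eta> x = 0 \<longleftrightarrow> x \<notin># \<eta>" by (simp add: not_in_iff)
  ultimately show "count \<eta> x = count (mset_set (set_mset \<eta>)) x"
    by (simp add: count_mset_set') linarith
qed

text \<open>On configurations with as many points as there are functions, say \<open>n\<close>, this
  is \<open>n!\<close> times the symmetric tensor product. The recursion removes one point at a time
  and so makes sense on multisets without an enumeration.\<close>

primrec tensor :: "('a \<Rightarrow> real) list \<Rightarrow> 'a multiset \<Rightarrow> complex" where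
  "tensor [] \<eta> = (if \<eta> = {#} then 1 else 0)"
| "tensor (\<phi> # \<phi>s) \<eta> = (\<Sum>x\<in>#\<eta>. complex_of_real (\<phi> x) * tensor \<phi>s (\<eta> - {#x#}))"

lemma tensor_size: "size \<eta> \<noteq> length \<phi>s \<Longrightarrow> tensor \<phi>s \<eta> = 0"
proof (induction \<phi>s arbitrary: \<eta>)
  case (Cons \<phi> \<phi>s)
  have "complex_of_real (\<phi> x) * tensor \<phi>s (\<eta> - {#x#}) = 0" if "x \<in># \<eta>" for x
  proof -
    have "size (\<eta> - {#x#}) \<noteq> length \<phi>s"
      using Cons.prems size_Diff_singleton[OF that] that by (cases "size \<eta>") auto
    then show ?thesis using Cons.IH by simp
  qed
  then show ?case by (simp add: sum_mset.neutral)
qed auto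

lemma sum_mset_nonzero: "(\<Sum>x\<in>#\<eta>. f x) \<noteq> (0::complex) \<Longrightarrow> \<exists>x\<in>#\<eta>. f x \<noteq> 0"
  by (metis (mono_tags, lifting) sum_mset.neutral imageE set_image_mset)

lemma tensor_support:
  assumes "\<And>\<phi> x. \<phi> \<in> set \<phi>s \<Longrightarrow> \<phi> x \<noteq> 0 \<Longrightarrow> x \<in> K" "tensor \<phi>s \<eta> \<noteq> 0"
  shows "set_mset \<eta> \<subseteq> K"
  using assms
proof (induction \<phi>s arbitrary: \<eta>)
  case Nil
  then show ?case by (simp split: if_splits)
next
  case (Cons \<phi> \<phi>s)
  then obtain x where x: "x \<in># \<eta>" "complex_of_real (\<phi> x) * tensor \<phi>s (\<eta> - {#x#}) \<noteq> 0"
    using sum_mset_nonzero[of "\<lambda>x. complex_of_real (\<phi> x) * tensor \<phi>s (\<eta> - {#x#})" \<eta>] by auto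
  have "set_mset (\<eta> - {#x#}) \<subseteq> K" by (rule Cons.IH) (use Cons.prems(1) x(2) in auto)
  moreover have "x \<in> K" using Cons.prems(1)[of \<phi> x] x(2) by auto
  moreover have "\<eta> = add_mset x (\<eta> - {#x#})" using x(1) by simp
  ultimately show ?case by (metis insert_subset set_mset_add_mset_insert)
qed

lemma tensor_cfg_Cons:
  "finite I \<Longrightarrow> tensor (\<phi> # \<phi>s) (cfg x I) = (\<Sum>i\<in>I. complex_of_real (\<phi> (x i)) * tensor \<phi>s (cfg x (I - {i})))"
proof -
  assume I: "finite I"
  have "tensor (\<phi> # \<phi>s) (cfg x I) = (\<Sum>i\<in>I. complex_of_real (\<phi> (x i)) * tensor \<phi>s (cfg x I - {#x i#}))"
    by (simp add: sum_mset_cfg[OF I])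
  also have "\<dots> = (\<Sum>i\<in>I. complex_of_real (\<phi> (x i)) * tensor \<phi>s (cfg x (I - {i})))"
    by (rule sum.cong[OF refl]) (simp add: cfg_remove[OF I])
  finally show ?thesis .
qed

subsection \<open>The convolution with one-particle functions\<close>

lemma finite_partitions3: "finite (partitions3 n)"
proof (rule finite_subset)
  show "partitions3 n \<subseteq> Pow {..<n} \<times> Pow {..<n} \<times> Pow {..<n}" by (auto simp: partitions3_def)
qed simp

lemma one_particle_cfg_singleton: "one_particle \<phi> (cfg x {i}) = complex_of_real (\<phi> (x i))"
  by (simp add: one_particle_def cfg_def)

text \<open>\<open>one_particle\<close> vanishes unless \<open>I \<union> J\<close> is a singleton.
  Its index lies either in \<open>I\<close>, which removes the point from the argument of
  \<open>G\<close>, or in \<open>J\<close>, which keeps it.\<close>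

lemma star_one_particle_cfg:
  "star (one_particle \<phi>) G (cfg x {..<n}) =
    (\<Sum>i<n. complex_of_real (\<phi> (x i)) * (G (cfg x {..<n}) + G (cfg x ({..<n} - {i}))))"
proof -
  let ?t = "\<lambda>(I, J, L). one_particle \<phi> (cfg x (I \<union> J)) * G (cfg x (J \<union> L))"
  let ?a = "\<lambda>i. ({i}, {}, {..<n} - {i})" and ?b = "\<lambda>i. ({}, {i}, {..<n} - {i})"
  have sub: "?a ` {..<n} \<union> ?b ` {..<n} \<subseteq> partitions3 n" by (auto simp: partitions3_def)
  have "star (one_particle \<phi>) G (cfg x {..<n}) = sum ?t (partitions3 n)"
    unfolding star_cfg star_tuple_def ..
  also have "\<dots> = sum ?t (?a ` {..<n} \<union> ?b ` {..<n})"
  proof (rule sum.mono_neutral_right[OF finite_partitions3 sub], rule ballI)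
    fix p assume p: "p \<in> partitions3 n - (?a ` {..<n} \<union> ?b ` {..<n})"
    obtain I J L where IJL: "p = (I, J, L)" by (cases p)
    have u: "I \<union> J \<union> L = {..<n}" "I \<inter> J = {}" "I \<inter> L = {}" "J \<inter> L = {}"
      using p IJL by (auto simp: partitions3_def)
    have "card (I \<union> J) \<noteq> 1"
    proof
      assume "card (I \<union> J) = 1"
      then obtain i where i: "I \<union> J = {i}" by (rule card_1_singletonE)
      then have L: "L = {..<n} - {i}" "i < n" using u by blast+
      have "i \<in> I \<and> J \<inter> {i} = {} \<or> i \<in> J \<and> I \<inter> {i} = {}" using i u(2) by auto
      moreover have "I \<subseteq> {i}" "J \<subseteq> {i}" using i by (simp_all flip: i)
      ultimately have "I = {i} \<and> J = {} \<or> I = {} \<and> J = {i}" by auto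
      then have "p = ?a i \<or> p = ?b i" unfolding IJL L(1) by (elim disjE conjE) (simp_all only: simp_thms prod.inject)
      then have "p \<in> ?a ` {..<n} \<union> ?b ` {..<n}"
      proof
        assume a: "p = ?a i"
        show ?thesis unfolding a by (rule UnI1, rule imageI) (simp add: L(2))
      next
        assume b: "p = ?b i"
        show ?thesis unfolding b by (rule UnI2, rule imageI) (simp add: L(2))
      qed
      then show False using p by blast
    qed
    moreover have "finite (I \<union> J)" using u(1) by (metis finite_Un finite_lessThan)
    ultimately show "?t p = 0" by (simp add: IJL one_particle_def)
  qed
  also have "\<dots> = sum ?t (?a ` {..<n}) + sum ?t (?b ` {..<n})"
    by (rule sum.union_disjoint) auto
  also have "sum ?t (?a ` {..<n}) = (\<Sum>i<n. complex_of_real (\<phi> (x i)) * G (cfg x ({..<n} - {i})))"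
    by (subst sum.reindex) (auto simp: inj_on_def one_particle_cfg_singleton)
  also have "sum ?t (?b ` {..<n}) = (\<Sum>i<n. complex_of_real (\<phi> (x i)) * G (cfg x {..<n}))"
    by (subst sum.reindex) (auto simp: inj_on_def one_particle_cfg_singleton insert_absorb intro!: sum.cong)
  finally show ?thesis by (simp add: sum.distrib algebra_simps)
qed

lemma star_one_particle:
  "star (one_particle \<phi>) G \<eta> = (\<Sum>x\<in>#\<eta>. complex_of_real (\<phi> x) * (G \<eta> + G (\<eta> - {#x#})))"
proof -
  obtain x where x: "cfg x {..<size \<eta>} = \<eta>" using cfg_exists by blast
  have "star (one_particle \<phi>) G (cfg x {..<size \<eta>}) =
      (\<Sum>y\<in>#cfg x {..<size \<eta>}. complex_of_real (\<phi> y) * (G (cfg x {..<size \<eta>}) + G (cfg x {..<size \<eta>} - {#y#})))"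
    unfolding star_one_particle_cfg by (simp add: sum_mset_cfg cfg_remove)
  then show ?thesis unfolding x .
qed

lemma sum_mset_remove:
  fixes f g :: "'a \<Rightarrow> complex"
  shows "x \<in># \<eta> \<Longrightarrow> (\<Sum>y\<in>#\<eta>. f y) = f x + (\<Sum>y\<in>#\<eta> - {#x#}. f y)"
  by (metis insert_DiffM sum_mset.insert image_mset_add_mset)

text \<open>A nonzero tensor distributes the points of \<eta> among its factors without remainder,
  so summing \<phi> over the points amounts to multiplying \<phi> into each factor in turn.\<close>

lemma tensor_pairing:
  "(\<Sum>x\<in>#\<eta>. complex_of_real (\<phi> x)) * tensor \<phi>s \<eta> =
    (\<Sum>k<length \<phi>s. tensor (\<phi>s[k := (\<lambda>x. \<phi> x * (\<phi>s ! k) x)]) \<eta>)"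
proof (induction \<phi>s arbitrary: \<eta>)
  case (Cons \<psi> \<phi>s)
  let ?p = "\<lambda>\<eta>. \<Sum>x\<in>#\<eta>. complex_of_real (\<phi> x)"
  have "?p \<eta> * tensor (\<psi> # \<phi>s) \<eta> = (\<Sum>x\<in>#\<eta>. ?p \<eta> * (complex_of_real (\<psi> x) * tensor \<phi>s (\<eta> - {#x#})))"
    by (simp add: sum_mset_distrib_left)
  also have "\<dots> = (\<Sum>x\<in>#\<eta>. complex_of_real (\<phi> x * \<psi> x) * tensor \<phi>s (\<eta> - {#x#}) +
      (\<Sum>k<length \<phi>s. complex_of_real (\<psi> x) * tensor (\<phi>s[k := (\<lambda>x. \<phi> x * (\<phi>s ! k) x)]) (\<eta> - {#x#})))"
  proof (intro arg_cong[of _ _ sum_mset] image_mset_cong)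
    fix x assume x: "x \<in># \<eta>"
    have "?p \<eta> * (complex_of_real (\<psi> x) * tensor \<phi>s (\<eta> - {#x#})) =
        complex_of_real (\<phi> x * \<psi> x) * tensor \<phi>s (\<eta> - {#x#}) +
        complex_of_real (\<psi> x) * (?p (\<eta> - {#x#}) * tensor \<phi>s (\<eta> - {#x#}))"
      unfolding sum_mset_remove[OF x, of "\<lambda>x. complex_of_real (\<phi> x)"] by (simp add: algebra_simps)
    then show "?p \<eta> * (complex_of_real (\<psi> x) * tensor \<phi>s (\<eta> - {#x#})) =
        complex_of_real (\<phi> x * \<psi> x) * tensor \<phi>s (\<eta> - {#x#}) +
        (\<Sum>k<length \<phi>s. complex_of_real (\<psi> x) * tensor (\<phi>s[k := (\<lambda>x. \<phi> x * (\<phi>s ! k) x)]) (\<eta> - {#x#}))"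
      unfolding Cons.IH by (simp add: sum_distrib_left)
  qed
  also have "\<dots> = tensor ((\<lambda>x. \<phi> x * \<psi> x) # \<phi>s) \<eta> +
      (\<Sum>k<length \<phi>s. tensor (\<psi> # \<phi>s[k := (\<lambda>x. \<phi> x * (\<phi>s ! k) x)]) \<eta>)"
  proof -
    have "(\<Sum>x\<in>#\<eta>. \<Sum>k<length \<phi>s. h x k) = (\<Sum>k<length \<phi>s. \<Sum>x\<in>#\<eta>. h x k)" for h :: "'a \<Rightarrow> nat \<Rightarrow> complex"
      by (induction \<eta>) (simp_all add: sum.distrib)
    then show ?thesis by (simp add: sum_mset.distrib)
  qed
  also have "\<dots> = (\<Sum>k<length (\<psi> # \<phi>s). tensor ((\<psi> # \<phi>s)[k := (\<lambda>x. \<phi> x * ((\<psi> # \<phi>s) ! k) x)]) \<eta>)"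
    by (simp add: sum.lessThan_Suc_shift del: sum.lessThan_Suc tensor.simps(2))
  finally show ?case .
qed simp

text \<open>A creation term plus a term that multiplies \<phi> into the factors present. Solved for
  the former, it expresses a tensor of length \<open>n + 1\<close> through a convolution and tensors
  of length \<open>n\<close>.\<close>

lemma star_tensor:
  "star (one_particle \<phi>) (tensor \<phi>s) \<eta> =
    tensor (\<phi> # \<phi>s) \<eta> + (\<Sum>k<length \<phi>s. tensor (\<phi>s[k := (\<lambda>x. \<phi> x * (\<phi>s ! k) x)]) \<eta>)"
proof -
  have "star (one_particle \<phi>) (tensor \<phi>s) \<eta> =
      (\<Sum>x\<in>#\<eta>. complex_of_real (\<phi> x)) * tensor \<phi>s \<eta> + tensor (\<phi> # \<phi>s) \<eta>"
    unfolding star_one_particle by (simp add: distrib_left sum_mset.distrib sum_mset_distrib_right)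
  then show ?thesis unfolding tensor_pairing by simp
qed

lemma star_lin:
  "star G (\<lambda>\<eta>. G1 \<eta> + z * G2 \<eta>) \<eta> = star G G1 \<eta> + z * star G G2 \<eta>"
  "star (\<lambda>\<eta>. G1 \<eta> + z * G2 \<eta>) G \<eta> = star G1 G \<eta> + z * star G2 G \<eta>"
  by (simp_all add: star_def star_tuple_def sum_distrib_left sum.distrib[symmetric] case_prod_beta' algebra_simps)

lemma star_cnj: "star G2 (conj_fun G1) \<eta> = cnj (star G1 (conj_fun G2) \<eta>)"
proof -
  have "star_tuple G2 (conj_fun G1) n x = cnj (star_tuple G1 (conj_fun G2) n x)" for n x
    unfolding star_tuple_def cnj_sum
    by (rule sum.reindex_bij_witness[where i = "\<lambda>(I, J, L). (L, J, I)" and j = "\<lambda>(I, J, L). (L, J, I)"])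
      (auto simp: partitions3_def conj_fun_def Un_commute)
  then show ?thesis by (simp add: star_def)
qed

text \<open>Only the triple with \<open>J\<close> and \<open>L\<close> empty survives. Pairing with
  this unit of the convolution turns \<open>a_form\<close> into plain integration.\<close>

lemma star_vac: "star G (tensor []) \<eta> = G \<eta>"
proof -
  obtain x where x: "cfg x {..<size \<eta>} = \<eta>" using cfg_exists by blast
  let ?n = "size \<eta>"
  have "star G (tensor []) (cfg x {..<?n}) =
      (\<Sum>(I, J, L)\<in>partitions3 ?n. G (cfg x (I \<union> J)) * tensor [] (cfg x (J \<union> L)))"
    unfolding star_cfg star_tuple_def ..
  also have "\<dots> = (\<Sum>(I, J, L)\<in>{({..<?n}, {}, {})}. G (cfg x (I \<union> J)) * tensor [] (cfg x (J \<union> L)))"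
  proof (rule sum.mono_neutral_right[OF finite_partitions3], goal_cases)
    case 1
    then show ?case by (simp add: partitions3_def)
  next
    case 2
    show ?case
    proof
      fix p assume p: "p \<in> partitions3 ?n - {({..<?n}, {}, {})}"
      obtain I J L where IJL: "p = (I, J, L)" by (cases p)
      have "J \<union> L \<noteq> {}" "finite (J \<union> L)"
        using p IJL finite_subset[of "J \<union> L" "{..<?n}"] by (auto simp: partitions3_def)
      then have "cfg x (J \<union> L) \<noteq> {#}" by (simp flip: size_eq_0_iff_empty)
      then show "(case p of (I, J, L) \<Rightarrow> G (cfg x (I \<union> J)) * tensor [] (cfg x (J \<union> L))) = 0" by (simp add: IJL)
    qed
  qed
  also have "\<dots> = G (cfg x {..<?n})" by (simp add: cfg_def)
  finally show ?thesis unfolding x .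
qed

subsection \<open>Alternating sums over subsets\<close>

text \<open>The Moebius transform on the lattice of finite subsets, inverse to summation over
  subsets.\<close>

definition alt_sum :: "('a set \<Rightarrow> 'b::comm_ring_1) \<Rightarrow> 'a set \<Rightarrow> 'b" where
  "alt_sum f Y = (\<Sum>Z\<in>Pow Y. (- 1) ^ card (Y - Z) * f Z)"

lemma alt_sum_insert:
  assumes "finite Y" "y \<notin> Y"
  shows "alt_sum f (insert y Y) = alt_sum (\<lambda>Z. f (insert y Z)) Y - alt_sum f Y"
proof -
  have "alt_sum f (insert y Y) = (\<Sum>Z\<in>Pow Y. (- 1) ^ card (insert y Y - Z) * f Z) +
      (\<Sum>Z\<in>insert y ` Pow Y. (- 1) ^ card (insert y Y - Z) * f Z)"
    unfolding alt_sum_def Pow_insert by (rule sum.union_disjoint) (use assms in auto)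
  also have "(\<Sum>Z\<in>Pow Y. (- 1) ^ card (insert y Y - Z) * f Z) = - alt_sum f Y"
    unfolding alt_sum_def sum_negf[symmetric]
  proof (rule sum.cong[OF refl])
    fix Z assume "Z \<in> Pow Y"
    then have "insert y Y - Z = insert y (Y - Z)" "y \<notin> Y - Z" "finite (Y - Z)" using assms by auto
    then show "(- 1) ^ card (insert y Y - Z) * f Z = - ((- 1) ^ card (Y - Z) * f Z)" by simp
  qed
  also have "(\<Sum>Z\<in>insert y ` Pow Y. (- 1) ^ card (insert y Y - Z) * f Z) = alt_sum (\<lambda>Z. f (insert y Z)) Y"
    unfolding alt_sum_def
  proof (subst sum.reindex)
    show "inj_on (insert y) (Pow Y)" using assms(2) by (auto simp: inj_on_def)
    have "insert y Y - insert y Z = Y - Z" if "Z \<in> Pow Y" for Z using assms(2) by auto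
    then show "sum ((\<lambda>Z. (- 1) ^ card (insert y Y - Z) * f Z) \<circ> insert y) (Pow Y) =
        (\<Sum>Z\<in>Pow Y. (- 1) ^ card (Y - Z) * f (insert y Z))" by (intro sum.cong) auto
  qed
  finally show ?thesis by simp
qed

lemma alt_sum_cong: "(\<And>Z. Z \<subseteq> Y \<Longrightarrow> f Z = g Z) \<Longrightarrow> alt_sum f Y = alt_sum g Y"
  unfolding alt_sum_def by (intro sum.cong) auto

text \<open>The terms with and without \<open>y\<close> cancel when \<open>f\<close> does not notice
  \<open>y\<close>. This is the source of locality: a configuration with a point where the test
  function vanishes drops out of the moments.\<close>

lemma alt_sum_zero:
  assumes "finite Y" "y \<in> Y" "\<And>Z. f (insert y Z) = f (Z - {y})"
  shows "alt_sum f Y = 0"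
proof -
  have "alt_sum f (insert y (Y - {y})) = alt_sum (\<lambda>Z. f (insert y Z)) (Y - {y}) - alt_sum f (Y - {y})"
    by (rule alt_sum_insert) (use assms(1) in auto)
  also have "alt_sum (\<lambda>Z. f (insert y Z)) (Y - {y}) = alt_sum f (Y - {y})"
    by (rule alt_sum_cong) (auto simp: assms(3) intro: arg_cong[of _ _ f])
  finally show ?thesis using assms(2) by (simp add: insert_absorb)
qed

text \<open>Under the Moebius transform, multiplication by the additive function built from
  \<open>h\<close> becomes the operation found in \<open>star_one_particle\<close>.\<close>

lemma alt_sum_weight:
  fixes h :: "'a \<Rightarrow> 'b::comm_ring_1"
  assumes "finite Y"
  shows "alt_sum (\<lambda>Z. (\<Sum>z\<in>Z. h z) * f Z) Y = (\<Sum>y\<in>Y. h y * (alt_sum f Y + alt_sum f (Y - {y})))"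
proof -
  have "alt_sum (\<lambda>Z. (\<Sum>z\<in>Z. h z) * f Z) Y = (\<Sum>y\<in>Y. h y * alt_sum (\<lambda>Z. if y \<in> Z then f Z else 0) Y)"
  proof -
    have "(\<Sum>z\<in>Z. h z) = (\<Sum>y\<in>Y. if y \<in> Z then h y else 0)" if "Z \<subseteq> Y" for Z
      using assms that by (simp add: sum.If_cases Int_absorb1 Int_commute)
    then have "alt_sum (\<lambda>Z. (\<Sum>z\<in>Z. h z) * f Z) Y = (\<Sum>Z\<in>Pow Y. \<Sum>y\<in>Y. h y * ((- 1) ^ card (Y - Z) * (if y \<in> Z then f Z else 0)))"
      unfolding alt_sum_def by (intro sum.cong refl) (auto simp: sum_distrib_left sum_distrib_right intro!: sum.cong)
    also have "\<dots> = (\<Sum>y\<in>Y. \<Sum>Z\<in>Pow Y. h y * ((- 1) ^ card (Y - Z) * (if y \<in> Z then f Z else 0)))" by (rule sum.swap)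
    finally show ?thesis by (simp add: alt_sum_def sum_distrib_left)
  qed
  also have "\<dots> = (\<Sum>y\<in>Y. h y * (alt_sum f Y + alt_sum f (Y - {y})))"
  proof (rule sum.cong[OF refl])
    fix y assume y: "y \<in> Y"
    have Y: "insert y (Y - {y}) = Y" "finite (Y - {y})" "y \<notin> Y - {y}" using y assms by auto
    have "alt_sum (\<lambda>Z. if y \<in> Z then f Z else 0) Y = alt_sum (\<lambda>Z. f (insert y Z)) (Y - {y}) - alt_sum (\<lambda>Z. if y \<in> Z then f Z else 0) (Y - {y})"
      using alt_sum_insert[OF Y(2,3), of "\<lambda>Z. if y \<in> Z then f Z else 0"] unfolding Y(1) by simp
    also have "alt_sum (\<lambda>Z. if y \<in> Z then f Z else 0) (Y - {y}) = alt_sum (\<lambda>_. 0) (Y - {y})"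
      by (rule alt_sum_cong) auto
    also have "alt_sum (\<lambda>Z. f (insert y Z)) (Y - {y}) = alt_sum f Y + alt_sum f (Y - {y})"
      using alt_sum_insert[OF Y(2,3), of f] unfolding Y(1) by simp
    finally show "h y * alt_sum (\<lambda>Z. if y \<in> Z then f Z else 0) Y = h y * (alt_sum f Y + alt_sum f (Y - {y}))"
      by (simp add: alt_sum_def)
  qed
  finally show ?thesis .
qed

primrec star_power :: "('a \<Rightarrow> real) \<Rightarrow> nat \<Rightarrow> 'a multiset \<Rightarrow> complex" where
  "star_power \<phi> 0 = tensor []"
| "star_power \<phi> (Suc k) = star (one_particle \<phi>) (star_power \<phi> k)"

text \<open>Both sides obey the same recursion, the right one by \<open>alt_sum_weight\<close>. At
  exponent 0 the transform of the constant 1 is the indicator of the empty set, which is the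
  vacuum.\<close>

lemma star_power_alt_sum:
  assumes "finite Y"
  shows "star_power \<phi> k (mset_set Y) = alt_sum (\<lambda>Z. complex_of_real ((\<Sum>z\<in>Z. \<phi> z) ^ k)) Y"
  using assms
proof (induction k arbitrary: Y)
  case 0
  show ?case
  proof (cases "Y = {}")
    case False
    then obtain y where y: "y \<in> Y" by blast
    have "alt_sum (\<lambda>Z. complex_of_real ((\<Sum>z\<in>Z. \<phi> z) ^ 0)) Y = 0" by (rule alt_sum_zero[OF 0 y]) simp
    moreover have "mset_set Y \<noteq> {#}" using False 0 by (simp add: mset_set_empty_iff)
    ultimately show ?thesis by simp
  qed (simp add: alt_sum_def)
next
  case (Suc k)
  let ?f = "\<lambda>Z. complex_of_real ((\<Sum>z\<in>Z. \<phi> z) ^ k)"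
  have "star_power \<phi> (Suc k) (mset_set Y) =
      (\<Sum>y\<in>Y. complex_of_real (\<phi> y) * (star_power \<phi> k (mset_set Y) + star_power \<phi> k (mset_set Y - {#y#})))"
    using Suc.prems by (simp add: star_one_particle sum_unfold_sum_mset)
  also have "\<dots> = (\<Sum>y\<in>Y. complex_of_real (\<phi> y) * (alt_sum ?f Y + alt_sum ?f (Y - {y})))"
  proof (rule sum.cong[OF refl])
    fix y assume y: "y \<in> Y"
    have "mset_set Y - {#y#} = mset_set (Y - {y})" using mset_set_Diff[OF Suc.prems, of "{y}"] y by simp
    then show "complex_of_real (\<phi> y) * (star_power \<phi> k (mset_set Y) + star_power \<phi> k (mset_set Y - {#y#})) =
      complex_of_real (\<phi> y) * (alt_sum ?f Y + alt_sum ?f (Y - {y}))"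
      by (simp only: Suc.IH[OF Suc.prems] Suc.IH[OF finite_Diff[OF Suc.prems]])
  qed
  also have "\<dots> = alt_sum (\<lambda>Z. (\<Sum>z\<in>Z. complex_of_real (\<phi> z)) * ?f Z) Y"
    by (rule alt_sum_weight[OF Suc.prems, symmetric])
  finally show ?case by simp
qed

section \<open>Topology of finite configurations\<close>

lemma cfg_cong: "(\<And>i. i \<in> I \<Longrightarrow> x i = y i) \<Longrightarrow> finite I \<Longrightarrow> cfg x I = cfg y I"
  by (auto simp: cfg_def intro!: image_mset_cong)

lemma cfg_exists_PiE: "\<exists>x\<in>PiE {..<size \<eta>} (\<lambda>_. UNIV). cfg x {..<size \<eta>} = \<eta>"
proof -
  obtain x where x: "cfg x {..<size \<eta>} = \<eta>" using cfg_exists by blast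
  have "cfg (restrict x {..<size \<eta>}) {..<size \<eta>} = cfg x {..<size \<eta>}" by (rule cfg_cong) auto
  then show ?thesis using x by (intro bexI[of _ "restrict x {..<size \<eta>}"]) auto
qed

lemma continuous_Xpow_nth: "i < n \<Longrightarrow> continuous_map (Xpow n) euclidean (\<lambda>x. x i)"
  unfolding Xpow_def by (rule continuous_map_product_projection) simp

lemma openin_Xpow_nth:
  assumes "i < n" "open U"
  shows "openin (Xpow n) {x \<in> topspace (Xpow n). x i \<in> U}"
  using openin_continuous_map_preimage[OF continuous_Xpow_nth[OF assms(1)], of U] assms(2) by simp

lemma openin_Xpow_inj: "openin (Xpow n :: (nat \<Rightarrow> 'a::t2_space) topology) {x \<in> topspace (Xpow n). inj_on x {..<n}}"
proof (subst openin_subopen, intro ballI)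
  fix x :: "nat \<Rightarrow> 'a" assume x: "x \<in> {x \<in> topspace (Xpow n). inj_on x {..<n}}"
  have "\<exists>U. open U \<and> x i \<in> U \<and> (\<exists>V. open V \<and> x j \<in> V \<and> U \<inter> V = {})" if "i < n" "j < n" "i \<noteq> j" for i j
  proof -
    have "x i \<noteq> x j" using x that by (auto simp: inj_on_def)
    then show ?thesis using hausdorff by metis
  qed
  then have "\<forall>i j. \<exists>U V. i < n \<longrightarrow> j < n \<longrightarrow> i \<noteq> j \<longrightarrow> open U \<and> open V \<and> x i \<in> U \<and> x j \<in> V \<and> U \<inter> V = {}"
    by metis
  then obtain U V where UV: "\<And>i j. i < n \<Longrightarrow> j < n \<Longrightarrow> i \<noteq> j \<Longrightarrow>
      open (U i j) \<and> open (V i j) \<and> x i \<in> U i j \<and> x j \<in> V i j \<and> U i j \<inter> V i j = {}"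
    by metis
  define Ix where "Ix = {(i, j). i < n \<and> j < n \<and> i \<noteq> j}"
  define W where "W = (\<lambda>(i, j). {y \<in> topspace (Xpow n). y i \<in> U i j} \<inter> {y \<in> topspace (Xpow n). y j \<in> V i j})"
  have "finite Ix" by (rule finite_subset[of _ "{..<n} \<times> {..<n}"]) (auto simp: Ix_def)
  moreover have "openin (Xpow n) (W p)" if "p \<in> Ix" for p
    using that UV by (auto simp: W_def Ix_def simp del: topspace_Xpow intro!: openin_Int openin_Xpow_nth)
  ultimately have "openin (Xpow n) (topspace (Xpow n) \<inter> \<Inter>(W ` Ix))"
    by (intro openin_Int_Inter) (auto simp del: topspace_Xpow)
  moreover have "x \<in> topspace (Xpow n) \<inter> \<Inter>(W ` Ix)" using x UV by (auto simp: W_def Ix_def)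
  moreover have "topspace (Xpow n) \<inter> \<Inter>(W ` Ix) \<subseteq> {x \<in> topspace (Xpow n). inj_on x {..<n}}"
  proof
    fix y assume y: "y \<in> topspace (Xpow n) \<inter> \<Inter>(W ` Ix)"
    have "inj_on y {..<n}"
    proof (rule inj_onI, rule ccontr)
      fix i j assume ij: "i \<in> {..<n}" "j \<in> {..<n}" "y i = y j" "i \<noteq> j"
      then have "y \<in> W (i, j)" using y by (auto simp: Ix_def)
      then have "y i \<in> U i j" "y j \<in> V i j" by (auto simp: W_def)
      then show False using UV[of i j] ij by auto
    qed
    then show "y \<in> {x \<in> topspace (Xpow n). inj_on x {..<n}}" using y by simp
  qed
  ultimately show "\<exists>T. openin (Xpow n) T \<and> x \<in> T \<and> T \<subseteq> {x \<in> topspace (Xpow n). inj_on x {..<n}}" by blast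
qed

lemma space_conf0_borel: "space conf0_borel = conf0"
  unfolding conf0_borel_def by (rule space_measure_of, rule subsetI, drule CollectD, drule openin_subset, simp)

text \<open>Configurations carry the quotient topology of the tuples, and distinctness of points is
  injectivity of the tuple. A condition that is open on injective tuples is thus open, in particular
  Borel, on configurations.\<close>

lemma sets_conf0I:
  fixes P :: "'a::t2_space multiset \<Rightarrow> bool"
  assumes "\<And>n. openin (Xpow n) {x \<in> topspace (Xpow n). inj_on x {..<n} \<and> P (cfg x {..<n})}"
  shows "{\<eta> \<in> conf0. P \<eta>} \<in> sets conf0_borel"
proof -
  have "openin ddconf_topology {\<eta> \<in> conf0. P \<eta>}"
    unfolding openin_ddconf_topology using assms by (simp add: cfg_conf0)
  then have "openin (subtopology ddconf_topology conf0) {\<eta> \<in> conf0. P \<eta>}"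
    unfolding openin_subtopology by (intro exI[of _ "{\<eta> \<in> conf0. P \<eta>}"]) auto
  moreover have "sets conf0_borel = sigma_sets (conf0 :: 'a multiset set) {U. openin (subtopology ddconf_topology conf0) U}"
    unfolding conf0_borel_def by (rule sets_measure_of, rule subsetI, drule CollectD, drule openin_subset, simp)
  ultimately show ?thesis by (simp add: sigma_sets.Basic)
qed

lemma measurable_conf0I:
  fixes h :: "'a::t2_space multiset \<Rightarrow> 'b::topological_space"
  assumes "\<And>n. continuous_map (Xpow n) euclidean (q n)"
    and "\<And>n x. x \<in> topspace (Xpow n) \<Longrightarrow> inj_on x {..<n} \<Longrightarrow> h (cfg x {..<n}) = q n x"
  shows "h \<in> borel_measurable conf0_borel"
proof (rule borel_measurableI)
  fix S :: "'b set" assume S: "open S"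
  have "{\<eta> \<in> conf0. h \<eta> \<in> S} \<in> sets conf0_borel"
  proof (rule sets_conf0I)
    fix n
    have "openin (Xpow n) ({x \<in> topspace (Xpow n). inj_on x {..<n}} \<inter> {x \<in> topspace (Xpow n). q n x \<in> S})"
      by (intro openin_Int openin_Xpow_inj openin_continuous_map_preimage[OF assms(1)]) (use S in simp)
    moreover have "{x \<in> topspace (Xpow n). inj_on x {..<n} \<and> h (cfg x {..<n}) \<in> S} =
        {x \<in> topspace (Xpow n). inj_on x {..<n}} \<inter> {x \<in> topspace (Xpow n). q n x \<in> S}"
      using assms(2) by auto
    ultimately show "openin (Xpow n) {x \<in> topspace (Xpow n). inj_on x {..<n} \<and> h (cfg x {..<n}) \<in> S}" by simp
  qed
  then show "h -` S \<inter> space conf0_borel \<in> sets conf0_borel"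
    unfolding space_conf0_borel by (simp add: vimage_def Int_def conj_commute)
qed

lemma conf_n_open:
  fixes V :: "'a::t2_space set"
  assumes "open V"
  shows "conf_n V n \<in> sets conf0_borel"
proof -
  have "{\<eta> \<in> conf0. size \<eta> = n \<and> set_mset \<eta> \<subseteq> V} \<in> sets conf0_borel"
  proof (rule sets_conf0I)
    fix m
    show "openin (Xpow m) {x \<in> topspace (Xpow m). inj_on x {..<m} \<and> size (cfg x {..<m}) = n \<and> set_mset (cfg x {..<m}) \<subseteq> V}"
    proof (cases "m = n")
      case True
      have "openin (Xpow m) (PiE {..<m} (\<lambda>_. V))" unfolding Xpow_def by (simp add: openin_PiE assms)
      then have "openin (Xpow m) ({x \<in> topspace (Xpow m). inj_on x {..<m}} \<inter> PiE {..<m} (\<lambda>_. V))"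
        by (intro openin_Int openin_Xpow_inj)
      moreover have "{x \<in> topspace (Xpow m). inj_on x {..<m} \<and> size (cfg x {..<m}) = n \<and> set_mset (cfg x {..<m}) \<subseteq> V} =
          {x \<in> topspace (Xpow m). inj_on x {..<m}} \<inter> PiE {..<m} (\<lambda>_. V)"
        using True by (auto simp: PiE_iff extensional_def)
      ultimately show ?thesis by simp
    qed simp
  qed
  then show ?thesis by (simp add: conf_n_def)
qed

lemma conf_n_closed:
  fixes K :: "'a::t2_space set"
  assumes "closed K"
  shows "conf_n K n \<in> sets conf0_borel"
proof -
  have "{\<eta> \<in> conf0. size \<eta> = n \<and> \<not> set_mset \<eta> \<subseteq> K} \<in> sets conf0_borel"
  proof (rule sets_conf0I)
    fix m
    show "openin (Xpow m) {x \<in> topspace (Xpow m). inj_on x {..<m} \<and> size (cfg x {..<m}) = n \<and> \<not> set_mset (cfg x {..<m}) \<subseteq> K}"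
    proof (cases "m = n")
      case True
      have "openin (Xpow m) ({x \<in> topspace (Xpow m). inj_on x {..<m}} \<inter> (\<Union>i<m. {x \<in> topspace (Xpow m). x i \<in> - K}))"
        by (intro openin_Int openin_Xpow_inj openin_Union ballI)
          (elim imageE, simp only: lessThan_iff, rule openin_Xpow_nth[OF _ open_Compl[OF assms]])
      moreover have "{x \<in> topspace (Xpow m). inj_on x {..<m} \<and> size (cfg x {..<m}) = n \<and> \<not> set_mset (cfg x {..<m}) \<subseteq> K} =
          {x \<in> topspace (Xpow m). inj_on x {..<m}} \<inter> (\<Union>i<m. {x \<in> topspace (Xpow m). x i \<in> - K})"
        using True by auto
      ultimately show ?thesis by simp
    qed simp
  qed
  moreover have "conf_n K n = conf_n UNIV n - {\<eta> \<in> conf0. size \<eta> = n \<and> \<not> set_mset \<eta> \<subseteq> K}"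
    by (auto simp: conf_n_def)
  ultimately show ?thesis using conf_n_open[OF open_UNIV] by auto
qed

lemma continuous_map_mult_complex:
  fixes f g :: "'b \<Rightarrow> complex"
  shows "continuous_map X euclidean f \<Longrightarrow> continuous_map X euclidean g \<Longrightarrow> continuous_map X euclidean (\<lambda>x. f x * g x)"
  unfolding continuous_map_atin limitin_canonical_iff by (auto intro: tendsto_mult)

lemma continuous_map_sum_euclidean:
  fixes f :: "'i \<Rightarrow> 'b \<Rightarrow> 'v::real_normed_vector"
  shows "(\<And>i. i \<in> I \<Longrightarrow> continuous_map X euclidean (f i)) \<Longrightarrow> continuous_map X euclidean (\<lambda>x. \<Sum>i\<in>I. f i x)"
  by (induction I rule: infinite_finite_induct) (auto intro: continuous_map_add)

context smooth_manifold
begin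

section \<open>Continuity and bounds for elements of \<open>Ffin\<close>\<close>

lemma smooth_pow_continuous:
  fixes f :: "(nat \<Rightarrow> 'a) \<Rightarrow> 'v::real_normed_vector"
  assumes "smooth_pow A n f"
  shows "continuous_map (Xpow n) euclidean f"
  unfolding continuous_map_def
proof (intro conjI allI impI)
  fix U :: "'v set" assume U: "openin euclidean U"
  show "openin (Xpow n) {x \<in> topspace (Xpow n). f x \<in> U}"
  proof (subst openin_subopen, intro ballI)
    fix x assume x: "x \<in> {x \<in> topspace (Xpow n). f x \<in> U}"
    obtain ch where ch: "\<And>x. ch x \<in> A" "\<And>x. x \<in> fst (ch x)" using chart_cover by metis
    define c where "c = (\<lambda>i\<in>{..<n}. ch (x i))"
    have c: "c \<in> {..<n} \<rightarrow>\<^sub>E A" using ch(1) by (simp add: c_def)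
    have cA: "c i \<in> A" if "i < n" for i using c that by auto
    define B where "B = PiE {..<n} (\<lambda>i. fst (c i))"
    have B: "openin (Xpow n) B" unfolding B_def Xpow_def by (simp add: openin_PiE open_chart_dom cA)
    have sub: "subtopology (Xpow n) B = product_topology (\<lambda>i. top_of_set (fst (c i))) {..<n}"
      unfolding B_def Xpow_def by (rule subtopology_product_topology)
    define m where "m y = (\<lambda>i\<in>{..<n}. snd (c i) (y i))" for y
    have "continuous_map (subtopology (Xpow n) B) (box_top n c) m"
      unfolding box_top_def continuous_map_componentwise
    proof (intro conjI ballI)
      fix i assume i: "i \<in> {..<n}"
      have "continuous_map (product_topology (\<lambda>i. top_of_set (fst (c i))) {..<n}) (top_of_set (fst (c i))) (\<lambda>y. y i)"
        by (rule continuous_map_product_projection[OF i])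
      moreover have "continuous_map (top_of_set (fst (c i))) (top_of_set (chart_image (c i))) (snd (c i))"
        using chart_homeomorphism[OF cA] chart_inv_simps(3)[OF cA] i by (auto simp: homeomorphism_def continuous_map_in_subtopology)
      ultimately have "continuous_map (subtopology (Xpow n) B) (top_of_set (chart_image (c i))) (snd (c i) \<circ> (\<lambda>y. y i))"
        unfolding sub by (rule continuous_map_compose)
      then show "continuous_map (subtopology (Xpow n) B) (top_of_set (chart_image (c i))) (\<lambda>y. m y i)"
        using i by (simp add: m_def o_def)
    qed (auto simp: m_def)
    moreover have "continuous_map (box_top n c) euclidean (in_charts n c f)"
      using assms c by (intro smooth_along_continuous) (auto simp: smooth_pow_def)
    ultimately have "continuous_map (subtopology (Xpow n) B) euclidean (in_charts n c f \<circ> m)" by (rule continuous_map_compose)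
    then have "continuous_map (subtopology (Xpow n) B) euclidean f"
    proof (rule continuous_map_eq)
      fix y assume "y \<in> topspace (subtopology (Xpow n) B)"
      then have y: "y \<in> PiE {..<n} (\<lambda>i. fst (c i))" by (simp add: B_def)
      have "(\<lambda>i\<in>{..<n}. chart_inv (c i) (m y i)) = y"
        by (rule extensionalityI[of _ "{..<n}"])
          (use y cA in \<open>auto simp: m_def PiE_iff chart_inv_simps(4)\<close>)
      then show "(in_charts n c f \<circ> m) y = f y" by (simp add: in_charts_def)
    qed
    then have "openin (subtopology (Xpow n) B) {y \<in> topspace (subtopology (Xpow n) B). f y \<in> U}"
      using U by (rule openin_continuous_map_preimage)
    then have "openin (Xpow n) {y \<in> topspace (subtopology (Xpow n) B). f y \<in> U}"
      using B by (rule openin_trans_full)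
    moreover have "x \<in> {y \<in> topspace (subtopology (Xpow n) B). f y \<in> U}"
      using x ch(2) by (auto simp: B_def c_def PiE_iff)
    moreover have "{y \<in> topspace (subtopology (Xpow n) B). f y \<in> U} \<subseteq> {x \<in> topspace (Xpow n). f x \<in> U}" by auto
    ultimately show "\<exists>T. openin (Xpow n) T \<and> x \<in> T \<and> T \<subseteq> {x \<in> topspace (Xpow n). f x \<in> U}" by blast
  qed
qed simp

lemma test_fun_continuous: "f \<in> test_fun A n \<Longrightarrow> continuous_map (Xpow n) euclidean f"
  by (rule smooth_pow_continuous) (simp add: test_fun_def)

lemma test_fun_bounded:
  fixes f :: "(nat \<Rightarrow> 'a) \<Rightarrow> 'v::real_normed_vector"
  assumes "f \<in> test_fun A n"
  shows "\<exists>B\<ge>0. \<forall>x. norm (f x) \<le> B"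
proof -
  obtain K where K: "compact K" "\<And>x. f x \<noteq> 0 \<Longrightarrow> x \<in> PiE {..<n} (\<lambda>_. K)" using test_fun_support[OF assms] by blast
  from image_compactin[OF compactin_Xpow[OF K(1)] test_fun_continuous[OF assms]]
  have "bounded (f ` PiE {..<n} (\<lambda>_. K))" by (simp add: compact_imp_bounded)
  then obtain B where B: "\<forall>u\<in>f ` PiE {..<n} (\<lambda>_. K). norm u \<le> B" unfolding bounded_iff by blast
  have "norm (f x) \<le> max B 0" for x
  proof (cases "f x = 0")
    case False
    then have "f x \<in> f ` PiE {..<n} (\<lambda>_. K)" using K(2) by blast
    then have "norm (f x) \<le> B" using B by blast
    then show ?thesis by simp
  qed simp
  then show ?thesis by (intro exI[of _ "max B 0"]) simp
qed

lemma Ffin_component: "G \<in> Ffin A \<Longrightarrow> component n G \<in> test_fun A n"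
  by (simp add: Ffin_def)

lemma component_cfg: "x \<in> PiE {..<n} (\<lambda>_. UNIV) \<Longrightarrow> component n G x = G (cfg x {..<n})"
  by (simp add: component_def)

text \<open>An enumeration of \<open>I\<close> reduces the claim to the component of degree
  \<open>card I\<close>. Subtuples are needed because the convolution evaluates its factors on
  them.\<close>

lemma Ffin_continuous:
  assumes G: "G \<in> Ffin A" and I: "I \<subseteq> {..<n}"
  shows "continuous_map (Xpow n) euclidean (\<lambda>x. G (cfg x I))"
proof -
  have fin: "finite I" using I finite_subset by blast
  define m where "m = card I"
  obtain e where e: "bij_betw e {..<m} I" using ex_bij_betw_nat_finite[OF fin] by (auto simp: m_def lessThan_atLeast0)
  have e_in: "e j < n" if "j < m" for j using bij_betwE[OF e] that I by auto
  define r where "r x = (\<lambda>j\<in>{..<m}. x (e j))" for x :: "nat \<Rightarrow> 'a"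
  have "continuous_map (Xpow n) (product_topology (\<lambda>_. euclidean) {..<m}) r"
    unfolding continuous_map_componentwise
  proof (intro conjI ballI)
    fix j assume j: "j \<in> {..<m}"
    show "continuous_map (Xpow n) euclidean (\<lambda>x. r x j)"
      using continuous_Xpow_nth[OF e_in[of j]] j by (simp add: r_def)
  qed (auto simp: r_def)
  then have "continuous_map (Xpow n) (Xpow m) r" unfolding Xpow_def .
  from continuous_map_compose[OF this test_fun_continuous[OF Ffin_component[OF G, of m]]]
  have "continuous_map (Xpow n) euclidean (component m G \<circ> r)" .
  moreover have "component m G (r x) = G (cfg x I)" for x
  proof -
    have "r x \<in> PiE {..<m} (\<lambda>_. UNIV)" by (simp add: r_def)
    then have "component m G (r x) = G (cfg (r x) {..<m})" by (rule component_cfg)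
    also have "cfg (r x) {..<m} = cfg (\<lambda>j. x (e j)) {..<m}" by (rule cfg_cong) (auto simp: r_def)
    also have "\<dots> = image_mset x (image_mset e (mset_set {..<m}))" by (simp add: cfg_def image_mset.compositionality comp_def)
    also have "image_mset e (mset_set {..<m}) = mset_set I"
      using image_mset_mset_set[OF bij_betw_imp_inj_on[OF e]] bij_betw_imp_surj_on[OF e] by simp
    finally show ?thesis by (simp add: cfg_def)
  qed
  ultimately show ?thesis by (simp add: o_def)
qed

definition Ffin_bounds :: "('a multiset \<Rightarrow> complex) \<Rightarrow> nat \<Rightarrow> 'a set \<Rightarrow> real \<Rightarrow> bool" where
  "Ffin_bounds G N K B \<longleftrightarrow> (\<forall>\<eta>. norm (G \<eta>) \<le> B \<and> (G \<eta> \<noteq> 0 \<longrightarrow> size \<eta> \<le> N \<and> set_mset \<eta> \<subseteq> K))"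

lemma Ffin_bounds_exist:
  assumes G: "G \<in> Ffin A"
  shows "\<exists>N K B. compact K \<and> Ffin_bounds G N K B"
proof -
  obtain N where N: "\<forall>\<eta>. size \<eta> > N \<longrightarrow> G \<eta> = 0" using G unfolding Ffin_def by blast
  have "\<forall>n. \<exists>K. compact K \<and> (\<forall>x. component n G x \<noteq> 0 \<longrightarrow> x \<in> PiE {..<n} (\<lambda>_. K))"
    using test_fun_support[OF Ffin_component[OF G]] by metis
  then obtain K where K: "\<And>n. compact (K n)" "\<And>n x. component n G x \<noteq> 0 \<Longrightarrow> x \<in> PiE {..<n} (\<lambda>_. K n)" by metis
  have "\<forall>n. \<exists>B\<ge>0. \<forall>x. norm (component n G x) \<le> B" using test_fun_bounded[OF Ffin_component[OF G]] by blast
  then obtain B where B: "\<And>n. B n \<ge> 0" "\<And>n x. norm (component n G x) \<le> B n" by metis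
  have "Ffin_bounds G N (\<Union>n\<le>N. K n) (\<Sum>n\<le>N. B n)"
    unfolding Ffin_bounds_def
  proof (intro allI)
    fix \<eta> :: "'a multiset"
    obtain x where x: "x \<in> PiE {..<size \<eta>} (\<lambda>_. UNIV)" "cfg x {..<size \<eta>} = \<eta>" using cfg_exists_PiE[of \<eta>] by blast
    have comp: "component (size \<eta>) G x = G \<eta>" using component_cfg[OF x(1), of G] x(2) by simp
    show "norm (G \<eta>) \<le> (\<Sum>n\<le>N. B n) \<and> (G \<eta> \<noteq> 0 \<longrightarrow> size \<eta> \<le> N \<and> set_mset \<eta> \<subseteq> (\<Union>n\<le>N. K n))"
    proof (cases "G \<eta> = 0")
      case True
      then show ?thesis using B(1) by (simp add: sum_nonneg)
    next
      case False
      then have s: "size \<eta> \<le> N" using N not_le_imp_less by blast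
      have "norm (G \<eta>) \<le> B (size \<eta>)" using B(2)[of "size \<eta>" x] comp by simp
      also have "\<dots> \<le> (\<Sum>n\<le>N. B n)" using s B(1) by (intro member_le_sum) auto
      finally have 1: "norm (G \<eta>) \<le> (\<Sum>n\<le>N. B n)" .
      have "x \<in> PiE {..<size \<eta>} (\<lambda>_. K (size \<eta>))" by (rule K(2)) (simp add: comp False)
      then have "x ` {..<size \<eta>} \<subseteq> K (size \<eta>)" by (auto simp: PiE_iff)
      moreover have "set_mset \<eta> = x ` {..<size \<eta>}" using arg_cong[OF x(2), of set_mset] by simp
      ultimately have "set_mset \<eta> \<subseteq> (\<Union>n\<le>N. K n)" using s by (intro subset_trans[OF _ UN_upper[of "size \<eta>"]]) simp_all
      then show ?thesis using 1 s by simp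
    qed
  qed
  moreover have "compact (\<Union>n\<le>N. K n)" using K(1) by (intro compact_UN) auto
  ultimately show ?thesis by blast
qed

lemma component_lin: "component n (\<lambda>\<eta>. G1 \<eta> + z * G2 \<eta>) = (\<lambda>x. component n G1 x + z * component n G2 x)"
  by (rule ext) (simp add: component_def)

lemma Ffin_lin:
  assumes "G1 \<in> Ffin A" "G2 \<in> Ffin A"
  shows "(\<lambda>\<eta>. G1 \<eta> + z * G2 \<eta>) \<in> Ffin A"
proof -
  obtain N1 N2 where N: "\<forall>\<eta>. size \<eta> > N1 \<longrightarrow> G1 \<eta> = 0" "\<forall>\<eta>. size \<eta> > N2 \<longrightarrow> G2 \<eta> = 0"
    using assms unfolding Ffin_def by blast
  have "\<forall>\<eta>. size \<eta> > max N1 N2 \<longrightarrow> G1 \<eta> + z * G2 \<eta> = 0" using N by simp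
  moreover have "component n (\<lambda>\<eta>. G1 \<eta> + z * G2 \<eta>) \<in> test_fun A n" for n
    unfolding component_lin by (intro test_fun_lin Ffin_component assms)
  ultimately show ?thesis unfolding Ffin_def by blast
qed

section \<open>Symmetric tensor products of test functions\<close>

lemma tensor_smooth:
  assumes "set \<phi>s \<subseteq> DD A" "I \<subseteq> {..<n}"
  shows "smooth_pow A n (\<lambda>x. tensor \<phi>s (cfg x I))"
  using assms
proof (induction \<phi>s arbitrary: I)
  case Nil
  have "finite I" using Nil.prems(2) finite_subset by blast
  then have "(\<lambda>x. tensor [] (cfg x I)) = (\<lambda>x::nat \<Rightarrow> 'a. if I = {} then 1 else 0)"
    by (auto simp: cfg_def mset_set_empty_iff)
  then show ?case by (simp only: smooth_pow_const)
next
  case (Cons \<phi> \<phi>s)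
  have fin: "finite I" using Cons.prems(2) finite_subset by blast
  have "smooth_pow A n (\<lambda>x. \<Sum>i\<in>I. complex_of_real (\<phi> (x i)) * tensor \<phi>s (cfg x (I - {i})))"
  proof (intro smooth_pow_sum smooth_pow_mult)
    fix i assume i: "i \<in> I"
    show "smooth_pow A n (\<lambda>x. complex_of_real (\<phi> (x i)))"
      by (rule smooth_pow_linear[OF bounded_linear_of_real smooth_pow_nth[OF DD_msmooth]])
        (use Cons.prems i in auto)
    show "smooth_pow A n (\<lambda>x. tensor \<phi>s (cfg x (I - {i})))" by (rule Cons.IH) (use Cons.prems in auto)
  qed
  then show ?case by (simp only: tensor_cfg_Cons[OF fin])
qed

lemma tensor_Ffin:
  assumes "set \<phi>s \<subseteq> DD A"
  shows "tensor \<phi>s \<in> Ffin A"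
proof -
  have "\<forall>\<phi>\<in>DD A. \<exists>K. compact K \<and> (\<forall>x. \<phi> x \<noteq> 0 \<longrightarrow> x \<in> K)" using DD_support by blast
  then obtain k where k: "\<And>\<phi>. \<phi> \<in> DD A \<Longrightarrow> compact (k \<phi>)" "\<And>\<phi> x. \<phi> \<in> DD A \<Longrightarrow> \<phi> x \<noteq> 0 \<Longrightarrow> x \<in> k \<phi>" by metis
  define K where "K = (\<Union>\<phi>\<in>set \<phi>s. k \<phi>)"
  have K: "compact K" unfolding K_def using k(1) assms by (intro compact_UN) auto
  have supp: "set_mset \<eta> \<subseteq> K" if "tensor \<phi>s \<eta> \<noteq> 0" for \<eta>
    by (rule tensor_support[OF _ that]) (use k(2) assms in \<open>auto simp: K_def\<close>)
  have "component n (tensor \<phi>s) \<in> test_fun A n" for n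
  proof (rule test_funI[OF _ _ _ K])
    show "smooth_pow A n (component n (tensor \<phi>s))"
      using tensor_smooth[OF assms order_refl] smooth_pow_cong[of n "component n (tensor \<phi>s)" "\<lambda>x. tensor \<phi>s (cfg x {..<n})" A]
      by (simp add: component_def)
    show "component n (tensor \<phi>s) x = 0" if "x \<notin> PiE {..<n} (\<lambda>_. UNIV)" for x
      using that by (auto simp: component_def)
    fix x :: "nat \<Rightarrow> 'a" assume x: "x \<in> PiE {..<n} (\<lambda>_. UNIV)"
    { fix \<pi> assume p: "\<pi> permutes {..<n}"
      have "x \<circ> \<pi> \<in> PiE {..<n} (\<lambda>_. UNIV)"
        using x permutes_not_in[OF p] by (auto simp: PiE_iff extensional_def)
      moreover have "cfg (x \<circ> \<pi>) {..<n} = cfg x {..<n}"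
        using image_mset_mset_set[OF permutes_inj_on[OF p], of "{..<n}"] permutes_image[OF p]
        by (simp add: cfg_def image_mset.compositionality[symmetric])
      ultimately show "component n (tensor \<phi>s) (x \<circ> \<pi>) = component n (tensor \<phi>s) x"
        by (simp add: component_cfg[OF x] component_cfg) }
    assume "component n (tensor \<phi>s) x \<noteq> 0"
    then have "set_mset (cfg x {..<n}) \<subseteq> K" unfolding component_cfg[OF x] by (rule supp)
    then show "x \<in> PiE {..<n} (\<lambda>_. K)" using x by (auto simp: PiE_iff)
  qed
  moreover have "\<exists>N. \<forall>\<eta>. size \<eta> > N \<longrightarrow> tensor \<phi>s \<eta> = 0"
    by (rule exI[of _ "length \<phi>s"]) (simp add: tensor_size)
  ultimately show ?thesis unfolding Ffin_def by blast
qed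

text \<open>A core that is stable under convolution with one-particle functions and, by
  \<open>tensor_span_dense\<close>, dense for the form. By \<open>star_tensor\<close> it is
  generated from the vacuum through such convolutions and linear combinations.\<close>

inductive_set tensor_span :: "('a multiset \<Rightarrow> complex) set" where
  tensor: "set \<phi>s \<subseteq> DD A \<Longrightarrow> tensor \<phi>s \<in> tensor_span"
| lin: "G1 \<in> tensor_span \<Longrightarrow> G2 \<in> tensor_span \<Longrightarrow> (\<lambda>\<eta>. G1 \<eta> + z * G2 \<eta>) \<in> tensor_span"

lemma tensor_span_Ffin: "G \<in> tensor_span \<Longrightarrow> G \<in> Ffin A"
  by (induction rule: tensor_span.induct) (simp_all add: tensor_Ffin Ffin_lin)

lemma tensor_span_zero: "(\<lambda>_. 0) \<in> tensor_span"
  using tensor_span.lin[OF tensor_span.tensor[of "[]"] tensor_span.tensor[of "[]"], of "-1"] by simp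

lemma tensor_span_add: "G1 \<in> tensor_span \<Longrightarrow> G2 \<in> tensor_span \<Longrightarrow> (\<lambda>\<eta>. G1 \<eta> + G2 \<eta>) \<in> tensor_span"
  using tensor_span.lin[of G1 G2 1] by simp

lemma tensor_span_sum:
  "(\<And>i. i \<in> I \<Longrightarrow> G i \<in> tensor_span) \<Longrightarrow> (\<lambda>\<eta>. \<Sum>i\<in>I. G i \<eta>) \<in> tensor_span"
  by (induction I rule: infinite_finite_induct) (simp_all add: tensor_span_zero tensor_span_add)

lemma DD_update_in:
  assumes "\<phi> \<in> DD A" "set \<phi>s \<subseteq> DD A" "k < length \<phi>s"
  shows "set (\<phi>s[k := (\<lambda>x. \<phi> x * (\<phi>s ! k) x)]) \<subseteq> DD A"
proof -
  have "\<phi>s ! k \<in> DD A" using assms(2,3) nth_mem by blast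
  then have "(\<lambda>x. \<phi> x * (\<phi>s ! k) x) \<in> DD A" by (rule DD_mult[OF assms(1)])
  then show ?thesis using set_update_subset_insert[of \<phi>s k] assms(2) by blast
qed

lemma tensor_span_star:
  assumes \<phi>: "\<phi> \<in> DD A" and G: "G \<in> tensor_span"
  shows "star (one_particle \<phi>) G \<in> tensor_span"
  using G
proof induction
  case (tensor \<phi>s)
  have "(\<lambda>\<eta>. tensor (\<phi> # \<phi>s) \<eta> + (\<Sum>k<length \<phi>s. tensor (\<phi>s[k := (\<lambda>x. \<phi> x * (\<phi>s ! k) x)]) \<eta>)) \<in> tensor_span"
    by (intro tensor_span_add tensor_span_sum tensor_span.tensor)
      (use \<phi> tensor DD_update_in[OF \<phi> tensor] in simp_all)
  then show ?case unfolding star_tensor[symmetric] .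
next
  case (lin G1 G2 z)
  have "(\<lambda>\<eta>. star (one_particle \<phi>) G1 \<eta> + z * star (one_particle \<phi>) G2 \<eta>) \<in> tensor_span"
    by (rule tensor_span.lin[OF lin.IH])
  then show ?case unfolding star_lin(1)[symmetric] .
qed

lemma star_power_span: "\<phi> \<in> DD A \<Longrightarrow> star_power \<phi> k \<in> tensor_span"
  by (induction k) (simp_all add: tensor_span_star tensor_span.tensor del: tensor.simps)

end

locale correlation = smooth_manifold A
  for A :: "('a::{t2_space, second_countable_topology}, 'n::finite) chart set" +
  fixes \<rho> :: "'a multiset measure"
  assumes sets_rho: "sets \<rho> = sets conf0_borel"
    and bound: "compact \<Lambda> \<Longrightarrow> \<exists>C>0. \<forall>n. emeasure \<rho> (conf_n \<Lambda> n) \<le> ennreal (C ^ n)"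
    and positive: "G \<in> Ffin A \<Longrightarrow> a_form \<rho> G (conj_fun G) \<in> \<real>\<^sub>\<ge>\<^sub>0"
begin

lemma space_rho: "space \<rho> = conf0"
  using sets_eq_imp_space_eq[OF sets_rho] by (simp add: space_conf0_borel)

lemma measurable_rho: "f \<in> borel_measurable conf0_borel \<Longrightarrow> f \<in> borel_measurable \<rho>"
  by (simp add: measurable_cong_sets[OF sets_rho refl])

lemma conj_fun_Ffin: "G \<in> Ffin A \<Longrightarrow> conj_fun G \<in> Ffin A"
proof -
  assume G: "G \<in> Ffin A"
  have "component n (conj_fun G) \<in> test_fun A n" for n
  proof -
    note c = Ffin_component[OF G, of n]
    obtain K where K: "compact K" "\<And>x. component n G x \<noteq> 0 \<Longrightarrow> x \<in> PiE {..<n} (\<lambda>_. K)" using test_fun_support[OF c] by blast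
    have eq: "component n (conj_fun G) = (\<lambda>x. cnj (component n G x))" by (rule ext) (simp add: component_def conj_fun_def)
    show ?thesis unfolding eq
      by (rule test_funI[OF smooth_pow_linear[OF bounded_linear_cnj] _ _ K(1)])
        (use c K(2) in \<open>auto simp: test_fun_def\<close>)
  qed
  moreover have "\<exists>N. \<forall>\<eta>. size \<eta> > N \<longrightarrow> conj_fun G \<eta> = 0" using G by (auto simp: Ffin_def conj_fun_def)
  ultimately show ?thesis unfolding Ffin_def by blast
qed

lemma conj_fun_bounds: "Ffin_bounds G N K B \<Longrightarrow> Ffin_bounds (conj_fun G) N K B"
  by (simp add: Ffin_bounds_def conj_fun_def)

section \<open>Integrating the convolution against \<rho>\<close>

lemma star_measurable:
  assumes "G1 \<in> Ffin A" "G2 \<in> Ffin A"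
  shows "star G1 G2 \<in> borel_measurable \<rho>"
proof (rule measurable_rho, rule measurable_conf0I[where q = "star_tuple G1 G2"])
  fix n
  show "continuous_map (Xpow n) euclidean (star_tuple G1 G2 n)"
    unfolding star_tuple_def case_prod_beta'
  proof (intro continuous_map_sum_euclidean continuous_map_mult_complex Ffin_continuous assms)
    fix p assume "p \<in> partitions3 n"
    then show "fst p \<union> fst (snd p) \<subseteq> {..<n}" "fst (snd p) \<union> snd (snd p) \<subseteq> {..<n}"
      by (auto simp: partitions3_def)
  qed
qed (rule star_cfg)

text \<open>Where the convolution is nonzero, \<eta> is the union of an argument of
  \<open>G1\<close> and one of \<open>G2\<close>, so it has at most \<open>2 * N\<close> points, all
  in \<open>K\<close>; such configurations have finite measure. The constant does not depend on the
  two functions, which makes uniform approximation effective for the form.\<close>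

lemma star_bound:
  assumes K: "compact K"
  obtains C where "C \<ge> 0" "\<And>G1 G2 B1 B2. G1 \<in> Ffin A \<Longrightarrow> G2 \<in> Ffin A \<Longrightarrow> Ffin_bounds G1 N K B1 \<Longrightarrow>
    Ffin_bounds G2 N K B2 \<Longrightarrow> integrable \<rho> (star G1 G2) \<and> norm (a_form \<rho> G1 G2) \<le> C * (B1 * B2)"
proof -
  define E where "E = (\<Union>n\<le>2 * N. conf_n K n)"
  have meas: "conf_n K n \<in> sets \<rho>" for n using conf_n_closed[OF compact_imp_closed[OF K]] by (simp add: sets_rho)
  then have E: "E \<in> sets \<rho>" unfolding E_def by (intro sets.finite_UN) auto
  obtain c where c: "\<forall>n. emeasure \<rho> (conf_n K n) \<le> ennreal (c ^ n)" using bound[OF K] by blast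
  have "emeasure \<rho> E \<le> (\<Sum>n\<le>2 * N. emeasure \<rho> (conf_n K n))"
    unfolding E_def by (intro emeasure_subadditive_finite) (use meas in auto)
  also have "\<dots> < \<infinity>"
  proof -
    have "emeasure \<rho> (conf_n K n) < \<infinity>" for n using c ennreal_less_top le_less_trans by (metis infinity_ennreal_def)
    then show ?thesis by simp
  qed
  finally have fin: "emeasure \<rho> E < \<infinity>" .
  \<comment> \<open>The number of triples depends on the size of \<eta>; adding up all sizes to
    \<open>2 * N\<close> gives one bound for all of them.\<close>
  define c' :: real where "c' = (\<Sum>n\<le>2 * N. real (card (partitions3 n)))"
  have c': "c' \<ge> 0" by (simp add: c'_def sum_nonneg)
  have pw: "norm (star G1 G2 \<eta>) \<le> c' * (B1 * B2) * indicator E \<eta>"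
    if b1: "Ffin_bounds G1 N K B1" and b2: "Ffin_bounds G2 N K B2" and \<eta>: "\<eta> \<in> conf0" for G1 G2 B1 B2 \<eta>
  proof -
    have B: "B1 \<ge> 0" "B2 \<ge> 0" using b1 b2 norm_ge_zero order_trans unfolding Ffin_bounds_def by blast+
    obtain x where x: "cfg x {..<size \<eta>} = \<eta>" using cfg_exists by blast
    let ?n = "size \<eta>" and ?t = "\<lambda>(I, J, L). G1 (cfg x (I \<union> J)) * G2 (cfg x (J \<union> L))"
    have st: "star G1 G2 \<eta> = sum ?t (partitions3 ?n)" using star_cfg[of G1 G2 x ?n] unfolding x star_tuple_def .
    show ?thesis
    proof (cases "\<eta> \<in> E")
      case True
      then have n: "?n \<le> 2 * N" by (auto simp: E_def conf_n_def)
      have "norm (star G1 G2 \<eta>) \<le> (\<Sum>p\<in>partitions3 ?n. B1 * B2)"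
        unfolding st
      proof (rule sum_norm_le)
        fix p assume "p \<in> partitions3 ?n"
        obtain I J L where p: "p = (I, J, L)" by (cases p)
        show "norm (?t p) \<le> B1 * B2"
          unfolding p prod.case norm_mult
          by (rule mult_mono) (use b1 b2 B in \<open>simp_all add: Ffin_bounds_def\<close>)
      qed
      also have "\<dots> = real (card (partitions3 ?n)) * (B1 * B2)" by simp
      also have "\<dots> \<le> c' * (B1 * B2)"
        unfolding c'_def by (intro mult_right_mono member_le_sum) (use n B in auto)
      finally show ?thesis using True by simp
    next
      case False
      have "?t p = 0" if p: "p \<in> partitions3 ?n" for p
      proof (rule ccontr)
        assume nz: "?t p \<noteq> 0"
        obtain I J L where ijl: "p = (I, J, L)" by (cases p)
        have u: "I \<union> J \<union> L = {..<?n}" using p by (simp add: ijl partitions3_def)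
        have fin: "finite (I \<union> J)" "finite (J \<union> L)" using u finite_subset[of _ "{..<?n}"] by blast+
        have "G1 (cfg x (I \<union> J)) \<noteq> 0" "G2 (cfg x (J \<union> L)) \<noteq> 0" using nz by (auto simp: ijl)
        then have "size (cfg x (I \<union> J)) \<le> N \<and> set_mset (cfg x (I \<union> J)) \<subseteq> K"
          "size (cfg x (J \<union> L)) \<le> N \<and> set_mset (cfg x (J \<union> L)) \<subseteq> K"
          using b1 b2 unfolding Ffin_bounds_def by blast+
        then have h: "card (I \<union> J) \<le> N" "card (J \<union> L) \<le> N" "x ` (I \<union> J) \<subseteq> K" "x ` (J \<union> L) \<subseteq> K"
          using fin by simp_all
        have un: "{..<?n} = (I \<union> J) \<union> (J \<union> L)" using u by blast
        have "?n = card ((I \<union> J) \<union> (J \<union> L))" unfolding un[symmetric] by simp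
        also have "\<dots> \<le> card (I \<union> J) + card (J \<union> L)" by (rule card_Un_le)
        finally have "?n \<le> 2 * N" using h by linarith
        moreover have "set_mset \<eta> = x ` ((I \<union> J) \<union> (J \<union> L))"
          using arg_cong[OF x, of set_mset] unfolding un[symmetric] by simp
        then have "set_mset \<eta> \<subseteq> K" using h(3,4) by blast
        ultimately show False using False \<eta> by (auto simp: E_def conf_n_def)
      qed
      then have "star G1 G2 \<eta> = 0" unfolding st by (rule sum.neutral[OF ballI])
      then show ?thesis using False by simp
    qed
  qed
  have "integrable \<rho> (star G1 G2) \<and> norm (a_form \<rho> G1 G2) \<le> c' * measure \<rho> E * (B1 * B2)"
    if "G1 \<in> Ffin A" "G2 \<in> Ffin A" "Ffin_bounds G1 N K B1" "Ffin_bounds G2 N K B2" for G1 G2 B1 B2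
  proof
    have int: "integrable \<rho> (\<lambda>\<eta>. c' * (B1 * B2) * indicator E \<eta>)"
      by (intro integrable_mult_right integrable_real_indicator E fin)
    show i: "integrable \<rho> (star G1 G2)"
      by (rule Bochner_Integration.integrable_bound[OF int star_measurable[OF that(1,2)]])
        (rule AE_I2, use pw[OF that(3,4)] in \<open>auto simp: space_rho intro: order_trans[OF _ abs_ge_self]\<close>)
    have "norm (a_form \<rho> G1 G2) \<le> (LINT \<eta>|\<rho>. norm (star G1 G2 \<eta>))" unfolding a_form_def by (rule integral_norm_bound)
    also have "\<dots> \<le> (LINT \<eta>|\<rho>. c' * (B1 * B2) * indicator E \<eta>)"
      by (rule integral_mono[OF integrable_norm[OF i] int]) (use pw[OF that(3,4)] in \<open>simp add: space_rho\<close>)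
    also have "\<dots> = c' * measure \<rho> E * (B1 * B2)" using E by simp
    finally show "norm (a_form \<rho> G1 G2) \<le> c' * measure \<rho> E * (B1 * B2)" .
  qed
  then show thesis using that[of "c' * measure \<rho> E"] c' by simp
qed

lemma star_integrable:
  assumes "G1 \<in> Ffin A" "G2 \<in> Ffin A"
  shows "integrable \<rho> (star G1 G2)"
proof -
  obtain N1 K1 B1 where 1: "compact K1" "Ffin_bounds G1 N1 K1 B1" using Ffin_bounds_exist[OF assms(1)] by blast
  obtain N2 K2 B2 where 2: "compact K2" "Ffin_bounds G2 N2 K2 B2" using Ffin_bounds_exist[OF assms(2)] by blast
  have b: "Ffin_bounds G1 (max N1 N2) (K1 \<union> K2) B1" "Ffin_bounds G2 (max N1 N2) (K1 \<union> K2) B2"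
    using 1(2) 2(2) unfolding Ffin_bounds_def by (meson Un_upper1 Un_upper2 max.coboundedI1 max.coboundedI2 subset_trans)+
  show ?thesis
    by (rule star_bound[OF compact_Un[OF 1(1) 2(1)], of "max N1 N2"]) (use assms b in blast)
qed

lemma a_form_lin:
  assumes "G1 \<in> Ffin A" "G2 \<in> Ffin A" "G \<in> Ffin A"
  shows "a_form \<rho> (\<lambda>\<eta>. G1 \<eta> + z * G2 \<eta>) G = a_form \<rho> G1 G + z * a_form \<rho> G2 G"
  unfolding a_form_def star_lin(2) using assms
  by (simp add: star_integrable Bochner_Integration.integral_add)

sublocale F: psd_space "Ffin_pre A \<rho>"
proof
  have op: "carr (Ffin_pre A \<rho>) = Ffin A" "vadd (Ffin_pre A \<rho>) = (\<lambda>G1 G2 \<eta>. G1 \<eta> + G2 \<eta>)"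
    "vscale (Ffin_pre A \<rho>) = (\<lambda>z G \<eta>. z * G \<eta>)" "inn (Ffin_pre A \<rho>) = (\<lambda>G1 G2. a_form \<rho> G1 (conj_fun G2))"
    by (simp_all add: Ffin_pre_def)
  have zero: "(\<lambda>_. 0) \<in> Ffin A" by (rule tensor_span_Ffin[OF tensor_span_zero])
  have a0: "a_form \<rho> (\<lambda>_. 0) G = 0" for G
    unfolding a_form_def star_def star_tuple_def by (simp add: case_prod_beta')
  show "vadd (Ffin_pre A \<rho>) x y \<in> carr (Ffin_pre A \<rho>)" if "x \<in> carr (Ffin_pre A \<rho>)" "y \<in> carr (Ffin_pre A \<rho>)" for x y
    using that Ffin_lin[of x y 1] unfolding op by simp
  show "vscale (Ffin_pre A \<rho>) z x \<in> carr (Ffin_pre A \<rho>)" if "x \<in> carr (Ffin_pre A \<rho>)" for x z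
    using that Ffin_lin[OF zero, of x z] unfolding op by simp
  show "inn (Ffin_pre A \<rho>) (vadd (Ffin_pre A \<rho>) x y) w = inn (Ffin_pre A \<rho>) x w + inn (Ffin_pre A \<rho>) y w"
    if "x \<in> carr (Ffin_pre A \<rho>)" "y \<in> carr (Ffin_pre A \<rho>)" "w \<in> carr (Ffin_pre A \<rho>)" for x y w
    using that a_form_lin[of x y "conj_fun w" 1] conj_fun_Ffin[of w] unfolding op by simp
  show "inn (Ffin_pre A \<rho>) (vscale (Ffin_pre A \<rho>) z x) w = z * inn (Ffin_pre A \<rho>) x w"
    if "x \<in> carr (Ffin_pre A \<rho>)" "w \<in> carr (Ffin_pre A \<rho>)" for x w z
    using that a_form_lin[OF zero, of x "conj_fun w" z] conj_fun_Ffin[of w] a0 unfolding op by simp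
  show "inn (Ffin_pre A \<rho>) y x = cnj (inn (Ffin_pre A \<rho>) x y)" for x y
    unfolding op a_form_def star_cnj[of y x] by (rule Bochner_Integration.integral_cnj)
  show "inn (Ffin_pre A \<rho>) x x \<in> \<real>\<^sub>\<ge>\<^sub>0" if "x \<in> carr (Ffin_pre A \<rho>)" for x
    using that positive unfolding op by simp
qed

end

section \<open>Density of the tensor products\<close>

lemma tensor_cfg:
  assumes "finite I" "card I = length \<phi>s"
  shows "tensor \<phi>s (cfg x I) = complex_of_real (\<Sum>is\<in>permutations_of_set I. \<Prod>k<length \<phi>s. (\<phi>s ! k) (x (is ! k)))"
  using assms
proof (induction \<phi>s arbitrary: I)
  case Nil
  then show ?case by (simp add: cfg_def)
next
  case (Cons \<phi> \<phi>s)
  let ?p = "\<lambda>is. \<Prod>k<length \<phi>s. (\<phi>s ! k) (x (is ! k))"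
  have ne: "I \<noteq> {}" using Cons.prems by auto
  have "tensor (\<phi> # \<phi>s) (cfg x I) = (\<Sum>i\<in>I. complex_of_real (\<phi> (x i)) * tensor \<phi>s (cfg x (I - {i})))"
    by (rule tensor_cfg_Cons[OF Cons.prems(1)])
  also have "\<dots> = (\<Sum>i\<in>I. complex_of_real (\<Sum>is\<in>permutations_of_set (I - {i}). \<phi> (x i) * ?p is))"
  proof (rule sum.cong[OF refl])
    fix i assume "i \<in> I"
    then have "tensor \<phi>s (cfg x (I - {i})) = complex_of_real (\<Sum>is\<in>permutations_of_set (I - {i}). ?p is)"
      using Cons.prems by (intro Cons.IH) auto
    then show "complex_of_real (\<phi> (x i)) * tensor \<phi>s (cfg x (I - {i})) =
        complex_of_real (\<Sum>is\<in>permutations_of_set (I - {i}). \<phi> (x i) * ?p is)"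
      by (simp add: sum_distrib_left)
  qed
  also have "\<dots> = complex_of_real (\<Sum>i\<in>I. \<Sum>is\<in>permutations_of_set (I - {i}). \<phi> (x i) * ?p is)" by simp
  also have "(\<Sum>i\<in>I. \<Sum>is\<in>permutations_of_set (I - {i}). \<phi> (x i) * ?p is) =
      (\<Sum>i\<in>I. \<Sum>is\<in>(#) i ` permutations_of_set (I - {i}). \<Prod>k<length (\<phi> # \<phi>s). ((\<phi> # \<phi>s) ! k) (x (is ! k)))"
    by (simp add: sum.reindex prod.lessThan_Suc_shift del: prod.lessThan_Suc)
  also have "\<dots> = (\<Sum>is\<in>permutations_of_set I. \<Prod>k<length (\<phi> # \<phi>s). ((\<phi> # \<phi>s) ! k) (x (is ! k)))"
    unfolding permutations_of_set_nonempty[OF ne]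
    by (rule sum.UNION_disjoint[symmetric]) (use Cons.prems in auto)
  finally show ?case .
qed

context smooth_manifold
begin

section \<open>Cutoff functions\<close>

lemma msmooth_bump:
  assumes "msmooth A UNIV f"
  shows "msmooth A UNIV (\<lambda>x. bump_deriv 0 (f x))"
  unfolding msmooth_def smooth_on_open_def
proof
  fix c assume c: "c \<in> A"
  show "smooth_along (top_of_set (snd c ` (fst c \<inter> UNIV))) shift_vec UNIV (\<lambda>y. bump_deriv 0 (f (chart_inv c y)))"
    by (rule smooth_along_compose_real[OF flow_chart[OF c open_UNIV], where W = UNIV])
      (use assms c in \<open>auto simp: msmooth_def smooth_on_open_def intro: bump_deriv_deriv\<close>)
qed

text \<open>With \<open>s\<close> a sum of bumps, positive on \<open>K\<close>, and \<open>m\<close>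
  its minimum there, \<kappa> is \<open>b(s) / (b(s) + b(m - s))\<close> for the one-sided function
  \<open>b = bump_deriv 0\<close>. The denominator is positive since \<open>s\<close> and
  \<open>m - s\<close> are never both nonpositive, and on \<open>K\<close> its second term
  vanishes.\<close>

lemma cutoff_exists:
  assumes K: "compact K"
  obtains \<kappa> where "\<kappa> \<in> DD A" "\<And>x. \<kappa> x \<ge> 0" "\<And>x. \<kappa> x \<le> 1" "\<And>x. x \<in> K \<Longrightarrow> \<kappa> x = 1"
proof (cases "K = {}")
  case True
  then show ?thesis using that[of "\<lambda>_. 0"] DD_zero by simp
next
  case False
  define \<B> where "\<B> = {V. \<exists>c a r. coord_ball c a r \<and> V = chart_inv c ` ball a r}"
  have bump: "\<exists>\<beta>. \<beta> \<in> DD A \<and> (\<forall>x. \<beta> x \<ge> 0) \<and> (\<forall>x. \<beta> x > 0 \<longleftrightarrow> x \<in> V)" if V: "V \<in> \<B>" for V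
  proof -
    obtain c a r where cb: "coord_ball c a r" "V = chart_inv c ` ball a r" using V unfolding \<B>_def by blast
    obtain \<beta> where "\<beta> \<in> DD A" "\<And>x. \<beta> x \<ge> 0" "\<And>x. \<beta> x > 0 \<longleftrightarrow> x \<in> chart_inv c ` ball a r"
      using coord_ball_bump[OF cb(1)] by blast
    then show ?thesis unfolding cb(2) by (intro exI[of _ \<beta>]) simp
  qed
  have op: "open V" if "V \<in> \<B>" for V using that coord_ball_open unfolding \<B>_def by blast
  have cov: "K \<subseteq> \<Union>\<B>"
  proof
    fix p
    obtain c a r where "coord_ball c a r" "p \<in> chart_inv c ` ball a r" "chart_inv c ` cball a r \<subseteq> UNIV"
      by (rule coord_ball_exists[OF open_UNIV UNIV_I])
    then show "p \<in> \<Union>\<B>" unfolding \<B>_def by blast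
  qed
  obtain F where F: "F \<subseteq> \<B>" "finite F" "K \<subseteq> \<Union>F" using compactE[OF K cov op] by blast
  have "\<forall>V\<in>F. \<exists>\<beta>. \<beta> \<in> DD A \<and> (\<forall>x. \<beta> x \<ge> 0) \<and> (\<forall>x. \<beta> x > 0 \<longleftrightarrow> x \<in> V)" using bump F(1) by blast
  then obtain \<beta> where \<beta>: "\<And>V. V \<in> F \<Longrightarrow> \<beta> V \<in> DD A" "\<And>V x. V \<in> F \<Longrightarrow> \<beta> V x \<ge> 0" "\<And>V x. V \<in> F \<Longrightarrow> \<beta> V x > 0 \<longleftrightarrow> x \<in> V"
    by metis
  define s where "s x = (\<Sum>V\<in>F. \<beta> V x)" for x
  have s: "s \<in> DD A" unfolding s_def by (rule DD_sum[OF \<beta>(1)])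
  have s0: "s x \<ge> 0" for x unfolding s_def by (rule sum_nonneg[OF \<beta>(2)])
  have s_pos: "s x > 0" if x: "x \<in> K" for x
  proof -
    obtain V where V: "V \<in> F" "x \<in> V" using x F(3) by blast
    have "0 < \<beta> V x" using \<beta>(3)[OF V(1)] V(2) by blast
    also have "\<beta> V x \<le> s x" unfolding s_def using F(2) V(1) \<beta>(2) by (intro member_le_sum) auto
    finally show ?thesis .
  qed
  obtain p where p: "p \<in> K" "\<And>x. x \<in> K \<Longrightarrow> s p \<le> s x"
    using continuous_attains_inf[OF K False continuous_on_subset[OF DD_continuous[OF s] subset_UNIV]] by blast
  define m where "m = s p"
  have m: "m > 0" unfolding m_def by (rule s_pos[OF p(1)])
  have b0: "bump_deriv 0 t \<ge> 0" "bump_deriv 0 t > 0 \<longleftrightarrow> t > 0" "bump_deriv 0 t = 0 \<longleftrightarrow> t \<le> 0" for t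
    by (auto simp: bump_deriv_def)
  define D where "D x = bump_deriv 0 (s x) + bump_deriv 0 (m + (-1) * s x)" for x
  have D_pos: "D x > 0" for x
    using b0(1)[of "s x"] b0(1)[of "m + (-1) * s x"] b0(2)[of "s x"] b0(2)[of "m + (-1) * s x"] m s0[of x]
    unfolding D_def by linarith
  note ms = DD_msmooth[OF s]
  have D: "msmooth A UNIV D"
    unfolding D_def by (intro msmooth_add msmooth_bump msmooth_mult msmooth_const open_UNIV ms)
  define \<kappa> where "\<kappa> x = bump_deriv 0 (s x) * inverse (D x)" for x
  have nz: "s x \<noteq> 0" if "\<kappa> x \<noteq> 0" for x using that b0(3)[of 0] by (auto simp: \<kappa>_def)
  have "msmooth A UNIV \<kappa>" unfolding \<kappa>_def by (intro msmooth_mult msmooth_bump msmooth_inverse open_UNIV ms D D_pos)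
  moreover obtain L where "compact L" "\<forall>x. s x \<noteq> 0 \<longrightarrow> x \<in> L" using DD_support[OF s] by blast
  ultimately have "\<kappa> \<in> DD A" unfolding DD_iff using nz by blast
  moreover have "\<kappa> x \<ge> 0" for x using b0(1)[of "s x"] D_pos[of x] by (simp add: \<kappa>_def)
  moreover have "\<kappa> x \<le> 1" for x
    using b0(1)[of "m + (-1) * s x"] D_pos[of x] by (simp add: \<kappa>_def D_def field_simps)
  moreover have "\<kappa> x = 1" if x: "x \<in> K" for x
  proof -
    have "bump_deriv 0 (m + (-1) * s x) = 0" unfolding b0(3) using p(2)[OF x] by (simp add: m_def)
    then show ?thesis using D_pos[of x] by (simp add: \<kappa>_def D_def)
  qed
  ultimately show ?thesis using that by blast
qed

section \<open>Approximation by sums of products\<close>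

inductive product_sums :: "nat \<Rightarrow> ((nat \<Rightarrow> 'a) \<Rightarrow> real) \<Rightarrow> bool" for n where
  product: "(\<And>i. i < n \<Longrightarrow> msmooth A UNIV (\<psi> i)) \<Longrightarrow> product_sums n (\<lambda>x. a * (\<Prod>i<n. \<psi> i (x i)))"
| add: "product_sums n p \<Longrightarrow> product_sums n q \<Longrightarrow> product_sums n (\<lambda>x. p x + q x)"

lemma product_sums_mult:
  assumes p: "product_sums n p" and q: "product_sums n q"
  shows "product_sums n (\<lambda>x. p x * q x)"
  using p
proof induction
  case (product \<psi> a)
  show ?case
    using q
  proof induction
    case (product \<psi>' b)
    have "product_sums n (\<lambda>x. (a * b) * (\<Prod>i<n. \<psi> i (x i) * \<psi>' i (x i)))"
      by (rule product_sums.product) (intro msmooth_mult open_UNIV \<open>\<And>i. i < n \<Longrightarrow> msmooth A UNIV (\<psi> i)\<close> product)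
    then show ?case by (simp add: prod.distrib ac_simps)
  next
    case (add p q)
    then show ?case by (simp add: distrib_left product_sums.add)
  qed
next
  case (add p q)
  then show ?case by (simp add: distrib_right product_sums.add)
qed

lemma product_sums_const: "product_sums n (\<lambda>x. c)"
  using product_sums.product[of n "\<lambda>_ _. 1" c] by (simp add: msmooth_const)

lemma product_sums_nth:
  assumes "i < n" "msmooth A UNIV \<psi>"
  shows "product_sums n (\<lambda>x. \<psi> (x i))"
proof -
  have "product_sums n (\<lambda>x. 1 * (\<Prod>k<n. (if k = i then \<psi> else (\<lambda>_. 1)) (x k)))"
    by (rule product_sums.product) (simp add: assms(2) msmooth_const)
  moreover have "(\<Prod>k<n. (if k = i then \<psi> else (\<lambda>_. 1)) (x k)) = \<psi> (x i)" for x
    using prod.delta[of "{..<n}" i "\<lambda>k. \<psi> (x k)"] assms(1) by (simp add: if_distrib[where f = "\<lambda>h. h (x _)"] cong: if_cong)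
  ultimately show ?thesis by simp
qed

lemma product_sums_continuous: "product_sums n p \<Longrightarrow> continuous_on S p"
proof (induction rule: product_sums.induct)
  case (product \<psi> a)
  have "continuous_on S (\<lambda>x. \<psi> i (x i))" if i: "i < n" for i
  proof -
    have "continuous_on UNIV (\<lambda>x. \<psi> i (x i))"
      by (rule continuous_on_compose2[OF msmooth_continuous[OF product[OF i]] continuous_on_product_coordinates]) simp
    then show ?thesis by (rule continuous_on_subset) simp
  qed
  then show ?case by (intro continuous_intros) auto
next
  case (add p q)
  then show ?case by (intro continuous_intros)
qed

definition relabel :: "nat \<Rightarrow> (nat \<Rightarrow> 'a) \<Rightarrow> nat list \<Rightarrow> nat \<Rightarrow> 'a" where
  "relabel n x is = (\<lambda>k\<in>{..<n}. x (is ! k))"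

lemma permutation_bij:
  assumes "is \<in> permutations_of_set {..<n}"
  shows "bij_betw ((!) is) {..<n} {..<n}"
proof (rule bij_betw_nth[OF permutations_of_setD(2)[OF assms]])
  show "{..<n} = {..<length is}" unfolding length_finite_permutations_of_set[OF assms] by simp
  show "{..<n} = set is" by (rule permutations_of_setD(1)[OF assms, symmetric])
qed

lemma cfg_relabel:
  assumes "is \<in> permutations_of_set {..<n}"
  shows "cfg (relabel n x is) {..<n} = cfg x {..<n}"
proof -
  note b = permutation_bij[OF assms]
  have "cfg (relabel n x is) {..<n} = cfg (\<lambda>k. x (is ! k)) {..<n}" by (rule cfg_cong) (auto simp: relabel_def)
  also have "\<dots> = image_mset x (image_mset ((!) is) (mset_set {..<n}))" by (simp add: cfg_def image_mset.compositionality comp_def)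
  also have "image_mset ((!) is) (mset_set {..<n}) = mset_set {..<n}"
    using image_mset_mset_set[OF bij_betw_imp_inj_on[OF b]] bij_betw_imp_surj_on[OF b] by simp
  finally show ?thesis by (simp add: cfg_def)
qed

text \<open>The factors of a product need not have compact support; multiplying each by the cutoff
  \<kappa> makes them test functions, and forming the tensor sums over all orderings of the points.
  Both effects show in the formula for the values.\<close>

lemma product_sums_tensor:
  assumes \<kappa>: "\<kappa> \<in> DD A" "\<And>x. \<kappa> x \<noteq> 0 \<Longrightarrow> x \<in> L" and p: "product_sums n p"
  shows "\<exists>P\<in>tensor_span. (\<forall>\<eta>. P \<eta> \<noteq> 0 \<longrightarrow> size \<eta> = n \<and> set_mset \<eta> \<subseteq> L) \<and>
    (\<forall>x. P (cfg x {..<n}) =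
      complex_of_real (\<Sum>is\<in>permutations_of_set {..<n}. p (relabel n x is) * (\<Prod>i<n. \<kappa> (x i))))"
  using p
proof induction
  case (product \<psi> a)
  define \<phi>s where "\<phi>s = map (\<lambda>i x. \<kappa> x * \<psi> i x) [0..<n]"
  have len: "length \<phi>s = n" by (simp add: \<phi>s_def)
  have \<phi>s: "set \<phi>s \<subseteq> DD A" using DD_mult_left[OF \<kappa>(1) product] by (auto simp: \<phi>s_def)
  define P where "P \<eta> = 0 + complex_of_real a * tensor \<phi>s \<eta>" for \<eta>
  have "P \<in> tensor_span"
    unfolding P_def by (rule tensor_span.lin[OF tensor_span_zero tensor_span.tensor[OF \<phi>s]])
  moreover have "size \<eta> = n \<and> set_mset \<eta> \<subseteq> L" if \<eta>: "P \<eta> \<noteq> 0" for \<eta>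
  proof
    have t: "tensor \<phi>s \<eta> \<noteq> 0" using \<eta> by (simp add: P_def)
    then show "size \<eta> = n" using tensor_size[of \<eta> \<phi>s] len by blast
    show "set_mset \<eta> \<subseteq> L" by (rule tensor_support[OF _ t]) (use \<kappa>(2) in \<open>auto simp: \<phi>s_def\<close>)
  qed
  moreover have "P (cfg x {..<n}) = complex_of_real (\<Sum>is\<in>permutations_of_set {..<n}.
      (a * (\<Prod>i<n. \<psi> i (relabel n x is i))) * (\<Prod>i<n. \<kappa> (x i)))" for x
  proof -
    have "(\<Prod>k<n. (\<phi>s ! k) (x (is ! k))) = (\<Prod>i<n. \<psi> i (relabel n x is i)) * (\<Prod>i<n. \<kappa> (x i))"
      if "is \<in> permutations_of_set {..<n}" for "is"
    proof -
      have "(\<Prod>k<n. (\<phi>s ! k) (x (is ! k))) = (\<Prod>k<n. \<psi> k (relabel n x is k) * \<kappa> (x (is ! k)))"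
        by (rule prod.cong) (auto simp: \<phi>s_def relabel_def)
      also have "\<dots> = (\<Prod>k<n. \<psi> k (relabel n x is k)) * (\<Prod>k<n. \<kappa> (x (is ! k)))" by (rule prod.distrib)
      also have "(\<Prod>k<n. \<kappa> (x (is ! k))) = (\<Prod>i<n. \<kappa> (x i))"
        by (rule prod.reindex_bij_betw[OF permutation_bij[OF that]])
      finally show ?thesis .
    qed
    then show ?thesis
      using tensor_cfg[of "{..<n}" \<phi>s x] len by (simp add: P_def sum_distrib_left mult.assoc)
  qed
  ultimately show ?case by (intro bexI[of _ P]) auto
next
  case (add p q)
  then obtain P Q where P: "P \<in> tensor_span" "\<And>\<eta>. P \<eta> \<noteq> 0 \<Longrightarrow> size \<eta> = n \<and> set_mset \<eta> \<subseteq> L"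
      "\<And>x. P (cfg x {..<n}) = complex_of_real (\<Sum>is\<in>permutations_of_set {..<n}. p (relabel n x is) * (\<Prod>i<n. \<kappa> (x i)))"
    and Q: "Q \<in> tensor_span" "\<And>\<eta>. Q \<eta> \<noteq> 0 \<Longrightarrow> size \<eta> = n \<and> set_mset \<eta> \<subseteq> L"
      "\<And>x. Q (cfg x {..<n}) = complex_of_real (\<Sum>is\<in>permutations_of_set {..<n}. q (relabel n x is) * (\<Prod>i<n. \<kappa> (x i)))"
    by (elim bexE conjE) metis
  have "size \<eta> = n \<and> set_mset \<eta> \<subseteq> L" if "P \<eta> + Q \<eta> \<noteq> 0" for \<eta>
    using that P(2)[of \<eta>] Q(2)[of \<eta>] by (cases "P \<eta> = 0") simp_all
  moreover have "P (cfg x {..<n}) + Q (cfg x {..<n}) = complex_of_real (\<Sum>is\<in>permutations_of_set {..<n}.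
      (p (relabel n x is) + q (relabel n x is)) * (\<Prod>i<n. \<kappa> (x i)))" for x
    unfolding P(3) Q(3) by (simp add: distrib_right sum.distrib)
  ultimately show ?case using tensor_span_add[OF P(1) Q(1)] by (intro bexI[of _ "\<lambda>\<eta>. P \<eta> + Q \<eta>"]) simp_all
qed

text \<open>Sequentially dense sequences on a countable cover by coordinate balls are put together.
  If all of them agreed at two points, so would their limits, among which there is a bump at one
  point vanishing at the other.\<close>

lemma separating_sequence:
  obtains \<psi> :: "nat \<Rightarrow> 'a \<Rightarrow> real" where "\<And>j. \<psi> j \<in> DD A" "\<And>x y. x \<noteq> y \<Longrightarrow> \<exists>j. \<psi> j x \<noteq> \<psi> j y"
proof -
  obtain \<V> :: "'a set set" where \<V>: "countable \<V>" "\<Union>\<V> = UNIV"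
    "\<And>V. V \<in> \<V> \<Longrightarrow> True \<and> (\<exists>c a r. coord_ball c a r \<and> V = chart_inv c ` ball a r)"
    by (rule countable_coord_cover[of "\<lambda>_. True"]) (use open_UNIV in blast)+
  have "\<forall>V\<in>\<V>. \<exists>\<psi>. (\<forall>j::nat. \<psi> j \<in> DD_in V) \<and> (\<forall>\<phi>\<in>DD_in V. \<exists>k. DD_conv (\<lambda>n. \<psi> (k n)) \<phi>)"
  proof
    fix V assume "V \<in> \<V>"
    then obtain c a r where cb: "coord_ball c a r" "V = chart_inv c ` ball a r" using \<V>(3) by blast
    obtain \<psi> :: "nat \<Rightarrow> 'a \<Rightarrow> real" where "\<And>j. \<psi> j \<in> DD_in V" "\<And>\<phi>. \<phi> \<in> DD_in V \<Longrightarrow> \<exists>k. DD_conv (\<lambda>n. \<psi> (k n)) \<phi>"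
      using DD_in_separable[OF cb(1)] unfolding cb(2) by metis
    then show "\<exists>\<psi>. (\<forall>j::nat. \<psi> j \<in> DD_in V) \<and> (\<forall>\<phi>\<in>DD_in V. \<exists>k. DD_conv (\<lambda>n. \<psi> (k n)) \<phi>)"
      by (intro exI[of _ \<psi>]) simp
  qed
  then obtain \<psi> :: "'a set \<Rightarrow> nat \<Rightarrow> 'a \<Rightarrow> real" where \<psi>: "\<And>V j. V \<in> \<V> \<Longrightarrow> \<psi> V j \<in> DD_in V"
    "\<And>V \<phi>. V \<in> \<V> \<Longrightarrow> \<phi> \<in> DD_in V \<Longrightarrow> \<exists>k. DD_conv (\<lambda>n. \<psi> V (k n)) \<phi>"
    by metis
  define Q where "Q = (\<Union>V\<in>\<V>. range (\<psi> V))"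
  have Q: "countable Q" unfolding Q_def by (rule countable_UN[OF \<V>(1)]) simp
  have "\<V> \<noteq> {}" using \<V>(2) by auto
  then have ne: "Q \<noteq> {}" by (auto simp: Q_def)
  have QD: "\<phi> \<in> DD A" if "\<phi> \<in> Q" for \<phi> using that \<psi>(1) by (auto simp: Q_def DD_in_def)
  have sep: "\<exists>\<phi>\<in>Q. \<phi> x \<noteq> \<phi> y" if "x \<noteq> y" for x y
  proof -
    have "x \<in> \<Union>\<V>" unfolding \<V>(2) by (rule UNIV_I)
    then obtain V where V: "V \<in> \<V>" "x \<in> V" by (rule UnionE)
    have "open V" using \<V>(3)[OF V(1)] coord_ball_open by blast
    then have W: "open (V - {y})" "x \<in> V - {y}" using V(2) that by auto
    obtain c a r where cb: "coord_ball c a r" "x \<in> chart_inv c ` ball a r" "chart_inv c ` cball a r \<subseteq> V - {y}"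
      by (rule coord_ball_exists[OF W])
    obtain \<beta> where \<beta>: "\<beta> \<in> DD A" "\<And>x. \<beta> x \<ge> 0" "\<And>x. \<beta> x > 0 \<longleftrightarrow> x \<in> chart_inv c ` ball a r"
      using coord_ball_bump[OF cb(1)] by blast
    have sub: "chart_inv c ` ball a r \<subseteq> V - {y}" using cb(3) image_mono[OF ball_subset_cball[of a r], of "chart_inv c"] by blast
    have off: "\<beta> z = 0" if "z \<notin> V - {y}" for z using \<beta>(2)[of z] \<beta>(3)[of z] that sub by force
    have "\<beta> \<in> DD_in V" using \<beta>(1) off by (auto simp: DD_in_def)
    then obtain k where k: "DD_conv (\<lambda>n. \<psi> V (k n)) \<beta>" using \<psi>(2)[OF V(1)] by blast
    show ?thesis
    proof (rule ccontr)
      assume "\<not> ?thesis"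
      then have "\<psi> V (k n) x = \<psi> V (k n) y" for n using V(1) by (auto simp: Q_def)
      then have "\<beta> x = \<beta> y" using DD_conv_pointwise[OF k, of x] DD_conv_pointwise[OF k, of y] by (simp add: LIMSEQ_unique)
      then show False using \<beta>(3)[of x] cb(2) off[of y] by simp
    qed
  qed
  show thesis
  proof
    show "from_nat_into Q j \<in> DD A" for j by (rule QD[OF from_nat_into[OF ne]])
    show "\<exists>j. from_nat_into Q j x \<noteq> from_nat_into Q j y" if "x \<noteq> y" for x y
      using sep[OF that] from_nat_into_surj[OF Q] by metis
  qed
qed

text \<open>Stone--Weierstrass requires a type of class \<open>t2_space\<close>, hence the embedding of \<open>L\<^sup>n\<close> into a space of real sequences.\<close>

lemma product_sums_dense:
  assumes L: "compact L" and f: "continuous_map (Xpow n) euclidean (f :: (nat \<Rightarrow> 'a) \<Rightarrow> real)" and e: "e > 0"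
  shows "\<exists>p. product_sums n p \<and> (\<forall>x\<in>PiE {..<n} (\<lambda>_. L). \<bar>f x - p x\<bar> < e)"
proof -
  obtain \<psi> :: "nat \<Rightarrow> 'a \<Rightarrow> real" where \<psi>: "\<And>j. \<psi> j \<in> DD A" "\<And>x y. x \<noteq> y \<Longrightarrow> \<exists>j. \<psi> j x \<noteq> \<psi> j y"
    by (rule separating_sequence) (rule that)
  define S where "S = PiE {..<n} (\<lambda>_. L)"
  define J where "J x = (\<lambda>(i, j). if i < n then \<psi> j (x i) else 0)" for x :: "nat \<Rightarrow> 'a"
  define J' where "J' = inv_into S J"
  \<comment> \<open>Coordinates from \<open>n\<close> on carry the single value
    \<open>undefined\<close>, so \<open>S\<close> is a product of compact sets in the full function
    space.\<close>
  have "S = PiE UNIV (\<lambda>i. if i < n then L else {undefined})"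
  proof (intro set_eqI iffI)
    fix x assume x: "x \<in> S"
    have "x i \<in> (if i < n then L else {undefined})" for i
      using x by (cases "i < n") (simp_all add: S_def PiE_iff extensional_def)
    then show "x \<in> PiE UNIV (\<lambda>i. if i < n then L else {undefined})" by (simp only: PiE_UNIV_domain Pi_iff) simp
  next
    fix x assume "x \<in> PiE UNIV (\<lambda>i. if i < n then L else {undefined})"
    then have a: "x i \<in> (if i < n then L else {undefined})" for i by (rule PiE_mem) simp
    have "x i \<in> L" if "i < n" for i using a[of i] that by simp
    moreover have "x i = undefined" if "\<not> i < n" for i using a[of i] that by simp
    ultimately show "x \<in> S" by (simp add: S_def PiE_iff extensional_def)
  qed
  moreover have "compactin (product_topology (\<lambda>_. euclidean) UNIV) (PiE UNIV (\<lambda>i. if i < n then L else {undefined}))"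
    unfolding compactin_PiE using L by simp
  ultimately have S: "compact S" by (simp add: euclidean_product_topology)
  have "inj_on J S"
  proof (rule inj_onI)
    fix x y assume xy: "x \<in> S" "y \<in> S" "J x = J y"
    show "x = y"
    proof (rule PiE_ext[OF xy(1,2)[unfolded S_def]])
      fix i assume i: "i \<in> {..<n}"
      have "\<psi> j (x i) = \<psi> j (y i)" for j using fun_cong[OF xy(3), of "(i, j)"] i by (simp add: J_def)
      then show "x i = y i" using \<psi>(2) by blast
    qed
  qed
  then have J': "J' (J x) = x" if "x \<in> S" for x using that unfolding J'_def by (rule inv_into_f_f)
  have J_cont: "continuous_on S J"
  proof (rule continuous_on_coordinatewise_then_product)
    fix p :: "nat \<times> nat"
    obtain i j where p: "p = (i, j)" by (cases p)
    have "continuous_on UNIV (\<lambda>x. \<psi> j (x i))"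
      by (rule continuous_on_compose2[OF DD_continuous[OF \<psi>(1)] continuous_on_product_coordinates]) simp
    then have "continuous_on S (\<lambda>x. \<psi> j (x i))" by (rule continuous_on_subset) simp
    then show "continuous_on S (\<lambda>x. J x p)" unfolding J_def p prod.case by (cases "i < n") simp_all
  qed
  have J'_cont: "continuous_on (J ` S) J'" by (rule continuous_on_inv[OF J_cont S]) (use J' in blast)
  have "continuous_map euclidean (product_topology (\<lambda>_. euclidean) {..<n}) (\<lambda>x::nat \<Rightarrow> 'a. restrict x {..<n})"
    unfolding continuous_map_componentwise
  proof (intro conjI ballI)
    fix k assume "k \<in> {..<n}"
    then show "continuous_map euclidean euclidean (\<lambda>x::nat \<Rightarrow> 'a. restrict x {..<n} k)" by simp
  qed auto
  then have "continuous_map euclidean (Xpow n) (\<lambda>x::nat \<Rightarrow> 'a. restrict x {..<n})" unfolding Xpow_def .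
  from continuous_map_compose[OF this f]
  have "continuous_on UNIV (\<lambda>x. f (restrict x {..<n}))" by (simp add: o_def)
  then have "continuous_on S (\<lambda>x. f (restrict x {..<n}))" by (rule continuous_on_subset) simp
  then have f_cont: "continuous_on S f" by (rule continuous_on_eq) (simp add: PiE_restrict S_def)
  have "\<exists>h. product_sums n (\<lambda>x. h (J x)) \<and> (\<forall>u\<in>J ` S. \<bar>f (J' u) - h u\<bar> < e)"
  proof (rule Stone_Weierstrass_HOL[where P = "\<lambda>h. product_sums n (\<lambda>x. h (J x))"])
    show "compact (J ` S)" by (rule compact_continuous_image[OF J_cont S])
    show "continuous_on (J ` S) (\<lambda>u. f (J' u))"
      by (rule continuous_on_compose2[OF f_cont J'_cont]) (use J' in auto)
    show "continuous_on (J ` S) h" if h: "product_sums n (\<lambda>x. h (J x))" for h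
    proof -
      have "continuous_on (J ` S) (\<lambda>u. h (J (J' u)))"
        by (rule continuous_on_compose2[OF product_sums_continuous[OF h, of S] J'_cont]) (use J' in auto)
      then show ?thesis by (rule continuous_on_eq) (use J' in auto)
    qed
    fix u v assume "u \<in> J ` S \<and> v \<in> J ` S \<and> u \<noteq> v"
    then obtain x y where xy: "u = J x" "v = J y" "J x \<noteq> J y" by blast
    obtain p where "J x p \<noteq> J y p" using xy(3) by (auto simp: fun_eq_iff)
    then obtain i j where ij: "i < n" "J x (i, j) \<noteq> J y (i, j)" by (cases p) (auto simp: J_def split: if_splits)
    have "product_sums n (\<lambda>x. J x (i, j))"
      using product_sums_nth[OF ij(1) DD_msmooth[OF \<psi>(1)], of j] ij(1) by (simp add: J_def)
    then show "\<exists>h. product_sums n (\<lambda>x. h (J x)) \<and> h u \<noteq> h v"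
      using ij(2) unfolding xy(1,2) by (intro exI[of _ "\<lambda>u. u (i, j)"]) simp
  qed (use e in \<open>simp_all add: product_sums_const product_sums.add product_sums_mult\<close>)
  then obtain h where h: "product_sums n (\<lambda>x. h (J x))" "\<And>u. u \<in> J ` S \<Longrightarrow> \<bar>f (J' u) - h u\<bar> < e" by blast
  have "\<bar>f x - h (J x)\<bar> < e" if "x \<in> PiE {..<n} (\<lambda>_. L)" for x
  proof -
    have x: "x \<in> S" using that by (simp add: S_def)
    show ?thesis using h(2)[OF imageI[OF x]] unfolding J'[OF x] .
  qed
  then show ?thesis using h(1) by blast
qed

text \<open>The approximant averages \<open>p + i q\<close>, times a product of cutoffs, over all
  orderings of the points. Whenever \<open>G\<close> is nonzero that product is 1, so by symmetry of
  \<open>G\<close> the error is at most that of \<open>p\<close> and \<open>q\<close> on the box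
  over \<open>L\<close>, each allowed \<open>e / 2\<close>.\<close>

lemma component_approx:
  assumes G: "G \<in> Ffin A" and K: "\<And>\<eta>. G \<eta> \<noteq> 0 \<Longrightarrow> set_mset \<eta> \<subseteq> K"
    and \<kappa>: "\<kappa> \<in> DD A" "\<And>x. \<kappa> x \<ge> 0" "\<And>x. \<kappa> x \<le> 1" "\<And>x. x \<in> K \<Longrightarrow> \<kappa> x = 1"
    and L: "compact L" "\<And>x. \<kappa> x \<noteq> 0 \<Longrightarrow> x \<in> L" and e: "e > 0"
  shows "\<exists>P\<in>tensor_span. \<forall>\<eta>. norm (P \<eta> - (if size \<eta> = n then G \<eta> else 0)) \<le> e \<and>
    (P \<eta> \<noteq> 0 \<longrightarrow> size \<eta> = n \<and> set_mset \<eta> \<subseteq> L)"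
proof -
  let ?perms = "permutations_of_set {..<n}" and ?f = "component n G"
  note c = test_fun_continuous[OF Ffin_component[OF G, of n]]
  have "continuous_map (Xpow n) euclidean (Re \<circ> ?f)" "continuous_map (Xpow n) euclidean (Im \<circ> ?f)"
    by (rule continuous_map_compose[OF c]; auto intro!: continuous_intros)+
  then have re: "continuous_map (Xpow n) euclidean (\<lambda>x. Re (?f x))" and im: "continuous_map (Xpow n) euclidean (\<lambda>x. Im (?f x))"
    by (simp_all add: o_def)
  have e2: "e / 2 > 0" using e by simp
  obtain p q where p: "product_sums n p" "\<And>x. x \<in> PiE {..<n} (\<lambda>_. L) \<Longrightarrow> \<bar>Re (?f x) - p x\<bar> < e / 2"
    and q: "product_sums n q" "\<And>x. x \<in> PiE {..<n} (\<lambda>_. L) \<Longrightarrow> \<bar>Im (?f x) - q x\<bar> < e / 2"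
    using product_sums_dense[OF L(1) re e2] product_sums_dense[OF L(1) im e2] by blast
  have tens: "\<exists>P. P \<in> tensor_span \<and> (\<forall>\<eta>. P \<eta> \<noteq> 0 \<longrightarrow> size \<eta> = n \<and> set_mset \<eta> \<subseteq> L) \<and>
      (\<forall>x. P (cfg x {..<n}) = complex_of_real (\<Sum>is\<in>?perms. p (relabel n x is) * (\<Prod>i<n. \<kappa> (x i))))"
    if "product_sums n p" for p
    using product_sums_tensor[of \<kappa> L n p] \<kappa>(1) L(2) that by blast
  obtain P where P: "P \<in> tensor_span" "\<And>\<eta>. P \<eta> \<noteq> 0 \<Longrightarrow> size \<eta> = n \<and> set_mset \<eta> \<subseteq> L"
      "\<And>x. P (cfg x {..<n}) = complex_of_real (\<Sum>is\<in>?perms. p (relabel n x is) * (\<Prod>i<n. \<kappa> (x i)))"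
    using tens[OF p(1)] by blast
  obtain Q where Q: "Q \<in> tensor_span" "\<And>\<eta>. Q \<eta> \<noteq> 0 \<Longrightarrow> size \<eta> = n \<and> set_mset \<eta> \<subseteq> L"
      "\<And>x. Q (cfg x {..<n}) = complex_of_real (\<Sum>is\<in>?perms. q (relabel n x is) * (\<Prod>i<n. \<kappa> (x i)))"
    using tens[OF q(1)] by blast
  \<comment> \<open>The factor \<open>1 / fact n\<close> turns the sum over orderings produced by
    \<open>tensor\<close> into an average.\<close>
  define R where "R \<eta> = 0 + (1 / fact n) * (P \<eta> + \<i> * Q \<eta>)" for \<eta>
  have "R \<in> tensor_span"
    unfolding R_def by (intro tensor_span.lin[OF tensor_span_zero] tensor_span.lin P(1) Q(1))
  moreover have supp: "size \<eta> = n \<and> set_mset \<eta> \<subseteq> L" if "R \<eta> \<noteq> 0" for \<eta>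
    using that P(2)[of \<eta>] Q(2)[of \<eta>] by (cases "P \<eta> = 0") (simp_all add: R_def)
  moreover have "norm (R \<eta> - (if size \<eta> = n then G \<eta> else 0)) \<le> e" for \<eta>
  proof (cases "size \<eta> = n")
    case False
    then have "R \<eta> = 0" using supp by blast
    then show ?thesis using False e by simp
  next
    case True
    obtain x where x: "x \<in> PiE {..<n} (\<lambda>_. UNIV)" "cfg x {..<n} = \<eta>" using cfg_exists_PiE[of \<eta>] True by blast
    have set: "set_mset \<eta> = x ` {..<n}" using arg_cong[OF x(2), of set_mset] by simp
    show ?thesis
    proof (cases "set_mset \<eta> \<subseteq> L")
      case False
      have "K \<subseteq> L" using \<kappa>(4) L(2) by force
      then have "G \<eta> = 0" using K[of \<eta>] False by blast
      moreover have "R \<eta> = 0" using supp False by blast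
      ultimately show ?thesis using e by simp
    next
      case xL: True
      define X where "X = complex_of_real (\<Prod>i<n. \<kappa> (x i))"
      have "norm X = (\<Prod>i<n. \<kappa> (x i))" unfolding X_def norm_of_real using \<kappa>(2) by (simp add: prod_nonneg)
      also have "\<dots> \<le> 1" by (rule prod_le_1) (use \<kappa>(2,3) in simp)
      finally have X: "norm X \<le> 1" .
      have GX: "G \<eta> * X = G \<eta>"
      proof (cases "G \<eta> = 0")
        case False
        then have "x ` {..<n} \<subseteq> K" using K[of \<eta>] set by blast
        then have "(\<Prod>i<n. \<kappa> (x i)) = 1" using \<kappa>(4) by (intro prod.neutral) auto
        then show ?thesis by (simp add: X_def)
      qed simp
      have close: "norm (Complex (p (relabel n x is)) (q (relabel n x is)) - G \<eta>) \<le> e" if "is \<in> ?perms" for "is"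
      proof -
        let ?y = "relabel n x is"
        have yL: "?y \<in> PiE {..<n} (\<lambda>_. L)"
        proof -
          have "x (is ! k) \<in> L" if "k < n" for k
            using bij_betwE[OF permutation_bij[OF \<open>is \<in> ?perms\<close>]] that xL set by blast
          then show ?thesis by (auto simp: relabel_def)
        qed
        then have yU: "?y \<in> PiE {..<n} (\<lambda>_. UNIV)" by (auto simp: PiE_iff)
        have fy: "?f ?y = G \<eta>" unfolding component_cfg[OF yU] cfg_relabel[OF that] x(2) ..
        have "norm (Complex (p ?y) (q ?y) - G \<eta>) \<le> \<bar>p ?y - Re (G \<eta>)\<bar> + \<bar>q ?y - Im (G \<eta>)\<bar>"
          using cmod_le[of "Complex (p ?y) (q ?y) - G \<eta>"] by simp
        also have "\<dots> \<le> e" using p(2)[OF yL] q(2)[OF yL] unfolding fy by linarith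
        finally show ?thesis .
      qed
      have "R \<eta> = (1 / fact n) * (\<Sum>is\<in>?perms. Complex (p (relabel n x is)) (q (relabel n x is)) * X)"
        using P(3)[of x] Q(3)[of x] unfolding x(2)
        by (simp add: R_def X_def Complex_eq distrib_right sum.distrib sum_distrib_left mult.assoc)
      moreover have "G \<eta> = (1 / fact n) * (\<Sum>is\<in>?perms. G \<eta> * X)" by (simp add: GX)
      ultimately have "R \<eta> - G \<eta> = (1 / fact n) * (\<Sum>is\<in>?perms. (Complex (p (relabel n x is)) (q (relabel n x is)) - G \<eta>) * X)"
        by (simp only: left_diff_distrib sum_subtractf right_diff_distrib)
      then have "norm (R \<eta> - G \<eta>) = (1 / fact n) * norm (\<Sum>is\<in>?perms. (Complex (p (relabel n x is)) (q (relabel n x is)) - G \<eta>) * X)"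
        by (simp add: norm_mult norm_divide)
      also have "\<dots> \<le> (1 / fact n) * (\<Sum>is\<in>?perms. e * 1)"
      proof (intro mult_left_mono sum_norm_le)
        fix "is" assume i: "is \<in> ?perms"
        show "norm ((Complex (p (relabel n x is)) (q (relabel n x is)) - G \<eta>) * X) \<le> e * 1"
          unfolding norm_mult by (rule mult_mono[OF close[OF i] X]) (use e in simp_all)
      qed simp
      also have "\<dots> = e" by simp
      finally show ?thesis using True by simp
    qed
  qed
  ultimately show ?thesis by (intro bexI[of _ R]) auto
qed

end

text \<open>Approximants of different degrees live on configurations of different size, so their
  uniform errors do not add up. \<open>star_bound\<close>, for the fixed degree \<open>N\<close> and
  compact set \<open>L\<close>, converts the uniform error into one for the form.\<close>

lemma (in correlation) tensor_span_dense:
  assumes G: "G \<in> Ffin A" and e: "e > 0"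
  shows "\<exists>P\<in>tensor_span. norm (a_form \<rho> (\<lambda>\<eta>. G \<eta> + (-1) * P \<eta>) (conj_fun (\<lambda>\<eta>. G \<eta> + (-1) * P \<eta>))) \<le> e"
proof -
  obtain N K B where NK: "compact K" "Ffin_bounds G N K B" using Ffin_bounds_exist[OF G] by blast
  obtain \<kappa> where \<kappa>: "\<kappa> \<in> DD A" "\<And>x. \<kappa> x \<ge> 0" "\<And>x. \<kappa> x \<le> 1" "\<And>x. x \<in> K \<Longrightarrow> \<kappa> x = 1"
    using cutoff_exists[OF NK(1)] by blast
  obtain L where L: "compact L" "\<And>x. \<kappa> x \<noteq> 0 \<Longrightarrow> x \<in> L" using DD_support[OF \<kappa>(1)] by blast
  have KL: "K \<subseteq> L" using \<kappa>(4) L(2) by force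
  obtain C where C: "C \<ge> 0" "\<And>G1 G2 B1 B2. G1 \<in> Ffin A \<Longrightarrow> G2 \<in> Ffin A \<Longrightarrow> Ffin_bounds G1 N L B1 \<Longrightarrow>
    Ffin_bounds G2 N L B2 \<Longrightarrow> integrable \<rho> (star G1 G2) \<and> norm (a_form \<rho> G1 G2) \<le> C * (B1 * B2)"
    by (rule star_bound[OF L(1), of N]) (rule that)
  \<comment> \<open>The form is bounded by \<open>C * d ^ 2\<close>; \<open>C + 1\<close> avoids
    division by zero.\<close>
  define d where "d = sqrt (e / (C + 1))"
  have d: "d > 0" "C * (d * d) \<le> e" using e C(1) by (simp_all add: d_def field_simps)
  have "\<forall>n. \<exists>P\<in>tensor_span. \<forall>\<eta>. norm (P \<eta> - (if size \<eta> = n then G \<eta> else 0)) \<le> d \<and>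
    (P \<eta> \<noteq> 0 \<longrightarrow> size \<eta> = n \<and> set_mset \<eta> \<subseteq> L)"
  proof (rule allI, rule component_approx[of G K \<kappa> L d])
    show "set_mset \<eta> \<subseteq> K" if "G \<eta> \<noteq> 0" for \<eta> using NK(2) that by (simp add: Ffin_bounds_def)
    show "\<kappa> x = 1" if "x \<in> K" for x by (rule \<kappa>(4)[OF that])
    show "x \<in> L" if "\<kappa> x \<noteq> 0" for x by (rule L(2)[OF that])
  qed (rule G \<kappa>(1,2,3) L(1) d(1))+
  then obtain P where P: "\<And>n. P n \<in> tensor_span" "\<And>n \<eta>. norm (P n \<eta> - (if size \<eta> = n then G \<eta> else 0)) \<le> d"
    "\<And>n \<eta>. P n \<eta> \<noteq> 0 \<Longrightarrow> size \<eta> = n \<and> set_mset \<eta> \<subseteq> L" by metis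
  define Q where "Q \<eta> = (\<Sum>n\<le>N. P n \<eta>)" for \<eta>
  have Q: "Q \<in> tensor_span" unfolding Q_def by (rule tensor_span_sum) (rule P(1))
  have Q_eq: "Q \<eta> = (if size \<eta> \<le> N then P (size \<eta>) \<eta> else 0)" for \<eta>
  proof -
    have "Q \<eta> = (\<Sum>n\<le>N. if n = size \<eta> then P n \<eta> else 0)"
      unfolding Q_def using P(3)[of _ \<eta>] by (intro sum.cong) auto
    then show ?thesis by (simp add: sum.delta')
  qed
  define D where "D \<eta> = G \<eta> + (-1) * Q \<eta>" for \<eta>
  have D: "D \<in> Ffin A" unfolding D_def by (rule Ffin_lin[OF G tensor_span_Ffin[OF Q]])
  have "Ffin_bounds D N L d"
    unfolding Ffin_bounds_def
  proof (intro allI conjI impI)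
    fix \<eta>
    have G0: "size \<eta> \<le> N \<and> set_mset \<eta> \<subseteq> K" if "G \<eta> \<noteq> 0" using NK(2) that by (simp add: Ffin_bounds_def)
    show "norm (D \<eta>) \<le> d"
    proof (cases "size \<eta> \<le> N")
      case True
      then show ?thesis using P(2)[of "size \<eta>" \<eta>] by (simp add: D_def Q_eq norm_minus_commute)
    next
      case False
      then have "D \<eta> = 0" using G0 by (auto simp: D_def Q_eq)
      then show ?thesis using d(1) by simp
    qed
    assume "D \<eta> \<noteq> 0"
    then consider "G \<eta> \<noteq> 0" | "Q \<eta> \<noteq> 0" by (cases "G \<eta> = 0") (simp_all add: D_def)
    then have "size \<eta> \<le> N \<and> set_mset \<eta> \<subseteq> L"
    proof cases
      case 1
      then show ?thesis using G0 KL by blast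
    next
      case 2
      then have "size \<eta> \<le> N" "P (size \<eta>) \<eta> \<noteq> 0" by (auto simp: Q_eq split: if_splits)
      then show ?thesis using P(3) by blast
    qed
    then show "size \<eta> \<le> N" "set_mset \<eta> \<subseteq> L" by auto
  qed
  then have "norm (a_form \<rho> D (conj_fun D)) \<le> C * (d * d)"
    using C(2)[OF D conj_fun_Ffin[OF D]] conj_fun_bounds by blast
  then have "norm (a_form \<rho> D (conj_fun D)) \<le> e" using d(2) by (rule order_trans)
  then show ?thesis using Q unfolding D_def[abs_def] by (intro bexI[of _ Q]) simp_all
qed

section \<open>The spectral measure\<close>

lemma alt_sum_of_real: "alt_sum (\<lambda>Z. complex_of_real (f Z)) Y = complex_of_real (alt_sum f Y)"
  by (simp add: alt_sum_def)

lemma conj_fun_vacuum: "conj_fun (tensor []) = tensor []"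
  by (auto simp: conj_fun_def fun_eq_iff)

lemma conf_n_mono: "V \<subseteq> W \<Longrightarrow> conf_n V n \<subseteq> conf_n W n"
  by (auto simp: conf_n_def)

locale spectral_measure = correlation A \<rho>
  for A :: "('a::{t2_space, second_countable_topology}, 'n::finite) chart set" and \<rho> +
  fixes \<mu> :: "(('a \<Rightarrow> real) \<Rightarrow> real) measure" and K
  assumes prob: "prob_space \<mu>" and sets_mu: "sets \<mu> = sets (cylinder_sigma A)"
    and unitary: "unitary_iso (H_space A \<rho>) (L2 \<mu>) K"
    and K_fun_in: "G \<in> Ffin A \<Longrightarrow> K_fun A G \<in> carr (L2_pre \<mu>)"
    and K_hat: "G \<in> Ffin A \<Longrightarrow> K (hat A \<rho> G) = vclass (L2_pre \<mu>) (K_fun A G)"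
    and K_graph: "\<phi> \<in> DD A \<Longrightarrow>
      (\<lambda>(x, y). (K x, K y)) ` op_closure (H_space A \<rho>) (A_op A \<rho> \<phi>) = mult_op \<mu> (\<lambda>\<omega>. \<omega> \<phi>)"
begin

lemma Ffin_pre_simps:
  "carr (Ffin_pre A \<rho>) = Ffin A" "inn (Ffin_pre A \<rho>) G1 G2 = a_form \<rho> G1 (conj_fun G2)"
  by (simp_all add: Ffin_pre_def)

sublocale R: L2_realization "Ffin_pre A \<rho>" \<mu> K "K_fun A"
  by unfold_locales
    (use unitary K_fun_in K_hat in \<open>simp_all add: Ffin_pre_simps H_space_def hat_def\<close>)

lemma space_mu: "space \<mu> = DD_dual A"
  using sets_eq_imp_space_eq[OF sets_mu] by (simp add: cylinder_sigma_simps)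

lemma evaluation_mu: "\<phi> \<in> DD A \<Longrightarrow> (\<lambda>\<omega>. \<omega> \<phi>) \<in> borel_measurable \<mu>"
  using evaluation_measurable by (simp add: measurable_cong_sets[OF sets_mu refl])

lemma vacuum_in: "tensor [] \<in> Ffin A"
  by (rule tensor_Ffin) simp

lemma K_fun_square: "G \<in> Ffin A \<Longrightarrow> integrable \<mu> (\<lambda>\<omega>. (cmod (K_fun A G \<omega>))\<^sup>2)"
  using K_fun_in by (simp_all add: L2_pre_def)

lemma K_fun_inn:
  "G1 \<in> Ffin A \<Longrightarrow> G2 \<in> Ffin A \<Longrightarrow> (LINT \<omega>|\<mu>. K_fun A G1 \<omega> * cnj (K_fun A G2 \<omega>)) = a_form \<rho> G1 (conj_fun G2)"
  using R.inn_F[of G1 G2] by (simp add: Ffin_pre_simps)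

lemma K_fun_star:
  assumes "\<phi> \<in> DD A" "G \<in> tensor_span"
  shows "AE \<omega> in \<mu>. K_fun A (star (one_particle \<phi>) G) \<omega> = complex_of_real (\<omega> \<phi>) * K_fun A G \<omega>"
proof (rule R.F_mult[where T = "A_op A \<rho> \<phi>"])
  have G: "G \<in> Ffin A" "star (one_particle \<phi>) G \<in> Ffin A"
    using tensor_span_Ffin assms(2) tensor_span_star[OF assms] by blast+
  show "(\<lambda>(x, y). (K x, K y)) ` op_closure (completion (quotient_space (Ffin_pre A \<rho>))) (A_op A \<rho> \<phi>) =
      mult_op \<mu> (\<lambda>\<omega>. \<omega> \<phi>)"
    using K_graph[OF assms(1)] unfolding H_space_def .
  show "(R.emb G, R.emb (star (one_particle \<phi>) G)) \<in> A_op A \<rho> \<phi>"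
    unfolding A_op_def hat_def using G(1) by blast
  show "G \<in> carr (Ffin_pre A \<rho>)" "star (one_particle \<phi>) G \<in> carr (Ffin_pre A \<rho>)"
    using G by (simp_all add: Ffin_pre_simps)
qed

text \<open>Linearity is read off from the isometry rather than from the series: the deviation from
  linearity is orthogonal to every \<open>K_fun A H\<close>, because the form is linear, and hence
  null by totality.\<close>

lemma K_fun_lin:
  assumes G: "G1 \<in> Ffin A" "G2 \<in> Ffin A"
  shows "AE \<omega> in \<mu>. K_fun A (\<lambda>\<eta>. G1 \<eta> + z * G2 \<eta>) \<omega> = K_fun A G1 \<omega> + z * K_fun A G2 \<omega>"
proof -
  let ?G = "\<lambda>\<eta>. G1 \<eta> + z * G2 \<eta>"
  let ?D = "\<lambda>\<omega>. K_fun A ?G \<omega> + ((-1) * K_fun A G1 \<omega> + (- z) * K_fun A G2 \<omega>)"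
  have G': "?G \<in> Ffin A" by (rule Ffin_lin[OF G])
  have add: "(\<lambda>\<omega>. f \<omega> + g \<omega>) \<in> carr (L2_pre \<mu>)" if "f \<in> carr (L2_pre \<mu>)" "g \<in> carr (L2_pre \<mu>)" for f g
    using R.L.add_closed[OF that] by (simp add: L2_pre_def)
  have scale: "(\<lambda>\<omega>. c * f \<omega>) \<in> carr (L2_pre \<mu>)" if "f \<in> carr (L2_pre \<mu>)" for f c
    using R.L.scale_closed[OF that, of c] by (simp add: L2_pre_def)
  have "AE \<omega> in \<mu>. ?D \<omega> = 0"
  proof (rule R.F_total)
    show "?D \<in> carr (L2_pre \<mu>)" by (intro add scale K_fun_in G G')
    fix H assume "H \<in> carr (Ffin_pre A \<rho>)"
    then have H: "H \<in> Ffin A" by (simp add: Ffin_pre_simps)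
    have i: "integrable \<mu> (\<lambda>\<omega>. K_fun A F \<omega> * cnj (K_fun A H \<omega>))" if "F \<in> Ffin A" for F
      by (rule L2_pre_integrable[OF K_fun_in[OF that] K_fun_in[OF H]])
    have "(LINT \<omega>|\<mu>. ?D \<omega> * cnj (K_fun A H \<omega>)) =
        (LINT \<omega>|\<mu>. K_fun A ?G \<omega> * cnj (K_fun A H \<omega>) +
          ((-1) * (K_fun A G1 \<omega> * cnj (K_fun A H \<omega>)) + (- z) * (K_fun A G2 \<omega> * cnj (K_fun A H \<omega>))))"
      by (rule Bochner_Integration.integral_cong) (simp_all add: algebra_simps)
    also have "\<dots> = a_form \<rho> ?G (conj_fun H) + ((-1) * a_form \<rho> G1 (conj_fun H) + (- z) * a_form \<rho> G2 (conj_fun H))"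
      using i[OF G'] i[OF G(1)] i[OF G(2)] K_fun_inn[OF G' H] K_fun_inn[OF G(1) H] K_fun_inn[OF G(2) H]
      by (simp add: Bochner_Integration.integral_add Bochner_Integration.integral_diff)
    also have "\<dots> = 0" using a_form_lin[OF G conj_fun_Ffin[OF H]] by simp
    finally show "(LINT \<omega>|\<mu>. ?D \<omega> * cnj (K_fun A H \<omega>)) = 0" .
  qed
  then show ?thesis by eventually_elim (simp add: algebra_simps)
qed

section \<open>The reweighted measure and its moments\<close>

definition h0 :: "(('a \<Rightarrow> real) \<Rightarrow> real) \<Rightarrow> complex" where
  "h0 = K_fun A (tensor [])"

lemma K_fun_star_power:
  assumes "\<phi> \<in> DD A"
  shows "AE \<omega> in \<mu>. K_fun A (star_power \<phi> k) \<omega> = complex_of_real (\<omega> \<phi> ^ k) * h0 \<omega>"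
proof (induction k)
  case (Suc k)
  from Suc.IH K_fun_star[OF assms star_power_span[OF assms, of k]] show ?case
    by eventually_elim simp
qed (simp add: h0_def del: tensor.simps)

definition nu :: "(('a \<Rightarrow> real) \<Rightarrow> real) measure" where
  "nu = density \<mu> (\<lambda>\<omega>. ennreal ((cmod (h0 \<omega>))\<^sup>2))"

lemma h0_measurable: "(\<lambda>\<omega>. (cmod (h0 \<omega>))\<^sup>2) \<in> borel_measurable \<mu>"
  and h0_integrable: "integrable \<mu> (\<lambda>\<omega>. (cmod (h0 \<omega>))\<^sup>2)"
  using K_fun_square[OF vacuum_in] borel_measurable_integrable unfolding h0_def by blast+

lemma finite_nu: "finite_measure nu"
proof
  have "emeasure nu (space nu) = (\<integral>\<^sup>+ \<omega>. ennreal ((cmod (h0 \<omega>))\<^sup>2) * indicator (space \<mu>) \<omega> \<partial>\<mu>)"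
    unfolding nu_def space_density by (rule emeasure_density) (use h0_measurable in simp_all)
  also have "\<dots> = (\<integral>\<^sup>+ \<omega>. ennreal ((cmod (h0 \<omega>))\<^sup>2) \<partial>\<mu>)" by (rule nn_integral_cong) simp
  also have "\<dots> = ennreal (LINT \<omega>|\<mu>. (cmod (h0 \<omega>))\<^sup>2)"
    by (rule nn_integral_eq_integral[OF h0_integrable]) simp
  finally show "emeasure nu (space nu) \<noteq> \<infinity>" by simp
qed

text \<open>The \<open>k\<close>-th convolution power is mapped to
  \<open>\<omega> \<phi> ^ k * h0 \<omega>\<close>. The inner product of this function with
  \<open>h0\<close> is the moment of \<open>nu\<close>; by isometry it is also the form against the
  unit \<open>tensor []\<close>, that is, the integral of the power over \<rho>.\<close>

lemma moments_nu:
  assumes \<phi>: "\<phi> \<in> DD A"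
  shows "integrable nu (\<lambda>\<omega>. \<omega> \<phi> ^ k)"
    and "(LINT \<omega>|nu. \<omega> \<phi> ^ k) = (LINT \<eta>|\<rho>. alt_sum (\<lambda>Z. (\<Sum>z\<in>Z. \<phi> z) ^ k) (set_mset \<eta>))"
proof -
  let ?G = "star_power \<phi> k"
  have G: "?G \<in> Ffin A" by (rule tensor_span_Ffin[OF star_power_span[OF \<phi>]])
  have m: "(\<lambda>\<omega>. \<omega> \<phi> ^ k) \<in> borel_measurable \<mu>" using evaluation_mu[OF \<phi>] by simp
  have ae: "AE \<omega> in \<mu>. K_fun A ?G \<omega> * cnj (h0 \<omega>) = complex_of_real ((cmod (h0 \<omega>))\<^sup>2 *\<^sub>R \<omega> \<phi> ^ k)"
    using K_fun_star_power[OF \<phi>, of k]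
    by eventually_elim (simp only: real_scaleR_def of_real_mult complex_norm_square mult_ac)
  have i: "integrable \<mu> (\<lambda>\<omega>. K_fun A ?G \<omega> * cnj (h0 \<omega>))"
    unfolding h0_def by (rule L2_pre_integrable[OF K_fun_in[OF G] K_fun_in[OF vacuum_in]])
  have m2: "(\<lambda>\<omega>. complex_of_real ((cmod (h0 \<omega>))\<^sup>2 *\<^sub>R \<omega> \<phi> ^ k)) \<in> borel_measurable \<mu>"
    by (rule measurable_compose[OF borel_measurable_scaleR[OF h0_measurable m]
        borel_measurable_continuous_onI[OF continuous_on_of_real[OF continuous_on_id]]])
  have "integrable \<mu> (\<lambda>\<omega>. complex_of_real ((cmod (h0 \<omega>))\<^sup>2 *\<^sub>R \<omega> \<phi> ^ k))"
    by (rule integrable_cong_AE_imp[OF i m2]) (use ae in \<open>eventually_elim, simp only:\<close>)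
  then have "integrable \<mu> (\<lambda>\<omega>. (cmod (h0 \<omega>))\<^sup>2 *\<^sub>R \<omega> \<phi> ^ k)" by (simp only: complex_of_real_integrable_eq)
  then show "integrable nu (\<lambda>\<omega>. \<omega> \<phi> ^ k)"
    unfolding nu_def by (subst integrable_density[OF m h0_measurable]) simp_all
  have "complex_of_real (LINT \<omega>|nu. \<omega> \<phi> ^ k) = complex_of_real (LINT \<omega>|\<mu>. (cmod (h0 \<omega>))\<^sup>2 *\<^sub>R \<omega> \<phi> ^ k)"
    unfolding nu_def by (subst integral_density[OF m h0_measurable]) simp_all
  also have "\<dots> = (LINT \<omega>|\<mu>. complex_of_real ((cmod (h0 \<omega>))\<^sup>2 *\<^sub>R \<omega> \<phi> ^ k))" by (rule integral_complex_of_real[symmetric])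
  also have "\<dots> = (LINT \<omega>|\<mu>. K_fun A ?G \<omega> * cnj (h0 \<omega>))"
    by (rule integral_cong_AE[OF m2 borel_measurable_integrable[OF i]]) (use ae in \<open>eventually_elim, simp only:\<close>)
  also have "\<dots> = (LINT \<eta>|\<rho>. ?G \<eta>)"
    unfolding h0_def K_fun_inn[OF G vacuum_in] conj_fun_vacuum a_form_def star_vac ..
  also have "\<dots> = (LINT \<eta>|\<rho>. complex_of_real (alt_sum (\<lambda>Z. (\<Sum>z\<in>Z. \<phi> z) ^ k) (set_mset \<eta>)))"
  proof (rule Bochner_Integration.integral_cong[OF refl])
    fix \<eta> assume "\<eta> \<in> space \<rho>"
    then have \<eta>: "\<eta> = mset_set (set_mset \<eta>)" unfolding space_rho by (rule conf0_eq_mset_set)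
    show "?G \<eta> = complex_of_real (alt_sum (\<lambda>Z. (\<Sum>z\<in>Z. \<phi> z) ^ k) (set_mset \<eta>))"
      using star_power_alt_sum[OF finite_set_mset, of \<phi> k \<eta>] unfolding \<eta>[symmetric] alt_sum_of_real .
  qed
  also have "\<dots> = complex_of_real (LINT \<eta>|\<rho>. alt_sum (\<lambda>Z. (\<Sum>z\<in>Z. \<phi> z) ^ k) (set_mset \<eta>))"
    by (rule integral_complex_of_real)
  finally show "(LINT \<omega>|nu. \<omega> \<phi> ^ k) = (LINT \<eta>|\<rho>. alt_sum (\<lambda>Z. (\<Sum>z\<in>Z. \<phi> z) ^ k) (set_mset \<eta>))"
    by (simp only: of_real_eq_iff)
qed

text \<open>On injective tuples the subsets of a configuration correspond to index sets
  \<open>J\<close>, which do not depend on the points; the alternating sum becomes a finite sum of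
  continuous functions.\<close>

lemma alt_sum_measurable:
  fixes F :: "(nat \<Rightarrow> real) \<Rightarrow> real"
  assumes \<psi>: "\<And>j. \<psi> j \<in> DD A" and F: "continuous_on UNIV F"
  shows "(\<lambda>\<eta>. alt_sum (\<lambda>Z. F (pairings \<psi> Z)) (set_mset \<eta>)) \<in> borel_measurable \<rho>"
proof (rule measurable_rho, rule measurable_conf0I)
  fix n :: nat
  let ?q = "\<lambda>x::nat \<Rightarrow> 'a. \<Sum>J\<in>Pow {..<n}. (-1) ^ card ({..<n} - J) * F (\<lambda>j. \<Sum>i\<in>J. \<psi> j (x i))"
  show "continuous_map (Xpow n) euclidean ?q"
  proof (rule continuous_map_sum_euclidean)
    fix J assume J: "J \<in> Pow {..<n}"
    have "continuous_map (Xpow n) (product_topology (\<lambda>_. euclidean) UNIV) (\<lambda>x j. \<Sum>i\<in>J. \<psi> j (x i))"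
      unfolding continuous_map_componentwise_UNIV
    proof (intro allI continuous_map_sum_euclidean)
      fix j i assume "i \<in> J"
      then have i: "i < n" using J by auto
      have "continuous_map euclidean euclidean (\<psi> j)" using DD_continuous[OF \<psi>, of j] by simp
      from continuous_map_compose[OF continuous_Xpow_nth[OF i] this]
      show "continuous_map (Xpow n) euclidean (\<lambda>x. \<psi> j (x i))" by (simp add: o_def)
    qed
    then have "continuous_map (Xpow n) euclidean (\<lambda>x j. \<Sum>i\<in>J. \<psi> j (x i))" unfolding euclidean_product_topology .
    moreover have "continuous_map euclidean euclidean F" using F by simp
    ultimately have "continuous_map (Xpow n) euclidean (F \<circ> (\<lambda>x j. \<Sum>i\<in>J. \<psi> j (x i)))" by (rule continuous_map_compose)
    then show "continuous_map (Xpow n) euclidean (\<lambda>x. (-1) ^ card ({..<n} - J) * F (\<lambda>j. \<Sum>i\<in>J. \<psi> j (x i)))"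
      unfolding o_def by (intro continuous_map_real_mult_left)
  qed
  fix x :: "nat \<Rightarrow> 'a" assume inj: "inj_on x {..<n}"
  have inj2: "inj_on (image x) (Pow {..<n})" by (rule inj_on_image_Pow[OF inj])
  have "alt_sum (\<lambda>Z. F (pairings \<psi> Z)) (x ` {..<n}) =
      (\<Sum>J\<in>Pow {..<n}. (-1) ^ card (x ` {..<n} - x ` J) * F (pairings \<psi> (x ` J)))"
    unfolding alt_sum_def image_Pow_surj[OF refl, symmetric] sum.reindex[OF inj2] o_def ..
  also have "\<dots> = ?q x"
  proof (rule sum.cong[OF refl])
    fix J assume "J \<in> Pow {..<n}"
    then have J: "J \<subseteq> {..<n}" by simp
    have "x ` {..<n} - x ` J = x ` ({..<n} - J)" by (rule inj_on_image_set_diff[OF inj _ J, symmetric]) simp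
    then have 1: "card (x ` {..<n} - x ` J) = card ({..<n} - J)"
      using card_image[OF inj_on_subset[OF inj Diff_subset]] by simp
    have 2: "pairings \<psi> (x ` J) = (\<lambda>j. \<Sum>i\<in>J. \<psi> j (x i))"
      by (rule ext) (simp add: pairings_def sum.reindex[OF inj_on_subset[OF inj J]])
    show "(-1) ^ card (x ` {..<n} - x ` J) * F (pairings \<psi> (x ` J)) =
        (-1) ^ card ({..<n} - J) * F (\<lambda>j. \<Sum>i\<in>J. \<psi> j (x i))" unfolding 1 2 ..
  qed
  finally show "alt_sum (\<lambda>Z. F (pairings \<psi> Z)) (set_mset (cfg x {..<n})) = ?q x" by simp
qed

section \<open>Local configurations almost everywhere\<close>

lemma size_measurable: "size \<in> measurable \<rho> (count_space UNIV)"
proof -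
  have "(size :: 'a multiset \<Rightarrow> nat) \<in> borel_measurable conf0_borel"
    by (rule measurable_conf0I[where q = "\<lambda>n _. n"]) simp_all
  then have "(size :: 'a multiset \<Rightarrow> nat) \<in> borel_measurable \<rho>" by (rule measurable_rho)
  then show ?thesis by (simp add: measurable_cong_sets[OF refl sets_borel_eq_count_space])
qed

text \<open>With \<theta> equal to half of \<open>ln ((2 + \<epsilon>) / 2)\<close>, the
  \<open>n\<close>-point configurations contribute at most \<open>r ^ n\<close> for
  \<open>r = 2 * exp \<theta> / (2 + \<epsilon>)\<close>. Taking half keeps \<theta> positive and
  \<open>r\<close> strictly below 1.\<close>

lemma exp_size_integrable:
  assumes meas: "\<And>n. conf_n V n \<in> sets \<rho>" and \<epsilon>: "\<epsilon> > 0"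
    and small: "\<And>n. emeasure \<rho> (conf_n V n) \<le> ennreal (inverse ((2 + \<epsilon>) ^ n))"
  shows "integrable (restrict_space \<rho> {\<eta> \<in> conf0. set_mset \<eta> \<subseteq> V})
    (\<lambda>\<eta>. 2 ^ size \<eta> * exp (ln ((2 + \<epsilon>) / 2) / 2 * real (size \<eta>)))"
proof -
  let ?E = "{\<eta> \<in> conf0. set_mset \<eta> \<subseteq> V}" and ?\<theta> = "ln ((2 + \<epsilon>) / 2) / 2"
  have E_eq: "?E = (\<Union>n. conf_n V n)" by (auto simp: conf_n_def)
  have E: "?E \<in> sets \<rho>" unfolding E_eq by (rule sets.countable_UN) (use meas in auto)
  define g where "g n = 2 ^ n * exp (?\<theta> * real n)" for n
  define r where "r = 2 * exp ?\<theta> / (2 + \<epsilon>)"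
  have "ln ((2 + \<epsilon>) / 2) > 0" using \<epsilon> by (intro ln_gt_zero) simp
  then have "exp ?\<theta> < exp (ln ((2 + \<epsilon>) / 2))" unfolding exp_less_cancel_iff by linarith
  also have "\<dots> = (2 + \<epsilon>) / 2" using \<epsilon> by simp
  finally have r: "0 < r" "r < 1" using \<epsilon> by (auto simp: r_def field_simps)
  have gr: "g n * inverse ((2 + \<epsilon>) ^ n) = r ^ n" for n
    by (simp add: g_def r_def power_divide power_mult_distrib exp_of_nat_mult[symmetric] mult.commute field_simps)
  have g: "(\<lambda>\<eta>. g (size \<eta>)) \<in> borel_measurable \<rho>"
    by (rule measurable_compose[OF size_measurable]) simp
  have ms: "(\<lambda>\<eta>. g (size \<eta>)) \<in> borel_measurable (restrict_space \<rho> ?E)" by (rule measurable_restrict_space1[OF g])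
  have "(\<integral>\<^sup>+ \<eta>. ennreal (g (size \<eta>)) \<partial>restrict_space \<rho> ?E) = (\<integral>\<^sup>+ \<eta>. ennreal (g (size \<eta>)) * indicator ?E \<eta> \<partial>\<rho>)"
    by (rule nn_integral_restrict_space) (use E in simp)
  also have "\<dots> = (\<integral>\<^sup>+ \<eta>. (\<Sum>n. ennreal (g n) * indicator (conf_n V n) \<eta>) \<partial>\<rho>)"
  proof (rule nn_integral_cong)
    fix \<eta>
    have "(\<Sum>n. ennreal (g n) * indicator (conf_n V n) \<eta>) = (\<Sum>n\<in>{size \<eta>}. ennreal (g n) * indicator (conf_n V n) \<eta>)"
      by (rule suminf_finite) (auto simp: conf_n_def indicator_def)
    also have "\<dots> = ennreal (g (size \<eta>)) * indicator ?E \<eta>" by (auto simp: conf_n_def indicator_def)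
    finally show "ennreal (g (size \<eta>)) * indicator ?E \<eta> = (\<Sum>n. ennreal (g n) * indicator (conf_n V n) \<eta>)" ..
  qed
  also have "\<dots> = (\<Sum>n. \<integral>\<^sup>+ \<eta>. ennreal (g n) * indicator (conf_n V n) \<eta> \<partial>\<rho>)"
    by (rule nn_integral_suminf) (use meas in measurable)
  also have "\<dots> = (\<Sum>n. ennreal (g n) * emeasure \<rho> (conf_n V n))"
    using meas by (simp add: nn_integral_cmult_indicator)
  also have "\<dots> \<le> (\<Sum>n. ennreal (r ^ n))"
  proof (rule suminf_le)
    fix n
    have "ennreal (g n) * emeasure \<rho> (conf_n V n) \<le> ennreal (g n) * ennreal (inverse ((2 + \<epsilon>) ^ n))"
      by (rule mult_left_mono[OF small]) simp
    also have "\<dots> = ennreal (r ^ n)" unfolding gr[symmetric] using \<epsilon> by (subst ennreal_mult) (simp_all add: g_def)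
    finally show "ennreal (g n) * emeasure \<rho> (conf_n V n) \<le> ennreal (r ^ n)" .
  qed simp_all
  also have "\<dots> = ennreal (\<Sum>n. r ^ n)" by (rule suminf_ennreal2) (use r in \<open>simp_all add: summable_geometric\<close>)
  also have "\<dots> < \<infinity>" by simp
  finally have "integrable (restrict_space \<rho> ?E) (\<lambda>\<eta>. g (size \<eta>))"
    by (intro integrableI_bounded ms) (simp add: g_def)
  then show ?thesis unfolding g_def .
qed

text \<open>\<open>AE_not_in\<close> is applied to the sequence that decides local configurations.
  All atoms \<open>Z\<close> are finite subsets of the ball, so their pairings avoid the complement
  of the admissible sequences; that complement is null for \<open>nu\<close>, hence null for \<mu>
  where \<open>h0\<close> does not vanish.\<close>

lemma loc_conf_AE:
  assumes cb: "coord_ball c a r" and W: "open W" "chart_inv c ` ball a r \<subseteq> W" and \<epsilon>: "\<epsilon> > 0"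
    and small: "\<And>n. emeasure \<rho> (conf_n W n) \<le> ennreal (inverse ((2 + \<epsilon>) ^ n))"
  shows "AE \<omega> in \<mu>. h0 \<omega> \<noteq> 0 \<longrightarrow> (\<exists>Z. loc_conf (chart_inv c ` ball a r) \<omega> Z)"
proof -
  let ?V = "chart_inv c ` ball a r"
  from loc_conf_sequence[OF cb] obtain \<psi> :: "nat \<Rightarrow> 'a \<Rightarrow> real" where \<psi>V: "\<forall>j. \<psi> j \<in> DD_in ?V"
    and S: "pairings \<psi> ` {Z. finite Z \<and> Z \<subseteq> ?V} \<in> sets borel"
    and iff: "\<forall>\<omega>\<in>DD_dual A. (\<lambda>j. \<omega> (\<psi> j)) \<in> pairings \<psi> ` {Z. finite Z \<and> Z \<subseteq> ?V} \<longleftrightarrow> (\<exists>Z. loc_conf ?V \<omega> Z)"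
    by (elim exE conjE) (rule that)
  let ?S = "pairings \<psi> ` {Z. finite Z \<and> Z \<subseteq> ?V}"
  have \<psi>: "\<psi> j \<in> DD A" for j using \<psi>V by (simp add: DD_in_def)
  have \<psi>0: "\<psi> j x = 0" if "x \<notin> ?V" for j x using \<psi>V that unfolding DD_in_def by blast
  have V: "conf_n ?V n \<in> sets \<rho>" "conf_n W n \<in> sets \<rho>" for n
    using conf_n_open[OF coord_ball_open[OF cb]] conf_n_open[OF W(1)] by (simp_all add: sets_rho)
  have small': "emeasure \<rho> (conf_n ?V n) \<le> ennreal (inverse ((2 + \<epsilon>) ^ n))" for n
    using emeasure_mono[OF conf_n_mono[OF W(2)] V(2)] small by (rule order_trans)
  have "\<forall>j. \<exists>B. \<forall>x. \<bar>\<psi> j x\<bar> \<le> B"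
  proof
    fix j
    obtain L where L: "compact L" "\<forall>x. \<psi> j x \<noteq> 0 \<longrightarrow> x \<in> L" using DD_support[OF \<psi>] by blast
    have "bounded (\<psi> j ` L)"
      by (rule compact_imp_bounded, rule compact_continuous_image[OF continuous_on_subset[OF DD_continuous[OF \<psi>] subset_UNIV] L(1)])
    then obtain B where B: "\<And>x. x \<in> L \<Longrightarrow> \<bar>\<psi> j x\<bar> \<le> B" unfolding bounded_iff by auto
    have "\<bar>\<psi> j x\<bar> \<le> max B 0" for x
    proof (cases "x \<in> L")
      case True
      show ?thesis using B[OF True] by simp
    next
      case False
      then have "\<psi> j x = 0" using L(2) by blast
      then show ?thesis by simp
    qed
    then show "\<exists>B. \<forall>x. \<bar>\<psi> j x\<bar> \<le> B" by blast
  qed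
  then obtain B where B: "\<And>j x. \<bar>\<psi> j x\<bar> \<le> B j" by metis
  \<comment> \<open>The smallness of \<rho> is local; only on configurations inside the ball does it
    yield an exponential moment.\<close>
  define E where "E = {\<eta> \<in> conf0. set_mset \<eta> \<subseteq> ?V}"
  have "E = (\<Union>n. conf_n ?V n)" by (auto simp: E_def conf_n_def)
  then have E: "E \<inter> space \<rho> \<in> sets \<rho>" using V(1) by (simp add: sets.countable_UN)
  have spM: "space (restrict_space \<rho> E) = E" by (auto simp: space_restrict_space space_rho E_def)
  have card: "card (set_mset \<eta>) = size \<eta>" if "\<eta> \<in> E" for \<eta>
  proof -
    have "\<eta> = mset_set (set_mset \<eta>)" by (rule conf0_eq_mset_set) (use that in \<open>simp add: E_def\<close>)
    then have "size \<eta> = size (mset_set (set_mset \<eta>))" by (rule arg_cong)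
    then show ?thesis by simp
  qed
  interpret M: signed_moments nu "\<lambda>j \<omega>. \<omega> (\<psi> j)" "restrict_space \<rho> E" size "\<lambda>\<eta>. Pow (set_mset \<eta>)"
    "\<lambda>\<eta> Z. (-1) ^ card (set_mset \<eta> - Z)" "pairings \<psi>" B "ln ((2 + \<epsilon>) / 2) / 2"
  proof (rule signed_moments.intro)
    show "finite_measure nu" by (rule finite_nu)
    show "(\<lambda>\<omega>. \<omega> (\<psi> j)) \<in> borel_measurable nu" for j
      unfolding nu_def measurable_density_eq1 using evaluation_mu[OF \<psi>] by simp
    show "finite (Pow (set_mset \<eta>))" for \<eta> :: "'a multiset" by simp
    show "card (Pow (set_mset \<eta>)) \<le> 2 ^ size \<eta>" if "\<eta> \<in> space (restrict_space \<rho> E)" for \<eta>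
      using card that unfolding spM by (simp add: card_Pow)
    show "\<bar>(-1) ^ card (set_mset \<eta> - Z)\<bar> \<le> (1::real)" for \<eta> :: "'a multiset" and Z by (simp add: power_abs)
    show "\<bar>pairings \<psi> Z j\<bar> \<le> B j * real (size \<eta>)" if \<eta>: "\<eta> \<in> space (restrict_space \<rho> E)" and Z: "Z \<in> Pow (set_mset \<eta>)" for \<eta> Z j
    proof -
      have B0: "B j \<ge> 0" using B[of j] abs_ge_zero order_trans by blast
      have "\<bar>pairings \<psi> Z j\<bar> \<le> (\<Sum>x\<in>Z. B j)" unfolding pairings_def by (rule order_trans[OF sum_abs sum_mono[OF B]])
      also have "\<dots> = real (card Z) * B j" by simp
      also have "card Z \<le> size \<eta>" using card_mono[OF finite_set_mset[of \<eta>], of Z] Z card \<eta> unfolding spM by simp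
      then have "real (card Z) * B j \<le> real (size \<eta>) * B j" using B0 by (intro mult_right_mono) simp_all
      finally show ?thesis by (simp add: mult.commute)
    qed
    show "(\<lambda>\<eta>. \<Sum>Z\<in>Pow (set_mset \<eta>). (-1) ^ card (set_mset \<eta> - Z) * F (pairings \<psi> Z)) \<in> borel_measurable (restrict_space \<rho> E)"
      if "continuous_on UNIV F" for F :: "(nat \<Rightarrow> real) \<Rightarrow> real"
      using measurable_restrict_space1[OF alt_sum_measurable[OF \<psi> that], where \<Omega> = E] unfolding alt_sum_def .
    show "size \<in> measurable (restrict_space \<rho> E) (count_space UNIV)" by (rule measurable_restrict_space1[OF size_measurable])
    show "ln ((2 + \<epsilon>) / 2) / 2 > 0" using \<epsilon> by simp
    show "integrable (restrict_space \<rho> E) (\<lambda>\<eta>. 2 ^ size \<eta> * exp (ln ((2 + \<epsilon>) / 2) / 2 * real (size \<eta>)))"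
      unfolding E_def by (rule exp_size_integrable[OF V(1) \<epsilon> small'])
    fix m k and t :: "nat \<Rightarrow> real"
    define \<phi> where "\<phi> x = (\<Sum>j<m. t j * \<psi> j x)" for x
    have \<phi>: "\<phi> \<in> DD A" unfolding \<phi>_def by (intro DD_sum DD_scale \<psi>)
    have lin: "lin_form m t (\<lambda>j. \<omega> (\<psi> j)) = \<omega> \<phi>" if \<omega>: "\<omega> \<in> DD_dual A" for \<omega>
    proof -
      have "\<omega> \<phi> = (\<Sum>j<m. \<omega> (\<lambda>x. t j * \<psi> j x))" unfolding \<phi>_def by (rule dual_sum[OF \<omega> DD_scale[OF \<psi>]])
      also have "\<dots> = (\<Sum>j<m. t j * \<omega> (\<psi> j))"
        using \<omega> \<psi> by (simp add: DD_dual_def dual_space_def topspace_DD_topology)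
      finally show ?thesis by (simp add: lin_form_def)
    qed
    have cong: "\<omega> \<in> space nu \<Longrightarrow> lin_form m t (\<lambda>j. \<omega> (\<psi> j)) ^ k = \<omega> \<phi> ^ k" for \<omega>
      using lin by (simp add: nu_def space_mu)
    show "integrable nu (\<lambda>\<omega>. lin_form m t (\<lambda>j. \<omega> (\<psi> j)) ^ k)"
      using moments_nu(1)[OF \<phi>] by (simp cong: Bochner_Integration.integrable_cong add: cong)
    have alt: "(\<Sum>Z\<in>Pow Y. (-1) ^ card (Y - Z) * lin_form m t (pairings \<psi> Z) ^ k) = alt_sum (\<lambda>Z. (\<Sum>z\<in>Z. \<phi> z) ^ k) Y" for Y
    proof -
      have "lin_form m t (pairings \<psi> Z) = (\<Sum>z\<in>Z. \<phi> z)" for Z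
        unfolding lin_form_def pairings_def \<phi>_def sum_distrib_left by (rule sum.swap)
      then show ?thesis by (simp add: alt_sum_def)
    qed
    \<comment> \<open>A point outside the ball contributes 0 to every pairing, so the alternating
      sum cancels and restricting \<rho> to \<open>E\<close> leaves the moments unchanged.\<close>
    have off: "alt_sum (\<lambda>Z. (\<Sum>z\<in>Z. \<phi> z) ^ k) (set_mset \<eta>) = 0" if \<eta>: "\<eta> \<in> conf0" "\<eta> \<notin> E" for \<eta>
    proof -
      obtain y where y: "y \<in> set_mset \<eta>" "y \<notin> ?V" using \<eta> unfolding E_def by blast
      have "\<phi> y = 0" using \<psi>0[OF y(2)] by (simp add: \<phi>_def)
      then have "(\<Sum>z\<in>insert y Z. \<phi> z) = (\<Sum>z\<in>Z - {y}. \<phi> z)" for Z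
        by (cases "finite Z") (simp_all add: sum.insert_remove)
      then show ?thesis by (intro alt_sum_zero[OF _ y(1)]) simp_all
    qed
    have "(LINT \<omega>|nu. lin_form m t (\<lambda>j. \<omega> (\<psi> j)) ^ k) = (LINT \<omega>|nu. \<omega> \<phi> ^ k)"
      by (rule Bochner_Integration.integral_cong[OF refl cong])
    also have "\<dots> = (LINT \<eta>|\<rho>. alt_sum (\<lambda>Z. (\<Sum>z\<in>Z. \<phi> z) ^ k) (set_mset \<eta>))" by (rule moments_nu(2)[OF \<phi>])
    also have "\<dots> = (LINT \<eta>|\<rho>. indicator E \<eta> *\<^sub>R alt_sum (\<lambda>Z. (\<Sum>z\<in>Z. \<phi> z) ^ k) (set_mset \<eta>))"
      by (rule Bochner_Integration.integral_cong[OF refl]) (use off in \<open>auto simp: indicator_def space_rho\<close>)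
    also have "\<dots> = (LINT \<eta>|restrict_space \<rho> E. alt_sum (\<lambda>Z. (\<Sum>z\<in>Z. \<phi> z) ^ k) (set_mset \<eta>))"
      by (rule integral_restrict_space[OF E, symmetric])
    finally show "(LINT \<omega>|nu. lin_form m t (\<lambda>j. \<omega> (\<psi> j)) ^ k) =
        (LINT \<eta>|restrict_space \<rho> E. (\<Sum>Z\<in>Pow (set_mset \<eta>). (-1) ^ card (set_mset \<eta> - Z) * lin_form m t (pairings \<psi> Z) ^ k))"
      unfolding alt .
  qed
  have "AE \<omega> in nu. (\<lambda>j. \<omega> (\<psi> j)) \<notin> - ?S"
  proof (rule M.AE_not_in)
    show "- ?S \<in> sets borel" by (rule borel_comp[OF S])
    fix \<eta> Z assume "\<eta> \<in> space (restrict_space \<rho> E)" "Z \<in> Pow (set_mset \<eta>)"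
    then have "\<eta> \<in> E" "Z \<subseteq> set_mset \<eta>" unfolding spM by simp_all
    then have "finite Z" "Z \<subseteq> ?V" using finite_subset[OF _ finite_set_mset] unfolding E_def by blast+
    then show "pairings \<psi> Z \<notin> - ?S" by blast
  qed
  then have "AE \<omega> in \<mu>. 0 < ennreal ((cmod (h0 \<omega>))\<^sup>2) \<longrightarrow> (\<lambda>j. \<omega> (\<psi> j)) \<notin> - ?S"
    unfolding nu_def by (subst (asm) AE_density) (use h0_measurable in simp_all)
  moreover have "AE \<omega> in \<mu>. \<omega> \<in> DD_dual A" unfolding space_mu[symmetric] by (rule AE_space)
  ultimately show ?thesis
  proof eventually_elim
    case (elim \<omega>)
    show ?case
    proof
      assume "h0 \<omega> \<noteq> 0"
      then have "(\<lambda>j. \<omega> (\<psi> j)) \<in> ?S" using elim(1) by simp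
      then show "\<exists>Z. loc_conf ?V \<omega> Z" using bspec[OF iff elim(2)] by blast
    qed
  qed
qed

lemma loc_conf_measurable:
  assumes cb: "coord_ball c a r"
  shows "{\<omega> \<in> space \<mu>. \<exists>Z. loc_conf (chart_inv c ` ball a r) \<omega> Z} \<in> sets \<mu>"
proof -
  let ?V = "chart_inv c ` ball a r"
  from loc_conf_sequence[OF cb] obtain \<psi> :: "nat \<Rightarrow> 'a \<Rightarrow> real" where \<psi>V: "\<forall>j. \<psi> j \<in> DD_in ?V"
    and S: "pairings \<psi> ` {Z. finite Z \<and> Z \<subseteq> ?V} \<in> sets borel"
    and iff: "\<forall>\<omega>\<in>DD_dual A. (\<lambda>j. \<omega> (\<psi> j)) \<in> pairings \<psi> ` {Z. finite Z \<and> Z \<subseteq> ?V} \<longleftrightarrow> (\<exists>Z. loc_conf ?V \<omega> Z)"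
    by (elim exE conjE) (rule that)
  have "(\<lambda>\<omega> j. \<omega> (\<psi> j)) \<in> borel_measurable \<mu>"
    by (rule measurable_coordinatewise_then_product, rule evaluation_mu) (use \<psi>V in \<open>simp add: DD_in_def\<close>)
  from measurable_sets[OF this S]
  have "(\<lambda>\<omega> j. \<omega> (\<psi> j)) -` (pairings \<psi> ` {Z. finite Z \<and> Z \<subseteq> ?V}) \<inter> space \<mu> \<in> sets \<mu>" .
  moreover have "{\<omega> \<in> space \<mu>. \<exists>Z. loc_conf ?V \<omega> Z} =
      (\<lambda>\<omega> j. \<omega> (\<psi> j)) -` (pairings \<psi> ` {Z. finite Z \<and> Z \<subseteq> ?V}) \<inter> space \<mu>"
  proof (intro set_eqI)
    fix \<omega>
    show "\<omega> \<in> {\<omega> \<in> space \<mu>. \<exists>Z. loc_conf ?V \<omega> Z} \<longleftrightarrow>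
        \<omega> \<in> (\<lambda>\<omega> j. \<omega> (\<psi> j)) -` (pairings \<psi> ` {Z. finite Z \<and> Z \<subseteq> ?V}) \<inter> space \<mu>"
      using iff unfolding space_mu vimage_def by blast
  qed
  ultimately show ?thesis by (simp only:)
qed

text \<open>The multiplication rule propagates the vanishing of \<open>h0\<close> off \<open>\<Gamma>\<close> to the images of all tensor products.\<close>

lemma K_fun_zero_off:
  assumes h0: "AE \<omega> in \<mu>. \<omega> \<notin> \<Gamma> \<longrightarrow> h0 \<omega> = 0" and G: "G \<in> tensor_span"
  shows "AE \<omega> in \<mu>. \<omega> \<notin> \<Gamma> \<longrightarrow> K_fun A G \<omega> = 0"
proof -
  define Zr where "Zr G \<longleftrightarrow> G \<in> tensor_span \<and> (AE \<omega> in \<mu>. \<omega> \<notin> \<Gamma> \<longrightarrow> K_fun A G \<omega> = 0)" for G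
  have lin: "Zr (\<lambda>\<eta>. G1 \<eta> + z * G2 \<eta>)" if 1: "Zr G1" and 2: "Zr G2" for G1 G2 z
    unfolding Zr_def
  proof
    have ts: "G1 \<in> tensor_span" "G2 \<in> tensor_span" using 1 2 by (simp_all add: Zr_def)
    show "(\<lambda>\<eta>. G1 \<eta> + z * G2 \<eta>) \<in> tensor_span" by (rule tensor_span.lin[OF ts])
    have "AE \<omega> in \<mu>. \<omega> \<notin> \<Gamma> \<longrightarrow> K_fun A G1 \<omega> = 0" "AE \<omega> in \<mu>. \<omega> \<notin> \<Gamma> \<longrightarrow> K_fun A G2 \<omega> = 0"
      using 1 2 by (simp_all add: Zr_def)
    with K_fun_lin[OF tensor_span_Ffin[OF ts(1)] tensor_span_Ffin[OF ts(2)], of z]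
    show "AE \<omega> in \<mu>. \<omega> \<notin> \<Gamma> \<longrightarrow> K_fun A (\<lambda>\<eta>. G1 \<eta> + z * G2 \<eta>) \<omega> = 0"
      by eventually_elim simp
  qed
  have star: "Zr (star (one_particle \<phi>) G)" if \<phi>: "\<phi> \<in> DD A" and G: "Zr G" for \<phi> G
    unfolding Zr_def
  proof
    have ts: "G \<in> tensor_span" using G by (simp add: Zr_def)
    show "star (one_particle \<phi>) G \<in> tensor_span" by (rule tensor_span_star[OF \<phi> ts])
    have "AE \<omega> in \<mu>. \<omega> \<notin> \<Gamma> \<longrightarrow> K_fun A G \<omega> = 0" using G by (simp add: Zr_def)
    with K_fun_star[OF \<phi> ts] show "AE \<omega> in \<mu>. \<omega> \<notin> \<Gamma> \<longrightarrow> K_fun A (star (one_particle \<phi>) G) \<omega> = 0"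
      by eventually_elim simp
  qed
  have vac: "Zr (tensor [])" unfolding Zr_def using h0 tensor_span.tensor[of "[]"] by (simp add: h0_def)
  have zero: "Zr (\<lambda>_. 0)" using lin[OF vac vac, of "-1"] by simp
  have sum: "Zr (\<lambda>\<eta>. \<Sum>k\<in>I. G k \<eta>)" if "\<And>k. k \<in> I \<Longrightarrow> Zr (G k)" for I :: "nat set" and G
    using that
  proof (induction I rule: infinite_finite_induct)
    case (insert i I)
    then show ?case using lin[of "G i" "\<lambda>\<eta>. \<Sum>k\<in>I. G k \<eta>" 1] by simp
  qed (simp_all add: zero)
  \<comment> \<open>Induction on the length, since the recursion alters the entries of the list as
    well.\<close>
  have tens: "Zr (tensor \<phi>s)" if "length \<phi>s = n" "set \<phi>s \<subseteq> DD A" for n \<phi>s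
    using that
  proof (induction n arbitrary: \<phi>s)
    case 0
    then have e: "\<phi>s = []" by simp
    show ?case unfolding e by (rule vac)
  next
    case (Suc n)
    then obtain \<phi> \<psi>s where c: "\<phi>s = \<phi> # \<psi>s" "length \<psi>s = n" by (cases \<phi>s) auto
    have in_DD: "\<phi> \<in> DD A" "set \<psi>s \<subseteq> DD A" using Suc.prems(2) unfolding c(1) by simp_all
    \<comment> \<open>\<open>star_tensor\<close> solved for the tensor of length
      \<open>Suc n\<close>; all tensors that remain have length \<open>n\<close>.\<close>
    have "Zr (\<lambda>\<eta>. star (one_particle \<phi>) (tensor \<psi>s) \<eta> +
        (-1) * (\<Sum>k\<in>{..<length \<psi>s}. tensor (\<psi>s[k := (\<lambda>x. \<phi> x * (\<psi>s ! k) x)]) \<eta>))"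
    proof (rule lin[OF star[OF in_DD(1) Suc.IH[OF c(2) in_DD(2)]] sum])
      fix k assume "k \<in> {..<length \<psi>s}"
      then have "set (\<psi>s[k := (\<lambda>x. \<phi> x * (\<psi>s ! k) x)]) \<subseteq> DD A" by (intro DD_update_in in_DD) simp
      then show "Zr (tensor (\<psi>s[k := (\<lambda>x. \<phi> x * (\<psi>s ! k) x)]))" by (intro Suc.IH) (simp_all add: c(2))
    qed
    then show ?case unfolding c(1) star_tensor by (simp del: tensor.simps)
  qed
  have "Zr G"
    using G by (induction rule: tensor_span.induct) (blast intro: tens, rule lin)
  then show ?thesis by (simp add: Zr_def)
qed

text \<open>Vanishing off \<Gamma> passes from the tensor span to all of \<open>Ffin\<close> by
  density. The indicator of the complement is then orthogonal to every \<open>K_fun A G\<close>,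
  hence zero by totality.\<close>

lemma full_measure:
  assumes \<Gamma>: "\<Gamma> \<in> sets \<mu>" and h0: "AE \<omega> in \<mu>. \<omega> \<notin> \<Gamma> \<longrightarrow> h0 \<omega> = 0"
  shows "emeasure \<mu> \<Gamma> = 1"
proof -
  have zero: "AE \<omega> in \<mu>. \<omega> \<notin> \<Gamma> \<longrightarrow> K_fun A G \<omega> = 0" if G: "G \<in> Ffin A" for G
  proof -
    let ?u = "\<lambda>\<omega>. indicator (- \<Gamma>) \<omega> * (cmod (K_fun A G \<omega>))\<^sup>2 :: real"
    have mC: "(indicator (- \<Gamma>) :: _ \<Rightarrow> real) \<in> borel_measurable \<mu>"
      by (subst borel_measurable_indicator_iff) (use \<Gamma> in \<open>simp add: Diff_eq[symmetric] Int_commute[of "- \<Gamma>"]\<close>)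
    have m: "?u \<in> borel_measurable \<mu>"
      using mC borel_measurable_integrable[OF K_fun_square[OF G]] by (rule borel_measurable_times)
    have i: "integrable \<mu> ?u"
      by (rule Bochner_Integration.integrable_bound[OF K_fun_square[OF G] m]) (auto simp: indicator_def)
    have "(LINT \<omega>|\<mu>. ?u \<omega>) \<le> e" if e: "e > 0" for e
    proof -
      obtain P where P: "P \<in> tensor_span"
        "norm (a_form \<rho> (\<lambda>\<eta>. G \<eta> + (-1) * P \<eta>) (conj_fun (\<lambda>\<eta>. G \<eta> + (-1) * P \<eta>))) \<le> e"
        using tensor_span_dense[OF G e] by blast
      let ?D = "\<lambda>\<eta>. G \<eta> + (-1) * P \<eta>"
      have D: "?D \<in> Ffin A" by (rule Ffin_lin[OF G tensor_span_Ffin[OF P(1)]])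
      \<comment> \<open>Off \<Gamma> the image of \<open>P\<close> vanishes, so there
        \<open>K_fun A G\<close> equals \<open>K_fun A ?D\<close>, whose norm is small.\<close>
      have "(LINT \<omega>|\<mu>. ?u \<omega>) \<le> (LINT \<omega>|\<mu>. (cmod (K_fun A ?D \<omega>))\<^sup>2)"
      proof (rule integral_mono_AE[OF i K_fun_square[OF D]])
        from K_fun_lin[OF G tensor_span_Ffin[OF P(1)], of "-1"] K_fun_zero_off[OF h0 P(1)]
        show "AE \<omega> in \<mu>. ?u \<omega> \<le> (cmod (K_fun A ?D \<omega>))\<^sup>2"
          by eventually_elim (auto simp: indicator_def)
      qed
      also have "\<dots> \<le> cmod (complex_of_real (LINT \<omega>|\<mu>. (cmod (K_fun A ?D \<omega>))\<^sup>2))" by simp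
      also have "complex_of_real (LINT \<omega>|\<mu>. (cmod (K_fun A ?D \<omega>))\<^sup>2) = a_form \<rho> ?D (conj_fun ?D)"
        unfolding integral_mult_cnj_self[symmetric] by (rule K_fun_inn[OF D D])
      also have "cmod \<dots> \<le> e" by (rule P(2))
      finally show ?thesis .
    qed
    then have "(LINT \<omega>|\<mu>. ?u \<omega>) \<le> 0" by (rule field_le_epsilon[where y = 0, simplified])
    moreover have "(LINT \<omega>|\<mu>. ?u \<omega>) \<ge> 0" by (rule Bochner_Integration.integral_nonneg) simp
    ultimately have "(LINT \<omega>|\<mu>. ?u \<omega>) = 0" by (rule antisym)
    then have "AE \<omega> in \<mu>. ?u \<omega> = 0" by (subst (asm) integral_nonneg_eq_0_iff_AE[OF i]) simp_all
    then show ?thesis by eventually_elim (auto simp: indicator_def)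
  qed
  let ?f = "indicator (space \<mu> - \<Gamma>) :: _ \<Rightarrow> complex"
  interpret prob_space \<mu> by (rule prob)
  have mf: "?f \<in> borel_measurable \<mu>" by (rule borel_measurable_indicator) (use \<Gamma> in auto)
  have "AE \<omega> in \<mu>. ?f \<omega> = 0"
  proof (rule R.F_total)
    have "integrable \<mu> (\<lambda>\<omega>. (cmod (?f \<omega>))\<^sup>2)"
    proof (rule integrable_const_bound[where B = 1])
      show "(\<lambda>\<omega>. (cmod (?f \<omega>))\<^sup>2) \<in> borel_measurable \<mu>" by (rule borel_measurable_power[OF measurable_compose[OF mf borel_measurable_norm]])
    qed (simp add: indicator_def)
    then show "?f \<in> carr (L2_pre \<mu>)" using mf by (simp add: L2_pre_def)
    fix G assume "G \<in> carr (Ffin_pre A \<rho>)"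
    then have G: "G \<in> Ffin A" by (simp add: Ffin_pre_simps)
    from zero[OF G] have "AE \<omega> in \<mu>. ?f \<omega> * cnj (K_fun A G \<omega>) = 0"
      by eventually_elim (auto simp: indicator_def)
    then show "(LINT \<omega>|\<mu>. ?f \<omega> * cnj (K_fun A G \<omega>)) = 0" by (rule integral_eq_zero_AE)
  qed
  then have "AE \<omega> in \<mu>. \<omega> \<in> \<Gamma>" using AE_space[of \<mu>]
    by eventually_elim (auto simp: indicator_def split: if_splits)
  then show ?thesis by (rule emeasure_eq_1_AE[OF \<Gamma>])
qed

text \<open>The set of configurations is the intersection of the local events over a countable cover
  by coordinate balls. This yields its measurability and, together with \<open>loc_conf_AE\<close>,
  that \<open>h0\<close> vanishes almost everywhere off it.\<close>

lemma configurations_full_measure: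
  assumes cover: "\<And>p. \<exists>W \<epsilon>. open W \<and> p \<in> W \<and> \<epsilon> > 0 \<and>
    (\<forall>n. emeasure \<rho> (conf_n W n) \<le> ennreal (inverse ((2 + \<epsilon>) ^ n)))"
  shows "emeasure \<mu> (conf_functional A ` conf_space) = 1"
proof -
  \<comment> \<open>Smallness is asked of an open superset \<open>W\<close>, which makes the
    property hereditary.\<close>
  define P where "P V \<longleftrightarrow> (\<exists>W \<epsilon>. open W \<and> V \<subseteq> W \<and> \<epsilon> > 0 \<and>
    (\<forall>n. emeasure \<rho> (conf_n W n) \<le> ennreal (inverse ((2 + \<epsilon>) ^ n))))" for V
  have P1: "\<exists>W. open W \<and> p \<in> W \<and> P W" for p using cover[of p] unfolding P_def by blast
  have P2: "P V" if "P W" "V \<subseteq> W" for V W using that unfolding P_def by (meson subset_trans)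
  obtain \<V> where \<V>: "countable \<V>" "\<Union>\<V> = UNIV"
    "\<And>V. V \<in> \<V> \<Longrightarrow> P V \<and> (\<exists>c a r. coord_ball c a r \<and> V = chart_inv c ` ball a r)"
    by (rule countable_coord_cover[of P, OF P1 P2]) (assumption | rule that)+
  let ?\<Gamma> = "conf_functional A ` conf_space" and ?T = "\<lambda>V. {\<omega> \<in> space \<mu>. \<exists>Z. loc_conf V \<omega> Z}"
  have T: "?T V \<in> sets \<mu>" if V: "V \<in> \<V>" for V
  proof -
    obtain c a r where cb: "coord_ball c a r" "V = chart_inv c ` ball a r" using \<V>(3)[OF V] by blast
    show ?thesis unfolding cb(2) by (rule loc_conf_measurable[OF cb(1)])
  qed
  have AE_T: "AE \<omega> in \<mu>. h0 \<omega> \<noteq> 0 \<longrightarrow> (\<exists>Z. loc_conf V \<omega> Z)" if V: "V \<in> \<V>" for V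
  proof -
    obtain c a r where cb: "coord_ball c a r" "V = chart_inv c ` ball a r" using \<V>(3)[OF V] by blast
    obtain W \<epsilon> where W: "open W" "V \<subseteq> W" "\<epsilon> > 0" "\<forall>n. emeasure \<rho> (conf_n W n) \<le> ennreal (inverse ((2 + \<epsilon>) ^ n))"
      using \<V>(3)[OF V] unfolding P_def by blast
    show ?thesis unfolding cb(2) by (rule loc_conf_AE[OF cb(1) W(1) W(2)[unfolded cb(2)] W(3)]) (use W(4) in blast)
  qed
  have mem: "\<omega> \<in> ?\<Gamma> \<longleftrightarrow> (\<forall>V\<in>\<V>. \<exists>Z. loc_conf V \<omega> Z)" if \<omega>: "\<omega> \<in> space \<mu>" for \<omega>
  proof
    assume "\<omega> \<in> ?\<Gamma>"
    then obtain \<gamma> where \<gamma>: "\<gamma> \<in> conf_space" "\<omega> = conf_functional A \<gamma>" by (rule imageE) (rule that)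
    show "\<forall>V\<in>\<V>. \<exists>Z. loc_conf V \<omega> Z"
    proof
      fix V assume V: "V \<in> \<V>"
      obtain c a r where cb: "coord_ball c a r" "V = chart_inv c ` ball a r" using \<V>(3)[OF V] by blast
      show "\<exists>Z. loc_conf V \<omega> Z" unfolding \<gamma>(2) cb(2) by (rule exI, rule conf_functional_loc_conf[OF \<gamma>(1) cb(1)])
    qed
  next
    assume l: "\<forall>V\<in>\<V>. \<exists>Z. loc_conf V \<omega> Z"
    show "\<omega> \<in> ?\<Gamma>"
    proof (rule dual_loc_conf_imp[of \<omega> \<V>])
      show "\<omega> \<in> DD_dual A" using \<omega> unfolding space_mu .
      show "\<exists>c a r. coord_ball c a r \<and> V = chart_inv c ` ball a r" if "V \<in> \<V>" for V using \<V>(3)[OF that] by (rule conjunct2)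
      show "\<Union>\<V> = UNIV" by (rule \<V>(2))
      show "\<exists>Z. loc_conf V \<omega> Z" if "V \<in> \<V>" for V using l that by (rule bspec)
    qed
  qed
  have sub: "\<omega> \<in> space \<mu>" if "\<omega> \<in> ?\<Gamma>" for \<omega>
    using that unfolding space_mu by (elim imageE) (simp add: conf_functional_dual)
  have "?\<Gamma> = space \<mu> - (\<Union>V\<in>\<V>. space \<mu> - ?T V)"
  proof (rule set_eqI)
    fix \<omega>
    show "\<omega> \<in> ?\<Gamma> \<longleftrightarrow> \<omega> \<in> space \<mu> - (\<Union>V\<in>\<V>. space \<mu> - ?T V)"
    proof (cases "\<omega> \<in> space \<mu>")
      case True
      show ?thesis unfolding mem[OF True] using True by simp
    next
      case False
      then have "\<omega> \<notin> ?\<Gamma>" using sub by (rule contrapos_nn)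
      then show ?thesis using False by simp
    qed
  qed
  moreover have "(\<Union>V\<in>\<V>. space \<mu> - ?T V) \<in> sets \<mu>"
    by (rule sets.countable_UN'[OF \<V>(1)], rule image_subsetI, rule sets.Diff[OF sets.top T])
  then have "space \<mu> - (\<Union>V\<in>\<V>. space \<mu> - ?T V) \<in> sets \<mu>" by (rule sets.Diff[OF sets.top])
  ultimately have \<Gamma>: "?\<Gamma> \<in> sets \<mu>" by (simp only:)
  have "AE \<omega> in \<mu>. \<forall>V\<in>\<V>. h0 \<omega> \<noteq> 0 \<longrightarrow> (\<exists>Z. loc_conf V \<omega> Z)" by (rule AE_ball_countable'[OF AE_T \<V>(1)])
  then have "AE \<omega> in \<mu>. \<omega> \<notin> ?\<Gamma> \<longrightarrow> h0 \<omega> = 0" using AE_space[of \<mu>]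
  proof eventually_elim
    case (elim \<omega>)
    show ?case
    proof (intro impI, rule ccontr)
      assume "\<omega> \<notin> ?\<Gamma>" "h0 \<omega> \<noteq> 0"
      then show False using elim(1) mem[OF elim(2)] by blast
    qed
  qed
  then show ?thesis by (rule full_measure[OF \<Gamma>])
qed

end

theorem theorem2:
  fixes A :: "('a::{t2_space, second_countable_topology}, 'n::finite) chart set"
    and g :: "('a, 'n) chart \<Rightarrow> real^'n \<Rightarrow> real^'n^'n"
    and \<rho> :: "'a multiset measure"
    and \<mu> :: "(('a \<Rightarrow> real) \<Rightarrow> real) measure"
  assumes "oriented_atlas A"
    and "riemannian_metric A g"
    and "connected (UNIV :: 'a set)"
    and "\<not> compact (UNIV :: 'a set)"
    and "sets \<rho> = sets conf0_borel"
    and "emeasure \<rho> (conf_n UNIV 0) = 1"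
    and "\<And>\<Lambda>. compact \<Lambda> \<Longrightarrow>
           \<exists>C>0. \<forall>n. emeasure \<rho> (conf_n \<Lambda> n) \<le> ennreal (C ^ n)"
    and "\<And>G. G \<in> Ffin A \<Longrightarrow> a_form \<rho> G (conj_fun G) \<in> \<real>\<^sub>\<ge>\<^sub>0"
    and "\<And>\<Lambda>. compact \<Lambda> \<Longrightarrow>
           \<exists>(k::nat) (U :: nat \<Rightarrow> 'a set) \<epsilon>. \<epsilon> > 0 \<and> \<Lambda> \<subseteq> (\<Union>i<k. U i) \<and>
             (\<forall>i<k. open (U i) \<and> compact (closure (U i)) \<and>
                (\<forall>n. emeasure \<rho> (conf_n (U i) n) \<le> ennreal (inverse ((2 + \<epsilon>) ^ n))))"
    and "associated_measure A \<rho> \<mu>"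
  shows "emeasure \<mu> (conf_functional A ` conf_space) = 1"
proof -
  obtain K where K: "unitary_iso (H_space A \<rho>) (L2 \<mu>) K"
    "\<forall>G\<in>Ffin A. K_fun A G \<in> carr (L2_pre \<mu>) \<and> K (hat A \<rho> G) = vclass (L2_pre \<mu>) (K_fun A G)"
    "\<forall>\<phi>\<in>DD A. (\<lambda>(x, y). (K x, K y)) ` op_closure (H_space A \<rho>) (A_op A \<rho> \<phi>) = mult_op \<mu> (\<lambda>\<omega>. \<omega> \<phi>)"
    and \<mu>: "prob_space \<mu>" "sets \<mu> = sets (cylinder_sigma A)"
    using assms(10) unfolding associated_measure_def by (elim conjE exE) (rule that)
  interpret spectral_measure A \<rho> \<mu> K
  proof (intro spectral_measure.intro correlation.intro smooth_manifold.intro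
      correlation_axioms.intro spectral_measure_axioms.intro)
    show "smooth_atlas A" using assms(1) by (simp add: oriented_atlas_def)
  qed (use assms(5,7,8) K \<mu> in simp_all)
  show ?thesis
  proof (rule configurations_full_measure)
    fix p :: 'a
    obtain k :: nat and U :: "nat \<Rightarrow> 'a set" and \<epsilon> where U: "\<epsilon> > 0" "{p} \<subseteq> (\<Union>i<k. U i)"
      "\<forall>i<k. open (U i) \<and> compact (closure (U i)) \<and>
         (\<forall>n. emeasure \<rho> (conf_n (U i) n) \<le> ennreal (inverse ((2 + \<epsilon>) ^ n)))"
      using assms(9)[of "{p}"] by auto
    then obtain i where "i < k" "p \<in> U i" by auto
    then show "\<exists>W \<epsilon>. open W \<and> p \<in> W \<and> \<epsilon> > 0 \<and>
        (\<forall>n. emeasure \<rho> (conf_n W n) \<le> ennreal (inverse ((2 + \<epsilon>) ^ n)))"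
      using U by (intro exI[of _ "U i"] exI[of _ \<epsilon>]) simp
  qed
qed

end
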